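(* Let $X$ be a proper $\mathrm{CAT}(-1)$ geodesic metric space. Let $\Gamma$ be a non elementary discrete group of isometries of $X$, with finite critical exponent $\delta$, of divergent type, and let $\widetilde{\mu}_{\mathrm{BM}}$ be the Bowen-Margulis measure of $\Gamma$ on the space $\mathcal{G}X$ of geodesic lines of $X$. Assume that $\mathrm{Card}(\Gamma x \cap B(x,n))\asymp e^{\delta n}$ for some $x\in X$. Let $\Gamma_0$ be an almost malnormal convex-cocompact subgroup of infinite index in $\Gamma$ with critical exponent $\delta_0$, and let $C_0$ be the convex hull of its limit set. Then for every $\epsilon>0$, for $\widetilde{\mu}_{\mathrm{BM}}$-almost every $\ell\in\mathcal{G}X$, we have $$\limsup_{t\to+\infty}\;\frac{\mathfrak{p}(\ell,t)}{\log t}=\frac{1}{\delta-\delta_0}\;,$$ where $\mathfrak{p}$ is the penetration map in $\Gamma\mathcal{N}_\epsilon C_0$.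
   Context: Geodesic lines are isometric maps $\ell:\mathbb{R}\to X$. For $\epsilon>0$, with $\mathcal{N}_\epsilon C_0$ the closed $\epsilon$-neighborhood of $C_0$ in $X$, the penetration map $\mathfrak{p}:\mathcal{G}X\times[0,+\infty[\,\to[0,+\infty]$ is defined as follows: if $\ell(t)\notin\Gamma\mathcal{N}_\epsilon C_0$ then $\mathfrak{p}(\ell,t)=0$; otherwise $\mathfrak{p}(\ell,t)$ is the upper bound of the lengths of the intervals $I$ in $\mathbb{R}$ containing $t$ such that there exists $\gamma\in\Gamma$ with $\ell(I)$ contained in $\gamma\mathcal{N}_\epsilon C_0$. For a discrete group $\Gamma$ of isometries of $X$, $\Lambda\Gamma\subset\partial_\infty X$ is its limit set; $\Gamma$ is non elementary if $\Lambda\Gamma$ has at least three points. The critical exponent is the unique $\delta_\Gamma\in[0,+\infty]$ such that $\sum_{\gamma\in\Gamma}e^{-s\,d(x_0,\gamma x_0)}$ converges for $s>\delta_\Gamma$ and diverges for $s<\delta_\Gamma$ (any $x_0\in X$); $\Gamma$ is of divergent type if this series diverges at $s=\delta_\Gamma$. $\Gamma_0$ is convex-cocompact if $\Lambda\Gamma_0$ has at least two points and $\Gamma_0$ acts with compact quotient on the convex hull of $\Lambda\Gamma_0$ in $X$. A subgroup $H$ of a group $G$ is almost malnormal if $gHg^{-1}\cap H$ is finite for every $g\in G-H$. For $u,v:\mathbb{N}\to[0,+\infty[$, $u\asymp v$ means that $\frac1c u\le v\le cu$ for some constant $c\geq1$. Bowen-Margulis measure: $\beta_\xi(x,y)=\lim_{t\to+\infty}d(x,\xi_t)-d(y,\xi_t)$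 for any geodesic ray $t\mapsto\xi_t$ ending at $\xi$. For $\Gamma$ of divergent type with critical exponent $\delta\in\,]0,+\infty[$ there is a family $(\mu_x)_{x\in X}$, unique up to a positive scalar, of nonzero finite Borel measures on $\partial_\infty X$ with $\gamma_*\mu_x=\mu_{\gamma x}$ for $\gamma\in\Gamma$ and $\frac{d\mu_x}{d\mu_y}(\xi)=e^{-\delta\beta_\xi(x,y)}$. For $x_0\in X$, identify $\mathcal{G}X$ with $\{(\xi,\eta)\in(\partial_\infty X)^2:\xi\neq\eta\}\times\mathbb{R}$ by $\ell\mapsto(\ell(-\infty),\ell(+\infty),t)$, $t$ being the algebraic distance on $\ell$ between $\ell(0)$ and the closest point of $\ell$ to $x_0$. Then $d\widetilde{\mu}_{\mathrm{BM}}=\frac{d\mu_{x_0}(\xi)\,d\mu_{x_0}(\eta)\,dt}{d_{x_0}(\xi,\eta)^{2\delta}}$, where $d_{x_0}(\xi,\eta)=\lim_{t\to+\infty}e^{\frac12(d(\xi_t,\eta_t)-d(x_0,\xi_t)-d(x_0,\eta_t))}$ is the visual distance ($\xi_t,\eta_t$ geodesic rays from $x_0$ to $\xi,\eta$); this does not depend on $x_0$. *)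

theory Defs
  imports "HOL-Analysis.Analysis" "HOL-Algebra.Coset"
begin

section \<open>CAT(-1) spaces\<close>

text \<open>The hyperbolic plane of curvature -1, in the upper half-plane model.\<close>

definition hyp_plane :: "complex set" where
  "hyp_plane = {z. 0 < Im z}"

definition hyp_dist :: "complex \<Rightarrow> complex \<Rightarrow> real" where
  "hyp_dist z w = arcosh (1 + (cmod (z - w))\<^sup>2 / (2 * Im z * Im w))"

definition geodesic_segment :: "(real \<Rightarrow> 'a::metric_space) \<Rightarrow> 'a \<Rightarrow> 'a \<Rightarrow> bool" where
  "geodesic_segment c x y \<longleftrightarrow> c 0 = x \<and> c (dist x y) = y \<and>
     (\<forall>s\<in>{0..dist x y}. \<forall>t\<in>{0..dist x y}. dist (c s) (c t) = \<bar>s - t\<bar>)"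

definition geodesic_space :: "'a::metric_space itself \<Rightarrow> bool" where
  "geodesic_space _ \<longleftrightarrow> (\<forall>x y :: 'a. \<exists>c. geodesic_segment c x y)"

text \<open>Two points on distinct sides of a geodesic triangle: the vertex common to the two sides is
  called \<open>x\<close>. Points \<open>x' y' z'\<close> span a comparison triangle, and \<open>p'\<close>, \<open>q'\<close> are the comparison
  points of \<open>b s\<close>, \<open>c t\<close>. Two points on the same side satisfy the inequality trivially.\<close>

definition cat_minus_one :: "'a::metric_space itself \<Rightarrow> bool" where
  "cat_minus_one T \<longleftrightarrow> geodesic_space T \<and>
     (\<forall>(x::'a) y z a b c. geodesic_segment a y z \<longrightarrow> geodesic_segment b x y \<longrightarrow> geodesic_segment c x z \<longrightarrow>
       (\<forall>x'\<in>hyp_plane. \<forall>y'\<in>hyp_plane. \<forall>z'\<in>hyp_plane.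
          hyp_dist x' y' = dist x y \<longrightarrow> hyp_dist x' z' = dist x z \<longrightarrow> hyp_dist y' z' = dist y z \<longrightarrow>
          (\<forall>s\<in>{0..dist x y}. \<forall>t\<in>{0..dist x z}. \<forall>p'\<in>hyp_plane. \<forall>q'\<in>hyp_plane.
             hyp_dist x' p' = s \<longrightarrow> hyp_dist p' y' = dist x y - s \<longrightarrow>
             hyp_dist x' q' = t \<longrightarrow> hyp_dist q' z' = dist x z - t \<longrightarrow>
             dist (b s) (c t) \<le> hyp_dist p' q')))"


section \<open>Geodesic lines, rays and the boundary at infinity\<close>

definition geodesic_lines :: "(real \<Rightarrow> 'a::metric_space) set" where
  "geodesic_lines = {l. \<forall>s t. dist (l s) (l t) = \<bar>s - t\<bar>}"

text \<open>Rays are functions on the whole real line whose values at negative times are irrelevant;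
  functions agreeing on \<open>{0..}\<close> are identified in the boundary.\<close>

definition geodesic_rays :: "(real \<Rightarrow> 'a::metric_space) set" where
  "geodesic_rays = {r. \<forall>s\<ge>0. \<forall>t\<ge>0. dist (r s) (r t) = \<bar>s - t\<bar>}"

definition asymptotic :: "((real \<Rightarrow> 'a::metric_space) \<times> (real \<Rightarrow> 'a)) set" where
  "asymptotic = {(r, r'). r \<in> geodesic_rays \<and> r' \<in> geodesic_rays \<and>
     (\<exists>B. \<forall>t\<ge>0. dist (r t) (r' t) \<le> B)}"

lemma equiv_asymptotic: "equiv geodesic_rays asymptotic"
proof (rule equivI)
  show "asymptotic \<subseteq> (geodesic_rays :: (real \<Rightarrow> 'a) set) \<times> geodesic_rays"
    by (auto simp: asymptotic_def)
  show "refl_on geodesic_rays (asymptotic :: ((real \<Rightarrow> 'a) \<times> _) set)"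
    by (auto simp: refl_on_def asymptotic_def intro!: exI[of _ 0])
  show "sym (asymptotic :: ((real \<Rightarrow> 'a) \<times> _) set)"
    by (auto simp: sym_def asymptotic_def dist_commute)
  show "trans (asymptotic :: ((real \<Rightarrow> 'a) \<times> _) set)"
  proof (rule transI)
    fix r s u :: "real \<Rightarrow> 'a"
    assume "(r, s) \<in> asymptotic" "(s, u) \<in> asymptotic"
    then obtain B C where "r \<in> geodesic_rays" "u \<in> geodesic_rays"
      and B: "\<forall>t\<ge>0. dist (r t) (s t) \<le> B" and C: "\<forall>t\<ge>0. dist (s t) (u t) \<le> C"
      by (auto simp: asymptotic_def)
    moreover have "\<forall>t\<ge>0. dist (r t) (u t) \<le> B + C"
      using B C by (meson add_mono dist_triangle order_trans)
    ultimately show "(r, u) \<in> asymptotic"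
      unfolding asymptotic_def by blast
  qed
qed

type_synonym 'a boundary_pt = "(real \<Rightarrow> 'a) set"

definition boundary :: "'a::metric_space boundary_pt set" where
  "boundary = geodesic_rays // asymptotic"

definition pos_end :: "(real \<Rightarrow> 'a::metric_space) \<Rightarrow> 'a boundary_pt" where
  "pos_end l = asymptotic `` {l}"

definition neg_end :: "(real \<Rightarrow> 'a::metric_space) \<Rightarrow> 'a boundary_pt" where
  "neg_end l = asymptotic `` {\<lambda>t. l (- t)}"

text \<open>The cone topology on the union of \<open>X\<close> and its boundary. A basic neighbourhood of the end
  of the ray \<open>c\<close> consists of the points whose geodesic segment or ray from \<open>c 0\<close> passes, at distance
  \<open>r\<close> from \<open>c 0\<close>, within less than \<open>e\<close> of \<open>c r\<close>.\<close>

definition cone_nbhd :: "(real \<Rightarrow> 'a::metric_space) \<Rightarrow> real \<Rightarrow> real \<Rightarrow> ('a + 'a boundary_pt) set" where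
  "cone_nbhd c r e =
     Inl ` {y. r < dist (c 0) y \<and>
        (\<exists>b. geodesic_segment b (c 0) y \<and> dist (b r) (c r) < e)} \<union>
     Inr ` {\<xi> \<in> boundary. \<exists>c'\<in>\<xi>. c' 0 = c 0 \<and> dist (c' r) (c r) < e}"

definition cone_topology :: "('a::metric_space + 'a boundary_pt) topology" where
  "cone_topology = topology_generated_by
     ({Inl ` ball x r |x r. 0 < r} \<union> {cone_nbhd c r e |c r e. c \<in> geodesic_rays \<and> 0 < r \<and> 0 < e})"

definition boundary_topology :: "'a::metric_space boundary_pt topology" where
  "boundary_topology = pullback_topology boundary Inr cone_topology"

definition boundary_borel :: "'a::metric_space boundary_pt measure" where
  "boundary_borel = sigma boundary {U. openin boundary_topology U}"

text \<open>The closed convex hull in \<open>X\<close> of a set of points at infinity.\<close>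

definition geodesically_convex :: "'a::metric_space set \<Rightarrow> bool" where
  "geodesically_convex C \<longleftrightarrow>
     (\<forall>x\<in>C. \<forall>y\<in>C. \<forall>c. geodesic_segment c x y \<longrightarrow> c ` {0..dist x y} \<subseteq> C)"

definition hull_at_infinity :: "'a::metric_space boundary_pt set \<Rightarrow> 'a set" where
  "hull_at_infinity A = \<Inter>{C. closed C \<and> geodesically_convex C \<and>
     (\<forall>l\<in>geodesic_lines. neg_end l \<in> A \<and> pos_end l \<in> A \<longrightarrow> range l \<subseteq> C)}"


section \<open>Discrete groups of isometries\<close>

definition isometry_group :: "('a::metric_space \<Rightarrow> 'a) monoid" where
  "isometry_group =
     \<lparr>carrier = {f. surj f \<and> (\<forall>x y. dist (f x) (f y) = dist x y)}, mult = (\<circ>), one = id\<rparr>"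

lemma group_isometry_group: "group (isometry_group :: ('a::metric_space \<Rightarrow> 'a) monoid)"
proof (rule groupI)
  fix f :: "'a \<Rightarrow> 'a" assume "f \<in> carrier isometry_group"
  then have f: "surj f" "\<And>x y. dist (f x) (f y) = dist x y"
    by (auto simp: isometry_group_def)
  have "inj f"
    by (rule injI) (metis f(2) dist_eq_0_iff)
  then have "inv_into UNIV f \<circ> f = id" "surj (inv_into UNIV f)"
    by (auto simp: inj_imp_surj_inv)
  moreover have "dist (inv_into UNIV f x) (inv_into UNIV f y) = dist x y" for x y
    by (metis f surj_f_inv_f)
  ultimately show "\<exists>g\<in>carrier isometry_group. g \<otimes>\<^bsub>isometry_group\<^esub> f = \<one>\<^bsub>isometry_group\<^esub>"
    by (auto simp: isometry_group_def)
qed (auto simp: isometry_group_def surj_def o_assoc, metis)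

text \<open>Here \<open>discrete\<close> refers to the topology of pointwise convergence on \<open>'a \<Rightarrow> 'a\<close>, which on
  isometries coincides with the compact-open topology.\<close>

definition discrete_isometry_group :: "('a::metric_space \<Rightarrow> 'a) set \<Rightarrow> bool" where
  "discrete_isometry_group \<Gamma> \<longleftrightarrow> subgroup \<Gamma> isometry_group \<and> discrete \<Gamma>"

definition isom_orbit :: "('a \<Rightarrow> 'a) set \<Rightarrow> 'a \<Rightarrow> 'a set" where
  "isom_orbit \<Gamma> x = (\<lambda>\<gamma>. \<gamma> x) ` \<Gamma>"

definition limit_set :: "('a::metric_space \<Rightarrow> 'a) set \<Rightarrow> 'a boundary_pt set" where
  "limit_set \<Gamma> = {\<xi> \<in> boundary. \<forall>x. Inr \<xi> \<in> cone_topology closure_of (Inl ` isom_orbit \<Gamma> x)}"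

definition non_elementary :: "('a::metric_space \<Rightarrow> 'a) set \<Rightarrow> bool" where
  "non_elementary \<Gamma> \<longleftrightarrow> (\<exists>A \<subseteq> limit_set \<Gamma>. card A = 3)"

definition poincare_converges :: "('a::metric_space \<Rightarrow> 'a) set \<Rightarrow> real \<Rightarrow> 'a \<Rightarrow> bool" where
  "poincare_converges \<Gamma> s x \<longleftrightarrow> (\<lambda>\<gamma>. exp (- s * dist x (\<gamma> x))) summable_on \<Gamma>"

text \<open>Only \<open>s \<ge> 0\<close> is considered, so that finite groups have critical exponent 0.\<close>

definition critical_exponent :: "('a::metric_space \<Rightarrow> 'a) set \<Rightarrow> ereal" where
  "critical_exponent \<Gamma> = (THE e. 0 \<le> e \<and>
     (\<forall>x. \<forall>s\<ge>0. (e < ereal s \<longrightarrow> poincare_converges \<Gamma> s x) \<and>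
                 (ereal s < e \<longrightarrow> \<not> poincare_converges \<Gamma> s x)))"

definition divergent_type :: "('a::metric_space \<Rightarrow> 'a) set \<Rightarrow> bool" where
  "divergent_type \<Gamma> \<longleftrightarrow>
     (\<exists>d. critical_exponent \<Gamma> = ereal d \<and> (\<forall>x. \<not> poincare_converges \<Gamma> d x))"

text \<open>The quotient topology \<open>Q\<close> on the set of orbits is uniquely determined by \<open>quotient_map\<close>.\<close>

definition convex_cocompact :: "('a::metric_space \<Rightarrow> 'a) set \<Rightarrow> bool" where
  "convex_cocompact \<Gamma> \<longleftrightarrow> (\<exists>A \<subseteq> limit_set \<Gamma>. card A = 2) \<and>
     (\<exists>Q. quotient_map (top_of_set (hull_at_infinity (limit_set \<Gamma>))) Q (isom_orbit \<Gamma>) \<and>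
          compact_space Q)"

definition almost_malnormal :: "'g set \<Rightarrow> ('g, 'm) monoid_scheme \<Rightarrow> bool" where
  "almost_malnormal H G \<longleftrightarrow>
     (\<forall>g\<in>carrier G - H. finite (((g <#\<^bsub>G\<^esub> H) #>\<^bsub>G\<^esub> inv\<^bsub>G\<^esub> g) \<inter> H))"

definition comparable :: "(nat \<Rightarrow> real) \<Rightarrow> (nat \<Rightarrow> real) \<Rightarrow> bool" where
  "comparable u v \<longleftrightarrow> (\<exists>c\<ge>1. \<forall>n. u n / c \<le> v n \<and> v n \<le> c * u n)"


section \<open>The Bowen-Margulis measure\<close>

definition busemann :: "'a::metric_space boundary_pt \<Rightarrow> 'a \<Rightarrow> 'a \<Rightarrow> real" where
  "busemann \<xi> x y = (THE b. \<forall>r\<in>\<xi>. ((\<lambda>t. dist x (r t) - dist y (r t)) \<longlongrightarrow> b) at_top)"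

definition visual_dist :: "'a::metric_space \<Rightarrow> 'a boundary_pt \<Rightarrow> 'a boundary_pt \<Rightarrow> real" where
  "visual_dist x \<xi> \<eta> = (THE d. \<forall>r\<in>\<xi>. \<forall>r'\<in>\<eta>. r 0 = x \<longrightarrow> r' 0 = x \<longrightarrow>
     ((\<lambda>t. exp ((dist (r t) (r' t) - dist x (r t) - dist x (r' t)) / 2)) \<longlongrightarrow> d) at_top)"

definition boundary_map :: "('a \<Rightarrow> 'a) \<Rightarrow> 'a boundary_pt \<Rightarrow> 'a boundary_pt" where
  "boundary_map \<gamma> \<xi> = (\<lambda>r. \<gamma> \<circ> r) ` \<xi>"

definition patterson_density ::
    "('a::metric_space \<Rightarrow> 'a) set \<Rightarrow> real \<Rightarrow> ('a \<Rightarrow> 'a boundary_pt measure) \<Rightarrow> bool" where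
  "patterson_density \<Gamma> \<delta> \<mu> \<longleftrightarrow>
     (\<forall>x. sets (\<mu> x) = sets boundary_borel \<and> finite_measure (\<mu> x) \<and> emeasure (\<mu> x) boundary \<noteq> 0) \<and>
     (\<forall>\<gamma>\<in>\<Gamma>. \<forall>x. distr (\<mu> x) boundary_borel (boundary_map \<gamma>) = \<mu> (\<gamma> x)) \<and>
     (\<forall>x y. \<mu> x = density (\<mu> y) (\<lambda>\<xi>. ennreal (exp (- \<delta> * busemann \<xi> x y))))"

text \<open>The third coordinate is the signed distance along \<open>l\<close> from \<open>l 0\<close> to the point of \<open>l\<close>
  closest to \<open>x\<close>. The opposite sign convention leads to the same Bowen-Margulis measure.\<close>

definition hopf :: "'a::metric_space \<Rightarrow> (real \<Rightarrow> 'a) \<Rightarrow> 'a boundary_pt \<times> 'a boundary_pt \<times> real" where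
  "hopf x l = (neg_end l, pos_end l, THE s. \<forall>u. dist x (l s) \<le> dist x (l u))"

definition bowen_margulis_hopf ::
    "real \<Rightarrow> ('a::metric_space \<Rightarrow> 'a boundary_pt measure) \<Rightarrow> 'a
      \<Rightarrow> ('a boundary_pt \<times> 'a boundary_pt \<times> real) measure" where
  "bowen_margulis_hopf \<delta> \<mu> x = density
     (restrict_space (\<mu> x \<Otimes>\<^sub>M (\<mu> x \<Otimes>\<^sub>M lborel)) {(\<xi>, \<eta>, t). \<xi> \<noteq> \<eta>})
     (\<lambda>(\<xi>, \<eta>, t). ennreal (1 / visual_dist x \<xi> \<eta> powr (2 * \<delta>)))"

text \<open>Transport to the space of geodesic lines, identified with its image under \<open>hopf x\<close>.\<close>

definition bowen_margulis ::
    "real \<Rightarrow> ('a::metric_space \<Rightarrow> 'a boundary_pt measure) \<Rightarrow> 'a \<Rightarrow> (real \<Rightarrow> 'a) measure" where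
  "bowen_margulis \<delta> \<mu> x = distr (bowen_margulis_hopf \<delta> \<mu> x)
     (vimage_algebra geodesic_lines (hopf x) (bowen_margulis_hopf \<delta> \<mu> x))
     (inv_into geodesic_lines (hopf x))"


section \<open>The penetration map\<close>

definition closed_nbhd :: "real \<Rightarrow> 'a::metric_space set \<Rightarrow> 'a set" where
  "closed_nbhd e C = {x. infdist x C \<le> e}"

definition penetration ::
    "('a::metric_space \<Rightarrow> 'a) set \<Rightarrow> 'a set \<Rightarrow> real \<Rightarrow> (real \<Rightarrow> 'a) \<Rightarrow> real \<Rightarrow> ereal" where
  "penetration \<Gamma> C e l t =
     (if l t \<notin> (\<Union>\<gamma>\<in>\<Gamma>. \<gamma> ` closed_nbhd e C) then 0
      else (SUP I \<in> {I. is_interval I \<and> t \<in> I \<and> (\<exists>\<gamma>\<in>\<Gamma>. l ` I \<subseteq> \<gamma> ` closed_nbhd e C)}.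
              enn2ereal (emeasure lborel I)))"

end

theory Submission
  imports Defs "HOL-Real_Asymp.Real_Asymp"
begin

text \<open>Asymptotic lines penetrate the same translates up to bounded errors, so only the end \<open>\<eta>\<close> of the line
  at \<open>+\<infinity>\<close> matters, and the statement is about \<open>\<mu>\<close>-almost every \<open>\<eta>\<close>. A line stays near \<open>\<gamma> C\<^sub>0\<close> from time
  \<open>t\<close> to time \<open>t + s\<close> iff it passes near \<open>\<gamma> x\<close> and \<open>\<gamma> h x\<close> for some \<open>h\<close> in \<open>\<Gamma>\<^sub>0\<close> of length about \<open>s\<close>. There are
  about \<open>exp (\<delta> t)\<close> such \<open>\<gamma>\<close> and \<open>exp (\<delta>\<^sub>0 s)\<close> such \<open>h\<close>, and by Sullivan's shadow lemma each pair is
  followed with probability about \<open>exp (- \<delta> (t + s))\<close>; so the excursion has probability about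
  \<open>exp (- (\<delta> - \<delta>\<^sub>0) s)\<close>. The Borel-Cantelli lemma gives the upper bound. For the lower bound, excursions at
  well separated times are quasi-independent, so infinitely many long ones occur with positive probability.
  Instead of ergodicity, this is applied to the restriction of \<open>\<mu>\<close> to an invariant set, which is again a
  conformal density: the complement of the \<open>\<Gamma>\<close>-saturation of the set of good ends must be null.\<close>

section \<open>Comparison in the hyperbolic plane\<close>

text \<open>The heuristic count multiplies the choices of \<open>\<gamma>\<close> by those of
  \<open>h\<close>, but an element factors as \<open>\<gamma> \<circ> h\<close> in many ways, and a
  ray near \<open>\<gamma> (h x)\<close> need not have passed near \<open>\<gamma> x\<close>. For
  the lower bound \<open>\<gamma>\<close> is therefore a shortest element of its left coset of
  \<open>\<Gamma>\<^sub>0\<close>: convexity and cocompactness of the core make lengths additive up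
  to a constant, which repairs both defects. That such elements still grow like
  \<open>exp (\<delta> * R)\<close> rests on the strict gap
  \<open>\<delta>\<^sub>0 < \<delta>\<close>, which almost malnormality forces. The growth of
  \<open>\<Gamma>\<^sub>0\<close> is controlled from above only with an exponential loss as small as
  desired, so a small \<open>\<eta>\<close> is carried along: the events start at times about
  \<open>k powr (1 + \<eta>)\<close> and last about
  \<open>ln k / (\<delta> - \<delta>\<^sub>0 + \<eta>)\<close>. Thin triangles give bounded
  closeness only; contraction in negative curvature turns it into closeness \<epsilon> at the price
  of a bounded time at both ends, which is why the limit does not depend on \<epsilon>.\<close>

lemma cosh_diff_eq_mult_sinh:
  fixes A B C :: real
  shows "cosh C - cosh (A - B) = 2 * sinh ((C + A - B) / 2) * sinh ((C - A + B) / 2)"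
proof -
  have "cosh ((C + A - B) / 2 + (C - A + B) / 2) - cosh ((C + A - B) / 2 - (C - A + B) / 2)
      = 2 * sinh ((C + A - B) / 2) * sinh ((C - A + B) / 2)"
    by (simp only: cosh_add cosh_diff)
  moreover have "(C + A - B) / 2 + (C - A + B) / 2 = C" "(C + A - B) / 2 - (C - A + B) / 2 = A - B"
    by (simp_all add: field_simps)
  ultimately show ?thesis by simp
qed

lemma cosh_real_mono: "cosh x \<le> cosh y" if "\<bar>x\<bar> \<le> \<bar>y\<bar>" for x y :: real
proof -
  have "cosh \<bar>x\<bar> \<le> cosh \<bar>y\<bar>"
    using that by (subst cosh_real_nonneg_le_iff) auto
  then show ?thesis by simp
qed

text \<open>Polar coordinates around \<open>\<i>\<close> in the upper half-plane, the angle being measured from the vertical ray.\<close>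

definition polar :: "real \<Rightarrow> real \<Rightarrow> complex" where
  "polar r \<theta> = Complex (sinh r * sin \<theta> / (cosh r - sinh r * cos \<theta>)) (1 / (cosh r - sinh r * cos \<theta>))"

lemma polar_denom_pos: "0 < cosh r - sinh r * cos \<theta>" for r \<theta> :: real
proof -
  have "\<bar>sinh r * cos \<theta>\<bar> \<le> \<bar>sinh r\<bar> * 1"
    unfolding abs_mult by (intro mult_left_mono) auto
  moreover have "\<bar>sinh r\<bar> < cosh r"
    by (simp add: abs_less_iff sinh_less_cosh_real) (metis cosh_minus sinh_less_cosh_real sinh_minus)
  ultimately show ?thesis by linarith
qed

lemma polar_in_hyp_plane: "polar r \<theta> \<in> hyp_plane"
  using polar_denom_pos[of r \<theta>] by (simp add: hyp_plane_def polar_def)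

lemma polar_zero_angle: "polar r 0 = Complex 0 (exp r)"
  by (simp add: polar_def cosh_minus_sinh exp_minus divide_inverse)

lemma cosh_hyp_dist:
  assumes "z \<in> hyp_plane" "w \<in> hyp_plane"
  shows "cosh (hyp_dist z w) = 1 + (cmod (z - w))\<^sup>2 / (2 * Im z * Im w)"
  using assms unfolding hyp_dist_def hyp_plane_def
  by (subst cosh_arcosh_real) auto

lemma hyp_dist_eqI:
  assumes "z \<in> hyp_plane" "w \<in> hyp_plane" "0 \<le> d"
    "1 + (cmod (z - w))\<^sup>2 / (2 * Im z * Im w) = cosh d"
  shows "hyp_dist z w = d"
  using assms unfolding hyp_dist_def by (simp add: arcosh_cosh_real)

text \<open>The hyperbolic law of cosines at \<open>\<i>\<close>, arranged so that the angle enters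
  only through \<open>1 - cos \<theta>\<close>, next to the purely radial term
  \<open>cosh (s - t)\<close>.\<close>

lemma polar_dist:
  "1 + (cmod (Complex 0 (exp s) - polar t \<theta>))\<^sup>2 / (2 * Im (Complex 0 (exp s)) * Im (polar t \<theta>))
   = cosh (s - t) + sinh s * sinh t * (1 - cos \<theta>)"
proof -
  define D where "D = cosh t - sinh t * cos \<theta>"
  have D: "D > 0" unfolding D_def by (rule polar_denom_pos)
  have c: "(cosh t)\<^sup>2 = 1 + (sinh t)\<^sup>2" by (simp add: cosh_square_eq)
  have sc: "(sin \<theta>)\<^sup>2 = 1 - (cos \<theta>)\<^sup>2" by (simp add: sin_squared_eq)
  \<comment> \<open>\<open>D\<close> times its conjugate is
    \<open>cosh\<^sup>2 - sinh\<^sup>2 cos\<^sup>2\<close>; this lets one factor \<open>D\<close>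
    cancel below.\<close>
  have key: "(sinh t * sin \<theta>)\<^sup>2 + 1 = D * (cosh t + sinh t * cos \<theta>)"
    unfolding D_def power_mult_distrib sc using c by (simp add: algebra_simps power2_eq_square)
  have "(cmod (Complex 0 (exp s) - polar t \<theta>))\<^sup>2 = (sinh t * sin \<theta> / D)\<^sup>2 + (exp s - 1 / D)\<^sup>2"
    by (simp add: polar_def cmod_power2 D_def)
  also have "\<dots> = ((sinh t * sin \<theta>)\<^sup>2 + 1) / D\<^sup>2 + (exp s)\<^sup>2 - 2 * exp s / D"
    using D by (simp add: power2_eq_square field_simps)
  also have "\<dots> = (cosh t + sinh t * cos \<theta>) / D + (exp s)\<^sup>2 - 2 * exp s / D"
    unfolding key using D by (simp add: power2_eq_square)
  finally have 1: "(cmod (Complex 0 (exp s) - polar t \<theta>))\<^sup>2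
     = (cosh t + sinh t * cos \<theta>) / D + (exp s)\<^sup>2 - 2 * exp s / D" .
  have im: "Im (polar t \<theta>) = 1 / D" by (simp add: polar_def D_def)
  have "1 + (cmod (Complex 0 (exp s) - polar t \<theta>))\<^sup>2 / (2 * Im (Complex 0 (exp s)) * Im (polar t \<theta>))
    = ((cosh t + sinh t * cos \<theta>) + (exp s)\<^sup>2 * D) / (2 * exp s)"
    unfolding 1 im using D by (simp add: field_simps)
  also have "\<dots> = (cosh t + sinh t * cos \<theta>) * (exp (- s) / 2) + (exp s / 2) * D"
    by (simp add: exp_minus power2_eq_square field_simps)
  also have "\<dots> = cosh s * cosh t - sinh s * sinh t * cos \<theta>"
    unfolding D_def cosh_def[of s] sinh_def[of s] by (simp add: algebra_simps)
  also have "\<dots> = cosh (s - t) + sinh s * sinh t * (1 - cos \<theta>)"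
    unfolding cosh_diff by (simp add: algebra_simps)
  finally show ?thesis .
qed

lemma hyp_dist_polar:
  assumes "0 \<le> d" "cosh d = cosh (s - t) + sinh s * sinh t * (1 - cos \<theta>)"
  shows "hyp_dist (Complex 0 (exp s)) (polar t \<theta>) = d"
  using assms polar_in_hyp_plane[of t \<theta>] by (intro hyp_dist_eqI) (auto simp: hyp_plane_def polar_dist[simplified])

lemma hyp_dist_polar_ray:
  assumes "0 \<le> s" "s \<le> t"
  shows "hyp_dist (polar s \<theta>) (polar t \<theta>) = t - s"
proof (rule hyp_dist_eqI[OF polar_in_hyp_plane polar_in_hyp_plane])
  define D E where "D = cosh s - sinh s * cos \<theta>" and "E = cosh t - sinh t * cos \<theta>"
  have D: "D > 0" "E > 0" unfolding D_def E_def by (rule polar_denom_pos)+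
  have ims: "Im (polar s \<theta>) = 1 / D" "Im (polar t \<theta>) = 1 / E" "Re (polar s \<theta>) = sinh s * sin \<theta> / D" "Re (polar t \<theta>) = sinh t * sin \<theta> / E"
    by (simp_all add: polar_def D_def E_def)
  have sc: "(sin \<theta>)\<^sup>2 = 1 - (cos \<theta>)\<^sup>2" by (simp add: sin_squared_eq)
  have m: "(cmod (polar s \<theta> - polar t \<theta>))\<^sup>2 = (sin \<theta>)\<^sup>2 * (sinh s / D - sinh t / E)\<^sup>2 + (1 / D - 1 / E)\<^sup>2"
    unfolding cmod_power2 by (simp add: ims power2_eq_square algebra_simps)
  have "1 + (cmod (polar s \<theta> - polar t \<theta>))\<^sup>2 / (2 * Im (polar s \<theta>) * Im (polar t \<theta>))
     = 1 + ((sin \<theta>)\<^sup>2 * (sinh s * E - sinh t * D)\<^sup>2 + (E - D)\<^sup>2) / (2 * D * E)"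
    unfolding m ims using D by (simp add: divide_simps power2_eq_square)
  \<comment> \<open>The angle drops out of this combination.\<close>
  also have "sinh s * E - sinh t * D = - sinh (t - s)"
    unfolding D_def E_def sinh_diff by (simp add: algebra_simps)
  also have "1 + ((sin \<theta>)\<^sup>2 * (- sinh (t - s))\<^sup>2 + (E - D)\<^sup>2) / (2 * D * E)
     = (2 * D * E + (sin \<theta>)\<^sup>2 * (sinh (t - s))\<^sup>2 + (E - D)\<^sup>2) / (2 * D * E)"
    using D by (simp add: divide_simps)
  also have "2 * D * E + (sin \<theta>)\<^sup>2 * (sinh (t - s))\<^sup>2 + (E - D)\<^sup>2 = 2 * cosh (t - s) * (D * E)"
  proof -
    have "(sin \<theta>)\<^sup>2 * (sinh (t - s))\<^sup>2 + D\<^sup>2 + E\<^sup>2 - 2 * cosh (t - s) * (D * E) = 0"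
      unfolding D_def E_def cosh_diff sinh_diff sc
      using cosh_square_eq[of s] cosh_square_eq[of t]
      by algebra
    then show ?thesis by (simp add: power2_eq_square algebra_simps)
  qed
  finally show "1 + (cmod (polar s \<theta> - polar t \<theta>))\<^sup>2 / (2 * Im (polar s \<theta>) * Im (polar t \<theta>)) = cosh (t - s)"
    using D by simp
qed (use assms in auto)

text \<open>The class \<open>heine_borel\<close> expresses that the space is proper.\<close>

locale cat1_space =
  fixes type_tag :: "'a::heine_borel itself"
  assumes cat: "cat_minus_one type_tag"
begin

lemma seg_ex: "\<exists>c. geodesic_segment c x (y::'a)"
  using cat by (auto simp: cat_minus_one_def geodesic_space_def)

text \<open>The comparison triangle is realised with \<open>x'\<close> at \<open>\<i>\<close>,
  \<open>y'\<close> straight above it and \<open>z'\<close> at the comparison angle. All later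
  geometry draws on the comparison axiom through this inequality alone.\<close>

lemma cat_ineq:
  fixes x y z :: 'a
  assumes b: "geodesic_segment b x y" and c: "geodesic_segment c x z"
    and s: "0 \<le> s" "s \<le> dist x y" and t: "0 \<le> t" "t \<le> dist x z"
    and pos: "0 < dist x y" "0 < dist x z"
  shows "cosh (dist (b s) (c t)) \<le> cosh (s - t) +
     sinh s * sinh t * (cosh (dist y z) - cosh (dist x y - dist x z)) / (sinh (dist x y) * sinh (dist x z))"
proof -
  define A B C where "A = dist x y" and "B = dist x z" and "C = dist y z"
  have AB: "A > 0" "B > 0" "C \<ge> 0" using pos by (auto simp: A_def B_def C_def)
  have tri: "\<bar>A - B\<bar> \<le> C" "C \<le> A + B"
    unfolding A_def B_def C_def using dist_triangle[of x y z] dist_triangle[of x z y] dist_triangle[of y z x]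
    by (auto simp: dist_commute)
  \<comment> \<open>By the law of cosines \<open>K\<close> is \<open>1 - cos\<close> of the
    comparison angle; the triangle inequalities place it in \<open>[0, 2]\<close>, so that
    \<open>arccos (1 - K)\<close> is meaningful.\<close>
  define K where "K = (cosh C - cosh (A - B)) / (sinh A * sinh B)"
  have sAB: "sinh A * sinh B > 0" using AB by simp
  have "0 \<le> K" unfolding K_def using sAB tri cosh_real_mono[of "A - B" C] by simp
  have "cosh C \<le> cosh (A + B)" using tri AB cosh_real_mono[of C "A + B"] by simp
  then have "cosh C - cosh (A - B) \<le> 2 * (sinh A * sinh B)"
    by (simp add: cosh_add cosh_diff)
  then have "K \<le> 2" unfolding K_def using sAB by (simp add: pos_divide_le_eq)
  define \<theta> where "\<theta> = arccos (1 - K)"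
  have cos: "1 - cos \<theta> = K" unfolding \<theta>_def using \<open>0 \<le> K\<close> \<open>K \<le> 2\<close> by (simp add: cos_arccos)
  define x' y' z' p' q' where "x' = polar 0 \<theta>" and "y' = polar A 0" and "z' = polar B \<theta>"
    and "p' = polar s 0" and "q' = polar t \<theta>"
  have x'0: "x' = polar 0 0" by (simp add: x'_def polar_def)
  have mem: "x' \<in> hyp_plane" "y' \<in> hyp_plane" "z' \<in> hyp_plane" "p' \<in> hyp_plane" "q' \<in> hyp_plane"
    by (simp_all add: x'_def y'_def z'_def p'_def q'_def polar_in_hyp_plane)
  have d1: "hyp_dist x' y' = A" unfolding x'0 y'_def using AB by (subst hyp_dist_polar_ray) auto
  have d2: "hyp_dist x' z' = B" unfolding x'_def z'_def using AB by (subst hyp_dist_polar_ray) auto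
  have d3: "hyp_dist y' z' = C" unfolding y'_def z'_def polar_zero_angle
    using AB sAB unfolding K_def
    by (intro hyp_dist_polar) (auto simp: cos K_def)
  have d4: "hyp_dist x' p' = s" "hyp_dist p' y' = A - s"
    unfolding x'0 y'_def p'_def using s by (subst hyp_dist_polar_ray; auto simp: A_def)+
  have d5: "hyp_dist x' q' = t" "hyp_dist q' z' = B - t"
    unfolding x'_def z'_def q'_def using t by (subst hyp_dist_polar_ray; auto simp: B_def)+
  obtain a where a: "geodesic_segment a y z" using seg_ex by blast
  have "dist (b s) (c t) \<le> hyp_dist p' q'"
    using cat a b c mem d1 d2 d3 d4 d5 s t unfolding cat_minus_one_def A_def B_def C_def
    by (metis atLeastAtMost_iff)
  then have "cosh (dist (b s) (c t)) \<le> cosh (hyp_dist p' q')"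
    by (intro cosh_real_mono) auto
  also have "\<dots> = cosh (s - t) + sinh s * sinh t * K"
    unfolding cosh_hyp_dist[OF mem(4,5)] unfolding p'_def q'_def polar_zero_angle polar_dist cos ..
  finally show ?thesis by (simp add: K_def A_def B_def C_def)
qed

end

section \<open>Thin triangles and contraction\<close>

text \<open>The Gromov product of \<open>y\<close> and \<open>z\<close> seen from \<open>x\<close>:
  up to a constant, the time during which geodesics from \<open>x\<close> to \<open>y\<close> and to
  \<open>z\<close> stay together.\<close>

definition gp :: "'a::metric_space \<Rightarrow> 'a \<Rightarrow> 'a \<Rightarrow> real" where
  "gp x y z = (dist x y + dist x z - dist y z) / 2"

lemma gp_commute: "gp x y z = gp x z y"
  by (simp add: gp_def dist_commute)

lemma gp_nonneg: "0 \<le> gp x y z"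
  using dist_triangle[of y z x] by (simp add: gp_def dist_commute)

lemma gp_le: "gp x y z \<le> dist x y" "gp x y z \<le> dist x z"
  using dist_triangle[of x z y] dist_triangle[of x y z] by (simp_all add: gp_def dist_commute)

lemma seg_dist:
  "geodesic_segment b x y \<Longrightarrow> 0 \<le> s \<Longrightarrow> s \<le> dist x y \<Longrightarrow> 0 \<le> t \<Longrightarrow> t \<le> dist x y \<Longrightarrow> dist (b s) (b t) = \<bar>s - t\<bar>"
  by (simp add: geodesic_segment_def)

lemma seg_ends: "geodesic_segment b x y \<Longrightarrow> b 0 = x" "geodesic_segment b x y \<Longrightarrow> b (dist x y) = y"
  by (simp_all add: geodesic_segment_def)

lemma seg_dist_ends:
  assumes "geodesic_segment b x y" "0 \<le> s" "s \<le> dist x y"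
  shows "dist x (b s) = s" "dist (b s) y = dist x y - s"
  using seg_dist[OF assms(1), of 0 s] seg_dist[OF assms(1), of s "dist x y"] assms seg_ends[OF assms(1)] by auto

lemma seg_rev: "geodesic_segment b x y \<Longrightarrow> geodesic_segment (\<lambda>t. b (dist x y - t)) y x"
  by (auto simp: geodesic_segment_def dist_commute)

lemma seg_sub:
  assumes "geodesic_segment b x y" "0 \<le> u" "u \<le> v" "v \<le> dist x y"
  shows "geodesic_segment (\<lambda>t. b (u + t)) (b u) (b v)"
proof -
  have "dist (b u) (b v) = v - u" using seg_dist[OF assms(1), of u v] assms by auto
  then show ?thesis using assms seg_dist[OF assms(1)] by (auto simp: geodesic_segment_def)
qed

lemma seg_initial:
  assumes "geodesic_segment b x y" "0 \<le> v" "v \<le> dist x y"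
  shows "geodesic_segment b x (b v)"
  using seg_sub[OF assms(1), of 0 v] assms seg_ends[OF assms(1)] by simp

lemma ray_dist: "r \<in> geodesic_rays \<Longrightarrow> 0 \<le> s \<Longrightarrow> 0 \<le> t \<Longrightarrow> dist (r s) (r t) = \<bar>s - t\<bar>"
  by (simp add: geodesic_rays_def)

lemma ray_seg:
  "r \<in> geodesic_rays \<Longrightarrow> 0 \<le> u \<Longrightarrow> u \<le> v \<Longrightarrow> geodesic_segment (\<lambda>t. r (u + t)) (r u) (r v)"
  by (auto simp: geodesic_segment_def ray_dist)

lemma ray_seg0: "r \<in> geodesic_rays \<Longrightarrow> 0 \<le> v \<Longrightarrow> geodesic_segment r (r 0) (r v)"
  using ray_seg[of r 0 v] by simp

lemma line_seg:
  "l \<in> geodesic_lines \<Longrightarrow> u \<le> v \<Longrightarrow> geodesic_segment (\<lambda>t. l (u + t)) (l u) (l v)"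
  by (auto simp: geodesic_segment_def geodesic_lines_def)

lemma line_ray: "l \<in> geodesic_lines \<Longrightarrow> l \<in> geodesic_rays"
  "l \<in> geodesic_lines \<Longrightarrow> (\<lambda>t. l (- t)) \<in> geodesic_rays"
  by (auto simp: geodesic_lines_def geodesic_rays_def)

lemma sinh_mul_exp_le: "sinh s * exp t \<le> sinh t * exp s" if "s \<le> t" for s t :: real
proof -
  have "exp (s - t) \<le> exp (t - s)" using that by simp
  then show ?thesis by (simp add: sinh_def algebra_simps flip: exp_add)
qed

lemma sinh_mul_sinh_le: "sinh a * sinh b \<le> sinh (a + b) / 2" if "0 \<le> a" "0 \<le> b" for a b :: real
proof -
  have "cosh (a - b) \<le> cosh (a + b)" "sinh (a + b) = exp (a + b) / 2 - exp (- (a + b)) / 2"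
    "sinh a * sinh b = exp (a + b) / 4 + exp (- (a + b)) / 4 - (exp (a - b) + exp (b - a)) / 4"
    using that by (auto simp: sinh_def field_simps simp flip: exp_add intro: cosh_real_mono)
  moreover have "2 \<le> exp (a - b) + exp (b - a)"
  proof -
    have "1 \<le> cosh (a - b)" by (rule cosh_real_ge_1)
    then show ?thesis by (simp add: cosh_def)
  qed
  moreover have "exp (- (a + b)) \<le> 1" using that by simp
  moreover have "P \<le> H / 2" if "H = E / 2 - F / 2" "P = E / 4 + F / 4 - G / 4" "2 \<le> G" "F \<le> 1" for P H E F G :: real
    using that by simp
  ultimately show ?thesis by blast
qed

lemma cosh_le_imp_le: "x \<le> 2" if "0 \<le> x" "cosh x \<le> 3 / 2" for x :: real
proof -
  have "exp x / 2 \<le> cosh x" by (simp add: cosh_def)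
  then show ?thesis using that exp_ge_add_one_self[of x] by linarith
qed

context cat1_space
begin

text \<open>Writing \<open>g\<close> for the Gromov product, the angle term factors as twice a
  product of two quotients \<open>sinh s * sinh (A - g) / sinh A\<close>, each at most
  \<open>1 / 2\<close> when \<open>s \<le> g\<close>. Hence \<open>cosh\<close> of the distance is
  at most \<open>3 / 2\<close>; the bound 2 is a convenient consequence.\<close>

lemma thin:
  fixes x y z :: 'a
  assumes b: "geodesic_segment b x y" and c: "geodesic_segment c x z" and s: "0 \<le> s" "s \<le> gp x y z"
  shows "dist (b s) (c s) \<le> 2"
proof (cases "dist x y = 0 \<or> dist x z = 0")
  case True
  then have "s = 0" using s gp_le[of x y z] by auto
  then show ?thesis using seg_ends[OF b] seg_ends[OF c] by simp
next
  case False
  define A B C g where "A = dist x y" and "B = dist x z" and "C = dist y z" and "g = gp x y z"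
  have AB: "A > 0" "B > 0" using False by (auto simp: A_def B_def)
  have g: "s \<le> g" "g \<le> A" "g \<le> B" "0 \<le> g" using s gp_le[of x y z] by (auto simp: A_def B_def g_def)
  have C: "(C + A - B) / 2 = A - g" "(C - A + B) / 2 = B - g"
    by (auto simp: A_def B_def C_def g_def gp_def field_simps)
  have "cosh (dist (b s) (c s)) \<le> cosh (s - s) + sinh s * sinh s * (cosh C - cosh (A - B)) / (sinh A * sinh B)"
    unfolding A_def B_def C_def by (rule cat_ineq[OF b c]) (use g s AB in \<open>auto simp: A_def B_def\<close>)
  also have "\<dots> = 1 + 2 * (sinh s * sinh (A - g) / sinh A) * (sinh s * sinh (B - g) / sinh B)"
    unfolding cosh_diff_eq_mult_sinh C by simp
  also have "\<dots> \<le> 1 + 2 * (1 / 2) * (1 / 2)"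
  proof -
    have *: "sinh s * sinh (D - g) / sinh D \<le> 1 / 2" "0 \<le> sinh s * sinh (D - g) / sinh D"
      if "g \<le> D" "0 < D" for D
    proof -
      have "sinh s * sinh (D - g) \<le> sinh g * sinh (D - g)"
        using g that by (intro mult_right_mono) auto
      also have "\<dots> \<le> sinh D / 2" using sinh_mul_sinh_le[of g "D - g"] g that by simp
      finally show "sinh s * sinh (D - g) / sinh D \<le> 1 / 2" using that by (simp add: divide_simps)
      show "0 \<le> sinh s * sinh (D - g) / sinh D" using s that by simp
    qed
    have "(sinh s * sinh (A - g) / sinh A) * (sinh s * sinh (B - g) / sinh B) \<le> (1 / 2) * (1 / 2)"
      using *[OF g(2) AB(1)] *[OF g(3) AB(2)] by (intro mult_mono) auto
    then show ?thesis by (simp add: mult_ac)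
  qed
  finally show ?thesis by (intro cosh_le_imp_le) auto
qed

text \<open>Up to the Gromov product the sides are 2-close; afterwards each moves at unit speed, so
  they separate at speed at most 2.\<close>

lemma fellow:
  fixes x y z :: 'a
  assumes b: "geodesic_segment b x y" and c: "geodesic_segment c x z"
    and s: "0 \<le> s" "s \<le> dist x y" "s \<le> dist x z"
  shows "dist (b s) (c s) \<le> 2 + 2 * max 0 (s - gp x y z)"
proof (cases "s \<le> gp x y z")
  case True
  then show ?thesis using thin[OF b c s(1)] by simp
next
  case False
  define g where "g = gp x y z"
  have g: "0 \<le> g" "g < s" using False gp_nonneg by (auto simp: g_def)
  have "dist (b s) (c s) \<le> dist (b s) (b g) + dist (b g) (c g) + dist (c g) (c s)"
    using dist_triangle[of "b s" "c s" "b g"] dist_triangle[of "b g" "c s" "c g"] by linarith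
  also have "\<dots> \<le> (s - g) + 2 + (s - g)"
    using seg_dist[OF b, of s g] seg_dist[OF c, of g s] thin[OF b c, of g] g s by (auto simp: g_def)
  finally show ?thesis using g by (simp add: g_def)
qed

text \<open>Gromov's four-point condition. The path from \<open>x\<close> to \<open>z\<close>
  through the points at time \<open>g\<close> on the three geodesics from \<open>w\<close> saves
  \<open>g\<close> at either end and loses 4 in the middle.\<close>

lemma gp_4:
  fixes w x y z :: 'a
  shows "min (gp w x y) (gp w y z) - 2 \<le> gp w x z"
proof -
  define g where "g = min (gp w x y) (gp w y z)"
  obtain a b c where abc: "geodesic_segment a w x" "geodesic_segment b w y" "geodesic_segment c w z"
    using seg_ex by metis
  have g: "0 \<le> g" "g \<le> dist w x" "g \<le> dist w z"
    using gp_nonneg[of w x y] gp_nonneg[of w y z] gp_le[of w x y] gp_le[of w y z] by (auto simp: g_def)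
  have 1: "dist (a g) (b g) \<le> 2" "dist (b g) (c g) \<le> 2"
    using thin[OF abc(1,2), of g] thin[OF abc(2,3), of g] g by (auto simp: g_def)
  have 2: "dist (a g) x = dist w x - g" "dist (c g) z = dist w z - g"
    using seg_dist_ends[OF abc(1), of g] seg_dist_ends[OF abc(3), of g] g by auto
  have "dist x z \<le> dist (a g) x + dist (a g) (b g) + dist (b g) (c g) + dist (c g) z"
    using dist_triangle[of x z "a g"] dist_triangle[of "a g" z "b g"] dist_triangle[of "b g" z "c g"]
    by (simp add: dist_commute)
  then have "g - 2 \<le> gp w x z" using 1 2 by (simp add: gp_def)
  then show ?thesis by (simp add: g_def)
qed

text \<open>Cutting both sides at time \<open>S\<close> makes the triangle isosceles, so the radial
  term of \<open>cat_ineq\<close> disappears and only the factor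
  \<open>(sinh s / sinh S)\<^sup>2\<close> remains. This exponential decay is what thinness alone
  would not give.\<close>

lemma isosceles_contraction:
  fixes x y z :: 'a
  assumes b: "geodesic_segment b x y" and c: "geodesic_segment c x z"
    and s: "0 \<le> s" "s \<le> S" "S \<le> dist x y" "S \<le> dist x z"
  shows "cosh (dist (b s) (c s)) - 1 \<le> exp (- 2 * (S - s)) * (cosh (dist (b S) (c S)) - 1)"
proof (cases "S = 0")
  case True
  then show ?thesis using s by simp
next
  case False
  then have S: "S > 0" using s by simp
  have b': "geodesic_segment b x (b S)" and c': "geodesic_segment c x (c S)"
    using seg_initial[OF b] seg_initial[OF c] s by auto
  have dS: "dist x (b S) = S" "dist x (c S) = S"
    using seg_dist_ends(1)[OF b, of S] seg_dist_ends(1)[OF c, of S] s by auto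
  have "cosh (dist (b s) (c s)) \<le> 1 + (sinh s / sinh S)\<^sup>2 * (cosh (dist (b S) (c S)) - 1)"
    using cat_ineq[OF b' c', of s s] s S unfolding dS by (simp add: power2_eq_square)
  moreover have "(sinh s / sinh S)\<^sup>2 \<le> (exp (s - S))\<^sup>2"
  proof (rule power_mono)
    show "sinh s / sinh S \<le> exp (s - S)"
      using sinh_mul_exp_le[OF s(2)] S by (simp add: exp_diff field_simps)
  qed (use s S in auto)
  moreover have "(exp (s - S))\<^sup>2 = exp (- 2 * (S - s))"
    by (simp add: power2_eq_square flip: exp_add)
  moreover have "0 \<le> cosh (dist (b S) (c S)) - 1" using cosh_real_ge_1 by simp
  ultimately show ?thesis by (smt (verit) mult_right_mono)
qed

text \<open>The waiting time \<open>T\<close> depends on \<epsilon> and \<open>B\<close> only. This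
  is the device that upgrades every bounded estimate to an arbitrarily fine one.\<close>

lemma contraction:
  assumes "0 < \<epsilon>"
  obtains T where "0 \<le> T"
    "\<And>x y z :: 'a. \<And>b c s. geodesic_segment b x y \<Longrightarrow> geodesic_segment c x z \<Longrightarrow> dist y z \<le> B \<Longrightarrow>
       0 \<le> s \<Longrightarrow> s + T \<le> dist x y \<Longrightarrow> dist (b s) (c s) \<le> \<epsilon> \<and> s \<le> dist x z"
proof -
  \<comment> \<open>After the cut at the shorter of the two sides the new endpoints are
    \<open>2 * B\<close>-close. The decay factor \<open>exp (- 2 * (S - s))\<close> must beat
    \<open>q\<close>, for which \<open>S - s \<ge> q\<close> suffices; the term
    \<open>\<bar>B\<bar>\<close> in \<open>T\<close> pays for the cut.\<close>
  define q where "q = (cosh (2 * B) - 1) / (cosh \<epsilon> - 1)"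
  have ce: "cosh \<epsilon> - 1 > 0" using assms cosh_real_strict_mono[of 0 \<epsilon>] by simp
  have q0: "q \<ge> 0" unfolding q_def using ce cosh_real_ge_1[of "2 * B"] by simp
  show ?thesis
  proof (rule that[of "\<bar>B\<bar> + q"])
    fix x y z :: 'a and b c s
    assume b: "geodesic_segment b x y" and c: "geodesic_segment c x z" and B: "dist y z \<le> B"
      and s: "0 \<le> s" "s + (\<bar>B\<bar> + q) \<le> dist x y"
    define S where "S = min (dist x y) (dist x z)"
    have B0: "0 \<le> B" using B zero_le_dist[of y z] by linarith
    have SS: "dist x y - B \<le> S" "dist x z - B \<le> S" "S \<le> dist x y" "S \<le> dist x z"
      using dist_triangle[of x y z] dist_triangle[of x z y] B B0 by (auto simp: S_def dist_commute)
    have sS: "s + q \<le> S" using s SS B0 by auto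
    have S0: "0 \<le> S" unfolding S_def by simp
    have sum: "dist (b S) y + dist z (c S) \<le> B"
      using seg_dist_ends(2)[OF b, of S] seg_dist_ends(2)[OF c, of S] SS S0
      by (auto simp: S_def min_def dist_commute)
    have "dist (b S) (c S) \<le> 2 * B"
      using dist_triangle[of "b S" "c S" y] dist_triangle[of y "c S" z] sum B by linarith
    then have "cosh (dist (b S) (c S)) \<le> cosh (2 * B)" by (intro cosh_real_mono) auto
    moreover have "q * (cosh \<epsilon> - 1) = cosh (2 * B) - 1"
      using ce unfolding q_def by (intro nonzero_eq_divide_eq[THEN iffD1]) auto
    ultimately have "cosh (dist (b S) (c S)) - 1 \<le> q * (cosh \<epsilon> - 1)" by simp
    then have "exp (- 2 * (S - s)) * (cosh (dist (b S) (c S)) - 1) \<le> exp (- 2 * (S - s)) * (q * (cosh \<epsilon> - 1))"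
      by (intro mult_left_mono) auto
    also have "\<dots> \<le> cosh \<epsilon> - 1"
    proof -
      have "q \<le> exp (2 * (S - s))"
        using exp_ge_add_one_self[of "2 * (S - s)"] sS q0 by (smt (verit))
      then have "exp (- 2 * (S - s)) * q \<le> exp (- 2 * (S - s)) * exp (2 * (S - s))" by (intro mult_left_mono) auto
      also have "\<dots> = 1" unfolding exp_add[symmetric] by simp
      finally have "exp (- 2 * (S - s)) * q \<le> 1" .
      then show ?thesis using ce mult_right_mono[of "exp (- 2 * (S - s)) * q" 1 "cosh \<epsilon> - 1"] by (simp add: mult.assoc)
    qed
    finally have "cosh (dist (b s) (c s)) \<le> cosh \<epsilon>"
      using isosceles_contraction[OF b c s(1), of S] sS SS q0 by auto
    then have "dist (b s) (c s) \<le> \<epsilon>" using assms by (subst (asm) cosh_real_nonneg_le_iff) auto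
    then show "dist (b s) (c s) \<le> \<epsilon> \<and> s \<le> dist x z" using sS SS q0 by auto
  qed (use q0 in auto)
qed

text \<open>Two applications of \<open>contraction\<close>: the first moves one endpoint of the
  segment into \<open>C\<close> while the other is kept, the second, seen from the new endpoint,
  moves the other. Each costs \<open>\<epsilon> / 2\<close>, and the final segment lies in
  \<open>C\<close>.\<close>

lemma convex_nbhd:
  assumes "0 < \<epsilon>"
  obtains T where "0 \<le> T"
    "\<And>(C::'a set) p q a a' b w. geodesically_convex C \<Longrightarrow> geodesic_segment b p q \<Longrightarrow> a \<in> C \<Longrightarrow> a' \<in> C \<Longrightarrow>
       dist p a \<le> B \<Longrightarrow> dist q a' \<le> B \<Longrightarrow> T \<le> w \<Longrightarrow> w + T \<le> dist p q \<Longrightarrow> infdist (b w) C \<le> \<epsilon>"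
proof -
  obtain T where T: "0 \<le> T"
    "\<And>x y z :: 'a. \<And>b c s. geodesic_segment b x y \<Longrightarrow> geodesic_segment c x z \<Longrightarrow> dist y z \<le> B \<Longrightarrow>
       0 \<le> s \<Longrightarrow> s + T \<le> dist x y \<Longrightarrow> dist (b s) (c s) \<le> \<epsilon> / 2 \<and> s \<le> dist x z"
    using contraction[of "\<epsilon> / 2" B] assms by auto
  show ?thesis
  proof (rule that[OF T(1)])
    fix C :: "'a set" and p q a a' b w
    assume C: "geodesically_convex C" and b: "geodesic_segment b p q" and a: "a \<in> C" "a' \<in> C"
      and B: "dist p a \<le> B" "dist q a' \<le> B" and w: "T \<le> w" "w + T \<le> dist p q"
    obtain c where c: "geodesic_segment c p a'" using seg_ex by blast
    obtain e where e: "geodesic_segment e a' a" using seg_ex by blast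
    have 1: "dist (b w) (c w) \<le> \<epsilon> / 2" "w \<le> dist p a'"
      using T(2)[OF b c B(2)] w T(1) by auto
    \<comment> \<open>The same point of the segment \<open>c\<close>, with time now counted from its
      end \<open>a'\<close>.\<close>
    define u where "u = dist p a' - w"
    have 2: "dist (c (dist p a' - u)) (e u) \<le> \<epsilon> / 2 \<and> u \<le> dist a' a"
      using 1 w T(1) B(1) by (intro T(2)[OF seg_rev[OF c] e]) (auto simp: u_def dist_commute)
    have "e u \<in> C" using C a e 2 1 unfolding geodesically_convex_def u_def by fastforce
    then have "infdist (b w) C \<le> dist (b w) (e u)" by (rule infdist_le)
    also have "\<dots> \<le> \<epsilon>"
      using dist_triangle[of "b w" "e u" "c w"] 1 2 by (simp add: u_def)
    finally show "infdist (b w) C \<le> \<epsilon>" .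
  qed
qed

text \<open>Strict convexity of the distance to \<open>x\<close>, needed for the uniqueness of the
  closest point in the Hopf coordinates.\<close>

lemma midpoint_closer:
  fixes p q x :: 'a
  assumes b: "geodesic_segment b p q" and "p \<noteq> q" "dist x p = dist x q"
  shows "dist x (b (dist p q / 2)) < dist x p"
proof -
  define A C where "A = dist x p" and "C = dist p q"
  have C: "C > 0" using assms by (simp add: C_def)
  have A: "A > 0"
  proof (rule ccontr)
    assume "\<not> A > 0"
    then have "x = p" "x = q" using assms by (auto simp: A_def)
    then show False using assms by simp
  qed
  obtain c where c: "geodesic_segment c p x" using seg_ex by blast
  have "cosh (dist (c A) (b (C / 2))) \<le> cosh (A - C / 2) + sinh A * sinh (C / 2) * (cosh A - cosh (A - C)) / (sinh A * sinh C)"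
  proof -
    have d: "dist p x = A" "dist p q = C" "dist x q = A"
      using assms by (auto simp: A_def C_def dist_commute)
    show ?thesis using cat_ineq[OF c b, of A "C / 2"] A C unfolding d by simp
  qed
  also have "c A = x" using seg_ends[OF c] by (simp add: A_def dist_commute)
  \<comment> \<open>Hyperbolic Pythagoras: the median of an isosceles triangle with legs
    \<open>A\<close> and base \<open>C\<close> satisfies
    \<open>cosh m = cosh A / cosh (C / 2)\<close>.\<close>
  also have "cosh (A - C / 2) + sinh A * sinh (C / 2) * (cosh A - cosh (A - C)) / (sinh A * sinh C) = cosh A / cosh (C / 2)"
  proof -
    have s: "sinh C = 2 * sinh (C / 2) * cosh (C / 2)" using sinh_double[of "C / 2"] by simp
    have h: "cosh C = 2 * (cosh (C / 2))\<^sup>2 - 1" using cosh_double_cosh[of "C / 2"] by simp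
    have ne: "sinh (C / 2) \<noteq> 0" "cosh (C / 2) \<noteq> 0" "sinh A \<noteq> 0" using A C by auto
    have sq: "(sinh (C / 2))\<^sup>2 = (cosh (C / 2))\<^sup>2 - 1" by (simp add: sinh_square_eq)
    have "cosh (A - C / 2) + (cosh A - cosh (A - C)) / (2 * cosh (C / 2)) = cosh A / cosh (C / 2)"
      using ne(2) sq unfolding cosh_diff h s by (simp add: divide_simps) (simp add: algebra_simps power2_eq_square)
    moreover have "sinh A * sinh (C / 2) * (cosh A - cosh (A - C)) / (sinh A * sinh C) = (cosh A - cosh (A - C)) / (2 * cosh (C / 2))"
      unfolding s using ne by (simp add: divide_simps)
    ultimately show ?thesis by simp
  qed
  also have "\<dots> < cosh A"
  proof -
    have "1 < cosh (C / 2)" using C cosh_real_strict_mono[of 0 "C / 2"] by simp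
    then show ?thesis by (simp add: divide_less_eq)
  qed
  finally show ?thesis using A unfolding A_def C_def by (subst (asm) cosh_real_nonneg_less_iff) auto
qed

lemma closest_ex1:
  fixes x :: 'a
  assumes l: "l \<in> geodesic_lines"
  shows "\<exists>!s. \<forall>u. dist x (l s) \<le> dist x (l u)"
proof -
  have ld: "dist (l s) (l t) = \<bar>s - t\<bar>" for s t using l by (simp add: geodesic_lines_def)
  have cont: "continuous_on UNIV l"
    unfolding continuous_on_iff by (metis dist_real_def ld)
  \<comment> \<open>Outside \<open>{-R..R}\<close> the triangle inequality puts the line farther
    from \<open>x\<close> than \<open>l 0\<close>, so a minimum over this compact interval is
    global. Two minimisers would contradict \<open>midpoint_closer\<close>.\<close>
  define R where "R = 2 * dist x (l 0)"
  obtain s where s: "s \<in> {-R..R}" "\<And>u. u \<in> {-R..R} \<Longrightarrow> dist x (l s) \<le> dist x (l u)"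
  proof -
    have "\<exists>s\<in>{-R..R}. \<forall>u\<in>{-R..R}. dist x (l s) \<le> dist x (l u)"
      by (rule continuous_attains_inf) (auto simp: R_def intro!: continuous_intros continuous_on_subset[OF cont])
    then show ?thesis using that by blast
  qed
  have "dist x (l s) \<le> dist x (l u)" for u
  proof (cases "u \<in> {-R..R}")
    case False
    have "dist x (l s) \<le> dist x (l 0)" using s(2)[of 0] by (auto simp: R_def)
    also have "\<dots> \<le> dist x (l u)"
    proof -
      have "\<bar>u\<bar> \<le> dist (l 0) x + dist x (l u)" using ld[of 0 u] dist_triangle[of "l 0" "l u" x] by simp
      then show ?thesis using False by (auto simp: R_def dist_commute)
    qed
    finally show ?thesis .
  qed (rule s(2))
  moreover have "s' = s''" if 1: "\<forall>u. dist x (l s') \<le> dist x (l u)" and 2: "\<forall>u. dist x (l s'') \<le> dist x (l u)" for s' s''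
  proof -
    have False if "s' < s''" "\<forall>u. dist x (l s') \<le> dist x (l u)" "\<forall>u. dist x (l s'') \<le> dist x (l u)" for s' s''
    proof -
      have "dist x (l s') = dist x (l s'')" using that by (meson order_antisym)
      moreover have "l s' \<noteq> l s''" using ld[of s' s''] that by auto
      ultimately have "dist x (l (s' + dist (l s') (l s'') / 2)) < dist x (l s')"
        using midpoint_closer[OF line_seg[OF l, of s' s'']] that by auto
      then show False using that by (meson not_less)
    qed
    then show ?thesis using 1 2 by (metis linorder_neqE)
  qed
  ultimately show ?thesis by blast
qed

end

section \<open>Rays, the boundary and Busemann functions\<close>

lemma boundary_repr:
  assumes "\<xi> \<in> boundary" "r \<in> \<xi>"
  shows "r \<in> geodesic_rays" "\<xi> = asymptotic `` {r}"
proof -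
  have e: "equiv geodesic_rays (asymptotic :: ((real \<Rightarrow> 'a) \<times> _) set)" by (rule equiv_asymptotic)
  show "r \<in> geodesic_rays" using assms in_quotient_imp_subset[OF e] unfolding boundary_def by blast
  show "\<xi> = asymptotic `` {r}"
    using assms e unfolding boundary_def
    by (metis quotientE Image_singleton_iff equiv_class_eq)
qed

lemma boundary_asymptotic:
  assumes "\<xi> \<in> boundary" "r \<in> \<xi>" "r' \<in> \<xi>"
  shows "(r, r') \<in> asymptotic"
  using boundary_repr(2)[OF assms(1,2)] assms(3) by auto

lemma boundary_asymptotic_mem:
  assumes "\<xi> \<in> boundary" "r \<in> \<xi>" "(r, r') \<in> asymptotic"
  shows "r' \<in> \<xi>"
  using boundary_repr(2)[OF assms(1,2)] assms(3) by auto

lemma boundary_nonempty: "\<xi> \<in> boundary \<Longrightarrow> \<exists>r. r \<in> \<xi>"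
  unfolding boundary_def using in_quotient_imp_non_empty[OF equiv_asymptotic] by blast

lemma boundary_eqI:
  assumes "\<xi> \<in> boundary" "\<eta> \<in> boundary" "r \<in> \<xi>" "r' \<in> \<eta>" "(r, r') \<in> asymptotic"
  shows "\<xi> = \<eta>"
  using boundary_asymptotic_mem[OF assms(1,3,5)] boundary_repr(2)[OF assms(1)] boundary_repr(2)[OF assms(2,4)] by metis

lemma ray_class:
  assumes "r \<in> geodesic_rays"
  shows "asymptotic `` {r} \<in> boundary" "r \<in> asymptotic `` {r}"
  using assms equiv_class_self[OF equiv_asymptotic assms] unfolding boundary_def by (auto intro: quotientI)

lemma pos_end_boundary: "l \<in> geodesic_lines \<Longrightarrow> pos_end l \<in> boundary" "l \<in> geodesic_lines \<Longrightarrow> l \<in> pos_end l"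
  unfolding pos_end_def using ray_class line_ray(1) by blast+

lemma neg_end_boundary: "l \<in> geodesic_lines \<Longrightarrow> neg_end l \<in> boundary" "l \<in> geodesic_lines \<Longrightarrow> (\<lambda>t. l (- t)) \<in> neg_end l"
  unfolding neg_end_def using ray_class line_ray(2) by blast+

lemma neg_end_ne_pos_end:
  assumes "l \<in> geodesic_lines"
  shows "neg_end l \<noteq> pos_end l"
proof
  assume "neg_end l = pos_end l"
  then have "(l, \<lambda>t. l (- t)) \<in> asymptotic"
    using boundary_asymptotic pos_end_boundary[OF assms] neg_end_boundary[OF assms] by metis
  then obtain B where B: "\<And>t. 0 \<le> t \<Longrightarrow> dist (l t) (l (- t)) \<le> B" by (auto simp: asymptotic_def)
  have "dist (l (\<bar>B\<bar> + 1)) (l (- (\<bar>B\<bar> + 1))) = 2 * (\<bar>B\<bar> + 1)"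
    using assms by (simp add: geodesic_lines_def)
  then show False using B[of "\<bar>B\<bar> + 1"] by simp
qed

context cat1_space
begin

text \<open>The new ray is the pointwise limit of the segments from \<open>x\<close> to
  \<open>r n\<close>. They agree for longer and longer times because their Gromov products tend to
  infinity, and a proper space is complete.\<close>

lemma ray_towards:
  fixes x :: 'a
  assumes r: "r \<in> geodesic_rays"
  shows "\<exists>q\<in>geodesic_rays. q 0 = x \<and> (r, q) \<in> asymptotic"
proof -
  define d0 where "d0 = dist x (r 0)"
  have d0: "0 \<le> d0" by (simp add: d0_def)
  define L where "L n = dist x (r (real n))" for n :: nat
  obtain c where c: "\<And>n. geodesic_segment (c n) x (r (real n))"
    using choice[of "\<lambda>n c. geodesic_segment c x (r (real n))"] seg_ex by blast
  have L: "\<bar>L n - n\<bar> \<le> d0" for n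
    using dist_triangle[of x "r n" "r 0"] dist_triangle[of "r 0" "r n" x] ray_dist[OF r, of 0 n]
    by (auto simp: L_def d0_def dist_commute)
  \<comment> \<open>Moving the vertex of a degenerate triangle from \<open>r 0\<close> to
    \<open>x\<close> changes its Gromov product by at most \<open>d0\<close>.\<close>
  have g: "real n - d0 \<le> gp x (r n) (r m)" if "n \<le> m" for n m :: nat
    using L[of n] L[of m] ray_dist[OF r, of n m] that by (auto simp: gp_def L_def)
  have close: "\<exists>N. \<forall>n\<ge>N. \<forall>m\<ge>N. dist (c n s) (c m s) \<le> e" if "0 < e" "0 \<le> s" for e s
  proof -
    obtain T where T: "0 \<le> T" and Tc:
      "\<And>x y z :: 'a. \<And>b c s. geodesic_segment b x y \<Longrightarrow> geodesic_segment c x z \<Longrightarrow> dist y z \<le> 2 \<Longrightarrow>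
         0 \<le> s \<Longrightarrow> s + T \<le> dist x y \<Longrightarrow> dist (b s) (c s) \<le> e \<and> s \<le> dist x z"
      using contraction[OF \<open>0 < e\<close>, of 2] by metis
    obtain N :: nat where N: "s + T + d0 \<le> real N" using real_arch_simple by blast
    have *: "dist (c n s) (c m s) \<le> e" if "N \<le> n" "n \<le> m" for n m
    proof -
      define S where "S = real n - d0"
      have S: "s + T \<le> S" "S \<le> gp x (r n) (r m)" "0 \<le> S"
        using N that g[of n m] T \<open>0 \<le> s\<close> by (auto simp: S_def)
      have S2: "S \<le> dist x (r n)" "S \<le> dist x (r m)" using S gp_le[of x "r n" "r m"] by auto
      have "dist (c n S) (c m S) \<le> 2" using thin[OF c c] S by auto
      then show ?thesis
        using Tc[OF seg_initial[OF c[of n], of S] seg_initial[OF c[of m], of S]] S S2 \<open>0 \<le> s\<close>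
          seg_dist_ends(1)[OF c[of n], of S] by auto
    qed
    then show ?thesis by (metis dist_commute nle_le)
  qed
  have conv: "convergent (\<lambda>n. c n s)" if "0 \<le> s" for s
  proof -
    have "Cauchy (\<lambda>n. c n s)"
      unfolding Cauchy_def using close[OF half_gt_zero that] by (metis field_sum_of_halves less_add_same_cancel1 order_le_less_trans half_gt_zero)
    then show ?thesis by (simp add: Cauchy_convergent_iff)
  qed
  define q where "q s = lim (\<lambda>n. c n s)" for s
  have q: "(\<lambda>n. c n s) \<longlonglongrightarrow> q s" if "0 \<le> s" for s
    unfolding q_def using conv[OF that] by (simp add: convergent_LIMSEQ_iff)
  have big: "eventually (\<lambda>n. s \<le> L n) sequentially" for s
  proof -
    obtain N :: nat where N: "s + d0 \<le> real N" using real_arch_simple by blast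
    have "s \<le> L n" if "N \<le> n" for n
      using N that L[of n] by (simp add: abs_le_iff)
    then show ?thesis by (auto simp: eventually_sequentially)
  qed
  have ray: "q \<in> geodesic_rays"
    unfolding geodesic_rays_def
  proof (intro CollectI allI impI)
    fix s t :: real assume st: "0 \<le> s" "0 \<le> t"
    have 1: "(\<lambda>n. dist (c n s) (c n t)) \<longlonglongrightarrow> dist (q s) (q t)"
      using q st by (intro tendsto_dist)
    have "eventually (\<lambda>n. dist (c n s) (c n t) = \<bar>s - t\<bar>) sequentially"
      using big[of s] big[of t]
      by eventually_elim (use seg_dist[OF c] st in \<open>auto simp: L_def\<close>)
    then have "(\<lambda>n. dist (c n s) (c n t)) \<longlonglongrightarrow> \<bar>s - t\<bar>"
      by (rule tendsto_eventually)
    then show "dist (q s) (q t) = \<bar>s - t\<bar>" using 1 LIMSEQ_unique by blast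
  qed
  have q0: "q 0 = x"
    using seg_ends(1)[OF c] by (simp add: q_def)
  have "dist (r t) (q t) \<le> 2 + 3 * d0" if t: "0 \<le> t" for t
  proof -
    have 1: "(\<lambda>n. dist (r t) (c n t)) \<longlonglongrightarrow> dist (r t) (q t)"
      by (intro tendsto_dist q t tendsto_const)
    have "eventually (\<lambda>n. t + d0 \<le> L n) sequentially" by (rule big)
    then have "eventually (\<lambda>n. dist (r t) (c n t) \<le> 2 + 3 * d0) sequentially"
    proof eventually_elim
      case (elim n)
      have tn: "t \<le> real n" using elim L[of n] by (simp add: abs_le_iff)
      show ?case
      proof (cases "t \<le> d0")
        case True
        have "dist x (c n t) = t" using seg_dist_ends[OF c[of n], of t] elim t d0 by (auto simp: L_def)
        then show ?thesis
          using True dist_triangle[of "r t" "c n t" "r 0"] dist_triangle[of "r 0" "c n t" x] ray_dist[OF r, of t 0] t d0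
          by (auto simp: d0_def dist_commute)
      next
        case False
        \<comment> \<open>Seen from \<open>r n\<close>, the sides towards \<open>r 0\<close> and
          towards \<open>x\<close> have endpoints \<open>d0\<close> apart, so \<open>fellow\<close>
          bounds their distance uniformly in \<open>n\<close>. Matching the two parametrisations
          costs another \<open>d0\<close>.\<close>
        define u where "u = real n - t"
        have u: "0 \<le> u" "u \<le> L n" "u \<le> n" using tn False L[of n] t by (auto simp: u_def abs_le_iff)
        have rn: "geodesic_segment (\<lambda>t. r (dist (r 0) (r n) - t)) (r n) (r 0)"
          by (rule seg_rev[OF ray_seg0[OF r]]) simp
        have dn: "dist (r 0) (r n) = n" using ray_dist[OF r, of 0 n] by simp
        have cn: "geodesic_segment (\<lambda>t. c n (L n - t)) (r n) x"
          using seg_rev[OF c[of n]] by (simp add: L_def)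
        have dd: "dist (r n) (r 0) = n" "dist (r n) x = L n" using dn by (auto simp: L_def dist_commute)
        have "dist (r (n - u)) (c n (L n - u)) \<le> 2 + 2 * max 0 (u - gp (r n) (r 0) x)"
          using fellow[OF rn cn, of u] u unfolding dn dd by auto
        also have "\<dots> \<le> 2 + 2 * d0"
          using L[of n] d0 u False by (auto simp: gp_def dd u_def abs_le_iff) (auto simp: d0_def dist_commute field_simps)
        finally have "dist (r t) (c n (L n - u)) \<le> 2 + 2 * d0" by (simp add: u_def)
        moreover have "dist (c n (L n - u)) (c n t) \<le> d0"
          using seg_dist[OF c[of n], of "L n - u" t] u elim t d0 L[of n] by (auto simp: L_def u_def)
        ultimately show ?thesis using dist_triangle[of "r t" "c n t" "c n (L n - u)"] by linarith
      qed
    qed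
    then show ?thesis by (intro tendsto_upperbound[OF 1]) auto
  qed
  then have "(r, q) \<in> asymptotic" using r ray by (auto simp: asymptotic_def)
  then show ?thesis using ray q0 by blast
qed

text \<open>The distance stays bounded at arbitrarily late times, so contraction makes it at earlier
  times smaller than any positive number, in particular than half of itself.\<close>

lemma asymptotic_same_start:
  assumes "(r, q) \<in> asymptotic" "r 0 = (q 0 :: 'a)" "0 \<le> s"
  shows "r s = q s"
proof (rule ccontr)
  assume ne: "r s \<noteq> q s"
  obtain B where r: "r \<in> geodesic_rays" "q \<in> geodesic_rays" and B: "\<And>t. 0 \<le> t \<Longrightarrow> dist (r t) (q t) \<le> B"
    using assms by (auto simp: asymptotic_def)
  have "0 < dist (r s) (q s) / 2" using ne by simp
  from contraction[OF this, of B] obtain T where T: "0 \<le> T" and Tc: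
      "\<And>x y z :: 'a. \<And>b c s'. geodesic_segment b x y \<Longrightarrow> geodesic_segment c x z \<Longrightarrow> dist y z \<le> B \<Longrightarrow>
         0 \<le> s' \<Longrightarrow> s' + T \<le> dist x y \<Longrightarrow> dist (b s') (c s') \<le> dist (r s) (q s) / 2 \<and> s' \<le> dist x z"
    by metis
  have "dist (r s) (q s) \<le> dist (r s) (q s) / 2"
    using Tc[OF ray_seg0[OF r(1), of "s + T"] ray_seg0[OF r(2), of "s + T", folded assms(2)]] B T assms(3)
      ray_dist[OF r(1), of 0 "s + T"] by auto
  then show False using ne by simp
qed

lemma ray_from_ex:
  fixes x :: 'a
  assumes "\<xi> \<in> boundary"
  shows "\<exists>q\<in>\<xi>. q 0 = x \<and> q \<in> geodesic_rays"
  using assms boundary_nonempty boundary_repr boundary_asymptotic_mem ray_towards by metis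

text \<open>Asymptotic rays converge to each other after a synchronising shift. This is what makes
  Busemann limits independent of the chosen ray.\<close>

lemma asymptotic_shift:
  assumes as: "(r, q) \<in> asymptotic"
  shows "\<exists>a. ((\<lambda>t. dist (r t) (q (t + a) :: 'a)) \<longlongrightarrow> 0) at_top"
proof -
  obtain B where r: "r \<in> geodesic_rays" "q \<in> geodesic_rays" and B: "\<And>t. 0 \<le> t \<Longrightarrow> dist (r t) (q t) \<le> B"
    using as by (auto simp: asymptotic_def)
  define L where "L n = dist (r 0) (q (real n))" for n :: nat
  \<comment> \<open>The shift is the limit of this sequence, which the triangle inequality makes
    increasing and bounded by \<open>B\<close>.\<close>
  define f where "f n = real n - L n" for n :: nat
  have "incseq f"
  proof (rule incseq_SucI)
    fix n show "f n \<le> f (Suc n)"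
      using dist_triangle[of "r 0" "q (real (Suc n))" "q n"] ray_dist[OF r(2), of n "Suc n"]
      by (simp add: f_def L_def)
  qed
  moreover have fb: "\<bar>f n\<bar> \<le> B" for n
    using B[of n] B[of 0] dist_triangle[of "r 0" "q n" "r n"] dist_triangle[of "r 0" "r n" "q n"] ray_dist[OF r(1), of 0 n]
    by (auto simp: f_def L_def dist_commute abs_le_iff)
  ultimately obtain a where a: "f \<longlonglongrightarrow> a"
    using incseq_convergent[of f B] by (metis abs_le_iff)
  have main: "\<exists>T. \<forall>s\<ge>T. dist (r s) (q (s + a)) \<le> 2 * e" if e: "0 < e" for e
  proof -
    obtain T where T: "0 \<le> T" and Tc:
      "\<And>x y z :: 'a. \<And>b c s'. geodesic_segment b x y \<Longrightarrow> geodesic_segment c x z \<Longrightarrow> dist y z \<le> B \<Longrightarrow>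
         0 \<le> s' \<Longrightarrow> s' + T \<le> dist x y \<Longrightarrow> dist (b s') (c s') \<le> e \<and> s' \<le> dist x z"
      using contraction[OF e, of B] by metis
    have "dist (r s) (q (s + a)) \<le> 2 * e" if s: "T + B \<le> s" for s
    proof -
      have B0: "0 \<le> B" using fb[of 0] by linarith
      have "eventually (\<lambda>n. real n \<ge> s + T + B) sequentially"
        using filterlim_real_sequentially by (auto simp: filterlim_at_top)
      then have "eventually (\<lambda>n. dist (r s) (q (s + a)) \<le> 2 * e + \<bar>f n - a\<bar>) sequentially"
      proof eventually_elim
        case (elim n)
        obtain c where c: "geodesic_segment c (r 0) (q n)" using seg_ex by blast
        have dn: "dist (r 0) (r n) = n" "dist (q 0) (q n) = n" using ray_dist[OF r(1), of 0 n] ray_dist[OF r(2), of 0 n] by auto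
        have 1: "dist (r s) (c s) \<le> e" "s \<le> L n"
          using Tc[OF ray_seg0[OF r(1), of n] c, of s] B[of n] dn elim s T B0 by (auto simp: L_def)
        \<comment> \<open>\<open>contraction\<close> is applied from both ends of the segment
          \<open>c\<close> from \<open>r 0\<close> to \<open>q n\<close>: from \<open>r 0\<close> it
          compares \<open>c\<close> with \<open>r\<close>, from \<open>q n\<close> it compares
          \<open>c\<close> with \<open>q\<close> traversed backwards.\<close>
        define u where "u = L n - s"
        have 2: "dist (c (dist (r 0) (q n) - u)) (q (dist (q 0) (q n) - u)) \<le> e" "u \<le> dist (q n) (q 0)"
          using Tc[OF seg_rev[OF c] seg_rev[OF ray_seg0[OF r(2), of n]], of u] B[of 0] 1 s T B0
          by (auto simp: u_def L_def dist_commute)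
        then have 3: "dist (c s) (q (s + f n)) \<le> e" using dn by (simp add: u_def f_def L_def algebra_simps)
        have "dist (q (s + f n)) (q (s + a)) = \<bar>f n - a\<bar>"
        proof -
          have "- B \<le> a" using a fb by (metis LIMSEQ_le_const abs_le_iff minus_le_iff)
          then show ?thesis using fb[of n] s T B0 by (subst ray_dist[OF r(2)]) auto
        qed
        then show ?case using 1 3 dist_triangle[of "r s" "q (s + a)" "c s"] dist_triangle[of "c s" "q (s + a)" "q (s + f n)"] by linarith
      qed
      moreover have "(\<lambda>n. 2 * e + \<bar>f n - a\<bar>) \<longlonglongrightarrow> 2 * e + \<bar>a - a\<bar>" by (intro tendsto_intros a)
      ultimately show ?thesis using tendsto_lowerbound by fastforce
    qed
    then show ?thesis by blast
  qed
  have "((\<lambda>t. dist (r t) (q (t + a))) \<longlongrightarrow> 0) at_top"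
  proof (rule tendstoI)
    fix e :: real assume "0 < e"
    then obtain T where "\<forall>s\<ge>T. dist (r s) (q (s + a)) \<le> 2 * (e / 3)" using main[of "e / 3"] by auto
    then have "\<forall>s\<ge>T. dist (dist (r s) (q (s + a))) 0 < e" using \<open>0 < e\<close> by (force simp: dist_real_def)
    then show "eventually (\<lambda>t. dist (dist (r t) (q (t + a))) 0 < e) at_top"
      by (auto simp: eventually_at_top_linorder)
  qed
  then show ?thesis by blast
qed

lemma ray_horofunction_limit:
  fixes x :: 'a
  assumes r: "r \<in> geodesic_rays"
  shows "\<exists>b. ((\<lambda>t. dist x (r t) - t) \<longlongrightarrow> b) at_top"
proof -
  define f where "f t = dist x (r t) - t" for t
  have mono: "f t \<le> f s" if "0 \<le> s" "s \<le> t" for s t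
    using dist_triangle[of x "r t" "r s"] ray_dist[OF r, of s t] that by (simp add: f_def)
  have bd: "- dist x (r 0) \<le> f t" if "0 \<le> t" for t
    using dist_triangle[of "r 0" "r t" x] ray_dist[OF r, of 0 t] that by (simp add: f_def dist_commute)
  define b where "b = Inf (f ` {0..})"
  have bdd: "bdd_below (f ` {0..})" using bd by (intro bdd_belowI[of _ "- dist x (r 0)"]) auto
  have "(f \<longlongrightarrow> b) at_top"
  proof (rule tendstoI)
    fix e :: real assume "0 < e"
    then obtain s where s: "0 \<le> s" "f s < b + e"
      using cInf_lessD[of "f ` {0..}" "b + e"] by (auto simp: b_def)
    have "dist (f t) b < e" if "s \<le> t" for t
      using mono[OF s(1) that] s cInf_lower[OF _ bdd, of "f t"] that by (auto simp: dist_real_def b_def[symmetric])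
    then show "eventually (\<lambda>t. dist (f t) b < e) at_top" by (auto simp: eventually_at_top_linorder)
  qed
  then show ?thesis unfolding f_def by blast
qed

text \<open>Shows that the description defining \<open>busemann\<close> is proper. Existence is
  monotonicity along one ray; for another ray in the class, shifted as in
  \<open>asymptotic_shift\<close>, the two expressions differ by at most twice a distance tending to
  0.\<close>

lemma busemann_limit:
  fixes x y :: 'a
  assumes \<xi>: "\<xi> \<in> boundary" and r: "r \<in> \<xi>"
  shows "((\<lambda>t. dist x (r t) - dist y (r t)) \<longlongrightarrow> busemann \<xi> x y) at_top"
proof -
  have lim: "\<exists>b. ((\<lambda>t. dist x (r t) - dist y (r t)) \<longlongrightarrow> b) at_top" if r: "r \<in> geodesic_rays" for r :: "real \<Rightarrow> 'a"
  proof -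
    obtain b b' where "((\<lambda>t. dist x (r t) - t) \<longlongrightarrow> b) at_top" "((\<lambda>t. dist y (r t) - t) \<longlongrightarrow> b') at_top"
      using ray_horofunction_limit[OF r] by meson
    from tendsto_diff[OF this] show ?thesis by auto
  qed
  obtain b where b: "((\<lambda>t. dist x (r t) - dist y (r t)) \<longlongrightarrow> b) at_top"
    using lim boundary_repr(1)[OF \<xi> r] by blast
  have all: "((\<lambda>t. dist x (q t) - dist y (q t)) \<longlongrightarrow> b) at_top" if q: "q \<in> \<xi>" for q
  proof -
    obtain b' where b': "((\<lambda>t. dist x (q t) - dist y (q t)) \<longlongrightarrow> b') at_top"
      using lim boundary_repr(1)[OF \<xi> q] by blast
    obtain a where a: "((\<lambda>t. dist (r t) (q (t + a))) \<longlongrightarrow> 0) at_top"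
      using asymptotic_shift boundary_asymptotic[OF \<xi> r q] by blast
    have sh: "filterlim (\<lambda>t. t + a) at_top at_top"
      by (rule filterlim_at_top_mono[OF filterlim_tendsto_add_at_top[OF tendsto_const[of a] filterlim_ident]]) auto
    have b'': "((\<lambda>t. dist x (q (t + a)) - dist y (q (t + a))) \<longlongrightarrow> b') at_top"
      using filterlim_compose[OF b' sh] by simp
    have "((\<lambda>t. (dist x (r t) - dist y (r t)) - (dist x (q (t + a)) - dist y (q (t + a)))) \<longlongrightarrow> 0) at_top"
    proof (rule Lim_null_comparison)
      show "((\<lambda>t. 2 * dist (r t) (q (t + a))) \<longlongrightarrow> 0) at_top"
        using tendsto_mult[OF tendsto_const[of 2] a] by simp
      show "\<forall>\<^sub>F t in at_top. norm (dist x (r t) - dist y (r t) - (dist x (q (t + a)) - dist y (q (t + a)))) \<le> 2 * dist (r t) (q (t + a))"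
      proof (intro always_eventually allI)
        fix t
        have "\<bar>dist x (r t) - dist x (q (t + a))\<bar> \<le> dist (r t) (q (t + a))" "\<bar>dist y (r t) - dist y (q (t + a))\<bar> \<le> dist (r t) (q (t + a))"
          by (metis abs_dist_diff_le dist_commute)+
        then show "norm (dist x (r t) - dist y (r t) - (dist x (q (t + a)) - dist y (q (t + a)))) \<le> 2 * dist (r t) (q (t + a))"
          unfolding real_norm_def by linarith
      qed
    qed
    then have "b - b' = 0"
      using tendsto_diff[OF b b''] tendsto_unique[OF trivial_limit_at_top_linorder] by blast
    then show ?thesis using b' by simp
  qed
  have "busemann \<xi> x y = b"
    unfolding busemann_def
  proof (rule the_equality)
    show "\<forall>r\<in>\<xi>. ((\<lambda>t. dist x (r t) - dist y (r t)) \<longlongrightarrow> b) at_top" using all by blast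
    show "b' = b" if "\<forall>r\<in>\<xi>. ((\<lambda>t. dist x (r t) - dist y (r t)) \<longlongrightarrow> b') at_top" for b'
      using that r b tendsto_unique[OF trivial_limit_at_top_linorder] by blast
  qed
  then show ?thesis using b by simp
qed

end

section \<open>Geodesic lines and null sets of the Bowen-Margulis measure\<close>

text \<open>Tychonoff. A filter takes the place of a subsequence, since the index set will be the
  uncountable real line.\<close>

lemma pointwise_cluster:
  fixes f :: "nat \<Rightarrow> 'i \<Rightarrow> 'a::metric_space"
  assumes K: "\<And>i. compact (K i)" and f: "\<And>n i. f n i \<in> K i"
  obtains l G where "G \<noteq> bot" "\<And>P. eventually (\<lambda>n. P (f n)) sequentially \<Longrightarrow> eventually P G"
    "\<And>i. ((\<lambda>g. g i) \<longlongrightarrow> l i) G"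
proof -
  have "compact (PiE UNIV K)"
    using K by (simp add: compactin_euclidean_iff[symmetric] compactin_PiE flip: euclidean_product_topology del: compactin_euclidean_iff)
  moreover have "eventually (\<lambda>g. g \<in> PiE UNIV K) (filtermap f sequentially)"
    using f by (simp add: eventually_filtermap PiE_iff extensional_def)
  moreover have "filtermap f sequentially \<noteq> bot" by (simp add: filtermap_bot_iff)
  ultimately obtain l where l: "inf (nhds l) (filtermap f sequentially) \<noteq> bot"
    unfolding compact_filter by blast
  show ?thesis
  proof (rule that[OF l])
    fix P assume "eventually (\<lambda>n. P (f n)) sequentially"
    then have "eventually P (filtermap f sequentially)" by (simp add: eventually_filtermap)
    then show "eventually P (inf (nhds l) (filtermap f sequentially))"
      by (rule filter_leD[OF inf_le2])
  next
    fix i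
    have "continuous_on UNIV (\<lambda>g::'i \<Rightarrow> 'a. g i)" by (rule continuous_on_product_coordinates)
    then have op: "open ((\<lambda>g::'i \<Rightarrow> 'a. g i) -` S)" if "open S" for S
      using that by (rule open_vimage[rotated])
    have "((\<lambda>g::'i \<Rightarrow> 'a. g i) \<longlongrightarrow> l i) (nhds l)"
    proof (rule topological_tendstoI)
      fix S :: "'a set" assume "open S" "l i \<in> S"
      then show "eventually (\<lambda>g. g i \<in> S) (nhds l)"
        using op[of S] by (auto simp: eventually_nhds)
    qed
    then show "((\<lambda>g. g i) \<longlongrightarrow> l i) (inf (nhds l) (filtermap f sequentially))"
      by (rule tendsto_mono[rotated]) simp
  qed
qed

context cat1_space
begin

text \<open>If the Gromov products were unbounded, \<open>thin\<close> would keep the rays 2-close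
  for all time and the ends would coincide.\<close>

lemma gp_bounded_distinct:
  fixes x :: 'a
  assumes "\<xi> \<in> boundary" "\<eta> \<in> boundary" "\<xi> \<noteq> \<eta>" "r \<in> \<xi>" "q \<in> \<eta>" "r 0 = x" "q 0 = x"
  obtains G where "0 \<le> G" "\<And>t u. 0 \<le> t \<Longrightarrow> 0 \<le> u \<Longrightarrow> gp x (r t) (q u) \<le> G"
proof -
  have r: "r \<in> geodesic_rays" and q: "q \<in> geodesic_rays" using boundary_repr assms by metis+
  have "\<exists>G. \<forall>t u. 0 \<le> t \<longrightarrow> 0 \<le> u \<longrightarrow> gp x (r t) (q u) \<le> G"
  proof (rule ccontr)
    assume n: "\<not> ?thesis"
    have "dist (r s) (q s) \<le> 2" if s: "0 \<le> s" for s
    proof -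
      obtain t u where tu: "0 \<le> t" "0 \<le> u" "s < gp x (r t) (q u)" using n by (meson not_le)
      show ?thesis
        using thin[OF ray_seg0[OF r tu(1)], of q "q u" s] ray_seg0[OF q tu(2)] tu s assms by auto
    qed
    then have "(r, q) \<in> asymptotic" using r q by (auto simp: asymptotic_def)
    then show False using boundary_eqI assms by blast
  qed
  then obtain G where "\<forall>t u. 0 \<le> t \<longrightarrow> 0 \<le> u \<longrightarrow> gp x (r t) (q u) \<le> G" by blast
  then show ?thesis using that[of "max 0 G"] by (simp add: max.coboundedI2)
qed

text \<open>The segments from \<open>r n\<close> to \<open>q n\<close> pass at bounded distance from
  \<open>x\<close> because the Gromov products are bounded. Parametrised from there, they have a
  pointwise cluster point, and it shadows both rays.\<close>

lemma line_ex:
  fixes \<xi> \<eta> :: "'a boundary_pt"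
  assumes "\<xi> \<in> boundary" "\<eta> \<in> boundary" "\<xi> \<noteq> \<eta>"
  shows "\<exists>l\<in>geodesic_lines. neg_end l = \<xi> \<and> pos_end l = \<eta>"
proof -
  fix x :: 'a
  obtain r q where r: "r \<in> \<xi>" "r 0 = x" "r \<in> geodesic_rays" and q: "q \<in> \<eta>" "q 0 = x" "q \<in> geodesic_rays"
    using ray_from_ex assms by metis
  obtain G where G: "0 \<le> G" "\<And>t u. 0 \<le> t \<Longrightarrow> 0 \<le> u \<Longrightarrow> gp x (r t) (q u) \<le> G"
    using gp_bounded_distinct[OF assms r(1) q(1) r(2) q(2)] by metis
  obtain c where c: "\<And>n. geodesic_segment (c n) (r (real n)) (q (real n))"
    using choice[of "\<lambda>n c. geodesic_segment c (r (real n)) (q (real n))"] seg_ex by blast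
  define g where "g n = gp x (r (real n)) (q (real n))" for n
  define L where "L n = dist (r (real n)) (q (real n))" for n
  have dr: "dist (r 0) (r (real n)) = n" "dist (q 0) (q (real n)) = n" for n
    using ray_dist[OF r(3), of 0 n] ray_dist[OF q(3), of 0 n] by auto
  have g: "0 \<le> g n" "g n \<le> G" "g n \<le> real n" and L: "L n = 2 * real n - 2 * g n" for n
    using G(2)[of n n] gp_nonneg[of x "r n" "q n"] gp_le[of x "r n" "q n"] dr[of n] r(2) q(2)
    by (auto simp: g_def L_def gp_def field_simps)
  have dx: "dist x (r (real n)) = n" "dist x (q (real n)) = n" "dist (r (real n)) x = n" "dist (q (real n)) x = n" for n
    using dr[of n] r(2) q(2) by (auto simp: dist_commute)
  have sr: "geodesic_segment (\<lambda>t. r (real n - t)) (r (real n)) x" and sq: "geodesic_segment (\<lambda>t. q (real n - t)) (q (real n)) x" for n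
    using seg_rev[OF ray_seg0[OF r(3), of "real n"]] seg_rev[OF ray_seg0[OF q(3), of "real n"]] r(2) q(2) dx[of n] by auto
  \<comment> \<open>Time 0 is the midpoint of the segment, as its length is
    \<open>2 * (real n - g n)\<close>. The value \<open>x\<close> outside the segment only keeps
    \<open>f n s\<close> inside a fixed ball.\<close>
  define f where "f n s = (if \<bar>s\<bar> \<le> real n - g n then c n (real n - g n + s) else x)" for n and s :: real
  have fq: "dist (f n s) (q s) \<le> 2 + G" if s: "0 \<le> s" "s \<le> real n - g n" for n s
  proof -
    define u where "u = real n - g n - s"
    have dd: "dist (q n) (r n) = L n" by (simp add: L_def dist_commute)
    have "dist (c n (L n - u)) (q (n - u)) \<le> 2"
      using thin[OF seg_rev[OF c[of n]] sq[of n], of u] s L[of n] g[of n]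
      unfolding L_def[symmetric] gp_def dd dx u_def by simp
    moreover have "L n - u = real n - g n + s" "n - u = g n + s" by (auto simp: u_def L)
    ultimately have "dist (f n s) (q (g n + s)) \<le> 2" using s by (simp add: f_def)
    moreover have "dist (q (g n + s)) (q s) \<le> G" using ray_dist[OF q(3), of "g n + s" s] g[of n] s by simp
    ultimately show ?thesis using dist_triangle[of "f n s" "q s" "q (g n + s)"] by linarith
  qed
  have fr: "dist (f n (- s)) (r s) \<le> 2 + G" if s: "0 \<le> s" "s \<le> real n - g n" for n s
  proof -
    define u where "u = real n - g n - s"
    have "dist (c n u) (r (n - u)) \<le> 2"
      using thin[OF c[of n] sr[of n], of u] s L[of n] g[of n]
      unfolding L_def[symmetric] gp_def dx u_def by simp
    moreover have "u = real n - g n - s" "n - u = g n + s" by (auto simp: u_def)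
    ultimately have "dist (f n (- s)) (r (g n + s)) \<le> 2" using s by (simp add: f_def)
    moreover have "dist (r (g n + s)) (r s) \<le> G" using ray_dist[OF r(3), of "g n + s" s] g[of n] s by simp
    ultimately show ?thesis using dist_triangle[of "f n (- s)" "r s" "r (g n + s)"] by linarith
  qed
  have fK: "f n s \<in> cball x (\<bar>s\<bar> + 2 + G)" for n s
  proof (cases "\<bar>s\<bar> \<le> real n - g n")
    case True
    show ?thesis
    proof (cases "0 \<le> s")
      case s: True
      then show ?thesis using fq[of s n] True dist_triangle[of x "f n s" "q s"] ray_dist[OF q(3), of 0 s] q(2)
        by (auto simp: dist_commute)
    next
      case False
      then show ?thesis using fr[of "- s" n] True dist_triangle[of x "f n s" "r (- s)"] ray_dist[OF r(3), of 0 "- s"] r(2)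
        by (auto simp: dist_commute)
    qed
  qed (use G in \<open>auto simp: f_def\<close>)
  obtain l F where F: "F \<noteq> bot" and ev: "\<And>P. eventually (\<lambda>n. P (f n)) sequentially \<Longrightarrow> eventually P F"
    and lim: "\<And>i. ((\<lambda>g. g i) \<longlongrightarrow> l i) F"
    by (rule pointwise_cluster[of "\<lambda>s. cball x (\<bar>s\<bar> + 2 + G)" f]) (use fK in auto)
  have big: "eventually (\<lambda>n. s \<le> real n - g n) sequentially" for s
  proof -
    obtain N :: nat where N: "s + G \<le> real N" using real_arch_simple by blast
    have "s \<le> real n - g n" if "N \<le> n" for n using N that g[of n] by simp
    then show ?thesis by (auto simp: eventually_sequentially)
  qed
  have l: "l \<in> geodesic_lines"
    unfolding geodesic_lines_def
  proof (intro CollectI allI)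
    fix s t :: real
    have "eventually (\<lambda>h. dist (h s) (h t) = \<bar>s - t\<bar>) F"
    proof (rule ev)
      show "\<forall>\<^sub>F n in sequentially. dist (f n s) (f n t) = \<bar>s - t\<bar>"
        using big[of "\<bar>s\<bar>"] big[of "\<bar>t\<bar>"]
      proof eventually_elim
        case (elim n)
        then show ?case using seg_dist[OF c[of n], of "real n - g n + s" "real n - g n + t"] L[of n]
          by (auto simp: f_def L_def)
      qed
    qed
    then have "((\<lambda>h. dist (h s) (h t)) \<longlongrightarrow> \<bar>s - t\<bar>) F" by (rule tendsto_eventually)
    then show "dist (l s) (l t) = \<bar>s - t\<bar>" using tendsto_unique[OF F tendsto_dist[OF lim lim]] by blast
  qed
  have lq: "dist (l s) (q s) \<le> 2 + G" if s: "0 \<le> s" for s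
  proof -
    have "eventually (\<lambda>h. dist (h s) (q s) \<le> 2 + G) F"
      by (rule ev, rule eventually_mono[OF big[of s]]) (use fq s in auto)
    then show ?thesis by (intro tendsto_upperbound[OF tendsto_dist[OF lim tendsto_const] _ F]) 
  qed
  have lr: "dist (l (- s)) (r s) \<le> 2 + G" if s: "0 \<le> s" for s
  proof -
    have "eventually (\<lambda>h. dist (h (- s)) (r s) \<le> 2 + G) F"
      by (rule ev, rule eventually_mono[OF big[of s]]) (use fr s in auto)
    then show ?thesis by (intro tendsto_upperbound[OF tendsto_dist[OF lim tendsto_const] _ F]) 
  qed
  have "(l, q) \<in> asymptotic" "(\<lambda>t. l (- t), r) \<in> asymptotic"
    using lq lr q(3) r(3) line_ray[OF l] by (auto simp: asymptotic_def)
  then have "pos_end l = \<eta>" "neg_end l = \<xi>"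
    using boundary_eqI pos_end_boundary[OF l] neg_end_boundary[OF l] assms q(1) r(1) by metis+
  then show ?thesis using l by blast
qed

lemma hopf_surj:
  fixes x :: 'a
  assumes "\<xi> \<in> boundary" "\<eta> \<in> boundary" "\<xi> \<noteq> \<eta>"
  shows "(\<xi>, \<eta>, t) \<in> hopf x ` geodesic_lines"
proof -
  obtain l where l: "l \<in> geodesic_lines" "neg_end l = \<xi>" "pos_end l = \<eta>" using line_ex assms by blast
  obtain s where s: "\<forall>u. dist x (l s) \<le> dist x (l u)" using closest_ex1[OF l(1)] by blast
  \<comment> \<open>Reparametrised so that the closest point, at time \<open>s\<close> on
    \<open>l\<close>, occurs at the prescribed time \<open>t\<close>.\<close>
  define m where "m u = l (u + (s - t))" for u
  have m: "m \<in> geodesic_lines" using l(1) by (auto simp: m_def geodesic_lines_def)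
  have "(m, l) \<in> asymptotic" "(\<lambda>t. m (- t), \<lambda>t. l (- t)) \<in> asymptotic"
    using line_ray[OF m] line_ray[OF l(1)] l(1) by (auto simp: asymptotic_def m_def geodesic_lines_def)
  then have "pos_end m = \<eta>" "neg_end m = \<xi>"
    using boundary_eqI pos_end_boundary[OF m] neg_end_boundary[OF m] pos_end_boundary[OF l(1)] neg_end_boundary[OF l(1)] l by metis+
  moreover have "(THE s. \<forall>u. dist x (m s) \<le> dist x (m u)) = t"
    using closest_ex1[OF m, of x] s by (intro the1_equality) (auto simp: m_def)
  ultimately show ?thesis using m by (force simp: hopf_def)
qed

lemma hopf_components:
  "l \<in> geodesic_lines \<Longrightarrow> fst (hopf x l) = neg_end l" "l \<in> geodesic_lines \<Longrightarrow> fst (snd (hopf x l)) = pos_end l"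
  by (auto simp: hopf_def)

end

text \<open>\<open>measure_of\<close> yields either the given set function or 0. This one-sided
  estimate is enough to show that sets are null.\<close>

lemma emeasure_measure_of_le: "emeasure (measure_of \<Omega> A \<mu>) X \<le> \<mu> X"
proof (cases "A \<subseteq> Pow \<Omega>")
  case True
  then show ?thesis by (simp add: emeasure_measure_of_conv)
next
  case False
  then show ?thesis
    by (metis (no_types, lifting) emeasure_measure_of_conv sigma_sets_into_sp measure_space_def sigma_algebra_iff2 sigma_sets.Basic subsetI zero_le order_refl)
qed

lemma emeasure_density_le: "emeasure (density M f) A \<le> (\<integral>\<^sup>+x. f x * indicator A x \<partial>M)"
  unfolding density_def by (rule emeasure_measure_of_le)

lemma null_density:
  assumes "A \<in> null_sets M"
  shows "emeasure (density M f) A = 0"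
proof -
  have "(\<integral>\<^sup>+x. f x * indicator A x \<partial>M) = (\<integral>\<^sup>+x. 0 \<partial>M)"
    by (rule nn_integral_cong_AE) (use AE_not_in[OF assms] in eventually_elim, simp)
  then show ?thesis using emeasure_density_le[of M f A] by simp
qed

text \<open>Neither the measurability of \<open>visual_dist\<close> nor that of the diagonal is needed: if one of them failed,
  the measure would be zero by definition.\<close>

lemma (in cat1_space) AE_bowen_margulis:
  fixes \<mu> :: "'a \<Rightarrow> 'a boundary_pt measure"
  assumes sets: "sets (\<mu> x) = sets boundary_borel" and fin: "finite_measure (\<mu> x)"
    and N: "N \<in> null_sets (\<mu> x)" and P: "\<And>l. l \<in> geodesic_lines \<Longrightarrow> pos_end l \<notin> N \<Longrightarrow> P l"
  shows "AE l in bowen_margulis \<delta> \<mu> x. P l"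
proof -
  interpret finite_measure "\<mu> x" by (rule fin)
  have sp: "space (\<mu> x) = boundary"
    using sets_eq_imp_space_eq[OF sets] by (simp add: boundary_borel_def space_measure_of_conv)
  define D where "D = {(\<xi>::'a boundary_pt, \<eta>, t::real). \<xi> \<noteq> \<eta>}"
  define Q where "Q = \<mu> x \<Otimes>\<^sub>M (\<mu> x \<Otimes>\<^sub>M (lborel :: real measure))"
  define R where "R = restrict_space Q D"
  define H where "H = bowen_margulis_hopf \<delta> \<mu> x"
  have HR: "space H = space R" "sets H = sets R" unfolding H_def bowen_margulis_hopf_def R_def Q_def D_def by simp_all
  have spR: "space R = D \<inter> (boundary \<times> boundary \<times> UNIV)"
    by (auto simp: R_def space_restrict_space Q_def space_pair_measure sp)
  define N1 where "N1 = (boundary :: 'a boundary_pt set) \<times> N \<times> (UNIV :: real set)"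
  interpret p: pair_sigma_finite "\<mu> x" "lborel :: real measure" ..
  have s2: "sigma_finite_measure (\<mu> x \<Otimes>\<^sub>M (lborel :: real measure))"
    by (rule sigma_finite_pair_measure) unfold_locales
  have N2: "emeasure (\<mu> x \<Otimes>\<^sub>M lborel) (N \<times> (UNIV :: real set)) = 0"
    using N by (subst sigma_finite_measure.emeasure_pair_measure_Times[OF lborel.sigma_finite_measure_axioms]) auto
  have Nb: "N \<in> sets (\<mu> x)" "boundary \<in> sets (\<mu> x)" using N sets.top[of "\<mu> x"] sp by auto
  have N1s: "N1 \<in> sets Q" unfolding N1_def Q_def using Nb by (intro pair_measureI) auto
  have "emeasure Q N1 = 0"
    unfolding N1_def Q_def using Nb N2
    by (subst sigma_finite_measure.emeasure_pair_measure_Times[OF s2]) auto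
  then have "emeasure Q (D \<inter> N1) = 0"
    using emeasure_mono[OF _ N1s, of "D \<inter> N1"] by auto
  then have "emeasure R (D \<inter> N1) = 0"
    using emeasure_measure_of_le[of "D \<inter> space Q" "(\<inter>) D ` sets Q" "emeasure Q" "D \<inter> N1"]
    unfolding R_def restrict_space_def by simp
  moreover have N1R: "D \<inter> N1 \<in> sets R" unfolding R_def sets_restrict_space using N1s by blast
  ultimately have "D \<inter> N1 \<in> null_sets R" by auto
  then have H0: "emeasure H (D \<inter> N1) = 0"
    unfolding H_def bowen_margulis_hopf_def D_def[symmetric] Q_def[symmetric] R_def[symmetric] by (rule null_density)
  define V where "V = vimage_algebra geodesic_lines (hopf x) H"
  define Z where "Z = hopf x -` (D \<inter> N1) \<inter> geodesic_lines"
  have hm: "hopf x \<in> geodesic_lines \<rightarrow> space H"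
    unfolding HR spR D_def hopf_def
    using neg_end_ne_pos_end pos_end_boundary(1) neg_end_boundary(1) by auto
  have ZV: "Z \<in> sets V"
    unfolding V_def sets_vimage_algebra2[OF hm] Z_def HR(2) using N1R by blast
  \<comment> \<open>Surjectivity of the Hopf coordinates makes \<open>inv_into\<close> a right
    inverse, so that the preimage of \<open>Z\<close> falls back into the null set
    \<open>D \<inter> N1\<close>.\<close>
  have inv: "hopf x (inv_into geodesic_lines (hopf x) z) = z" if "z \<in> space H" for z
  proof -
    have "z \<in> hopf x ` geodesic_lines" using that hopf_surj unfolding HR spR D_def by auto
    then show ?thesis by (rule f_inv_into_f)
  qed
  have "inv_into geodesic_lines (hopf x) -` Z \<inter> space H \<subseteq> D \<inter> N1"
    using inv by (auto simp: Z_def)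
  then have "emeasure H (inv_into geodesic_lines (hopf x) -` Z \<inter> space H) = 0"
    using emeasure_mono[of "inv_into geodesic_lines (hopf x) -` Z \<inter> space H" "D \<inter> N1" H] H0 N1R HR by auto
  then have "emeasure (bowen_margulis \<delta> \<mu> x) Z = 0"
    using emeasure_measure_of_le[of "space V" "sets V" "\<lambda>A. emeasure H (inv_into geodesic_lines (hopf x) -` A \<inter> space H)" Z]
    unfolding bowen_margulis_def H_def[symmetric] V_def[symmetric] distr_def by simp
  moreover have "sets (bowen_margulis \<delta> \<mu> x) = sets V" "space (bowen_margulis \<delta> \<mu> x) = geodesic_lines"
    by (simp_all add: bowen_margulis_def V_def H_def)
  ultimately have "Z \<in> null_sets (bowen_margulis \<delta> \<mu> x)" using ZV by auto
  then show ?thesis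
  proof (rule AE_I')
    show "{l \<in> space (bowen_margulis \<delta> \<mu> x). \<not> P l} \<subseteq> Z"
      using P hm hopf_components unfolding HR spR D_def Z_def N1_def \<open>space (bowen_margulis \<delta> \<mu> x) = geodesic_lines\<close>
      by (auto simp: hopf_def neg_end_boundary(1)) (metis neg_end_ne_pos_end)+
  qed
qed

section \<open>Isometric actions\<close>

text \<open>The shadow of a ball around \<open>y\<close>, with light source \<open>x\<close>.
  Closeness is tested at the single time \<open>dist x y\<close>, which costs a bounded factor in
  the radius; the strict inequality makes shadows open when \<open>x \<noteq> y\<close>.\<close>

definition shadow :: "'a::metric_space \<Rightarrow> 'a \<Rightarrow> real \<Rightarrow> 'a boundary_pt set" where
  "shadow x y R = {\<xi> \<in> boundary. \<exists>r\<in>\<xi>. r 0 = x \<and> dist (r (dist x y)) y < R}"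

lemma topspace_cone: "topspace (cone_topology :: ('a::metric_space + 'a boundary_pt) topology) = Inl ` UNIV \<union> Inr ` boundary"
proof -
  have 1: "\<exists>c r e. c \<in> geodesic_rays \<and> 0 < r \<and> 0 < e \<and> Inr \<xi> \<in> cone_nbhd c r (e::real)" if \<xi>: "\<xi> \<in> (boundary :: 'a boundary_pt set)" for \<xi>
  proof -
    obtain c where c: "c \<in> \<xi>" using boundary_nonempty[OF \<xi>] by blast
    then have "Inr \<xi> \<in> cone_nbhd c 1 1" using \<xi> by (auto simp: cone_nbhd_def intro!: bexI[of _ c])
    moreover have "c \<in> geodesic_rays" using boundary_repr[OF \<xi> c] by simp
    ultimately show ?thesis using zero_less_one by blast
  qed
  show ?thesis
    unfolding cone_topology_def topology_generated_by_topspace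
  proof (intro equalityI subsetI)
    fix z :: "'a + 'a boundary_pt"
    assume "z \<in> \<Union> ({Inl ` ball x r |x r. 0 < r} \<union> {cone_nbhd c r e |c r e. c \<in> geodesic_rays \<and> 0 < r \<and> 0 < e})"
    then show "z \<in> Inl ` UNIV \<union> Inr ` boundary" by (auto simp: cone_nbhd_def)
  next
    fix z :: "'a + 'a boundary_pt"
    assume "z \<in> Inl ` UNIV \<union> Inr ` boundary"
    then consider x where "z = Inl x" | \<xi> where "z = Inr \<xi>" "\<xi> \<in> boundary" by blast
    then show "z \<in> \<Union> ({Inl ` ball x r |x r. 0 < r} \<union> {cone_nbhd c r e |c r e. c \<in> geodesic_rays \<and> 0 < r \<and> 0 < e})"
    proof cases
      case 1
      then have "z \<in> Inl ` ball x 1" by simp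
      then show ?thesis using zero_less_one by blast
    next
      case 2
      from 1[OF this(2)] show ?thesis unfolding 2(1) by blast
    qed
  qed
qed

text \<open>Basic cone neighbourhoods are centred at rays, while \<open>p\<close> is an arbitrary
  point: each ray passing near \<open>p\<close> becomes the centre of a neighbourhood whose size is
  the remaining slack.\<close>

lemma openin_boundary_passing:
  assumes "0 < s"
  shows "openin boundary_topology {\<xi> \<in> boundary. \<exists>c\<in>\<xi>. c 0 = x \<and> dist (c s) p < e}"
proof -
  define W where "W = \<Union> {cone_nbhd c s (e - dist (c s) p) |c. c \<in> geodesic_rays \<and> c 0 = x \<and> dist (c s) p < e}"
  have "openin cone_topology W"
    unfolding W_def
  proof (intro openin_Union, clarify)
    fix c assume "c \<in> geodesic_rays" "dist (c s) p < e"
    moreover from this have "0 < e - dist (c s) p" by simp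
    ultimately show "openin cone_topology (cone_nbhd c s (e - dist (c s) p))"
      unfolding cone_topology_def using assms by (intro topology_generated_by_Basis) blast
  qed
  moreover have "{\<xi> \<in> boundary. \<exists>c\<in>\<xi>. c 0 = x \<and> dist (c s) p < e} = Inr -` W \<inter> boundary"
  proof (intro equalityI subsetI)
    fix \<xi> assume "\<xi> \<in> {\<xi> \<in> boundary. \<exists>c\<in>\<xi>. c 0 = x \<and> dist (c s) p < e}"
    then obtain c where c: "\<xi> \<in> boundary" "c \<in> \<xi>" "c 0 = x" "dist (c s) p < e" by blast
    then have "Inr \<xi> \<in> cone_nbhd c s (e - dist (c s) p)" by (auto simp: cone_nbhd_def intro!: bexI[of _ c])
    then show "\<xi> \<in> Inr -` W \<inter> boundary" using c boundary_repr(1)[OF c(1,2)] unfolding W_def by blast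
  next
    fix \<xi> assume "\<xi> \<in> Inr -` W \<inter> boundary"
    then obtain c where c: "\<xi> \<in> boundary" "Inr \<xi> \<in> cone_nbhd c s (e - dist (c s) p)" "c 0 = x"
      unfolding W_def by blast
    then obtain c' where c': "c' \<in> \<xi>" "c' 0 = x" "dist (c' s) (c s) < e - dist (c s) p" by (auto simp: cone_nbhd_def)
    then have "dist (c' s) p < e" using dist_triangle[of "c' s" p "c s"] by linarith
    then show "\<xi> \<in> {\<xi> \<in> boundary. \<exists>c\<in>\<xi>. c 0 = x \<and> dist (c s) p < e}" using c c' by blast
  qed
  ultimately show ?thesis unfolding boundary_topology_def openin_pullback_topology by blast
qed

lemma space_boundary_borel: "space boundary_borel = boundary"
  by (simp add: boundary_borel_def space_measure_of_conv)

lemma openin_boundary_subset: "openin boundary_topology U \<Longrightarrow> U \<subseteq> boundary"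
  by (auto simp: boundary_topology_def openin_pullback_topology)

lemma open_in_boundary_borel:
  assumes "openin boundary_topology U"
  shows "U \<in> sets boundary_borel"
  using assms openin_boundary_subset unfolding boundary_borel_def
  by (subst sets_measure_of) blast+

context cat1_space
begin

lemma shadow_sets:
  fixes x y :: 'a
  shows "shadow x y R \<in> sets boundary_borel"
proof (cases "dist x y > 0")
  case True
  then show ?thesis unfolding shadow_def by (intro open_in_boundary_borel openin_boundary_passing)
next
  case False
  have xy: "x = y" using False by simp
  \<comment> \<open>The degenerate case escapes the cone topology, whose neighbourhoods look at
    positive times only.\<close>
  have "shadow x y R = (if 0 < R then boundary else {})"
    using ray_from_ex[of _ y] unfolding shadow_def xy by (auto, metis dist_self)
  then show ?thesis using sets.top[of boundary_borel] space_boundary_borel by (metis sets.empty_sets)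
qed

lemma boundary_sets: "(boundary :: 'a boundary_pt set) \<in> sets boundary_borel"
  using sets.top[of boundary_borel] space_boundary_borel by metis

end

section \<open>Isometries acting on the boundary, the limit set and its hull\<close>

locale isom_action = cat1_space type_tag for type_tag :: "'a::heine_borel itself" +
  fixes \<Gamma> :: "('a \<Rightarrow> 'a) set"
  assumes sub: "subgroup \<Gamma> isometry_group"
begin

lemma act_carrier: "\<gamma> \<in> \<Gamma> \<Longrightarrow> surj \<gamma>" "\<gamma> \<in> \<Gamma> \<Longrightarrow> dist (\<gamma> x) (\<gamma> y) = dist x y"
  using subgroup.subset[OF sub] by (auto simp: isometry_group_def)

lemma act_comp: "\<gamma> \<in> \<Gamma> \<Longrightarrow> \<gamma>' \<in> \<Gamma> \<Longrightarrow> \<gamma> \<circ> \<gamma>' \<in> \<Gamma>"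
  using subgroup.m_closed[OF sub] by (auto simp: isometry_group_def)

lemma act_id: "id \<in> \<Gamma>"
  using subgroup.one_closed[OF sub] by (auto simp: isometry_group_def)

abbreviation ginv :: "('a \<Rightarrow> 'a) \<Rightarrow> 'a \<Rightarrow> 'a" where
  "ginv \<gamma> \<equiv> inv_into UNIV \<gamma>"

lemma act_bij: "\<gamma> \<in> \<Gamma> \<Longrightarrow> bij \<gamma>"
  using act_carrier by (metis bijI dist_eq_0_iff injI)

lemma ginv_simps [simp]:
  "\<gamma> \<in> \<Gamma> \<Longrightarrow> ginv \<gamma> (\<gamma> x) = x" "\<gamma> \<in> \<Gamma> \<Longrightarrow> \<gamma> (ginv \<gamma> x) = x"
  "\<gamma> \<in> \<Gamma> \<Longrightarrow> ginv \<gamma> \<circ> \<gamma> = id" "\<gamma> \<in> \<Gamma> \<Longrightarrow> \<gamma> \<circ> ginv \<gamma> = id"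
  using act_bij[of \<gamma>] by (auto simp: bij_is_inj bij_is_surj surj_f_inv_f fun_eq_iff)

lemma m_inv_eq: "\<gamma> \<in> \<Gamma> \<Longrightarrow> m_inv isometry_group \<gamma> = ginv \<gamma>"
proof -
  assume g: "\<gamma> \<in> \<Gamma>"
  have c: "\<gamma> \<in> carrier isometry_group" using g subgroup.subset[OF sub] by blast
  have "ginv \<gamma> \<in> carrier isometry_group"
    using act_bij[OF g] act_carrier(2)[OF g] g
    by (auto simp: isometry_group_def bij_imp_bij_inv bij_is_surj) (metis ginv_simps(2))
  moreover have "mult isometry_group (ginv \<gamma>) \<gamma> = one isometry_group"
    using g by (simp add: isometry_group_def)
  ultimately show ?thesis
    using group.inv_equality[OF group_isometry_group _ c] by blast
qed

lemma act_inv: "\<gamma> \<in> \<Gamma> \<Longrightarrow> ginv \<gamma> \<in> \<Gamma>"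
  using subgroup.m_inv_closed[OF sub] m_inv_eq by metis

lemma dist_ginv: "\<gamma> \<in> \<Gamma> \<Longrightarrow> dist (ginv \<gamma> x) y = dist x (\<gamma> y)"
  using act_carrier(2)[of \<gamma> "ginv \<gamma> x" y] by simp

lemma dist_ginv': "\<gamma> \<in> \<Gamma> \<Longrightarrow> dist x (ginv \<gamma> y) = dist (\<gamma> x) y"
  using act_carrier(2)[of \<gamma> x "ginv \<gamma> y"] by simp

lemma act_seg: "\<gamma> \<in> \<Gamma> \<Longrightarrow> geodesic_segment b x y \<Longrightarrow> geodesic_segment (\<gamma> \<circ> b) (\<gamma> x) (\<gamma> y)"
  by (simp add: geodesic_segment_def act_carrier)

lemma act_ray: "\<gamma> \<in> \<Gamma> \<Longrightarrow> r \<in> geodesic_rays \<Longrightarrow> \<gamma> \<circ> r \<in> geodesic_rays"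
  by (simp add: geodesic_rays_def act_carrier)

lemma act_line: "\<gamma> \<in> \<Gamma> \<Longrightarrow> l \<in> geodesic_lines \<Longrightarrow> \<gamma> \<circ> l \<in> geodesic_lines"
  by (simp add: geodesic_lines_def act_carrier)

lemma act_asymptotic:
  "\<gamma> \<in> \<Gamma> \<Longrightarrow> (\<gamma> \<circ> r, \<gamma> \<circ> q) \<in> asymptotic \<longleftrightarrow> (r, q) \<in> asymptotic"
  by (auto simp: asymptotic_def act_carrier geodesic_rays_def)

lemma boundary_map_class:
  assumes g: "\<gamma> \<in> \<Gamma>" and r: "r \<in> geodesic_rays"
  shows "boundary_map \<gamma> (asymptotic `` {r}) = asymptotic `` {\<gamma> \<circ> r}"
proof (intro equalityI subsetI)
  fix q assume "q \<in> boundary_map \<gamma> (asymptotic `` {r})"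
  then show "q \<in> asymptotic `` {\<gamma> \<circ> r}" using act_asymptotic[OF g] by (auto simp: boundary_map_def)
next
  fix q assume "q \<in> asymptotic `` {\<gamma> \<circ> r}"
  moreover have "q = \<gamma> \<circ> (ginv \<gamma> \<circ> q)" using g by (simp add: fun_eq_iff)
  ultimately have "(\<gamma> \<circ> r, \<gamma> \<circ> (ginv \<gamma> \<circ> q)) \<in> asymptotic" by simp
  then have "ginv \<gamma> \<circ> q \<in> asymptotic `` {r}" using act_asymptotic[OF g] by blast
  then show "q \<in> boundary_map \<gamma> (asymptotic `` {r})"
    unfolding boundary_map_def using \<open>q = \<gamma> \<circ> (ginv \<gamma> \<circ> q)\<close> by blast
qed

lemma boundary_map_boundary:
  assumes g: "\<gamma> \<in> \<Gamma>" and \<xi>: "\<xi> \<in> boundary"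
  shows "boundary_map \<gamma> \<xi> \<in> boundary"
proof -
  obtain r where r: "r \<in> geodesic_rays" "\<xi> = asymptotic `` {r}" using boundary_nonempty[OF \<xi>] boundary_repr[OF \<xi>] by metis
  show ?thesis unfolding r(2) boundary_map_class[OF g r(1)] by (rule ray_class(1)[OF act_ray[OF g r(1)]])
qed

lemma boundary_map_comp: "boundary_map \<gamma> (boundary_map \<gamma>' \<xi>) = boundary_map (\<gamma> \<circ> \<gamma>') \<xi>"
  by (auto simp: boundary_map_def image_image comp_assoc)

lemma boundary_map_id: "boundary_map id \<xi> = \<xi>"
  by (simp add: boundary_map_def)

lemma boundary_map_ginv:
  assumes "\<gamma> \<in> \<Gamma>"
  shows "boundary_map (ginv \<gamma>) (boundary_map \<gamma> \<xi>) = \<xi>" "boundary_map \<gamma> (boundary_map (ginv \<gamma>) \<xi>) = \<xi>"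
  using assms by (simp_all add: boundary_map_comp boundary_map_id)

lemma pos_end_act:
  assumes "\<gamma> \<in> \<Gamma>" "l \<in> geodesic_lines"
  shows "pos_end (\<gamma> \<circ> l) = boundary_map \<gamma> (pos_end l)" "neg_end (\<gamma> \<circ> l) = boundary_map \<gamma> (neg_end l)"
  using boundary_map_class[OF assms(1) line_ray(1)[OF assms(2)]] boundary_map_class[OF assms(1) line_ray(2)[OF assms(2)]]
  by (auto simp: pos_end_def neg_end_def comp_def)

lemma shadow_act:
  assumes g: "\<gamma> \<in> \<Gamma>" and \<xi>: "\<xi> \<in> boundary"
  shows "boundary_map \<gamma> \<xi> \<in> shadow (\<gamma> x) (\<gamma> y) R \<longleftrightarrow> \<xi> \<in> shadow x y R"
proof -
  have "(\<exists>r\<in>boundary_map \<gamma> \<xi>. r 0 = \<gamma> x \<and> dist (r (dist x y)) (\<gamma> y) < R) \<longleftrightarrow> (\<exists>r\<in>\<xi>. r 0 = x \<and> dist (r (dist x y)) y < R)"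
    using act_bij[OF g] by (auto simp: boundary_map_def act_carrier[OF g] bij_is_inj inj_eq)
  then show ?thesis using boundary_map_boundary[OF g \<xi>] \<xi> by (simp add: shadow_def act_carrier[OF g])
qed

text \<open>The preimage of a ball or cone neighbourhood is one of the same kind, based at the
  translate by the inverse. It yields invariance of the limit set as well as measurability of the
  boundary maps.\<close>

lemma continuous_map_cone_act:
  assumes g: "\<gamma> \<in> \<Gamma>"
  shows "continuous_map cone_topology cone_topology (map_sum \<gamma> (boundary_map \<gamma>))"
proof -
  define \<Phi> where "\<Phi> = map_sum \<gamma> (boundary_map \<gamma>)"
  define T where "T = (Inl ` UNIV \<union> Inr ` boundary :: ('a + 'a boundary_pt) set)"
  note gi = act_inv[OF g]
  have ball: "\<Phi> -` (Inl ` ball x r) \<inter> T = Inl ` ball (ginv \<gamma> x) r" for x r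
    using g by (auto simp: \<Phi>_def T_def dist_ginv image_iff map_sum.simps elim!: sumE)
  have cone: "\<Phi> -` cone_nbhd c r e \<inter> T = cone_nbhd (ginv \<gamma> \<circ> c) r e" for c r e
  proof -
    have 1: "(\<exists>b. geodesic_segment b (c 0) (\<gamma> y) \<and> dist (b r) (c r) < e) \<longleftrightarrow>
      (\<exists>b. geodesic_segment b (ginv \<gamma> (c 0)) y \<and> dist (b r) (ginv \<gamma> (c r)) < e)" for y
    proof
      assume "\<exists>b. geodesic_segment b (c 0) (\<gamma> y) \<and> dist (b r) (c r) < e"
      then obtain b where "geodesic_segment b (c 0) (\<gamma> y)" "dist (b r) (c r) < e" by blast
      then have "geodesic_segment (ginv \<gamma> \<circ> b) (ginv \<gamma> (c 0)) y \<and> dist ((ginv \<gamma> \<circ> b) r) (ginv \<gamma> (c r)) < e"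
        using isom_action.act_seg[OF isom_action_axioms gi, of b "c 0" "\<gamma> y"] g gi by (simp add: act_carrier(2))
      then show "\<exists>b. geodesic_segment b (ginv \<gamma> (c 0)) y \<and> dist (b r) (ginv \<gamma> (c r)) < e" by blast
    next
      assume "\<exists>b. geodesic_segment b (ginv \<gamma> (c 0)) y \<and> dist (b r) (ginv \<gamma> (c r)) < e"
      then obtain b where "geodesic_segment b (ginv \<gamma> (c 0)) y" "dist (b r) (ginv \<gamma> (c r)) < e" by blast
      then have "geodesic_segment (\<gamma> \<circ> b) (c 0) (\<gamma> y) \<and> dist ((\<gamma> \<circ> b) r) (c r) < e"
        using act_seg[OF g, of b "ginv \<gamma> (c 0)" y] g by (simp add: dist_ginv')
      then show "\<exists>b. geodesic_segment b (c 0) (\<gamma> y) \<and> dist (b r) (c r) < e" by blast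
    qed
    have 2: "(\<exists>c'\<in>boundary_map \<gamma> \<xi>. c' 0 = c 0 \<and> dist (c' r) (c r) < e) \<longleftrightarrow>
      (\<exists>c'\<in>\<xi>. c' 0 = ginv \<gamma> (c 0) \<and> dist (c' r) (ginv \<gamma> (c r)) < e)" for \<xi>
    proof -
      have "\<gamma> p = c 0 \<longleftrightarrow> p = ginv \<gamma> (c 0)" for p using g by (metis ginv_simps(1,2))
      then show ?thesis using g by (auto simp: boundary_map_def dist_ginv')
    qed
    have mem: "z \<in> \<Phi> -` cone_nbhd c r e \<inter> T \<longleftrightarrow> z \<in> cone_nbhd (ginv \<gamma> \<circ> c) r e" for z
    proof (cases z)
      case (Inl y)
      then show ?thesis using 1[of y] g by (auto simp: \<Phi>_def T_def cone_nbhd_def dist_ginv)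
    next
      case (Inr \<xi>)
      have "boundary_map \<gamma> \<xi> \<in> boundary \<longleftrightarrow> \<xi> \<in> boundary"
        using boundary_map_boundary[OF g] boundary_map_boundary[OF gi] boundary_map_ginv[OF g] by metis
      then show ?thesis using 2[of \<xi>] Inr by (auto simp: \<Phi>_def T_def cone_nbhd_def)
    qed
    then show ?thesis by blast
  qed
  have b1: "openin cone_topology (Inl ` ball x r)" if "0 < r" for x :: 'a and r
    unfolding cone_topology_def using that by (intro topology_generated_by_Basis) blast
  have b2: "openin cone_topology (cone_nbhd c r e)" if "c \<in> geodesic_rays" "0 < r" "0 < e" for c :: "real \<Rightarrow> 'a" and r e
    unfolding cone_topology_def using that by (intro topology_generated_by_Basis) blast
  define \<S> where "\<S> = {Inl ` ball (x::'a) r |x r. 0 < r} \<union> {cone_nbhd c r e |c r e. c \<in> geodesic_rays \<and> 0 < r \<and> 0 < e}"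
  have "continuous_map cone_topology (topology_generated_by \<S>) \<Phi>"
    unfolding continuous_on_generated_topo_iff topspace_cone T_def[symmetric]
  proof (intro conjI allI impI)
    fix U assume "U \<in> \<S>"
    then consider x r where "U = Inl ` ball x r" "0 < r" | c r e where "U = cone_nbhd c r e" "c \<in> geodesic_rays" "0 < r" "0 < e"
      unfolding \<S>_def by blast
    then show "openin cone_topology (\<Phi> -` U \<inter> T)"
    proof cases
      case 1
      then show ?thesis using ball b1 by simp
    next
      case 2
      then show ?thesis unfolding 2(1) cone using act_ray[OF gi] by (intro b2) auto
    qed
  next
    have "\<Phi> ` T \<subseteq> T" using boundary_map_boundary[OF g] by (auto simp: \<Phi>_def T_def)
    also have "T = \<Union> \<S>" unfolding T_def topspace_cone[symmetric] cone_topology_def \<S>_def topology_generated_by_topspace ..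
    finally show "\<Phi> ` T \<subseteq> \<Union> \<S>" .
  qed
  then show ?thesis unfolding \<S>_def cone_topology_def[symmetric] \<Phi>_def .
qed

lemma limit_set_act:
  assumes g: "\<gamma> \<in> \<Gamma>" and \<xi>: "\<xi> \<in> limit_set \<Gamma>"
  shows "boundary_map \<gamma> \<xi> \<in> limit_set \<Gamma>"
  unfolding limit_set_def
proof (intro CollectI conjI allI)
  show "boundary_map \<gamma> \<xi> \<in> boundary" using \<xi> boundary_map_boundary[OF g] by (simp add: limit_set_def)
  fix x
  have "Inr \<xi> \<in> cone_topology closure_of (Inl ` isom_orbit \<Gamma> x)" using \<xi> by (simp add: limit_set_def)
  then have "map_sum \<gamma> (boundary_map \<gamma>) (Inr \<xi>) \<in> cone_topology closure_of (map_sum \<gamma> (boundary_map \<gamma>) ` Inl ` isom_orbit \<Gamma> x)"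
    using continuous_map_image_closure_subset[OF continuous_map_cone_act[OF g]] by blast
  moreover have "map_sum \<gamma> (boundary_map \<gamma>) ` Inl ` isom_orbit \<Gamma> x \<subseteq> Inl ` isom_orbit \<Gamma> x"
  proof -
    have "\<gamma> ` isom_orbit \<Gamma> x \<subseteq> isom_orbit \<Gamma> x"
    proof -
      have "\<gamma> (\<gamma>' x) \<in> isom_orbit \<Gamma> x" if "\<gamma>' \<in> \<Gamma>" for \<gamma>'
        unfolding isom_orbit_def using imageI[OF act_comp[OF g that], of "\<lambda>\<gamma>. \<gamma> x"] by simp
      then show ?thesis by (auto simp: isom_orbit_def)
    qed
    then show ?thesis by (auto simp: image_image)
  qed
  ultimately show "Inr (boundary_map \<gamma> \<xi>) \<in> cone_topology closure_of (Inl ` isom_orbit \<Gamma> x)"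
    using closure_of_mono by fastforce
qed

text \<open>The preimage under \<gamma> of a set from the intersection defining the hull again
  belongs to that family.\<close>

lemma hull_act:
  assumes g: "\<gamma> \<in> \<Gamma>" and p: "p \<in> hull_at_infinity (limit_set \<Gamma>)"
  shows "\<gamma> p \<in> hull_at_infinity (limit_set \<Gamma>)"
  unfolding hull_at_infinity_def
proof (intro InterI, clarify)
  fix C assume C: "closed C" "geodesically_convex C"
    "\<forall>l\<in>geodesic_lines. neg_end l \<in> limit_set \<Gamma> \<and> pos_end l \<in> limit_set \<Gamma> \<longrightarrow> range l \<subseteq> C"
  have cont: "continuous_on UNIV \<gamma>"
    unfolding continuous_on_iff by (metis act_carrier(2)[OF g])
  have "closed (\<gamma> -` C)" using C(1) cont by (simp add: closed_vimage)
  moreover have "geodesically_convex (\<gamma> -` C)"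
    unfolding geodesically_convex_def
  proof (intro ballI allI impI)
    fix x y c assume xy: "x \<in> \<gamma> -` C" "y \<in> \<gamma> -` C" "geodesic_segment c x y"
    then have "(\<gamma> \<circ> c) ` {0..dist (\<gamma> x) (\<gamma> y)} \<subseteq> C"
      using C(2) act_seg[OF g xy(3)] xy(1,2) unfolding geodesically_convex_def vimage_eq by blast
    then show "c ` {0..dist x y} \<subseteq> \<gamma> -` C" by (auto simp: act_carrier[OF g])
  qed
  moreover have "range l \<subseteq> \<gamma> -` C" if "l \<in> geodesic_lines" "neg_end l \<in> limit_set \<Gamma> \<and> pos_end l \<in> limit_set \<Gamma>" for l
  proof -
    have "range (\<gamma> \<circ> l) \<subseteq> C"
      using C(3) act_line[OF g that(1)] that limit_set_act[OF g] pos_end_act[OF g that(1)] by metis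
    then show ?thesis by auto
  qed
  ultimately have "p \<in> \<gamma> -` C" using p unfolding hull_at_infinity_def by blast
  then show "\<gamma> p \<in> C" by simp
qed

lemma hull_convex: "geodesically_convex (hull_at_infinity A)"
  unfolding hull_at_infinity_def geodesically_convex_def by blast

lemma hull_line:
  "l \<in> geodesic_lines \<Longrightarrow> neg_end l \<in> A \<Longrightarrow> pos_end l \<in> A \<Longrightarrow> l t \<in> hull_at_infinity A"
  unfolding hull_at_infinity_def by blast

text \<open>The orbits that meet the ball of radius \<open>n\<close> around \<open>x\<close> form
  open sets covering the compact quotient as \<open>n\<close> grows; a finite subcover bounds the
  distance to the orbit of \<open>x\<close>.\<close>

lemma cocompact_orbit_dense:
  assumes Q: "quotient_map (top_of_set C) Q (isom_orbit \<Gamma>)" and comp: "compact_space Q"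
    and inv: "\<And>\<gamma> p. \<gamma> \<in> \<Gamma> \<Longrightarrow> p \<in> C \<Longrightarrow> \<gamma> p \<in> C"
  shows "\<exists>D\<ge>0. \<forall>p\<in>C. \<exists>\<gamma>\<in>\<Gamma>. dist p (\<gamma> x) \<le> D"
proof -
  define U where "U n = isom_orbit \<Gamma> ` (C \<inter> ball x (real n))" for n :: nat
  have top: "topspace Q = isom_orbit \<Gamma> ` C" using Q by (auto simp: quotient_map_def)
  have same: "isom_orbit \<Gamma> (\<gamma> p) = isom_orbit \<Gamma> p" if g: "\<gamma> \<in> \<Gamma>" for \<gamma> p
  proof -
    have "\<gamma>' (\<gamma> p) \<in> isom_orbit \<Gamma> p" if "\<gamma>' \<in> \<Gamma>" for \<gamma>'
      unfolding isom_orbit_def using imageI[OF act_comp[OF that g], of "\<lambda>\<gamma>. \<gamma> p"] by simp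
    moreover have "\<gamma>' p \<in> isom_orbit \<Gamma> (\<gamma> p)" if "\<gamma>' \<in> \<Gamma>" for \<gamma>'
      unfolding isom_orbit_def using imageI[OF act_comp[OF that act_inv[OF g]], of "\<lambda>\<gamma>'. \<gamma>' (\<gamma> p)"] g by simp
    ultimately show ?thesis by (auto simp: isom_orbit_def)
  qed
  \<comment> \<open>By invariance of \<open>C\<close>, an orbit meets the ball at \<open>x\<close>
    iff the point lies in a translated ball. The right-hand side is visibly open in
    \<open>C\<close>, and openness of \<open>U n\<close> follows from
    \<open>quotient_map\<close>.\<close>
  have pre: "{p \<in> C. isom_orbit \<Gamma> p \<in> U n} = C \<inter> (\<Union>\<gamma>\<in>\<Gamma>. ball (\<gamma> x) (real n))" for n
  proof (intro equalityI subsetI)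
    fix p assume "p \<in> {p \<in> C. isom_orbit \<Gamma> p \<in> U n}"
    then obtain q where q: "p \<in> C" "q \<in> C" "dist x q < n" "isom_orbit \<Gamma> p = isom_orbit \<Gamma> q" by (auto simp: U_def)
    have "p \<in> isom_orbit \<Gamma> p" unfolding isom_orbit_def using imageI[OF act_id, of "\<lambda>\<gamma>. \<gamma> p"] by simp
    then obtain \<gamma> where \<gamma>: "\<gamma> \<in> \<Gamma>" "p = \<gamma> q" using q(4) by (auto simp: isom_orbit_def)
    then have "p \<in> ball (\<gamma> x) (real n)" using q by (simp add: act_carrier(2))
    then show "p \<in> C \<inter> (\<Union>\<gamma>\<in>\<Gamma>. ball (\<gamma> x) (real n))" using q(1) \<gamma>(1) by blast
  next
    fix p assume "p \<in> C \<inter> (\<Union>\<gamma>\<in>\<Gamma>. ball (\<gamma> x) (real n))"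
    then obtain \<gamma> where \<gamma>: "p \<in> C" "\<gamma> \<in> \<Gamma>" "dist (\<gamma> x) p < n" by auto
    then have "ginv \<gamma> p \<in> C \<inter> ball x n" using inv[OF act_inv] by (simp add: dist_ginv')
    then show "p \<in> {p \<in> C. isom_orbit \<Gamma> p \<in> U n}"
      using \<gamma> same[OF act_inv[OF \<gamma>(2)], of p] unfolding U_def by (metis (mono_tags, lifting) image_eqI mem_Collect_eq)
  qed
  have opU: "openin Q (U n)" for n
  proof -
    have "openin (top_of_set C) (C \<inter> (\<Union>\<gamma>\<in>\<Gamma>. ball (\<gamma> x) (real n)))" by (auto intro: openin_open_Int)
    moreover have "U n \<subseteq> topspace Q" unfolding top U_def by (intro image_mono) simp
    moreover have "\<forall>V\<subseteq>topspace Q. openin (top_of_set C) {p \<in> C. isom_orbit \<Gamma> p \<in> V} = openin Q V"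
      using Q unfolding quotient_map_def by simp
    ultimately show ?thesis using pre[of n] by metis
  qed
  have "topspace Q \<subseteq> \<Union> (range U)"
  proof
    fix z assume "z \<in> topspace Q"
    then obtain p where p: "p \<in> C" "z = isom_orbit \<Gamma> p" unfolding top by (elim imageE)
    obtain n :: nat where "dist x p < n" using reals_Archimedean2 by blast
    then have "z \<in> U n" using p by (auto simp: U_def)
    then show "z \<in> \<Union> (range U)" by blast
  qed
  then obtain \<F> where F: "finite \<F>" "\<F> \<subseteq> range U" "topspace Q \<subseteq> \<Union>\<F>"
    using comp opU unfolding compact_space_alt by (metis (no_types, lifting) imageE)
  obtain I where I: "finite I" "\<F> = U ` I" using finite_subset_image[OF F(1,2)] by blast
  define N where "N = Max (insert 0 I)"
  have "\<exists>\<gamma>\<in>\<Gamma>. dist p (\<gamma> x) \<le> real N" if p: "p \<in> C" for p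
  proof -
    obtain n where n: "n \<in> I" "isom_orbit \<Gamma> p \<in> U n" 
    proof -
      have "isom_orbit \<Gamma> p \<in> \<Union> (U ` I)" using F(3) imageI[OF p, of "isom_orbit \<Gamma>"] unfolding top I(2) by (rule subsetD)
      then show ?thesis using that by (elim UN_E)
    qed
    then have "p \<in> (\<Union>\<gamma>\<in>\<Gamma>. ball (\<gamma> x) (real n))" using pre[of n] p by blast
    then obtain \<gamma> where "\<gamma> \<in> \<Gamma>" "dist (\<gamma> x) p < n" by auto
    moreover have "n \<le> N" using n(1) I(1) by (simp add: N_def)
    ultimately show ?thesis by (intro bexI[of _ \<gamma>]) (auto simp: dist_commute)
  qed
  then show ?thesis by (intro exI[of _ "real N"]) simp
qed

end

section \<open>Proper discontinuity of discrete groups\<close>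

locale discrete_action = isom_action type_tag \<Gamma> for type_tag :: "'a::heine_borel itself" and \<Gamma> +
  assumes disc: "discrete \<Gamma>"
begin

text \<open>A basic neighbourhood of \<open>id\<close> for pointwise convergence restricts finitely
  many values only.\<close>

lemma discrete_at_id:
  obtains F e where "finite F" "0 < e" "\<And>\<gamma>. \<gamma> \<in> \<Gamma> \<Longrightarrow> (\<And>y. y \<in> F \<Longrightarrow> dist (\<gamma> y) y < e) \<Longrightarrow> \<gamma> = id"
proof -
  have "id isolated_in \<Gamma>" using disc act_id by (simp add: discrete_def)
  then obtain U where U: "open U" "U \<inter> \<Gamma> = {id}" by (auto simp: isolated_in_def)
  have oU: "openin (product_topology (\<lambda>_. euclidean) UNIV) U" using U(1) by (simp add: euclidean_product_topology)
  have "id \<in> U" using U(2) by blast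
  from product_topology_open_contains_basis[OF oU this] obtain X where X: "id \<in> PiE UNIV X" "\<And>i. openin euclidean (X i)"
    "finite {i. X i \<noteq> topspace (euclidean :: 'a topology)}" "PiE UNIV X \<subseteq> U" by blast
  define F where "F = {i. X i \<noteq> UNIV}"
  have F: "finite F" using X(3) by (simp add: F_def)
  have "\<exists>e>0. ball i e \<subseteq> X i" for i
    using X(1) X(2)[of i] open_contains_ball[of "X i"] by (auto simp: PiE_iff)
  then obtain e where e: "\<And>i. 0 < e i" "\<And>i. ball i (e i) \<subseteq> X i" by metis
  define e0 where "e0 = Min (insert 1 (e ` F))"
  have e0: "0 < e0" "\<And>i. i \<in> F \<Longrightarrow> e0 \<le> e i" using F e by (auto simp: e0_def)
  show ?thesis
  proof (rule that[OF F e0(1)])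
    fix \<gamma> assume g: "\<gamma> \<in> \<Gamma>" "\<And>y. y \<in> F \<Longrightarrow> dist (\<gamma> y) y < e0"
    have "\<gamma> i \<in> X i" for i
    proof (cases "i \<in> F")
      case True
      then have "\<gamma> i \<in> ball i (e i)" using g(2)[OF True] e0(2)[OF True] by (simp add: dist_commute)
      then show ?thesis using e(2) by blast
    next
      case False
      then show ?thesis by (simp add: F_def)
    qed
    then have "\<gamma> \<in> PiE UNIV X" by (simp add: PiE_iff extensional_def)
    then show "\<gamma> = id" using X(4) U(2) g(1) by blast
  qed
qed

text \<open>Infinitely many elements of bounded displacement move each of the finitely many test
  points inside a compact ball. By pigeonhole two of them nearly agree at all test points, and then
  their quotient is \<open>id\<close>.\<close>

lemma finite_ball: "finite {\<gamma> \<in> \<Gamma>. dist x (\<gamma> x) \<le> R}"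
proof (rule ccontr)
  assume inf: "infinite {\<gamma> \<in> \<Gamma>. dist x (\<gamma> x) \<le> R}"
  obtain F e where F: "finite F" "0 < e" "\<And>\<gamma>. \<gamma> \<in> \<Gamma> \<Longrightarrow> (\<And>y. y \<in> F \<Longrightarrow> dist (\<gamma> y) y < e) \<Longrightarrow> \<gamma> = id"
    using discrete_at_id by metis
  define S where "S = {\<gamma> \<in> \<Gamma>. dist x (\<gamma> x) \<le> R}"
  have "\<exists>S'\<subseteq>S. infinite S' \<and> (\<forall>y\<in>F. \<forall>\<gamma>\<in>S'. \<forall>\<gamma>'\<in>S'. dist (\<gamma> y) (\<gamma>' y) < e)"
    using F(1)
  proof (induction F rule: finite_induct)
    case empty
    then show ?case using inf by (auto simp: S_def)
  next
    case (insert y F)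
    then obtain S' where S': "S' \<subseteq> S" "infinite S'" "\<forall>y\<in>F. \<forall>\<gamma>\<in>S'. \<forall>\<gamma>'\<in>S'. dist (\<gamma> y) (\<gamma>' y) < e" by blast
    define K where "K = cball x (R + dist x y)"
    have K: "\<gamma> y \<in> K" if "\<gamma> \<in> S'" for \<gamma>
    proof -
      have "\<gamma> \<in> \<Gamma>" "dist x (\<gamma> x) \<le> R" using that S'(1) by (auto simp: S_def)
      then show ?thesis using dist_triangle[of x "\<gamma> y" "\<gamma> x"] act_carrier(2)[of \<gamma> x y] by (simp add: K_def)
    qed
    have "compact K" by (simp add: K_def)
    then have "\<forall>e>0. \<exists>k. finite k \<and> K \<subseteq> (\<Union>z\<in>k. ball z e)"
      using compact_eq_totally_bounded[of K] by blast
    then obtain k where k: "finite k" "K \<subseteq> (\<Union>z\<in>k. ball z (e / 2))"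
      using half_gt_zero[OF F(2)] by blast
    have "S' \<subseteq> (\<Union>z\<in>k. {\<gamma> \<in> S'. \<gamma> y \<in> ball z (e / 2)})" using K k(2) by blast
    then have "\<not> finite (\<Union>z\<in>k. {\<gamma> \<in> S'. \<gamma> y \<in> ball z (e / 2)})" using S'(2) finite_subset by blast
    then have "\<exists>z\<in>k. infinite {\<gamma> \<in> S'. \<gamma> y \<in> ball z (e / 2)}"
      using finite_UN_I[OF k(1)] by (metis (no_types, lifting))
    then obtain z where z: "infinite {\<gamma> \<in> S'. \<gamma> y \<in> ball z (e / 2)}" by blast
    have "dist (\<gamma> y) (\<gamma>' y) < e" if "\<gamma> y \<in> ball z (e / 2)" "\<gamma>' y \<in> ball z (e / 2)" for \<gamma> \<gamma>' :: "'a \<Rightarrow> 'a"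
      using dist_triangle_half_r[of z "\<gamma> y" e "\<gamma>' y"] that by simp
    then show ?case
      using S' z by (intro exI[of _ "{\<gamma> \<in> S'. \<gamma> y \<in> ball z (e / 2)}"]) auto
  qed
  then obtain S' where S': "S' \<subseteq> S" "infinite S'" "\<forall>y\<in>F. \<forall>\<gamma>\<in>S'. \<forall>\<gamma>'\<in>S'. dist (\<gamma> y) (\<gamma>' y) < e" by blast
  obtain \<gamma> where g: "\<gamma> \<in> S'" using S'(2) by fastforce
  have "infinite (S' - {\<gamma>})" using S'(2) by simp
  then obtain \<gamma>' where g': "\<gamma>' \<in> S'" "\<gamma>' \<noteq> \<gamma>" by (metis Diff_iff ex_in_conv finite.emptyI singletonI)
  have G: "\<gamma> \<in> \<Gamma>" "\<gamma>' \<in> \<Gamma>" using g g' S'(1) by (auto simp: S_def)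
  have "ginv \<gamma> \<circ> \<gamma>' = id"
    using G g g' S'(3) by (intro F(3) act_comp act_inv) (auto simp: dist_ginv)
  then have "\<gamma> \<circ> (ginv \<gamma> \<circ> \<gamma>') = \<gamma>" by simp
  then have "\<gamma>' = \<gamma>" using G(1) by (simp flip: comp_assoc)
  then show False using g' by simp
qed

end

section \<open>Counting orbit points\<close>

text \<open>Group by the integer part \<open>k\<close> of \<open>L\<close>: each shell contributes
  at most \<open>K * exp (s * (k + 1)) * exp (- q * k)\<close>. The next two lemmas sum the
  geometric series in its convergent and in its divergent regime.\<close>

lemma shell_sum_bound:
  fixes L :: "'b \<Rightarrow> real"
  assumes F: "finite F" and L0: "\<And>\<gamma>. \<gamma> \<in> F \<Longrightarrow> 0 \<le> L \<gamma>" and Ln: "\<And>\<gamma>. \<gamma> \<in> F \<Longrightarrow> L \<gamma> \<le> real n"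
    and K: "\<And>R. 0 \<le> R \<Longrightarrow> real (card {\<gamma> \<in> F. L \<gamma> \<le> R}) \<le> K * exp (s * R)" and q: "0 \<le> q"
  shows "(\<Sum>\<gamma>\<in>F. exp (- q * L \<gamma>)) \<le> K * exp s * (\<Sum>k\<le>n. exp (s - q) ^ k)"
proof -
  define A where "A k = {\<gamma> \<in> F. nat \<lfloor>L \<gamma>\<rfloor> = k}" for k
  have "(\<Sum>\<gamma>\<in>F. exp (- q * L \<gamma>)) = (\<Sum>k\<le>n. \<Sum>\<gamma>\<in>A k. exp (- q * L \<gamma>))"
    unfolding A_def
  proof (rule sum.group[symmetric])
    show "(\<lambda>\<gamma>. nat \<lfloor>L \<gamma>\<rfloor>) ` F \<subseteq> {..n}"
      using Ln by (auto simp: le_nat_iff nat_le_iff floor_le_iff) (meson le_less_trans less_add_one)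
  qed (use F in auto)
  also have "\<dots> \<le> (\<Sum>k\<le>n. K * exp s * exp (s - q) ^ k)"
  proof (rule sum_mono)
    fix k assume "k \<in> {..n}"
    have Lk: "real k \<le> L \<gamma> \<and> L \<gamma> \<le> real k + 1" if "\<gamma> \<in> A k" for \<gamma>
      using that L0[of \<gamma>] by (auto simp: A_def)
    have "(\<Sum>\<gamma>\<in>A k. exp (- q * L \<gamma>)) \<le> (\<Sum>\<gamma>\<in>A k. exp (- q * real k))"
      using Lk q by (intro sum_mono) (auto intro: mult_left_mono)
    also have "\<dots> = real (card (A k)) * exp (- q * real k)" by simp
    also have "\<dots> \<le> (K * exp (s * (real k + 1))) * exp (- q * real k)"
    proof (intro mult_right_mono)
      have "card (A k) \<le> card {\<gamma> \<in> F. L \<gamma> \<le> real k + 1}"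
        using Lk F by (intro card_mono) (auto simp: A_def)
      then show "real (card (A k)) \<le> K * exp (s * (real k + 1))" using K[of "real k + 1"] by linarith
    qed auto
    also have "\<dots> = K * exp s * exp (s - q) ^ k"
      by (simp add: exp_add[symmetric] exp_of_nat_mult[symmetric] algebra_simps)
    finally show "(\<Sum>\<gamma>\<in>A k. exp (- q * L \<gamma>)) \<le> K * exp s * exp (s - q) ^ k" .
  qed
  finally show ?thesis by (simp add: sum_distrib_left)
qed

lemma shell_sum_conv:
  fixes L :: "'b \<Rightarrow> real"
  assumes "finite F" "\<And>\<gamma>. \<gamma> \<in> F \<Longrightarrow> 0 \<le> L \<gamma>"
    and K: "\<And>R. 0 \<le> R \<Longrightarrow> real (card {\<gamma> \<in> F. L \<gamma> \<le> R}) \<le> K * exp (s * R)" and "0 \<le> q" "s < q" "0 \<le> K"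
  shows "(\<Sum>\<gamma>\<in>F. exp (- q * L \<gamma>)) \<le> K * exp s / (1 - exp (s - q))"
proof -
  obtain n :: nat where n: "\<And>\<gamma>. \<gamma> \<in> F \<Longrightarrow> L \<gamma> \<le> real n"
  proof -
    obtain n :: nat where "Max (insert 0 (L ` F)) \<le> real n" using real_arch_simple by blast
    then have "L \<gamma> \<le> real n" if "\<gamma> \<in> F" for \<gamma> using assms(1) that by simp
    then show ?thesis by (rule that)
  qed
  have "(\<Sum>\<gamma>\<in>F. exp (- q * L \<gamma>)) \<le> K * exp s * (\<Sum>k\<le>n. exp (s - q) ^ k)"
    by (rule shell_sum_bound) (use assms n in auto)
  also have "\<dots> \<le> K * exp s * (1 / (1 - exp (s - q)))"
  proof (intro mult_left_mono)
    have "(\<Sum>k\<le>n. exp (s - q) ^ k) \<le> (\<Sum>k. exp (s - q) ^ k)"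
      using assms by (intro sum_le_suminf summable_geometric) auto
    then show "(\<Sum>k\<le>n. exp (s - q) ^ k) \<le> 1 / (1 - exp (s - q))" using assms by (simp add: suminf_geometric)
  qed (use assms in auto)
  finally show ?thesis by simp
qed

lemma shell_sum_div:
  fixes L :: "'b \<Rightarrow> real"
  assumes "finite F" "\<And>\<gamma>. \<gamma> \<in> F \<Longrightarrow> 0 \<le> L \<gamma>" "\<And>\<gamma>. \<gamma> \<in> F \<Longrightarrow> L \<gamma> \<le> R" "0 \<le> R"
    and K: "\<And>R. 0 \<le> R \<Longrightarrow> real (card {\<gamma> \<in> F. L \<gamma> \<le> R}) \<le> K * exp (s * R)" and "0 \<le> q" "q < s" "0 \<le> K"
  shows "(\<Sum>\<gamma>\<in>F. exp (- q * L \<gamma>)) \<le> K * exp s * exp (2 * (s - q)) / (exp (s - q) - 1) * exp ((s - q) * R)"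
proof -
  define n where "n = nat \<lceil>R\<rceil>"
  have n: "R \<le> real n" "real n \<le> R + 1" using assms(4) by (auto simp: n_def)
  have e: "exp (s - q) > 1" using assms by simp
  have "(\<Sum>\<gamma>\<in>F. exp (- q * L \<gamma>)) \<le> K * exp s * (\<Sum>k\<le>n. exp (s - q) ^ k)"
    by (rule shell_sum_bound) (use assms n in \<open>auto intro: order_trans\<close>)
  also have "\<dots> \<le> K * exp s * (exp ((s - q) * (R + 2)) / (exp (s - q) - 1))"
  proof (intro mult_left_mono)
    have "(\<Sum>k\<le>n. exp (s - q) ^ k) = (exp (s - q) ^ Suc n - 1) / (exp (s - q) - 1)"
      using geometric_sum[of "exp (s - q)" "Suc n"] e by (simp add: lessThan_Suc_atMost)
    also have "\<dots> \<le> exp ((s - q) * (R + 2)) / (exp (s - q) - 1)"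
    proof (intro divide_right_mono)
      have "exp (s - q) ^ Suc n = exp ((s - q) * (real n + 1))"
        by (simp add: exp_of_nat_mult[symmetric] exp_add[symmetric] algebra_simps)
      also have "\<dots> \<le> exp ((s - q) * (R + 2))" using n assms by simp
      finally show "exp (s - q) ^ Suc n - 1 \<le> exp ((s - q) * (R + 2))" by simp
    qed (use e in auto)
    finally show "(\<Sum>k\<le>n. exp (s - q) ^ k) \<le> exp ((s - q) * (R + 2)) / (exp (s - q) - 1)" .
  qed (use assms in auto)
  also have "exp ((s - q) * (R + 2)) = exp (2 * (s - q)) * exp ((s - q) * R)"
    by (simp add: exp_add[symmetric] algebra_simps)
  finally show ?thesis by simp
qed

lemma exp_growth_summable:
  fixes L :: "'b \<Rightarrow> real"
  assumes L0: "\<And>\<gamma>. \<gamma> \<in> S \<Longrightarrow> 0 \<le> L \<gamma>" and fin: "\<And>R. finite {\<gamma> \<in> S. L \<gamma> \<le> R}"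
    and K: "\<And>R. 0 \<le> R \<Longrightarrow> real (card {\<gamma> \<in> S. L \<gamma> \<le> R}) \<le> K * exp (s * R)" and "0 \<le> q" "s < q" "0 \<le> K"
  shows "(\<lambda>\<gamma>. exp (- q * L \<gamma>)) summable_on S"
proof (rule nonneg_bdd_above_summable_on)
  show "bdd_above (sum (\<lambda>\<gamma>. exp (- q * L \<gamma>)) ` {F. F \<subseteq> S \<and> finite F})"
  proof (rule bdd_aboveI2)
    fix F assume F: "F \<in> {F. F \<subseteq> S \<and> finite F}"
    show "(\<Sum>\<gamma>\<in>F. exp (- q * L \<gamma>)) \<le> K * exp s / (1 - exp (s - q))"
    proof (rule shell_sum_conv)
      fix R :: real assume "0 \<le> R"
      have "card {\<gamma> \<in> F. L \<gamma> \<le> R} \<le> card {\<gamma> \<in> S. L \<gamma> \<le> R}" using F by (intro card_mono fin) auto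
      then show "real (card {\<gamma> \<in> F. L \<gamma> \<le> R}) \<le> K * exp (s * R)" using K[OF \<open>0 \<le> R\<close>] by linarith
    qed (use F L0 assms in auto)
  qed
qed simp

text \<open>Exact exponential growth, on both sides, is asked of the large group only; of the small
  group only the abscissa of its Poincare series is known. The base point lies on a line of the
  core, so it belongs to the core and \<open>\<Gamma>\<^sub>0\<close> has elements of every length
  up to an error \<open>D\<close>.\<close>

locale core_pair = discrete_action type_tag \<Gamma> for type_tag :: "'a::heine_borel itself" and \<Gamma> +
  fixes \<Gamma>\<^sub>0 :: "('a \<Rightarrow> 'a) set" and x :: 'a and \<delta> \<delta>\<^sub>0 cN CN D :: real and C\<^sub>0 :: "'a set" and l\<^sub>0 :: "real \<Rightarrow> 'a"
  assumes sub0: "subgroup \<Gamma>\<^sub>0 isometry_group" and sub0': "\<Gamma>\<^sub>0 \<subseteq> \<Gamma>"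
    and malnormal: "\<And>g. g \<in> \<Gamma> \<Longrightarrow> g \<notin> \<Gamma>\<^sub>0 \<Longrightarrow> finite {h \<in> \<Gamma>\<^sub>0. g \<circ> h \<circ> inv_into UNIV g \<in> \<Gamma>\<^sub>0}"
    and proper_sub: "\<Gamma>\<^sub>0 \<noteq> \<Gamma>"
    and d0_nonneg: "0 \<le> \<delta>\<^sub>0" and d_nonneg: "0 \<le> \<delta>"
    and cN: "0 < cN" and growth_lower: "\<And>R. 0 \<le> R \<Longrightarrow> cN * exp (\<delta> * R) \<le> real (card {\<gamma> \<in> \<Gamma>. dist x (\<gamma> x) \<le> R})"
    and CN: "0 < CN" and growth_upper: "\<And>R. 0 \<le> R \<Longrightarrow> real (card {\<gamma> \<in> \<Gamma>. dist x (\<gamma> x) \<le> R}) \<le> CN * exp (\<delta> * R)"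
    and conv0: "\<And>s. \<delta>\<^sub>0 < s \<Longrightarrow> (\<lambda>\<gamma>. exp (- s * dist x (\<gamma> x))) summable_on \<Gamma>\<^sub>0"
    and div0: "\<And>s. 0 \<le> s \<Longrightarrow> s < \<delta>\<^sub>0 \<Longrightarrow> \<not> (\<lambda>\<gamma>. exp (- s * dist x (\<gamma> x))) summable_on \<Gamma>\<^sub>0"
    and core_convex: "geodesically_convex C\<^sub>0" and core_inv: "\<And>h p. h \<in> \<Gamma>\<^sub>0 \<Longrightarrow> p \<in> C\<^sub>0 \<Longrightarrow> h p \<in> C\<^sub>0"
    and D: "0 \<le> D" and core_dense: "\<And>p. p \<in> C\<^sub>0 \<Longrightarrow> \<exists>h\<in>\<Gamma>\<^sub>0. dist p (h x) \<le> D"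
    and line0: "l\<^sub>0 \<in> geodesic_lines" "\<And>t. l\<^sub>0 t \<in> C\<^sub>0" "l\<^sub>0 0 = x"
begin

sublocale act0: isom_action type_tag \<Gamma>\<^sub>0
  by (intro isom_action.intro isom_action_axioms.intro cat1_space_axioms sub0)

definition len :: "('a \<Rightarrow> 'a) \<Rightarrow> real" where
  "len \<gamma> = dist x (\<gamma> x)"

lemma len_nonneg [simp]: "0 \<le> len \<gamma>"
  by (simp add: len_def)

lemma len_id [simp]: "len id = 0"
  by (simp add: len_def)

lemma x_core: "x \<in> C\<^sub>0"
  using line0 by metis

lemma mem0: "h \<in> \<Gamma>\<^sub>0 \<Longrightarrow> h \<in> \<Gamma>"
  using sub0' by blast

lemma len_comp: "\<gamma> \<in> \<Gamma> \<Longrightarrow> len (\<gamma> \<circ> \<gamma>') \<le> len \<gamma> + len \<gamma>'"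
  using dist_triangle[of x "\<gamma> (\<gamma>' x)" "\<gamma> x"] by (simp add: len_def act_carrier(2))

lemma len_ginv: "\<gamma> \<in> \<Gamma> \<Longrightarrow> len (ginv \<gamma>) = len \<gamma>"
  by (simp add: len_def dist_ginv' dist_commute)

lemma dist_act: "\<gamma> \<in> \<Gamma> \<Longrightarrow> dist (\<gamma> x) (\<gamma>' x) = len (ginv \<gamma> \<circ> \<gamma>')"
  by (simp add: len_def dist_ginv')

definition orbit_count where "orbit_count R = card {\<gamma> \<in> \<Gamma>. len \<gamma> \<le> R}"
definition core_count where "core_count R = card {\<gamma> \<in> \<Gamma>\<^sub>0. len \<gamma> \<le> R}"

lemma fin_ball: "finite {\<gamma> \<in> \<Gamma>. len \<gamma> \<le> R}" "finite {\<gamma> \<in> \<Gamma>\<^sub>0. len \<gamma> \<le> R}"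
proof -
  show 1: "finite {\<gamma> \<in> \<Gamma>. len \<gamma> \<le> R}" using finite_ball by (simp add: len_def)
  show "finite {\<gamma> \<in> \<Gamma>\<^sub>0. len \<gamma> \<le> R}" by (rule finite_subset[OF _ 1]) (auto intro: mem0)
qed

lemma orbit_count_bounds: "0 \<le> R \<Longrightarrow> cN * exp (\<delta> * R) \<le> orbit_count R" "0 \<le> R \<Longrightarrow> orbit_count R \<le> CN * exp (\<delta> * R)"
  using growth_lower growth_upper by (simp_all add: orbit_count_def len_def)

lemma core_count_mono: "R \<le> R' \<Longrightarrow> core_count R \<le> core_count R'"
  unfolding core_count_def by (intro card_mono fin_ball) auto

lemma core_count_le: "core_count R \<le> orbit_count R"
  unfolding core_count_def orbit_count_def by (intro card_mono fin_ball) (auto intro: mem0)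

lemma core_count_ge_1: "0 \<le> R \<Longrightarrow> 1 \<le> core_count R"
proof -
  assume "0 \<le> R"
  then have "id \<in> {\<gamma> \<in> \<Gamma>\<^sub>0. len \<gamma> \<le> R}" using act0.act_id by simp
  then show ?thesis unfolding core_count_def using fin_ball(2)[of R] by (metis One_nat_def Suc_leI card_gt_0_iff empty_iff)
qed

lemma card_near_orbit:
  assumes g: "g \<in> \<Gamma>"
  shows "finite {\<gamma> \<in> \<Gamma>. dist (g x) (\<gamma> x) \<le> R}" "card {\<gamma> \<in> \<Gamma>. dist (g x) (\<gamma> x) \<le> R} \<le> orbit_count R"
proof -
  define f where "f \<gamma> = ginv g \<circ> \<gamma>" for \<gamma> :: "'a \<Rightarrow> 'a"
  have inj: "inj_on f {\<gamma> \<in> \<Gamma>. dist (g x) (\<gamma> x) \<le> R}"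
  proof (rule inj_onI)
    fix \<gamma> \<gamma>' assume "f \<gamma> = f \<gamma>'"
    then have "g \<circ> (ginv g \<circ> \<gamma>) = g \<circ> (ginv g \<circ> \<gamma>')" by (simp add: f_def)
    then show "\<gamma> = \<gamma>'" using g by (simp flip: comp_assoc)
  qed
  have sub: "f ` {\<gamma> \<in> \<Gamma>. dist (g x) (\<gamma> x) \<le> R} \<subseteq> {\<gamma> \<in> \<Gamma>. len \<gamma> \<le> R}"
    using dist_act[OF g] act_comp[OF act_inv[OF g]] by (auto simp: f_def)
  show "finite {\<gamma> \<in> \<Gamma>. dist (g x) (\<gamma> x) \<le> R}" "card {\<gamma> \<in> \<Gamma>. dist (g x) (\<gamma> x) \<le> R} \<le> orbit_count R"
    using inj_on_finite[OF inj sub fin_ball(1)] card_inj_on_le[OF inj sub fin_ball(1)] by (simp_all add: orbit_count_def)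
qed

text \<open>Any orbit point near \<open>p\<close> can replace \<open>p\<close> as the centre if the
  radius is doubled.\<close>

lemma card_orbit_near:
  assumes "0 \<le> R"
  shows "finite {\<gamma> \<in> \<Gamma>. dist p (\<gamma> x) \<le> R}" "card {\<gamma> \<in> \<Gamma>. dist p (\<gamma> x) \<le> R} \<le> orbit_count (2 * R)"
proof -
  have "finite {\<gamma> \<in> \<Gamma>. dist p (\<gamma> x) \<le> R} \<and> card {\<gamma> \<in> \<Gamma>. dist p (\<gamma> x) \<le> R} \<le> orbit_count (2 * R)"
  proof (cases "{\<gamma> \<in> \<Gamma>. dist p (\<gamma> x) \<le> R} = {}")
    case True
    show ?thesis unfolding True by simp
  next
    case False
    then obtain g where g: "g \<in> \<Gamma>" "dist p (g x) \<le> R" by blast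
    have sub: "{\<gamma> \<in> \<Gamma>. dist p (\<gamma> x) \<le> R} \<subseteq> {\<gamma> \<in> \<Gamma>. dist (g x) (\<gamma> x) \<le> 2 * R}"
    proof clarify
      fix \<gamma> assume "dist p (\<gamma> x) \<le> R"
      then show "dist (g x) (\<gamma> x) \<le> 2 * R"
        using g(2) dist_triangle[of "g x" "\<gamma> x" p] by (simp add: dist_commute)
    qed
    show ?thesis
      using finite_subset[OF sub card_near_orbit(1)[OF g(1)]] card_mono[OF card_near_orbit(1)[OF g(1)] sub]
        card_near_orbit(2)[OF g(1), of "2 * R"] by linarith
  qed
  then show "finite {\<gamma> \<in> \<Gamma>. dist p (\<gamma> x) \<le> R}" "card {\<gamma> \<in> \<Gamma>. dist p (\<gamma> x) \<le> R} \<le> orbit_count (2 * R)" by auto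
qed

text \<open>Markov's inequality for the convergent Poincare series at \<open>s\<close>.\<close>

lemma core_count_upper:
  assumes "\<delta>\<^sub>0 < s"
  shows "\<exists>K>0. \<forall>R. real (core_count R) \<le> K * exp (s * R)"
proof -
  define K where "K = (\<Sum>\<^sub>\<infinity>\<gamma>\<in>\<Gamma>\<^sub>0. exp (- s * len \<gamma>)) + 1"
  have s: "0 < s" using assms d0_nonneg by simp
  show ?thesis
  proof (intro exI[of _ K] conjI allI)
    show "0 < K" unfolding K_def by (smt (verit) exp_ge_zero infsum_nonneg)
    fix R
    have "real (core_count R) * exp (- s * R) = (\<Sum>\<gamma>\<in>{\<gamma> \<in> \<Gamma>\<^sub>0. len \<gamma> \<le> R}. exp (- s * R))" by (simp add: core_count_def)
    also have "\<dots> \<le> (\<Sum>\<gamma>\<in>{\<gamma> \<in> \<Gamma>\<^sub>0. len \<gamma> \<le> R}. exp (- s * len \<gamma>))"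
      using s by (intro sum_mono) auto
    also have "\<dots> \<le> (\<Sum>\<^sub>\<infinity>\<gamma>\<in>\<Gamma>\<^sub>0. exp (- s * len \<gamma>))"
      using conv0[OF assms] fin_ball(2) unfolding len_def[symmetric] by (intro finite_sum_le_infsum) auto
    also have "\<dots> \<le> K" by (simp add: K_def)
    finally have "real (core_count R) * exp (- s * R) * exp (s * R) \<le> K * exp (s * R)" by (intro mult_right_mono) auto
    then show "real (core_count R) \<le> K * exp (s * R)" by (simp add: mult.assoc flip: exp_add)
  qed
qed

text \<open>The segment from \<open>x\<close> to \<open>h x\<close> stays in the convex core, where
  every point has an orbit point of \<open>\<Gamma>\<^sub>0\<close> within \<open>D\<close>. Hence
  elements can be cut at any prescribed length.\<close>

lemma cut0:
  assumes h: "h \<in> \<Gamma>\<^sub>0" and m: "0 \<le> m" "m \<le> len h"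
  obtains h1 where "h1 \<in> \<Gamma>\<^sub>0" "\<bar>len h1 - m\<bar> \<le> D" "\<bar>len (ginv h1 \<circ> h) - (len h - m)\<bar> \<le> D"
proof -
  obtain b where b: "geodesic_segment b x (h x)" using seg_ex by blast
  have "b m \<in> C\<^sub>0"
    using core_convex x_core core_inv[OF h x_core] b m unfolding geodesically_convex_def len_def by fastforce
  then obtain h1 where h1: "h1 \<in> \<Gamma>\<^sub>0" "dist (b m) (h1 x) \<le> D" using core_dense by blast
  have e: "dist x (b m) = m" "dist (b m) (h x) = len h - m" using seg_dist_ends[OF b] m by (auto simp: len_def)
  have "\<bar>len h1 - m\<bar> \<le> D" using dist_triangle[of x "h1 x" "b m"] dist_triangle[of x "b m" "h1 x"] h1 e
    by (auto simp: len_def dist_commute)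
  moreover have "\<bar>len (ginv h1 \<circ> h) - (len h - m)\<bar> \<le> D"
    using dist_triangle[of "h1 x" "h x" "b m"] dist_triangle[of "b m" "h x" "h1 x"] h1 e
    by (auto simp: dist_act[OF mem0, symmetric] dist_commute)
  ultimately show ?thesis using that h1(1) by blast
qed

text \<open>Cutting at length \<open>m\<close> records an element by its two pieces, from which it
  is recovered as their product.\<close>

lemma core_count_submult:
  assumes "0 \<le> m" "0 \<le> n"
  shows "core_count (m + n) \<le> core_count (m + D) * core_count (n + D)"
proof -
  have "\<exists>h1\<in>\<Gamma>\<^sub>0. len h1 \<le> m + D \<and> len (ginv h1 \<circ> h) \<le> n + D" if h: "h \<in> \<Gamma>\<^sub>0" "len h \<le> m + n" for h
  proof (cases "m \<le> len h")
    case True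
    obtain h1 where "h1 \<in> \<Gamma>\<^sub>0" "\<bar>len h1 - m\<bar> \<le> D" "\<bar>len (ginv h1 \<circ> h) - (len h - m)\<bar> \<le> D"
      using cut0[OF h(1) assms(1) True] by metis
    then show ?thesis using h(2) by (intro bexI[of _ h1]) auto
  next
    case False
    then show ?thesis using h D assms mem0 by (intro bexI[of _ h]) auto
  qed
  then obtain f where f: "\<And>h. h \<in> \<Gamma>\<^sub>0 \<Longrightarrow> len h \<le> m + n \<Longrightarrow> f h \<in> \<Gamma>\<^sub>0 \<and> len (f h) \<le> m + D \<and> len (ginv (f h) \<circ> h) \<le> n + D"
    by metis
  define B where "B R = {\<gamma> \<in> \<Gamma>\<^sub>0. len \<gamma> \<le> R}" for R
  have "card (B (m + n)) \<le> card (B (m + D) \<times> B (n + D))"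
  proof (rule card_inj_on_le)
    show "inj_on (\<lambda>h. (f h, ginv (f h) \<circ> h)) (B (m + n))"
    proof (rule inj_onI)
      fix h h' assume h: "h \<in> B (m + n)" and "(f h, ginv (f h) \<circ> h) = (f h', ginv (f h') \<circ> h')"
      then have "f h \<circ> (ginv (f h) \<circ> h) = f h \<circ> (ginv (f h) \<circ> h')" by (metis Pair_inject)
      moreover have "f h \<in> \<Gamma>\<^sub>0" using f h by (simp add: B_def)
      ultimately show "h = h'" by (simp flip: comp_assoc)
    qed
    show "(\<lambda>h. (f h, ginv (f h) \<circ> h)) ` B (m + n) \<subseteq> B (m + D) \<times> B (n + D)"
      using f act0.act_comp act0.act_inv by (auto simp: B_def)
  qed (use fin_ball in \<open>auto simp: B_def\<close>)
  then show ?thesis by (simp add: card_cartesian_product core_count_def B_def)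
qed

text \<open>A Fekete argument. If the count fell below \<open>exp (\<delta>\<^sub>0 * R)\<close> by
  more than a constant at a single radius, submultiplicativity would spread this to an exponential
  rate smaller than \<open>\<delta>\<^sub>0\<close>, and the Poincare series would converge below
  its critical exponent.\<close>

lemma core_count_lower:
  "\<exists>c>0. \<forall>R\<ge>0. c * exp (\<delta>\<^sub>0 * R) \<le> real (core_count R)"
proof -
  define A where "A = real (core_count (3 * D))"
  have A: "1 \<le> A" using core_count_ge_1[of "3 * D"] D by (simp add: A_def)
  have 1: "real (core_count (m + D)) \<le> A * real (core_count m)" if "0 \<le> m" for m
  proof (cases "D \<le> m")
    case True
    have "core_count (m + D) \<le> core_count m * core_count (3 * D)" using core_count_submult[of "m - D" "2 * D"] True D by (simp add: algebra_simps)
    then have "real (core_count (m + D)) \<le> real (core_count m * core_count (3 * D))" by (simp only: of_nat_le_iff)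
    then show ?thesis by (simp add: A_def mult.commute)
  next
    case False
    have "real (core_count (m + D)) \<le> A * 1" using core_count_mono[of "m + D" "3 * D"] False D by (simp add: A_def)
    also have "\<dots> \<le> A * real (core_count m)" using core_count_ge_1[OF that] A by (intro mult_left_mono) auto
    finally show ?thesis .
  qed
  \<comment> \<open>Each of the two factors loses a factor \<open>A\<close> when its radius is
    shifted by \<open>D\<close>; the normalisation by \<open>A ^ 2\<close> makes \<open>v\<close>
    exactly submultiplicative.\<close>
  define v where "v R = A ^ 2 * real (core_count R)" for R
  have v1: "1 \<le> v R" if "0 \<le> R" for R
    using mult_mono[of 1 "A^2" 1 "real (core_count R)"] A core_count_ge_1[OF that] by (simp add: v_def)
  have vsub: "v (m + n) \<le> v m * v n" if "0 \<le> m" "0 \<le> n" for m n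
  proof -
    have "real (core_count (m + n)) \<le> real (core_count (m + D)) * real (core_count (n + D))"
      using core_count_submult[OF that] by (metis of_nat_le_iff of_nat_mult)
    also have "\<dots> \<le> (A * real (core_count m)) * (A * real (core_count n))" using 1 that A by (intro mult_mono) auto
    finally have "A ^ 2 * real (core_count (m + n)) \<le> A ^ 2 * ((A * real (core_count m)) * (A * real (core_count n)))" by (intro mult_left_mono) auto
    then show ?thesis by (simp add: v_def power2_eq_square mult_ac)
  qed
  have main: "exp (\<delta>\<^sub>0 * R0) \<le> v R0" if R0: "0 < R0" for R0
  proof (rule ccontr)
    assume n: "\<not> exp (\<delta>\<^sub>0 * R0) \<le> v R0"
    \<comment> \<open>The rate that the single bad radius imposes on all multiples of it.\<close>
    define s where "s = ln (v R0) / R0"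
    have vR: "v R0 = exp (s * R0)" using R0 v1[of R0] by (simp add: s_def)
    have s0: "0 \<le> s" using R0 v1[of R0] by (simp add: s_def)
    have sd: "s < \<delta>\<^sub>0" using n R0 by (simp add: vR)
    have vk: "v (real (Suc k) * R0) \<le> exp (s * R0 * real (Suc k))" for k
    proof (induction k)
      case 0 then show ?case by (simp add: vR)
    next
      case (Suc k)
      have "v (real (Suc (Suc k)) * R0) = v (real (Suc k) * R0 + R0)" by (simp add: algebra_simps)
      also have "\<dots> \<le> v (real (Suc k) * R0) * v R0" using R0 by (intro vsub) auto
      also have "\<dots> \<le> exp (s * R0 * real (Suc k)) * exp (s * R0)"
        using Suc v1[of R0] R0 by (intro mult_mono) (auto simp: vR)
      also have "\<dots> = exp (s * R0 * real (Suc (Suc k)))" by (simp add: exp_add[symmetric] algebra_simps)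
      finally show ?case .
    qed
    have aK: "real (core_count R) \<le> exp (s * (2 * R0)) * exp (s * R)" if R: "0 \<le> R" for R
    proof -
      define k where "k = nat \<lceil>R / R0\<rceil>"
      have k: "R / R0 \<le> real k" "real k \<le> R / R0 + 1" using R R0 by (auto simp: k_def)
      have k': "R \<le> real (Suc k) * R0" "real (Suc k) * R0 \<le> R + 2 * R0"
        using k R0 by (auto simp: field_simps)
      have "real (core_count R) \<le> real (core_count (real (Suc k) * R0))" using core_count_mono[OF k'(1)] by simp
      also have "\<dots> \<le> v (real (Suc k) * R0)" using mult_right_mono[of 1 "A\<^sup>2" "real (core_count (real (Suc k) * R0))"] one_le_power[OF A, of 2] by (simp add: v_def)
      also have "\<dots> \<le> exp (s * (R0 * real (Suc k)))" using vk by (simp add: mult.assoc)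
      also have "\<dots> \<le> exp (s * (R + 2 * R0))" using k'(2) s0 by (simp add: mult_left_mono mult.commute)
      also have "\<dots> = exp (s * (2 * R0)) * exp (s * R)" by (simp add: exp_add[symmetric] algebra_simps)
      finally show ?thesis .
    qed
    define q where "q = (s + \<delta>\<^sub>0) / 2"
    have q: "0 \<le> q" "s < q" "q < \<delta>\<^sub>0" using s0 sd by (auto simp: q_def)
    have "(\<lambda>\<gamma>. exp (- q * len \<gamma>)) summable_on \<Gamma>\<^sub>0"
      by (rule exp_growth_summable[where K = "exp (s * (2 * R0))" and s = s])
        (use aK q fin_ball in \<open>auto simp: core_count_def\<close>)
    then show False using div0[OF q(1,3)] by (simp add: len_def)
  qed
  show ?thesis
  proof (intro exI[of _ "1 / A ^ 2"] conjI allI impI)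
    show "0 < 1 / A ^ 2" using A by simp
    fix R :: real assume R: "0 \<le> R"
    have "exp (\<delta>\<^sub>0 * R) \<le> v R"
      using main[of R] v1[of R] R by (cases "R = 0") auto
    then show "1 / A ^ 2 * exp (\<delta>\<^sub>0 * R) \<le> real (core_count R)" using A by (simp add: v_def divide_simps mult.commute)
  qed
qed

lemma ex_len_near:
  assumes "0 \<le> t"
  obtains h where "h \<in> \<Gamma>\<^sub>0" "\<bar>len h - t\<bar> \<le> D"
proof -
  obtain h where h: "h \<in> \<Gamma>\<^sub>0" "dist (l\<^sub>0 t) (h x) \<le> D" using core_dense line0(2) by blast
  have "dist (l\<^sub>0 0) (l\<^sub>0 t) = t" using ray_dist[OF line_ray(1)[OF line0(1)], of 0 t] assms by simp
  then have "dist x (l\<^sub>0 t) = t" by (simp add: line0(3))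
  then have "\<bar>len h - t\<bar> \<le> D" using h(2) dist_triangle[of x "h x" "l\<^sub>0 t"] dist_triangle[of x "l\<^sub>0 t" "h x"]
    by (auto simp: len_def dist_commute)
  then show ?thesis using that h(1) by blast
qed

end

section \<open>The critical gap and shortest coset representatives\<close>

lemma card_le_fibers:
  assumes "finite P" "\<And>y. y \<in> f ` P \<Longrightarrow> card {p \<in> P. f p = y} \<le> F"
  shows "card P \<le> F * card (f ` P)"
proof -
  have "card P = (\<Sum>p\<in>P. 1)" by simp
  also have "\<dots> = (\<Sum>y\<in>f ` P. \<Sum>p\<in>{p \<in> P. f p = y}. 1)"
    by (rule sum.group[symmetric]) (use assms in auto)
  also have "\<dots> \<le> (\<Sum>y\<in>f ` P. F)" using assms by (intro sum_mono) auto
  finally show ?thesis by (simp add: mult.commute)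
qed

lemma ex_minimum:
  fixes f :: "'b \<Rightarrow> real"
  assumes "finite A" "A \<noteq> {}"
  shows "\<exists>h\<in>A. \<forall>h'\<in>A. f h \<le> f h'"
  using arg_min_if_finite(1)[OF assms, of f] arg_min_least[OF assms, of _ f] by blast

context core_pair
begin

text \<open>If \<open>h g h'\<close> equals \<open>h1 g h1'\<close>, then conjugating
  \<open>h1' (h')\<inverse>\<close> by \<open>g\<close> gives \<open>h1\<inverse> h\<close>, an
  element of \<open>\<Gamma>\<^sub>0\<close>. So a fiber embeds into the set that almost
  malnormality makes finite.\<close>

lemma pair_fiber:
  assumes g: "g \<in> \<Gamma>" "g \<notin> \<Gamma>\<^sub>0" and P: "finite P" "P \<subseteq> \<Gamma>\<^sub>0 \<times> \<Gamma>\<^sub>0"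
  shows "card P \<le> card {h \<in> \<Gamma>\<^sub>0. g \<circ> h \<circ> ginv g \<in> \<Gamma>\<^sub>0} * card ((\<lambda>(h, h'). h \<circ> g \<circ> h') ` P)"
proof (rule card_le_fibers[OF P(1)])
  define f where "f = (\<lambda>(h, h'). h \<circ> g \<circ> h' :: 'a \<Rightarrow> 'a)"
  fix y assume "y \<in> (\<lambda>(h, h'). h \<circ> g \<circ> h') ` P"
  then obtain h1 h1' where h1: "(h1, h1') \<in> P" "y = h1 \<circ> g \<circ> h1'" by auto
  then have h1m: "h1 \<in> \<Gamma>\<^sub>0" "h1' \<in> \<Gamma>\<^sub>0" using P by auto
  define k where "k = (\<lambda>(h :: 'a \<Rightarrow> 'a, h'). h1' \<circ> ginv h')"
  have "card {p \<in> P. f p = y} \<le> card {h \<in> \<Gamma>\<^sub>0. g \<circ> h \<circ> ginv g \<in> \<Gamma>\<^sub>0}"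
  proof (rule card_inj_on_le)
    have eq: "g \<circ> k p \<circ> ginv g = ginv h1 \<circ> fst p \<and> k p \<in> \<Gamma>\<^sub>0 \<and> fst p \<in> \<Gamma>\<^sub>0 \<and> snd p \<in> \<Gamma>\<^sub>0" if p: "p \<in> P" "f p = y" for p
    proof -
      obtain h0 h0' where pp: "p = (h0, h0')" by force
      have m: "h0 \<in> \<Gamma>\<^sub>0" "h0' \<in> \<Gamma>\<^sub>0" using p P pp by auto
      have e: "h0 (g (h0' z)) = h1 (g (h1' z))" for z using p h1(2) by (auto simp: f_def pp fun_eq_iff)
      have "g (h1' (ginv h0' (ginv g z))) = ginv h1 (h0 z)" for z
      proof -
        have "h1 (g (h1' (ginv h0' (ginv g z)))) = h0 z"
          unfolding e[symmetric] using m g mem0 by simp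
        then show ?thesis using h1m by (metis act0.ginv_simps(1))
      qed
      then show ?thesis using m h1m act0.act_comp act0.act_inv by (auto simp: k_def pp fun_eq_iff)
    qed
    show "inj_on k {p \<in> P. f p = y}"
    proof (rule inj_onI)
      fix p q assume p: "p \<in> {p \<in> P. f p = y}" and q: "q \<in> {p \<in> P. f p = y}" and k: "k p = k q"
      have "ginv h1 \<circ> fst p = ginv h1 \<circ> fst q" using eq[of p] eq[of q] p q k by auto
      then have "h1 \<circ> (ginv h1 \<circ> fst p) = h1 \<circ> (ginv h1 \<circ> fst q)" by metis
      then have f: "fst p = fst q" using h1m by (simp flip: comp_assoc)
      have "ginv h1' \<circ> k p = ginv h1' \<circ> k q" using k by simp
      then have "ginv (snd p) = ginv (snd q)" using h1m by (simp add: k_def case_prod_beta flip: comp_assoc)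
      then have "snd p \<circ> ginv (snd p) \<circ> snd q = snd p \<circ> ginv (snd q) \<circ> snd q" by simp
      then have "snd p \<circ> ginv (snd p) \<circ> snd q = snd p \<circ> (ginv (snd q) \<circ> snd q)" by (simp only: comp_assoc)
      moreover have "snd p \<in> \<Gamma>\<^sub>0" "snd q \<in> \<Gamma>\<^sub>0" using eq[of p] eq[of q] p q by auto
      ultimately have "snd q = snd p" by simp
      then show "p = q" using f by (simp add: prod_eq_iff)
    qed
    show "k ` {p \<in> P. f p = y} \<subseteq> {h \<in> \<Gamma>\<^sub>0. g \<circ> h \<circ> ginv g \<in> \<Gamma>\<^sub>0}"
    proof clarify
      fix p assume p: "p \<in> P" "y = f p"
      note e = eq[OF p(1) p(2)[symmetric]]
      then have "ginv h1 \<circ> fst p \<in> \<Gamma>\<^sub>0" using act0.act_comp[OF act0.act_inv[OF h1m(1)]] by simp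
      then show "k p \<in> \<Gamma>\<^sub>0 \<and> g \<circ> k p \<circ> ginv g \<in> \<Gamma>\<^sub>0" using e by simp
    qed
    show "finite {h \<in> \<Gamma>\<^sub>0. g \<circ> h \<circ> ginv g \<in> \<Gamma>\<^sub>0}" by (rule malnormal[OF g])
  qed
  then show "card {p \<in> P. (case p of (h, h') \<Rightarrow> h \<circ> g \<circ> h') = y} \<le> card {h \<in> \<Gamma>\<^sub>0. g \<circ> h \<circ> ginv g \<in> \<Gamma>\<^sub>0}"
    by (simp add: f_def)
qed

text \<open>Serves the contradiction in \<open>critical_gap\<close>: disjoint annuli are needed to
  let the contributions of many cut points add up. When \<open>\<delta> = 0\<close> no exponential
  gain is available, and single elements of prescribed length are used instead.\<close>

lemma annulus0:
  assumes "\<delta> \<le> \<delta>\<^sub>0"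
  shows "\<exists>W>0. \<exists>c>0. \<forall>k::nat. c * exp (\<delta> * (real k * W)) \<le> real (card {h \<in> \<Gamma>\<^sub>0. real k * W < len h \<and> len h \<le> (real k + 1) * W})"
proof (cases "\<delta> = 0")
  case True
  define W where "W = 2 * D + 1"
  have main: "1 * exp (\<delta> * (real k * W)) \<le> real (card {h \<in> \<Gamma>\<^sub>0. real k * W < len h \<and> len h \<le> (real k + 1) * W})" for k :: nat
  proof -
    obtain h where h: "h \<in> \<Gamma>\<^sub>0" "\<bar>len h - (real k * W + D + 1 / 2)\<bar> \<le> D"
      using ex_len_near[of "real k * W + D + 1 / 2"] D by (auto simp: W_def)
    have "h \<in> {h \<in> \<Gamma>\<^sub>0. real k * W < len h \<and> len h \<le> (real k + 1) * W}"
      using h D unfolding abs_le_iff by (auto simp: W_def algebra_simps)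
    moreover have "finite {h \<in> \<Gamma>\<^sub>0. real k * W < len h \<and> len h \<le> (real k + 1) * W}"
      by (rule finite_subset[OF _ fin_ball(2)]) auto
    ultimately have "0 < card {h \<in> \<Gamma>\<^sub>0. real k * W < len h \<and> len h \<le> (real k + 1) * W}" unfolding card_gt_0_iff by blast
    then show ?thesis using True by simp
  qed
  have W0: "0 < W" using D by (simp add: W_def)
  show ?thesis by (rule exI[of _ W], intro exI[of _ "1::real"] conjI allI zero_less_one W0 main)
next
  case False
  then have d: "0 < \<delta>" using d_nonneg by simp
  obtain c where c: "0 < c" "\<And>R. 0 \<le> R \<Longrightarrow> c * exp (\<delta>\<^sub>0 * R) \<le> real (core_count R)" using core_count_lower by auto
  have lo: "c * exp (\<delta> * R) \<le> real (core_count R)" if "0 \<le> R" for R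
  proof -
    have "c * exp (\<delta> * R) \<le> c * exp (\<delta>\<^sub>0 * R)" using c(1) assms that by (simp add: mult_right_mono)
    then show ?thesis using c(2)[OF that] by linarith
  qed
  have up: "real (core_count R) \<le> CN * exp (\<delta> * R)" if "0 \<le> R" for R
    using orbit_count_bounds(2)[OF that] core_count_le[of R] by linarith
  \<comment> \<open>Chosen so that \<open>c * exp (\<delta> * W) \<ge> 2 * CN\<close>: the lower
    bound at the outer radius is then twice the upper bound at the inner one.\<close>
  define W where "W = max 1 (ln (2 * CN / c) / \<delta>)"
  have W: "0 < W" by (simp add: W_def)
  have "ln (2 * CN / c) \<le> \<delta> * W" using d by (simp add: W_def max_def field_simps)
  then have "2 * CN / c \<le> exp (\<delta> * W)" using CN c by (metis divide_pos_pos exp_le_cancel_iff exp_ln mult_pos_pos zero_less_numeral)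
  then have eW: "2 * CN \<le> c * exp (\<delta> * W)" using c by (simp add: field_simps)
  show ?thesis
  proof (rule exI[of _ W], intro exI[of _ CN] conjI W CN allI)
    fix k :: nat
    have "core_count ((real k + 1) * W) \<le> card {h \<in> \<Gamma>\<^sub>0. real k * W < len h \<and> len h \<le> (real k + 1) * W} + core_count (real k * W)"
    proof -
      have "{h \<in> \<Gamma>\<^sub>0. len h \<le> (real k + 1) * W} \<subseteq> {h \<in> \<Gamma>\<^sub>0. real k * W < len h \<and> len h \<le> (real k + 1) * W} \<union> {h \<in> \<Gamma>\<^sub>0. len h \<le> real k * W}" by auto
      moreover have "finite ({h \<in> \<Gamma>\<^sub>0. real k * W < len h \<and> len h \<le> (real k + 1) * W} \<union> {h \<in> \<Gamma>\<^sub>0. len h \<le> real k * W})"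
        using fin_ball(2)[of "(real k + 1) * W"] fin_ball(2)[of "real k * W"] by (auto elim: finite_subset[rotated])
      ultimately show ?thesis unfolding core_count_def by (meson card_Un_le card_mono le_trans)
    qed
    then have "real (core_count ((real k + 1) * W)) \<le> real (card {h \<in> \<Gamma>\<^sub>0. real k * W < len h \<and> len h \<le> (real k + 1) * W}) + real (core_count (real k * W))"
      by linarith
    moreover have "c * exp (\<delta> * ((real k + 1) * W)) \<le> real (core_count ((real k + 1) * W))" using lo W by simp
    moreover have "real (core_count (real k * W)) \<le> CN * exp (\<delta> * (real k * W))" using up W by simp
    moreover have "2 * CN * exp (\<delta> * (real k * W)) \<le> c * exp (\<delta> * ((real k + 1) * W))"
    proof -
      have "\<delta> * ((real k + 1) * W) = \<delta> * W + \<delta> * (real k * W)" by (simp add: algebra_simps)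
      then have "exp (\<delta> * ((real k + 1) * W)) = exp (\<delta> * W) * exp (\<delta> * (real k * W))" by (metis exp_add)
      then show ?thesis using mult_right_mono[OF eW, of "exp (\<delta> * (real k * W))"] by (simp add: mult.assoc)
    qed
    ultimately show "CN * exp (\<delta> * (real k * W)) \<le> real (card {h \<in> \<Gamma>\<^sub>0. real k * W < len h \<and> len h \<le> (real k + 1) * W})" by simp
  qed
qed

text \<open>By almost malnormality \<open>(h, h') \<mapsto> h g h'\<close> is finite-to-one on pairs in \<open>\<Gamma>\<^sub>0\<close>. If \<open>\<delta> \<le> \<delta>\<^sub>0\<close>, this
  would produce about \<open>m e\<^sup>\<delta>\<^sup>m\<close> elements of length at most \<open>m\<close>.\<close>

lemma critical_gap: "\<delta>\<^sub>0 < \<delta>"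
proof (rule ccontr)
  assume "\<not> \<delta>\<^sub>0 < \<delta>"
  then have le: "\<delta> \<le> \<delta>\<^sub>0" by simp
  obtain g where g: "g \<in> \<Gamma>" "g \<notin> \<Gamma>\<^sub>0" using proper_sub sub0' by blast
  define F where "F = card {h \<in> \<Gamma>\<^sub>0. g \<circ> h \<circ> ginv g \<in> \<Gamma>\<^sub>0}"
  obtain W c1 where W: "0 < W" "0 < c1"
    and ann: "\<And>k::nat. c1 * exp (\<delta> * (real k * W)) \<le> real (card {h \<in> \<Gamma>\<^sub>0. real k * W < len h \<and> len h \<le> (real k + 1) * W})"
    using annulus0[OF le] by blast
  obtain c where c: "0 < c" "\<And>R. 0 \<le> R \<Longrightarrow> c * exp (\<delta>\<^sub>0 * R) \<le> real (core_count R)" using core_count_lower by auto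
  have key: "real m * (c1 * c * exp (- \<delta> * W)) \<le> F * CN * exp (\<delta> * len g)" for m :: nat
  proof -
    \<comment> \<open>The radii are complementary: the upper bounds for the two factors always sum
      to \<open>m * W\<close>, whatever \<open>k\<close> is. Each of the \<open>m\<close> disjoint
      annuli therefore contributes the full order \<open>exp (\<delta> * m * W)\<close>.\<close>
    define A where "A k = {h \<in> \<Gamma>\<^sub>0. real k * W < len h \<and> len h \<le> (real k + 1) * W}" for k :: nat
    define B where "B k = {h \<in> \<Gamma>\<^sub>0. len h \<le> (real m - 1 - real k) * W}" for k :: nat
    define P where "P = (\<Union>k<m. A k \<times> B k)"
    have finA: "finite (A k)" "finite (B k)" for k unfolding A_def B_def by (auto intro: finite_subset[OF _ fin_ball(2)])
    have disj: "A i \<inter> A j = {}" if "i < j" for i j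
    proof -
      have "(real i + 1) * W \<le> real j * W" using that W by (intro mult_right_mono) auto
      then show ?thesis by (auto simp: A_def)
    qed
    have "card P = (\<Sum>k<m. card (A k \<times> B k))"
      unfolding P_def
    proof (rule card_UN_disjoint)
      show "\<forall>i\<in>{..<m}. \<forall>j\<in>{..<m}. i \<noteq> j \<longrightarrow> A i \<times> B i \<inter> A j \<times> B j = {}"
        using disj by (metis Sigma_empty1 Times_Int_Times inf_commute linorder_neqE_nat)
    qed (use finA in auto)
    then have "real (card P) = (\<Sum>k<m. real (card (A k)) * real (card (B k)))" by (simp add: card_cartesian_product)
    also have "\<dots> \<ge> (\<Sum>k<m. c1 * c * exp (\<delta> * ((real m - 1) * W)))"
    proof (rule sum_mono)
      fix k assume "k \<in> {..<m}"
      then have km: "0 \<le> (real m - 1 - real k) * W" using W by simp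
      have "c * exp (\<delta> * ((real m - 1 - real k) * W)) \<le> c * exp (\<delta>\<^sub>0 * ((real m - 1 - real k) * W))"
        using c(1) le km by (simp add: mult_right_mono)
      also have "\<dots> \<le> real (card (B k))" using c(2)[OF km] by (simp add: core_count_def B_def)
      finally have b: "c * exp (\<delta> * ((real m - 1 - real k) * W)) \<le> real (card (B k))" .
      have "c1 * c * exp (\<delta> * ((real m - 1) * W)) = (c1 * exp (\<delta> * (real k * W))) * (c * exp (\<delta> * ((real m - 1 - real k) * W)))"
        by (simp add: exp_add[symmetric] algebra_simps)
      also have "\<dots> \<le> real (card (A k)) * real (card (B k))"
        using ann[of k] b c(1) W(2) by (intro mult_mono) (auto simp: A_def)
      finally show "c1 * c * exp (\<delta> * ((real m - 1) * W)) \<le> real (card (A k)) * real (card (B k))" .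
    qed
    finally have lo: "real m * (c1 * c * exp (\<delta> * ((real m - 1) * W))) \<le> real (card P)" by simp
    have finP: "finite P" and subP: "P \<subseteq> \<Gamma>\<^sub>0 \<times> \<Gamma>\<^sub>0" unfolding P_def using finA by (auto simp: A_def B_def)
    have "(\<lambda>(h, h'). h \<circ> g \<circ> h') ` P \<subseteq> {\<gamma> \<in> \<Gamma>. len \<gamma> \<le> m * W + len g}"
    proof clarify
      fix h h' assume "(h, h') \<in> P"
      then obtain k where k: "h \<in> \<Gamma>\<^sub>0" "h' \<in> \<Gamma>\<^sub>0" "len h \<le> (real k + 1) * W" "len h' \<le> (real m - 1 - real k) * W"
        by (auto simp: P_def A_def B_def)
      have G: "h \<circ> g \<in> \<Gamma>" using k g mem0 act_comp by blast
      have "len (h \<circ> g \<circ> h') \<le> len h + len g + len h'"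
        using len_comp[OF G, of h'] len_comp[OF mem0[OF k(1)], of g] by simp
      also have "\<dots> \<le> m * W + len g" using k by (simp add: algebra_simps)
      finally show "h \<circ> g \<circ> h' \<in> \<Gamma> \<and> len (h \<circ> g \<circ> h') \<le> m * W + len g" using act_comp[OF G mem0[OF k(2)]] by simp
    qed
    then have "card ((\<lambda>(h, h'). h \<circ> g \<circ> h') ` P) \<le> orbit_count (m * W + len g)"
      unfolding orbit_count_def by (intro card_mono fin_ball)
    then have "card P \<le> F * orbit_count (m * W + len g)"
      using pair_fiber[OF g finP subP] unfolding F_def by (meson le_trans mult_le_mono2)
    then have "real (card P) \<le> real F * real (orbit_count (m * W + len g))" by (metis of_nat_le_iff of_nat_mult)
    also have "\<dots> \<le> real F * (CN * exp (\<delta> * (m * W + len g)))"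
      using orbit_count_bounds(2)[of "m * W + len g"] W by (intro mult_left_mono) auto
    finally have "real m * (c1 * c * exp (\<delta> * ((real m - 1) * W))) \<le> real F * (CN * exp (\<delta> * (m * W + len g)))"
      using lo by linarith
    then have "real m * (c1 * c * exp (\<delta> * ((real m - 1) * W))) * exp (- \<delta> * (m * W)) \<le> real F * (CN * exp (\<delta> * (m * W + len g))) * exp (- \<delta> * (m * W))"
      by (intro mult_right_mono) auto
    then show ?thesis by (simp add: mult.assoc exp_add[symmetric] algebra_simps)
  qed
  have pos: "0 < c1 * c * exp (- \<delta> * W)" using W c by simp
  obtain m :: nat where "F * CN * exp (\<delta> * len g) / (c1 * c * exp (- \<delta> * W)) < real m" using reals_Archimedean2 by blast
  then show False using key[of m] pos by (simp add: divide_less_eq)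
qed

lemma d_pos: "0 < \<delta>"
  using critical_gap d0_nonneg by simp

text \<open>Shortest elements of the left cosets of \<open>\<Gamma>\<^sub>0\<close>; ties are
  kept.\<close>

definition short_reps where "short_reps = {\<gamma> \<in> \<Gamma>. \<forall>h\<in>\<Gamma>\<^sub>0. len \<gamma> \<le> len (\<gamma> \<circ> h)}"

lemma minimal_decomp:
  assumes g: "\<gamma> \<in> \<Gamma>"
  obtains \<gamma>' h where "\<gamma>' \<in> short_reps" "h \<in> \<Gamma>\<^sub>0" "\<gamma> = \<gamma>' \<circ> h"
proof -
  define A where "A = {h \<in> \<Gamma>\<^sub>0. len (\<gamma> \<circ> h) \<le> len \<gamma>}"
  have "A \<subseteq> {h \<in> \<Gamma>\<^sub>0. len h \<le> 2 * len \<gamma>}"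
  proof
    fix h assume h: "h \<in> A"
    have "len (ginv \<gamma> \<circ> (\<gamma> \<circ> h)) \<le> len (ginv \<gamma>) + len (\<gamma> \<circ> h)" by (rule len_comp[OF act_inv[OF g]])
    moreover have "ginv \<gamma> \<circ> (\<gamma> \<circ> h) = h" using g by (simp flip: comp_assoc)
    ultimately show "h \<in> {h \<in> \<Gamma>\<^sub>0. len h \<le> 2 * len \<gamma>}" using h len_ginv[OF g] by (simp add: A_def)
  qed
  then have "finite A" by (rule finite_subset) (rule fin_ball(2))
  moreover have "id \<in> A" using act0.act_id by (simp add: A_def)
  ultimately obtain h where h: "h \<in> A" "\<And>h'. h' \<in> A \<Longrightarrow> len (\<gamma> \<circ> h) \<le> len (\<gamma> \<circ> h')"
    using ex_minimum[of A "\<lambda>h. len (\<gamma> \<circ> h)"] by blast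
  have hm: "h \<in> \<Gamma>\<^sub>0" "len (\<gamma> \<circ> h) \<le> len \<gamma>" using h(1) by (auto simp: A_def)
  have "\<gamma> \<circ> h \<in> short_reps"
    unfolding short_reps_def
  proof (intro CollectI conjI ballI)
    show "\<gamma> \<circ> h \<in> \<Gamma>" using g hm mem0 act_comp by blast
    fix h' assume h': "h' \<in> \<Gamma>\<^sub>0"
    show "len (\<gamma> \<circ> h) \<le> len (\<gamma> \<circ> h \<circ> h')"
    proof (cases "h \<circ> h' \<in> A")
      case True
      then show ?thesis using h(2) by (simp add: comp_assoc)
    next
      case False
      then show ?thesis using hm h' act0.act_comp by (auto simp: A_def comp_assoc)
    qed
  qed
  moreover have "\<gamma> = (\<gamma> \<circ> h) \<circ> ginv h" using hm by (simp add: comp_assoc)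
  ultimately show ?thesis using that act0.act_inv hm by blast
qed

text \<open>Minimality says that \<open>x\<close> is an almost closest orbit point of
  \<open>\<Gamma>\<^sub>0\<close> to \<open>ginv \<gamma> x\<close>. If the geodesics from
  \<open>x\<close> to \<open>h x\<close> and to \<open>ginv \<gamma> x\<close> stayed together
  longer than \<open>D + 2\<close>, an orbit point near the branching point would be closer. A
  bounded Gromov product means additive lengths.\<close>

lemma minimal_gap:
  assumes g: "\<gamma> \<in> short_reps" and h: "h \<in> \<Gamma>\<^sub>0"
  shows "len \<gamma> + len h - (2 * D + 4) \<le> len (\<gamma> \<circ> h)"
proof -
  have G: "\<gamma> \<in> \<Gamma>" and min: "\<And>h. h \<in> \<Gamma>\<^sub>0 \<Longrightarrow> len \<gamma> \<le> len (\<gamma> \<circ> h)" using g by (auto simp: short_reps_def)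
  define y where "y = ginv \<gamma> x"
  have ly: "len (\<gamma> \<circ> h') = dist y (h' x)" for h' using G by (simp add: y_def len_def dist_ginv)
  have ly0: "len \<gamma> = dist x y" using G by (simp add: y_def len_def dist_ginv' dist_commute)
  define g where "g = gp x (h x) y"
  have g0: "0 \<le> g" "g \<le> dist x (h x)" "g \<le> dist x y" using gp_nonneg gp_le by (auto simp: g_def)
  obtain b where b: "geodesic_segment b x (h x)" using seg_ex by blast
  obtain c where c: "geodesic_segment c x y" using seg_ex by blast
  have bc: "dist (b g) (c g) \<le> 2" using thin[OF b c g0(1)] by (simp add: g_def)
  have "b g \<in> C\<^sub>0"
    using core_convex x_core core_inv[OF h x_core] b g0 unfolding geodesically_convex_def by fastforce
  then obtain h' where h': "h' \<in> \<Gamma>\<^sub>0" "dist (b g) (h' x) \<le> D" using core_dense by blast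
  have "dist x y \<le> dist y (h' x)" using min[OF h'(1)] ly ly0 by simp
  also have "\<dots> \<le> dist (c g) y + 2 + D"
    using dist_triangle[of y "h' x" "c g"] dist_triangle[of "c g" "h' x" "b g"] h'(2) bc by (simp add: dist_commute)
  also have "dist (c g) y = dist x y - g" using seg_dist_ends(2)[OF c, of g] g0 by simp
  finally have "g \<le> D + 2" by simp
  then show ?thesis unfolding ly ly0 by (simp add: g_def gp_def len_def dist_commute field_simps)
qed

text \<open>Every element of length at most \<open>R\<close> is a shortest representative times a
  core element, of total length at most \<open>R + K1\<close>. Since the core grows at a rate
  \<open>q < \<delta>\<close>, the representatives much shorter than \<open>R\<close> account for at
  most half of these products; the others must be numerous.\<close>

lemma minimal_window:
  "\<exists>W>0. \<exists>c>0. \<forall>R\<ge>0. c * exp (\<delta> * R) \<le> real (card {\<gamma> \<in> short_reps. R - W < len \<gamma> \<and> len \<gamma> \<le> R + W})"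
proof -
  define K1 where "K1 = 2 * D + 4"
  have K1: "0 < K1" using D by (simp add: K1_def)
  define q where "q = (\<delta>\<^sub>0 + \<delta>) / 2"
  have q: "\<delta>\<^sub>0 < q" "q < \<delta>" "0 \<le> q" using critical_gap d0_nonneg by (auto simp: q_def)
  obtain K where K: "0 < K" "\<And>R. real (core_count R) \<le> K * exp (q * R)" using core_count_upper[OF q(1)] by blast
  define E where "E = CN * exp \<delta> * exp (2 * (\<delta> - q)) / (exp (\<delta> - q) - 1)"
  have E: "0 < E" using CN q by (simp add: E_def)
  have sumE: "(\<Sum>\<gamma>\<in>{\<gamma> \<in> \<Gamma>. len \<gamma> \<le> R}. exp (- q * len \<gamma>)) \<le> E * exp ((\<delta> - q) * R)" if R: "0 \<le> R" for R
    unfolding E_def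
  proof (rule shell_sum_div)
    fix R' :: real assume "0 \<le> R'"
    have "card {\<gamma> \<in> {\<gamma> \<in> \<Gamma>. len \<gamma> \<le> R}. len \<gamma> \<le> R'} \<le> orbit_count R'" unfolding orbit_count_def by (intro card_mono fin_ball) auto
    then show "real (card {\<gamma> \<in> {\<gamma> \<in> \<Gamma>. len \<gamma> \<le> R}. len \<gamma> \<le> R'}) \<le> CN * exp (\<delta> * R')" using orbit_count_bounds(2)[OF \<open>0 \<le> R'\<close>] by linarith
  qed (use q CN R fin_ball in auto)
  have sumE': "(\<Sum>\<gamma>\<in>{\<gamma> \<in> \<Gamma>. len \<gamma> \<le> R}. exp (- q * len \<gamma>)) \<le> E * exp ((\<delta> - q) * R)" for R
  proof (cases "0 \<le> R")
    case False
    then have e: "{\<gamma> \<in> \<Gamma>. len \<gamma> \<le> R} = {}" using len_nonneg by (auto simp: not_le intro: order_less_le_trans)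
    show ?thesis unfolding e using E by simp
  qed (rule sumE)
  \<comment> \<open>Makes the share of the representatives shorter than \<open>R' - W0\<close> at
    most half of the lower bound \<open>cN * exp (\<delta> * R)\<close>.\<close>
  define W0 where "W0 = max 0 (ln (2 * K * E * exp (\<delta> * K1) / cN) / (\<delta> - q))"
  have W0: "0 \<le> W0" "K * E * exp (- (\<delta> - q) * W0) \<le> cN / 2 * exp (- \<delta> * K1)"
  proof -
    have "ln (2 * K * E * exp (\<delta> * K1) / cN) \<le> (\<delta> - q) * W0"
      using q by (simp add: W0_def max_def field_simps)
    then have "2 * K * E * exp (\<delta> * K1) / cN \<le> exp ((\<delta> - q) * W0)"
      using K E cN by (metis divide_pos_pos exp_gt_zero exp_le_cancel_iff exp_ln mult_pos_pos zero_less_numeral)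
    then have "2 * K * E * exp (\<delta> * K1) \<le> cN * exp ((\<delta> - q) * W0)" using cN by (simp add: field_simps)
    then have "2 * K * E * exp (\<delta> * K1) * (exp (- (\<delta> - q) * W0) * exp (- \<delta> * K1)) \<le> cN * exp ((\<delta> - q) * W0) * (exp (- (\<delta> - q) * W0) * exp (- \<delta> * K1))"
      by (intro mult_right_mono) auto
    also have "\<dots> = cN * exp (- \<delta> * K1)" by (simp add: exp_add[symmetric] mult.assoc) (simp add: algebra_simps)
    also have "2 * K * E * exp (\<delta> * K1) * (exp (- (\<delta> - q) * W0) * exp (- \<delta> * K1)) = 2 * (K * E * exp (- (\<delta> - q) * W0))"
      by (simp add: exp_add[symmetric] mult.assoc)
    finally show "K * E * exp (- (\<delta> - q) * W0) \<le> cN / 2 * exp (- \<delta> * K1)" by simp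
  qed (simp add: W0_def)
  define W where "W = W0 + K1"
  define c where "c = cN / (2 * (real (core_count W) + 1)) * exp (- \<delta> * K1)"
  have main: "c * exp (\<delta> * R) \<le> real (card {\<gamma> \<in> short_reps. R - W < len \<gamma> \<and> len \<gamma> \<le> R + W})" if R: "0 \<le> R" for R
  proof -
    define R' where "R' = R + K1"
    define A where "A = {\<gamma> \<in> short_reps. R' - W0 < len \<gamma> \<and> len \<gamma> \<le> R'}"
    define B where "B = {\<gamma> \<in> short_reps. len \<gamma> \<le> R' - W0}"
    have MnG: "short_reps \<subseteq> \<Gamma>" by (auto simp: short_reps_def)
    have finAB: "finite A" "finite B" 
      using finite_subset[OF _ fin_ball(1)[of R'], of A] finite_subset[OF _ fin_ball(1)[of "R' - W0"], of B] MnG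
      unfolding A_def B_def by auto
    define H where "H t = {h \<in> \<Gamma>\<^sub>0. len h \<le> t}" for t
    have "{\<gamma> \<in> \<Gamma>. len \<gamma> \<le> R} \<subseteq> (\<Union>\<gamma>'\<in>A \<union> B. (\<lambda>h. \<gamma>' \<circ> h) ` H (R' - len \<gamma>'))"
    proof
      fix \<gamma> assume "\<gamma> \<in> {\<gamma> \<in> \<Gamma>. len \<gamma> \<le> R}"
      then have \<gamma>: "\<gamma> \<in> \<Gamma>" "len \<gamma> \<le> R" by auto
      obtain \<gamma>' h where d: "\<gamma>' \<in> short_reps" "h \<in> \<Gamma>\<^sub>0" "\<gamma> = \<gamma>' \<circ> h" by (rule minimal_decomp[OF \<gamma>(1)])
      have "len \<gamma>' + len h \<le> R'" using minimal_gap[OF d(1,2)] d(3) \<gamma>(2) by (simp add: R'_def K1_def)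
      moreover from this have "len \<gamma>' \<le> R'" using len_nonneg[of h] by linarith
      ultimately have "h \<in> H (R' - len \<gamma>')" "\<gamma>' \<in> A \<union> B" using d by (auto simp: H_def A_def B_def)
      then show "\<gamma> \<in> (\<Union>\<gamma>'\<in>A \<union> B. (\<lambda>h. \<gamma>' \<circ> h) ` H (R' - len \<gamma>'))" using d(3) by blast
    qed
    then have "orbit_count R \<le> card (\<Union>\<gamma>'\<in>A \<union> B. (\<lambda>h. \<gamma>' \<circ> h) ` H (R' - len \<gamma>'))"
      unfolding orbit_count_def using finAB fin_ball(2) by (intro card_mono) (auto simp: H_def)
    also have "\<dots> \<le> (\<Sum>\<gamma>'\<in>A \<union> B. card ((\<lambda>h. \<gamma>' \<circ> h) ` H (R' - len \<gamma>')))"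
      using finAB by (intro card_UN_le) auto
    also have "\<dots> \<le> (\<Sum>\<gamma>'\<in>A \<union> B. core_count (R' - len \<gamma>'))"
      unfolding core_count_def H_def using fin_ball(2) by (intro sum_mono card_image_le) auto
    also have "\<dots> = (\<Sum>\<gamma>'\<in>A. core_count (R' - len \<gamma>')) + (\<Sum>\<gamma>'\<in>B. core_count (R' - len \<gamma>'))"
      using finAB by (intro sum.union_disjoint) (auto simp: A_def B_def)
    finally have "real (orbit_count R) \<le> (\<Sum>\<gamma>'\<in>A. real (core_count (R' - len \<gamma>'))) + (\<Sum>\<gamma>'\<in>B. real (core_count (R' - len \<gamma>')))"
      by (metis (mono_tags, lifting) of_nat_add of_nat_le_iff of_nat_sum sum.cong)
    \<comment> \<open>A representative in the window leaves room only for a core element of bounded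
      length.\<close>
    moreover have "(\<Sum>\<gamma>'\<in>A. real (core_count (R' - len \<gamma>'))) \<le> (\<Sum>\<gamma>'\<in>A. real (core_count W))"
      using K1 by (intro sum_mono) (auto simp: A_def W_def intro!: core_count_mono)
    moreover have "(\<Sum>\<gamma>'\<in>B. real (core_count (R' - len \<gamma>'))) \<le> K * E * exp (- (\<delta> - q) * W0) * exp (\<delta> * R')"
    proof -
      have "(\<Sum>\<gamma>'\<in>B. real (core_count (R' - len \<gamma>'))) \<le> (\<Sum>\<gamma>'\<in>B. K * exp (q * (R' - len \<gamma>')))"
        by (intro sum_mono K(2))
      also have "\<dots> = K * exp (q * R') * (\<Sum>\<gamma>'\<in>B. exp (- q * len \<gamma>'))"
        by (simp add: sum_distrib_left mult.assoc exp_add[symmetric] algebra_simps)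
      also have "\<dots> \<le> K * exp (q * R') * (\<Sum>\<gamma>'\<in>{\<gamma> \<in> \<Gamma>. len \<gamma> \<le> R' - W0}. exp (- q * len \<gamma>'))"
        using K(1) MnG by (intro mult_left_mono sum_mono2 fin_ball) (auto simp: B_def)
      also have "\<dots> \<le> K * exp (q * R') * (E * exp ((\<delta> - q) * (R' - W0)))"
        using K(1) sumE' by (intro mult_left_mono) auto
      also have "\<dots> = K * E * exp (- (\<delta> - q) * W0) * exp (\<delta> * R')"
        by (simp add: exp_add[symmetric] algebra_simps)
      finally show ?thesis .
    qed
    moreover have "K * E * exp (- (\<delta> - q) * W0) * exp (\<delta> * R') \<le> cN / 2 * exp (\<delta> * R)"
    proof -
      have "K * E * exp (- (\<delta> - q) * W0) * exp (\<delta> * R') \<le> cN / 2 * exp (- \<delta> * K1) * exp (\<delta> * R')"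
        using W0 by (intro mult_right_mono) auto
      also have "\<dots> = cN / 2 * exp (\<delta> * R)" by (simp add: R'_def exp_add[symmetric] algebra_simps)
      finally show ?thesis .
    qed
    ultimately have "cN / 2 * exp (\<delta> * R) \<le> real (card A) * real (core_count W)" using orbit_count_bounds(1)[OF R] by simp
    also have "\<dots> \<le> real (card A) * (real (core_count W) + 1)" by (intro mult_left_mono) auto
    finally have "cN / (2 * (real (core_count W) + 1)) * exp (\<delta> * R) \<le> real (card A)" by (simp add: field_simps add_pos_nonneg)
    moreover have "c * exp (\<delta> * R) \<le> cN / (2 * (real (core_count W) + 1)) * exp (\<delta> * R)"
      unfolding c_def using cN d_nonneg K1 by (intro mult_right_mono mult_left_le) (auto intro: mult_nonneg_nonneg)
    moreover have "card A \<le> card {\<gamma> \<in> short_reps. R - W < len \<gamma> \<and> len \<gamma> \<le> R + W}"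
    proof (rule card_mono)
      show "finite {\<gamma> \<in> short_reps. R - W < len \<gamma> \<and> len \<gamma> \<le> R + W}" by (rule finite_subset[OF _ fin_ball(1)[of "R + W"]]) (use MnG in auto)
      show "A \<subseteq> {\<gamma> \<in> short_reps. R - W < len \<gamma> \<and> len \<gamma> \<le> R + W}" using K1 W0(1) by (auto simp: A_def R'_def W_def)
    qed
    ultimately show ?thesis by linarith
  qed
  show ?thesis
  proof (rule exI[of _ W], intro exI[of _ c] conjI allI impI main)
    show "0 < W" using W0 K1 by (simp add: W_def)
    show "0 < c" using cN by (simp add: c_def add_nonneg_pos)
  qed
qed

text \<open>The upper count of the core is not sharp enough for a window of fixed position. Elements
  shorter than \<open>(1 - \<eta>) * s\<close> are negligible, and of the at most
  \<open>s + 1\<close> unit windows above that length one contains enough elements by pigeonhole;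
  its position \<open>s'\<close> is not controlled further.\<close>

lemma window0:
  assumes \<eta>: "0 < \<eta>" "\<eta> < 1"
  shows "\<exists>W s1. 0 < W \<and> (\<forall>s\<ge>s1. \<exists>s'. (1 - \<eta>) * s \<le> s' \<and> s' \<le> s \<and>
     exp ((\<delta>\<^sub>0 - \<eta>) * s) \<le> real (card {h \<in> \<Gamma>\<^sub>0. s' \<le> len h \<and> len h \<le> s' + W}))"
proof (cases "\<delta>\<^sub>0 = 0")
  case True
  define W where "W = 2 * D + 1"
  show ?thesis
  proof (rule exI[of _ W], rule exI[of _ "2 * D / \<eta> + D"], intro conjI allI impI)
    fix s assume s: "2 * D / \<eta> + D \<le> s"
    have "0 \<le> 2 * D / \<eta>" using D \<eta> by simp
    then have sD: "D \<le> s" using s by linarith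
    have "2 * D / \<eta> \<le> s" using s D by linarith
    then have s2: "2 * D \<le> \<eta> * s" using \<eta> by (simp add: field_simps)
    obtain h where h: "h \<in> \<Gamma>\<^sub>0" "\<bar>len h - (s - D)\<bar> \<le> D" using ex_len_near[of "s - D"] sD by auto
    have "h \<in> {h \<in> \<Gamma>\<^sub>0. s - 2 * D \<le> len h \<and> len h \<le> s - 2 * D + W}" using h unfolding abs_le_iff by (auto simp: W_def)
    moreover have "finite {h \<in> \<Gamma>\<^sub>0. s - 2 * D \<le> len h \<and> len h \<le> s - 2 * D + W}" by (rule finite_subset[OF _ fin_ball(2)]) auto
    ultimately have "0 < card {h \<in> \<Gamma>\<^sub>0. s - 2 * D \<le> len h \<and> len h \<le> s - 2 * D + W}" unfolding card_gt_0_iff by blast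
    moreover have "exp ((\<delta>\<^sub>0 - \<eta>) * s) \<le> 1"
      unfolding True using \<eta> sD D by (simp add: zero_le_mult_iff)
    moreover have "(1 - \<eta>) * s \<le> s - 2 * D" using s2 by (simp add: algebra_simps)
    moreover have "1 \<le> real (card {h \<in> \<Gamma>\<^sub>0. s - 2 * D \<le> len h \<and> len h \<le> s - 2 * D + W})"
      using calculation(1) by linarith
    ultimately have "(1 - \<eta>) * s \<le> s - 2 * D \<and> s - 2 * D \<le> s \<and> exp ((\<delta>\<^sub>0 - \<eta>) * s) \<le> real (card {h \<in> \<Gamma>\<^sub>0. s - 2 * D \<le> len h \<and> len h \<le> s - 2 * D + W})"
      using D by linarith
    then show "\<exists>s'. (1 - \<eta>) * s \<le> s' \<and> s' \<le> s \<and> exp ((\<delta>\<^sub>0 - \<eta>) * s) \<le> real (card {h \<in> \<Gamma>\<^sub>0. s' \<le> len h \<and> len h \<le> s' + W})"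
      by (rule exI)
  next
    show "0 < W" using D by (simp add: W_def)
  qed
next
  case False
  then have d0: "0 < \<delta>\<^sub>0" using d0_nonneg by simp
  obtain c where c: "0 < c" "\<And>R. 0 \<le> R \<Longrightarrow> c * exp (\<delta>\<^sub>0 * R) \<le> real (core_count R)" using core_count_lower by auto
  \<comment> \<open>\<open>q * (1 - \<eta>) = \<delta>\<^sub>0 * (1 - \<eta> / 2 - \<eta>\<^sup>2 /
    2)\<close> is still below \<open>\<delta>\<^sub>0\<close>. That \<open>q\<close> exceeds
    \<open>\<delta>\<^sub>0\<close> uses \<open>\<delta>\<^sub>0 > 0\<close>, whence the case
    distinction.\<close>
  define q where "q = \<delta>\<^sub>0 * (1 + \<eta> / 2)"
  have "\<delta>\<^sub>0 < q" using d0 \<eta> by (simp add: q_def)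
  then obtain K where K: "0 < K" "\<And>R. real (core_count R) \<le> K * exp (q * R)" using core_count_upper by blast
  have "eventually (\<lambda>s. K * exp (- (\<delta>\<^sub>0 * \<eta> / 2 * s)) < c / 2) at_top"
  proof -
    have "((\<lambda>s. K * exp (- (\<delta>\<^sub>0 * \<eta> / 2 * s))) \<longlongrightarrow> 0) at_top"
      using d0 \<eta> by real_asymp
    then show ?thesis using c by (intro order_tendstoD(2)) auto
  qed
  moreover have "eventually (\<lambda>s. (s + 1) * exp (- (\<eta> * s)) < c / 2) at_top"
  proof -
    have "((\<lambda>s. (s + 1) * exp (- (\<eta> * s))) \<longlongrightarrow> 0) at_top"
      using \<eta> by real_asymp
    then show ?thesis using c by (intro order_tendstoD(2)) auto
  qed
  moreover have "eventually (\<lambda>s::real. 0 < s) at_top" by (rule eventually_gt_at_top)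
  ultimately have "eventually (\<lambda>s. 0 < s \<and> K * exp (- (\<delta>\<^sub>0 * \<eta> / 2 * s)) < c / 2 \<and> (s + 1) * exp (- (\<eta> * s)) < c / 2) at_top"
    by eventually_elim simp
  then obtain s1 where s1: "\<And>s. s1 \<le> s \<Longrightarrow> 0 < s \<and> K * exp (- (\<delta>\<^sub>0 * \<eta> / 2 * s)) < c / 2 \<and> (s + 1) * exp (- (\<eta> * s)) < c / 2"
    by (auto simp: eventually_at_top_linorder)
  show ?thesis
  proof (rule exI[of _ 1], rule exI[of _ s1], intro conjI allI impI)
    fix s assume "s1 \<le> s"
    note s = s1[OF this]
    have s0: "0 \<le> s" "0 \<le> (1 - \<eta>) * s" using s \<eta> by auto
    define A where "A = {h \<in> \<Gamma>\<^sub>0. (1 - \<eta>) * s < len h \<and> len h \<le> s}"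
    have finA: "finite A" unfolding A_def by (rule finite_subset[OF _ fin_ball(2)]) auto
    have "core_count s \<le> card (A \<union> {h \<in> \<Gamma>\<^sub>0. len h \<le> (1 - \<eta>) * s})"
      unfolding core_count_def using finA fin_ball by (intro card_mono) (auto simp: A_def)
    also have "\<dots> \<le> card A + core_count ((1 - \<eta>) * s)" unfolding core_count_def by (rule card_Un_le)
    finally have "real (core_count s) \<le> real (card A) + real (core_count ((1 - \<eta>) * s))" by linarith
    moreover have "real (core_count ((1 - \<eta>) * s)) \<le> c / 2 * exp (\<delta>\<^sub>0 * s)"
    proof -
      have "real (core_count ((1 - \<eta>) * s)) \<le> K * exp (q * ((1 - \<eta>) * s))" by (rule K(2))
      also have "q * ((1 - \<eta>) * s) = \<delta>\<^sub>0 * s - \<delta>\<^sub>0 * \<eta> / 2 * s - \<delta>\<^sub>0 * \<eta> ^ 2 / 2 * s"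
        by (simp add: q_def field_simps power2_eq_square)
      also have "K * exp (\<delta>\<^sub>0 * s - \<delta>\<^sub>0 * \<eta> / 2 * s - \<delta>\<^sub>0 * \<eta> ^ 2 / 2 * s) \<le> K * exp (\<delta>\<^sub>0 * s - \<delta>\<^sub>0 * \<eta> / 2 * s)"
        using K(1) d0 s by (intro mult_left_mono) auto
      also have "\<dots> = K * exp (- (\<delta>\<^sub>0 * \<eta> / 2 * s)) * exp (\<delta>\<^sub>0 * s)" by (simp add: exp_add[symmetric])
      also have "\<dots> \<le> c / 2 * exp (\<delta>\<^sub>0 * s)" using s by (intro mult_right_mono) auto
      finally show ?thesis .
    qed
    ultimately have cA: "c / 2 * exp (\<delta>\<^sub>0 * s) \<le> real (card A)" using c(2)[OF s0(1)] by simp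
    define w where "w k = {h \<in> \<Gamma>\<^sub>0. (1 - \<eta>) * s + real k \<le> len h \<and> len h \<le> (1 - \<eta>) * s + real k + 1}" for k :: nat
    define n where "n = nat \<lfloor>\<eta> * s\<rfloor>"
    have n: "real n \<le> \<eta> * s" using s \<eta> by (simp add: n_def)
    have finw: "finite (w k)" for k unfolding w_def by (rule finite_subset[OF _ fin_ball(2)]) auto
    have "\<exists>k\<le>n. exp ((\<delta>\<^sub>0 - \<eta>) * s) \<le> real (card (w k))"
    proof (rule ccontr)
      assume no: "\<not> ?thesis"
      have "A \<subseteq> (\<Union>k\<le>n. w k)"
      proof
        fix h assume h: "h \<in> A"
        define k where "k = nat \<lfloor>len h - (1 - \<eta>) * s\<rfloor>"
        have "k \<le> n" unfolding k_def n_def using h by (intro nat_mono floor_mono) (auto simp: A_def algebra_simps)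
        moreover have "real k \<le> len h - (1 - \<eta>) * s" "len h - (1 - \<eta>) * s \<le> real k + 1"
          using h by (auto simp: k_def A_def)
        ultimately show "h \<in> (\<Union>k\<le>n. w k)" using h by (auto simp: w_def A_def intro!: bexI[of _ k])
      qed
      then have "card A \<le> card (\<Union>k\<le>n. w k)" using finw by (intro card_mono) auto
      also have "\<dots> \<le> (\<Sum>k\<le>n. card (w k))" by (rule card_UN_le) simp
      finally have "real (card A) \<le> (\<Sum>k\<le>n. real (card (w k)))" by (metis of_nat_le_iff of_nat_sum)
      also have "\<dots> \<le> (\<Sum>k\<le>n. exp ((\<delta>\<^sub>0 - \<eta>) * s))" using no by (intro sum_mono) (meson atMost_iff linear)
      also have "\<dots> = (real n + 1) * exp ((\<delta>\<^sub>0 - \<eta>) * s)" by simp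
      also have "\<dots> \<le> (s + 1) * exp ((\<delta>\<^sub>0 - \<eta>) * s)"
      proof (intro mult_right_mono)
        have "\<eta> * s \<le> 1 * s" using \<eta> s0 by (intro mult_right_mono) auto
        then show "real n + 1 \<le> s + 1" using n by simp
      qed auto
      also have "\<dots> = (s + 1) * exp (- (\<eta> * s)) * exp (\<delta>\<^sub>0 * s)" by (simp add: exp_add[symmetric] algebra_simps)
      also have "\<dots> < c / 2 * exp (\<delta>\<^sub>0 * s)" using s by (intro mult_strict_right_mono) auto
      finally show False using cA by simp
    qed
    then obtain k where k: "k \<le> n" "exp ((\<delta>\<^sub>0 - \<eta>) * s) \<le> real (card (w k))" by blast
    have "(1 - \<eta>) * s + real k \<le> s" using k(1) n by (simp add: algebra_simps)
    then show "\<exists>s'. (1 - \<eta>) * s \<le> s' \<and> s' \<le> s \<and> exp ((\<delta>\<^sub>0 - \<eta>) * s) \<le> real (card {h \<in> \<Gamma>\<^sub>0. s' \<le> len h \<and> len h \<le> s' + 1})"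
      using k(2) by (intro exI[of _ "(1 - \<eta>) * s + real k"]) (simp add: w_def)
  qed simp
qed

end

section \<open>The shadow lemma\<close>

context cat1_space
begin

lemma busemann_swap:
  fixes y z :: 'a
  assumes "\<xi> \<in> boundary"
  shows "busemann \<xi> z y = - busemann \<xi> y z"
proof -
  obtain r where r: "r \<in> \<xi>" using boundary_nonempty[OF assms] by blast
  have "((\<lambda>t. dist z (r t) - dist y (r t)) \<longlongrightarrow> - busemann \<xi> y z) at_top"
    using tendsto_minus[OF busemann_limit[OF assms r, of y z]] by simp
  then show ?thesis using tendsto_unique[OF trivial_limit_at_top_linorder busemann_limit[OF assms r]] by blast
qed

lemma busemann_le_dist:
  fixes y z :: 'a
  assumes "\<xi> \<in> boundary"
  shows "busemann \<xi> y z \<le> dist y z"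
proof -
  obtain r where r: "r \<in> \<xi>" using boundary_nonempty[OF assms] by blast
  have "dist y (r t) - dist z (r t) \<le> dist y z" for t using dist_triangle[of y "r t" z] by simp
  then show ?thesis by (intro tendsto_upperbound[OF busemann_limit[OF assms r]]) auto
qed

lemma busemann_shadow:
  fixes y z :: 'a
  assumes "\<xi> \<in> shadow y z R"
  shows "dist y z - R \<le> busemann \<xi> y z"
proof -
  obtain r where \<xi>: "\<xi> \<in> boundary" and r: "r \<in> \<xi>" "r 0 = y" "dist (r (dist y z)) z < R" using assms by (auto simp: shadow_def)
  have ray: "r \<in> geodesic_rays" using boundary_repr(1)[OF \<xi> r(1)] .
  have "eventually (\<lambda>t. dist y z - R \<le> dist y (r t) - dist z (r t)) at_top"
    using eventually_ge_at_top[of "dist y z"]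
  proof eventually_elim
    case (elim t)
    have "0 \<le> t" using elim zero_le_dist order_trans by blast
    then have "dist y (r t) = t" "dist (r (dist y z)) (r t) = t - dist y z"
      using ray_dist[OF ray, of 0 t] ray_dist[OF ray, of "dist y z" t] elim r(2) by auto
    then show ?case using dist_triangle[of z "r t" "r (dist y z)"] r(3) by (simp add: dist_commute)
  qed
  then show ?thesis by (intro tendsto_lowerbound[OF busemann_limit[OF \<xi> r(1)]]) auto
qed

text \<open>A ray from \<open>y\<close> that misses a large ball around \<open>x\<close> must leave
  the segment from \<open>y\<close> to \<open>x\<close> well before \<open>x\<close>, so
  \<open>y\<close> and the end look close from \<open>x\<close>. Thinness costs 1 and the four-point
  condition 2.\<close>

lemma gp_outside_shadow:
  fixes x y :: 'a
  assumes \<xi>: "\<xi> \<in> boundary" and n: "\<xi> \<notin> shadow y x R" and q: "q \<in> \<xi>" "q 0 = x"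
  shows "eventually (\<lambda>t. R / 2 - 3 \<le> gp x y (q t)) at_top"
proof -
  obtain r where r: "r \<in> \<xi>" "r 0 = y" "r \<in> geodesic_rays" using ray_from_ex[OF \<xi>] by blast
  have qr: "q \<in> geodesic_rays" using boundary_repr(1)[OF \<xi> q(1)] .
  obtain B where B: "\<And>t. 0 \<le> t \<Longrightarrow> dist (r t) (q t) \<le> B"
    using boundary_asymptotic[OF \<xi> r(1) q(1)] by (auto simp: asymptotic_def)
  define d where "d = dist y x"
  have far: "R \<le> dist (r d) x" using n \<xi> r by (auto simp: shadow_def d_def not_less)
  obtain c where c: "geodesic_segment c y x" using seg_ex by blast
  have "eventually (\<lambda>t. max d (R + B + d) \<le> t) at_top" by (rule eventually_ge_at_top)
  then show ?thesis
  proof eventually_elim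
    case (elim t)
    have d0: "0 \<le> d" by (simp add: d_def)
    then have t: "0 \<le> t" "d \<le> t" "R + B + d \<le> t" using elim by auto
    define g where "g = gp y x (r t)"
    have dy: "dist y (r t) = t" using ray_dist[OF r(3), of 0 t] r(2) t by simp
    have g: "0 \<le> g" "g \<le> d" using gp_nonneg gp_le(1)[of y x "r t"] by (auto simp: g_def d_def)
    have "dist (c g) (r g) \<le> 2" using thin[OF c, of r "r t" g] ray_seg0[OF r(3) t(1)] r(2) g by (simp add: g_def)
    moreover have "dist x (c g) = d - g" using seg_dist_ends(2)[OF c, of g] g by (simp add: d_def dist_commute)
    moreover have "dist (r g) (r d) = d - g" using ray_dist[OF r(3), of g d] g by simp
    ultimately have "R \<le> 2 * (d - g) + 2"
      using far dist_triangle[of x "r d" "c g"] dist_triangle[of "c g" "r d" "r g"] by (simp add: dist_commute)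
    moreover have "d - g = gp x y (r t)"
      using dy by (simp add: g_def gp_def d_def dist_commute field_simps)
    ultimately have 1: "R / 2 - 1 \<le> gp x y (r t)" by simp
    have "R / 2 - 1 \<le> gp x (r t) (q t)"
    proof -
      have "dist x (q t) = t" using ray_dist[OF qr, of 0 t] q(2) t by simp
      moreover have "t - d \<le> dist x (r t)" using dy dist_triangle[of y "r t" x] by (simp add: d_def)
      ultimately show ?thesis using B[OF t(1)] t by (simp add: gp_def)
    qed
    then show ?case using gp_4[of x y "r t" "q t"] 1 by linarith
  qed
qed

text \<open>Two ends that both look close to the same far point look close to each other by
  \<open>gp_4\<close>, for arbitrarily large Gromov product.\<close>

lemma outside_shadows_unique:
  fixes x :: 'a
  assumes \<xi>: "\<xi> \<in> boundary" "\<xi>' \<in> boundary"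
    and n: "\<And>R0. \<exists>R\<ge>R0. \<exists>y. \<xi> \<notin> shadow y x R \<and> \<xi>' \<notin> shadow y x R"
  shows "\<xi> = \<xi>'"
proof -
  obtain q q' where q: "q \<in> \<xi>" "q 0 = x" "q \<in> geodesic_rays" and q': "q' \<in> \<xi>'" "q' 0 = x" "q' \<in> geodesic_rays"
    using ray_from_ex \<xi> by metis
  have "dist (q s) (q' s) \<le> 2" if s: "0 \<le> s" for s
  proof -
    obtain R y where R: "2 * (s + 5) \<le> R" "\<xi> \<notin> shadow y x R" "\<xi>' \<notin> shadow y x R" using n by blast
    have "eventually (\<lambda>t. s \<le> t \<and> R / 2 - 3 \<le> gp x y (q t) \<and> R / 2 - 3 \<le> gp x y (q' t)) at_top"
      by (intro eventually_conj eventually_ge_at_top gp_outside_shadow[OF \<xi>(1) R(2) q(1,2)] gp_outside_shadow[OF \<xi>(2) R(3) q'(1,2)])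
    from eventually_happens[OF this] obtain t where t: "s \<le> t" "R / 2 - 3 \<le> gp x y (q t)" "R / 2 - 3 \<le> gp x y (q' t)"
      by auto
    have "s \<le> gp x (q t) (q' t)" 
    proof -
      have "s + 2 \<le> min (gp x (q t) y) (gp x y (q' t))"
        using t R(1) gp_commute[of x "q t" y] by simp
      then show ?thesis using gp_4[of x "q t" y "q' t"] by linarith
    qed
    moreover have "geodesic_segment q x (q t)" "geodesic_segment q' x (q' t)"
      using ray_seg0[OF q(3), of t] ray_seg0[OF q'(3), of t] q(2) q'(2) s t(1) by auto
    ultimately show ?thesis using thin s by blast
  qed
  then have "(q, q') \<in> asymptotic" using q(3) q'(3) by (auto simp: asymptotic_def)
  then show ?thesis using boundary_eqI[OF \<xi> q(1) q'(1)] by blast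
qed

end

section \<open>Conformal densities and the measure of shadows\<close>

context core_pair
begin

text \<open>At least one end of \<open>l\<^sub>0\<close> differs from \<xi>. Going far enough
  towards that end moves away from \<xi>, and a core orbit point is nearby.\<close>

lemma busemann_core_positive:
  assumes \<xi>: "\<xi> \<in> boundary"
  shows "\<exists>h\<in>\<Gamma>\<^sub>0. 0 < busemann \<xi> (h x) x"
proof -
  note P = pos_end_boundary[OF line0(1)] and Ng = neg_end_boundary[OF line0(1)]
  have "\<exists>\<eta> q. \<eta> \<in> boundary \<and> \<eta> \<noteq> \<xi> \<and> q \<in> \<eta> \<and> q 0 = x \<and> (\<forall>t. q t \<in> C\<^sub>0)"
  proof (cases "pos_end l\<^sub>0 = \<xi>")
    case True
    then have "neg_end l\<^sub>0 \<noteq> \<xi>" using neg_end_ne_pos_end[OF line0(1)] by simp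
    then show ?thesis using Ng line0 by (intro exI[of _ "neg_end l\<^sub>0"] exI[of _ "\<lambda>t. l\<^sub>0 (- t)"]) auto
  next
    case False
    then show ?thesis using P line0 by (intro exI[of _ "pos_end l\<^sub>0"] exI[of _ l\<^sub>0]) auto
  qed
  then obtain \<eta> q where q: "\<eta> \<in> boundary" "\<eta> \<noteq> \<xi>" "q \<in> \<eta>" "q 0 = x" "\<And>t. q t \<in> C\<^sub>0" by blast
  obtain r where r: "r \<in> \<xi>" "r 0 = x" "r \<in> geodesic_rays" using ray_from_ex[OF \<xi>] by blast
  have qr: "q \<in> geodesic_rays" using boundary_repr(1)[OF q(1,3)] .
  obtain G where G: "0 \<le> G" "\<And>t u. 0 \<le> t \<Longrightarrow> 0 \<le> u \<Longrightarrow> gp x (q t) (r u) \<le> G"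
    by (rule gp_bounded_distinct[OF q(1) \<xi> q(2,3) r(1) q(4) r(2)]) (rule that)
  \<comment> \<open>The Busemann function gains at least \<open>t - 2 * G\<close> along
    \<open>q\<close>, and replacing \<open>q t\<close> by an orbit point loses \<open>D\<close>; at
    least 1 is left.\<close>
  define t where "t = 2 * G + D + 1"
  have t: "0 \<le> t" using G D by (simp add: t_def)
  obtain h where h: "h \<in> \<Gamma>\<^sub>0" "dist (q t) (h x) \<le> D" using core_dense[OF q(5)] by blast
  have "eventually (\<lambda>u. 1 \<le> dist (h x) (r u) - dist x (r u)) at_top"
    using eventually_ge_at_top[of 0]
  proof eventually_elim
    case (elim u)
    have "dist x (q t) = t" "dist x (r u) = u" using ray_dist[OF qr, of 0 t] ray_dist[OF r(3), of 0 u] q(4) r(2) t elim by auto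
    then show ?case using G(2)[OF t elim] dist_triangle[of "q t" "r u" "h x"] h(2) by (simp add: gp_def t_def)
  qed
  then have "1 \<le> busemann \<xi> (h x) x" by (intro tendsto_lowerbound[OF busemann_limit[OF \<xi> r(1)]]) auto
  then show ?thesis using h(1) by (intro bexI[of _ h]) auto
qed

end

text \<open>Conformality is stated as an inequality on sets rather than through densities. In this
  form it passes at once to the restriction of \<open>\<nu>\<close> to an invariant set, on which
  the replacement of ergodicity depends.\<close>

locale conformal_pair = core_pair +
  fixes \<nu> :: "'a \<Rightarrow> 'a boundary_pt measure"
  assumes sets_nu: "\<And>y. sets (\<nu> y) = sets boundary_borel" and fin_nu: "\<And>y. finite_measure (\<nu> y)"
    and nu_pos: "0 < measure (\<nu> x) boundary"
    and nu_equiv: "\<And>\<gamma> y A. \<gamma> \<in> \<Gamma> \<Longrightarrow> A \<in> sets boundary_borel \<Longrightarrow>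
       measure (\<nu> (\<gamma> y)) A = measure (\<nu> y) (boundary_map \<gamma> -` A \<inter> boundary)"
    and nu_conf: "\<And>y z A b. A \<in> sets boundary_borel \<Longrightarrow> (\<And>\<xi>. \<xi> \<in> A \<Longrightarrow> b \<le> busemann \<xi> y z) \<Longrightarrow>
       measure (\<nu> y) A \<le> exp (- \<delta> * b) * measure (\<nu> z) A"
begin

lemma space_nu: "space (\<nu> y) = boundary"
  using sets_eq_imp_space_eq[OF sets_nu] space_boundary_borel by metis

lemma nu_mono: "A \<subseteq> B \<Longrightarrow> B \<in> sets boundary_borel \<Longrightarrow> measure (\<nu> y) A \<le> measure (\<nu> y) B"
  using finite_measure.finite_measure_mono[OF fin_nu] sets_nu by metis

definition mass where "mass = measure (\<nu> x) boundary"

lemma mass_pos: "0 < mass"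
  using nu_pos by (simp add: mass_def)

lemma mass_translate: "\<gamma> \<in> \<Gamma> \<Longrightarrow> measure (\<nu> (\<gamma> x)) boundary = mass"
proof -
  assume g: "\<gamma> \<in> \<Gamma>"
  have "boundary_map \<gamma> -` boundary \<inter> boundary = boundary" using boundary_map_boundary[OF g] by auto
  then show ?thesis using nu_equiv[OF g boundary_sets, of x] by (simp add: mass_def)
qed

text \<open>On the shadow the Busemann function is at least \<open>len \<gamma> - R\<close>, and the
  total mass at \<open>\<gamma> x\<close> equals that at \<open>x\<close>.\<close>

lemma shadow_upper:
  assumes g: "\<gamma> \<in> \<Gamma>"
  shows "measure (\<nu> x) (shadow x (\<gamma> x) R) \<le> exp (\<delta> * R) * mass * exp (- \<delta> * len \<gamma>)"
proof -
  have "measure (\<nu> x) (shadow x (\<gamma> x) R) \<le> exp (- \<delta> * (len \<gamma> - R)) * measure (\<nu> (\<gamma> x)) (shadow x (\<gamma> x) R)"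
    by (rule nu_conf[OF shadow_sets]) (use busemann_shadow in \<open>auto simp: len_def\<close>)
  also have "\<dots> \<le> exp (- \<delta> * (len \<gamma> - R)) * mass"
    unfolding mass_translate[OF g, symmetric]
    by (intro mult_left_mono nu_mono boundary_sets) (auto simp: shadow_def)
  also have "\<dots> = exp (\<delta> * R) * mass * exp (- \<delta> * len \<gamma>)"
    by (simp add: exp_add[symmetric] algebra_simps)
  finally show ?thesis .
qed

text \<open>Otherwise \<open>\<nu>\<close> would be concentrated at a single point \<open>\<xi>\<^sub>0\<close>, and conformality would make the
  mass at \<open>h x\<close> smaller than the mass at \<open>x\<close> for some \<open>h\<close> in \<open>\<Gamma>\<^sub>0\<close>.\<close>

lemma opposite_shadow_lower:
  "\<exists>R>0. \<exists>c>0. \<forall>\<gamma>\<in>\<Gamma>. c \<le> measure (\<nu> x) (shadow (\<gamma> x) x R)"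
proof (rule ccontr)
  interpret finite_measure "\<nu> x" by (rule fin_nu)
  assume no: "\<not> ?thesis"
  have "\<exists>\<gamma>\<in>\<Gamma>. measure (\<nu> x) (shadow (\<gamma> x) x (real n + 1)) < (1 / 2) ^ n" for n
  proof (rule ccontr)
    assume "\<not> ?thesis"
    then have "\<forall>\<gamma>\<in>\<Gamma>. (1 / 2) ^ n \<le> measure (\<nu> x) (shadow (\<gamma> x) x (real n + 1))" by (auto simp: not_less)
    moreover have "0 < real n + 1" "(0::real) < (1 / 2) ^ n" by auto
    ultimately show False using no by blast
  qed
  then obtain f where f: "\<And>n. f n \<in> \<Gamma>" "\<And>n. measure (\<nu> x) (shadow (f n x) x (real n + 1)) < (1 / 2) ^ n" by metis
  define S where "S n = shadow (f n x) x (real n + 1)" for n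
  have Ss: "S n \<in> sets (\<nu> x)" for n by (simp add: S_def sets_nu shadow_sets)
  have "summable (\<lambda>n. measure (\<nu> x) (S n))"
    by (rule summable_comparison_test'[of "\<lambda>n. (1 / 2) ^ n" 0])
      (use f(2) in \<open>auto simp: S_def intro!: summable_geometric less_imp_le\<close>)
  \<comment> \<open>Borel-Cantelli: almost every end lies outside all but finitely many of these
    shadows. Their radii tend to infinity, so \<open>outside_shadows_unique\<close> identifies any
    two such ends.\<close>
  then have ae: "AE \<xi> in \<nu> x. eventually (\<lambda>n. \<xi> \<in> space (\<nu> x) - S n) sequentially"
    by (intro borel_cantelli_AE1 Ss) (auto simp: emeasure_eq_measure)
  define L where "L = (\<Union>N. \<Inter>n\<in>{N..}. space (\<nu> x) - S n)"
  have Lb: "L \<in> sets boundary_borel"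
    unfolding L_def sets_nu[symmetric, of x] using Ss by (intro sets.countable_UN sets.countable_INT' image_subsetI) auto
  have L: "\<xi> \<in> L \<longleftrightarrow> \<xi> \<in> boundary \<and> eventually (\<lambda>n. \<xi> \<notin> S n) sequentially" for \<xi>
    by (auto simp: L_def eventually_sequentially space_nu)
  have aeL: "AE \<xi> in \<nu> x. \<xi> \<in> L"
    using ae by (rule AE_mp) (auto intro!: AE_I2 simp: L space_nu elim: eventually_mono)
  have bL: "boundary - L = {\<xi> \<in> space (\<nu> x). \<xi> \<notin> L}" by (auto simp: space_nu)
  have "{\<xi> \<in> space (\<nu> x). \<xi> \<notin> L} \<in> sets (\<nu> x)"
    unfolding bL[symmetric] sets_nu using Lb boundary_sets by (rule sets.Diff[rotated])
  then have "emeasure (\<nu> x) (boundary - L) = 0"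
    using AE_iff_null[of "\<nu> x" "\<lambda>\<xi>. \<xi> \<in> L"] aeL unfolding bL by blast
  then have null: "measure (\<nu> x) (boundary - L) = 0" by (simp add: measure_def)
  have Lsub: "L \<subseteq> boundary" by (auto simp: L)
  have split: "measure (\<nu> y) boundary = measure (\<nu> y) L + measure (\<nu> y) (boundary - L)" for y
  proof -
    interpret y: finite_measure "\<nu> y" by (rule fin_nu)
    show ?thesis using y.finite_measure_Union[of L "boundary - L"] Lb boundary_sets sets_nu[of y] Lsub by (simp add: Un_absorb1)
  qed
  have "L \<noteq> {}"
    using split[of x] null nu_pos by auto
  then obtain \<xi>0 where x0: "\<xi>0 \<in> L" by blast
  have "\<xi> = \<xi>0" if "\<xi> \<in> L" for \<xi>
  proof (rule outside_shadows_unique)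
    show "\<xi> \<in> boundary" "\<xi>0 \<in> boundary" using that x0 L by auto
    fix R0 :: real
    have "eventually (\<lambda>n. \<xi> \<notin> S n \<and> \<xi>0 \<notin> S n \<and> R0 \<le> real n) sequentially"
      using that x0 L filterlim_real_sequentially by (intro eventually_conj) (auto simp: filterlim_at_top)
    from eventually_happens[OF this] obtain n where "\<xi> \<notin> S n \<and> \<xi>0 \<notin> S n \<and> R0 \<le> real n" by auto
    then show "\<exists>R\<ge>R0. \<exists>y. \<xi> \<notin> shadow y x R \<and> \<xi>0 \<notin> shadow y x R"
      unfolding S_def by (intro exI[of _ "real n + 1"]) auto
  qed
  then have L1: "\<xi> \<in> L \<Longrightarrow> \<xi> = \<xi>0" for \<xi> .
  obtain h where h: "h \<in> \<Gamma>\<^sub>0" "0 < busemann \<xi>0 (h x) x" using busemann_core_positive[of \<xi>0] x0 L by auto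
  define b where "b = busemann \<xi>0 (h x) x"
  have "measure (\<nu> (h x)) L \<le> exp (- \<delta> * b) * measure (\<nu> x) L"
    by (rule nu_conf[OF Lb]) (use L1 in \<open>auto simp: b_def\<close>)
  moreover have "measure (\<nu> (h x)) (boundary - L) \<le> exp (- \<delta> * (- dist (h x) x)) * measure (\<nu> x) (boundary - L)"
  proof (rule nu_conf)
    fix \<xi> assume "\<xi> \<in> boundary - L"
    then show "- dist (h x) x \<le> busemann \<xi> (h x) x" using busemann_le_dist[of \<xi> x "h x"] busemann_swap[of \<xi> "h x" x] by (simp add: dist_commute)
  qed (use Lb boundary_sets in auto)
  ultimately have "mass \<le> exp (- \<delta> * b) * mass"
    using split[of "h x"] split[of x] null mass_translate[OF mem0[OF h(1)]] by (simp add: mass_def)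
  moreover have "exp (- \<delta> * b) < 1" using d_pos h(2) by (simp add: b_def)
  ultimately show False using mass_pos by (simp add: mult_le_cancel_right1)
qed

text \<open>Translating by the inverse of \<gamma> turns the shadow into one cast from an orbit
  point onto the ball at \<open>x\<close>, which has mass bounded below; the change of base point
  costs at most \<open>exp (\<delta> * len \<gamma>)\<close>.\<close>

lemma shadow_lower:
  "\<exists>R>0. \<exists>c>0. \<forall>\<gamma>\<in>\<Gamma>. c * exp (- \<delta> * len \<gamma>) \<le> measure (\<nu> x) (shadow x (\<gamma> x) R)"
proof -
  obtain R c where R: "0 < R" "0 < c" "\<And>\<gamma>. \<gamma> \<in> \<Gamma> \<Longrightarrow> c \<le> measure (\<nu> x) (shadow (\<gamma> x) x R)"
    using opposite_shadow_lower by blast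
  have "c * exp (- \<delta> * len \<gamma>) \<le> measure (\<nu> x) (shadow x (\<gamma> x) R)" if g: "\<gamma> \<in> \<Gamma>" for \<gamma>
  proof -
    have "boundary_map \<gamma> -` shadow x (\<gamma> x) R \<inter> boundary = shadow (ginv \<gamma> x) x R"
    proof (intro equalityI subsetI)
      fix \<xi> assume "\<xi> \<in> boundary_map \<gamma> -` shadow x (\<gamma> x) R \<inter> boundary"
      then show "\<xi> \<in> shadow (ginv \<gamma> x) x R" using shadow_act[OF g, of \<xi> "ginv \<gamma> x" x R] g by simp
    next
      fix \<xi> assume "\<xi> \<in> shadow (ginv \<gamma> x) x R"
      moreover from this have "\<xi> \<in> boundary" by (simp add: shadow_def)
      ultimately show "\<xi> \<in> boundary_map \<gamma> -` shadow x (\<gamma> x) R \<inter> boundary" using shadow_act[OF g, of \<xi> "ginv \<gamma> x" x R] g by simp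
    qed
    then have "c \<le> measure (\<nu> (\<gamma> x)) (shadow x (\<gamma> x) R)"
      using R(3)[OF act_inv[OF g]] nu_equiv[OF g shadow_sets, of x x "\<gamma> x" R] by simp
    also have "\<dots> \<le> exp (- \<delta> * (- len \<gamma>)) * measure (\<nu> x) (shadow x (\<gamma> x) R)"
    proof (rule nu_conf[OF shadow_sets])
      fix \<xi> assume "\<xi> \<in> shadow x (\<gamma> x) R"
      then have "\<xi> \<in> boundary" by (simp add: shadow_def)
      then show "- len \<gamma> \<le> busemann \<xi> (\<gamma> x) x"
        using busemann_le_dist[of \<xi> x "\<gamma> x"] busemann_swap[of \<xi> "\<gamma> x" x] by (simp add: len_def)
    qed
    finally have "c * exp (- \<delta> * len \<gamma>) \<le> exp (- \<delta> * (- len \<gamma>)) * measure (\<nu> x) (shadow x (\<gamma> x) R) * exp (- \<delta> * len \<gamma>)"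
      by (intro mult_right_mono) auto
    also have "\<dots> = measure (\<nu> x) (shadow x (\<gamma> x) R)"
      by (simp add: exp_minus)
    finally show ?thesis .
  qed
  then show ?thesis using R(1,2) by blast
qed

end

section \<open>Quasi-independence and the Kochen-Stone inequality\<close>

lemma (in finite_measure) sum_measure_le_multiplicity:
  assumes I: "finite I" and S: "\<And>i. i \<in> I \<Longrightarrow> S i \<in> sets M"
    and m: "\<And>w. w \<in> space M \<Longrightarrow> card {i \<in> I. w \<in> S i} \<le> m"
  shows "(\<Sum>i\<in>I. measure M (S i)) \<le> real m * measure M (\<Union>i\<in>I. S i)"
proof -
  have U: "(\<Union>i\<in>I. S i) \<in> sets M" using I S by (intro sets.finite_UN) auto
  have "(\<Sum>i\<in>I. measure M (S i)) = (\<Sum>i\<in>I. \<integral>w. indicator (S i) w \<partial>M)"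
    using S sets.sets_into_space by (intro sum.cong) (auto simp: Int_absorb2)
  also have "\<dots> = (\<integral>w. (\<Sum>i\<in>I. indicator (S i) w) \<partial>M)"
    using S by (intro Bochner_Integration.integral_sum[symmetric]) (auto intro!: integrable_real_indicator simp: less_top[symmetric])
  also have "\<dots> \<le> (\<integral>w. real m * indicator (\<Union>i\<in>I. S i) w \<partial>M)"
  proof (rule integral_mono)
    fix w assume w: "w \<in> space M"
    have "(\<Sum>i\<in>I. indicator (S i) w :: real) = real (card {i \<in> I. w \<in> S i})"
      using I by (simp add: indicator_def sum.If_cases Int_def)
    also have "\<dots> \<le> real m * indicator (\<Union>i\<in>I. S i) w"
    proof (cases "w \<in> (\<Union>i\<in>I. S i)")
      case True
      then show ?thesis using m[OF w] by simp
    next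
      case False
      then have e: "{i \<in> I. w \<in> S i} = {}" by blast
      show ?thesis unfolding e by simp
    qed
    finally show "(\<Sum>i\<in>I. indicator (S i) w) \<le> real m * indicator (\<Union>i\<in>I. S i) w" .
  qed (use S U in \<open>auto intro!: Bochner_Integration.integrable_sum integrable_real_indicator integrable_mult_right simp: less_top[symmetric]\<close>)
  also have "\<dots> = real m * measure M (\<Union>i\<in>I. S i)"
    using U sets.sets_into_space by (simp add: Int_absorb2)
  finally show ?thesis .
qed

lemma (in finite_measure) kochen_stone:
  assumes A: "\<And>n::nat. A n \<in> sets M" and C: "0 \<le> C"
    and qi: "\<And>i j. i < j \<Longrightarrow> measure M (A i \<inter> A j) \<le> C * measure M (A i) * measure M (A j)"
    and dv: "\<not> summable (\<lambda>n. measure M (A n))"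
  shows "0 < measure M (\<Inter>N. \<Union>n\<in>{N..}. A n)"
proof -
  define p where "p n = measure M (A n)" for n
  have p0: "0 \<le> p n" for n by (simp add: p_def)
  define U where "U N = (\<Union>n\<in>{N..}. A n)" for N
  have Us: "U N \<in> sets M" for N unfolding U_def using A by (intro sets.countable_UN') auto
  have qi': "measure M (A i \<inter> A j) \<le> C * p i * p j" if "i \<noteq> j" for i j
    using qi[of i j] qi[of j i] that by (cases "i < j") (auto simp: p_def Int_commute mult_ac)
  have UN: "1 / (1 + C) \<le> measure M (U N)" for N
  proof -
    \<comment> \<open>A block of total mass at least 1 makes the diagonal contribution
      \<open>S\<close> at most \<open>S\<^sup>2\<close>.\<close>
    obtain m where m: "1 \<le> (\<Sum>n\<in>{N..<m}. p n)"
    proof -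
      have "\<not> summable p" using dv by (simp add: p_def[abs_def])
      then have "\<not> summable (\<lambda>n. p (n + N))" using summable_iff_shift[of p N] by simp
      then have "\<not> (\<forall>n. (\<Sum>i<n. p (i + N)) \<le> 1)"
        using summableI_nonneg_bounded[of "\<lambda>n. p (n + N)" 1] p0 by blast
      then obtain n where "1 < (\<Sum>i<n. p (i + N))" by (auto simp: not_le)
      also have "\<dots> = (\<Sum>i\<in>{N..<n + N}. p i)"
        using sum.shift_bounds_nat_ivl[of p 0 N n] by (simp add: lessThan_atLeast0)
      finally show ?thesis using that[of "n + N"] by simp
    qed
    define I where "I = {N..<m}"
    define S where "S = (\<Sum>n\<in>I. p n)"
    have S: "1 \<le> S" using m by (simp add: S_def I_def)
    define f where "f w = (\<Sum>n\<in>I. indicator (A n) w :: real)" for w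
    \<comment> \<open>The multiplier with which expanding the integral of the square
      \<open>(f - L * indicator (U N))\<^sup>2\<close> reproduces the Cauchy-Schwarz bound.\<close>
    define L where "L = (1 + C) * S"
    have int: "integrable M (indicator (X) :: 'a \<Rightarrow> real)" if "X \<in> sets M" for X
      using that by (intro integrable_real_indicator) (auto simp: less_top[symmetric])
    have intf: "integrable M f" unfolding f_def using A int by (intro Bochner_Integration.integrable_sum) auto
    have ind: "(\<integral>w. indicator X w \<partial>M) = measure M X" if "X \<in> sets M" for X
      using sets.sets_into_space[OF that] by (simp add: Int_absorb2)
    have Ef: "(\<integral>w. f w \<partial>M) = S"
      unfolding f_def S_def p_def using A int ind by (subst Bochner_Integration.integral_sum) auto
    have f2: "f w * f w = (\<Sum>i\<in>I. \<Sum>j\<in>I. indicator (A i \<inter> A j) w)" for w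
      by (simp add: f_def sum_product indicator_inter_arith)
    have intf2: "integrable M (\<lambda>w. f w * f w)"
      unfolding f2 using A int by (intro Bochner_Integration.integrable_sum) auto
    have Ef2: "(\<integral>w. f w * f w \<partial>M) \<le> (1 + C) * S * S"
    proof -
      have "(\<integral>w. f w * f w \<partial>M) = (\<Sum>i\<in>I. \<Sum>j\<in>I. measure M (A i \<inter> A j))"
        unfolding f2 using A int ind by (subst Bochner_Integration.integral_sum | auto intro!: Bochner_Integration.integrable_sum sum.cong)+
      also have "\<dots> \<le> (\<Sum>i\<in>I. \<Sum>j\<in>I. (if i = j then p i else 0) + C * p i * p j)"
        using qi' p0 C by (intro sum_mono) (auto simp: p_def)
      also have "\<dots> = S + C * S * S"
      proof -
        have "(\<Sum>i\<in>I. \<Sum>j\<in>I. (if i = j then p i else 0)) = S"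
          unfolding S_def by (intro sum.cong refl) (simp add: sum.delta I_def)
        moreover have "(\<Sum>i\<in>I. \<Sum>j\<in>I. C * p i * p j) = C * S * S"
          unfolding S_def by (simp add: sum_distrib_left sum_distrib_right mult_ac)
        ultimately show ?thesis by (simp add: sum.distrib)
      qed
      also have "\<dots> \<le> (1 + C) * S * S" using S mult_right_mono[of 1 S S] by (simp add: algebra_simps)
      finally show ?thesis .
    qed
    have fU: "f w * indicator (U N) w = f w" for w
    proof (cases "w \<in> U N")
      case False
      then have "f w = 0" unfolding f_def U_def I_def by (intro sum.neutral) (auto simp: indicator_def)
      then show ?thesis by simp
    qed simp
    have "0 \<le> (\<integral>w. (f w - L * indicator (U N) w)\<^sup>2 \<partial>M)" by simp
    also have "(\<integral>w. (f w - L * indicator (U N) w)\<^sup>2 \<partial>M) = (\<integral>w. (f w * f w - (2 * L) * f w) + L\<^sup>2 * indicator (U N) w \<partial>M)"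
    proof (rule Bochner_Integration.integral_cong[OF refl])
      fix w
      have "(f w - L * indicator (U N) w)\<^sup>2 = f w * f w - 2 * L * (f w * indicator (U N) w) + L\<^sup>2 * (indicator (U N) w * indicator (U N) w)"
        by (simp add: power2_eq_square algebra_simps)
      then show "(f w - L * indicator (U N) w)\<^sup>2 = (f w * f w - (2 * L) * f w) + L\<^sup>2 * indicator (U N) w"
        unfolding fU by (simp add: indicator_def)
    qed
    also have "\<dots> = (\<integral>w. f w * f w \<partial>M) - 2 * L * S + L\<^sup>2 * measure M (U N)"
      using intf intf2 int[OF Us[of N]] ind[OF Us[of N]] Ef by simp
    finally have "2 * L * S - (1 + C) * S * S \<le> L\<^sup>2 * measure M (U N)" using Ef2 by simp
    then have "(1 + C) * S\<^sup>2 * 1 \<le> (1 + C) * S\<^sup>2 * ((1 + C) * measure M (U N))"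
      by (simp add: L_def power2_eq_square algebra_simps)
    then have "1 \<le> (1 + C) * measure M (U N)"
      by (rule mult_left_le_imp_le) (use C S in auto)
    then show ?thesis using C by (simp add: field_simps)
  qed
  have "(\<lambda>N. measure M (U N)) \<longlonglongrightarrow> measure M (\<Inter>N. U N)"
  proof (rule finite_Lim_measure_decseq)
    show "range U \<subseteq> sets M" using Us by auto
    show "decseq U" unfolding U_def decseq_def by (intro allI impI UN_mono) auto
  qed
  then have "1 / (1 + C) \<le> measure M (\<Inter>N. U N)"
    using UN by (intro LIMSEQ_le_const) auto
  moreover have "0 < 1 / (1 + C)" using C by simp
  ultimately have "0 < measure M (\<Inter>N. U N)" by linarith
  then show ?thesis by (simp add: U_def)
qed

section \<open>Spiral events: ends of rays that follow a translate of the core\<close>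

context cat1_space
begin

lemma shadow_ray:
  fixes x y :: 'a
  assumes "\<xi> \<in> shadow x y R" "r \<in> \<xi>" "r 0 = x"
  shows "dist (r (dist x y)) y < R"
proof -
  obtain q where q: "\<xi> \<in> boundary" "q \<in> \<xi>" "q 0 = x" "dist (q (dist x y)) y < R" using assms(1) by (auto simp: shadow_def)
  have "r (dist x y) = q (dist x y)"
    using asymptotic_same_start[OF boundary_asymptotic[OF q(1) assms(2) q(2)]] assms(3) q(3) by simp
  then show ?thesis using q(4) by simp
qed

lemma shadow_mono: "R \<le> R' \<Longrightarrow> shadow x y R \<subseteq> shadow x (y :: 'a) R'"
  by (force simp: shadow_def)

end

context core_pair
begin

definition gap_const where "gap_const = 2 * D + 4"

lemma gap_const_pos: "0 < gap_const"
  using D by (simp add: gap_const_def)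

text \<open>By \<open>minimal_gap\<close> the geodesic from \<open>x\<close> to
  \<open>\<gamma> (h x)\<close> almost passes through \<open>\<gamma> x\<close>, so a ray near the
  endpoint has passed near \<open>\<gamma> x\<close> as well. This is why the events are built from
  shortest representatives.\<close>

lemma ray_passes_minimal:
  assumes g: "\<gamma> \<in> short_reps" and h: "h \<in> \<Gamma>\<^sub>0" and r: "r \<in> geodesic_rays" "r 0 = x"
    and near: "dist (r (len (\<gamma> \<circ> h))) ((\<gamma> \<circ> h) x) \<le> R"
  shows "dist (r (len \<gamma>)) (\<gamma> x) \<le> 3 * gap_const + R + 4"
proof -
  have G: "\<gamma> \<in> \<Gamma>" using g by (simp add: short_reps_def)
  have R0: "0 \<le> R" using near zero_le_dist order_trans by blast
  define k where "k = \<gamma> \<circ> h"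
  have gap: "len \<gamma> + len h - gap_const \<le> len k" using minimal_gap[OF g h] by (simp add: gap_const_def k_def)
  obtain b where b: "geodesic_segment b x (k x)" using seg_ex by blast
  obtain c where c: "geodesic_segment c x (\<gamma> x)" using seg_ex by blast
  \<comment> \<open>\<open>len k\<close> may fall short of \<open>len \<gamma>\<close> by up to
    \<open>gap_const\<close>; the three geodesics are compared at a time on which all are
    defined.\<close>
  define s where "s = min (len \<gamma>) (len k)"
  have s: "0 \<le> s" "s \<le> len \<gamma>" "s \<le> len k" by (auto simp: s_def)
  have s4: "len \<gamma> - s \<le> gap_const" using gap gap_const_pos len_nonneg[of h] unfolding s_def by linarith
  have dgk: "dist (\<gamma> x) (k x) = len h" using G by (simp add: k_def act_carrier(2) len_def)
  have "dist (c s) (b s) \<le> 2 + 2 * max 0 (s - gp x (\<gamma> x) (k x))"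
    using fellow[OF c b, of s] s by (simp add: len_def)
  also have "\<dots> \<le> 2 + gap_const"
  proof -
    have "gp x (\<gamma> x) (k x) = (len \<gamma> + len k - len h) / 2" using dgk by (simp add: gp_def len_def)
    then show ?thesis using gap s gap_const_pos by (simp add: max_def)
  qed
  finally have 1: "dist (c s) (b s) \<le> 2 + gap_const" .
  have rs: "geodesic_segment r x (r (len k))" using ray_seg0[OF r(1), of "len k"] r(2) by simp
  have dr: "dist x (r (len k)) = len k" using ray_dist[OF r(1), of 0 "len k"] r(2) by simp
  have "dist (r s) (b s) \<le> 2 + 2 * max 0 (s - gp x (r (len k)) (k x))"
    using fellow[OF rs b, of s] s dr by (simp add: len_def)
  also have "\<dots> \<le> 2 + R"
  proof -
    have "gp x (r (len k)) (k x) = (2 * len k - dist (r (len k)) (k x)) / 2" using dr by (simp add: gp_def len_def)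
    moreover have "dist (r (len k)) (k x) \<le> R" using near by (simp add: k_def)
    ultimately show ?thesis using s R0 by (simp add: max_def)
  qed
  finally have 2: "dist (r s) (b s) \<le> 2 + R" .
  have 3: "dist (c s) (\<gamma> x) = len \<gamma> - s" using seg_dist_ends(2)[OF c, of s] s by (simp add: len_def)
  have 4: "dist (r (len \<gamma>)) (r s) = len \<gamma> - s" using ray_dist[OF r(1), of "len \<gamma>" s] s by simp
  show ?thesis
    using 1 2 3 4 s4 dist_triangle[of "r (len \<gamma>)" "\<gamma> x" "r s"] dist_triangle[of "r s" "\<gamma> x" "b s"] dist_triangle[of "b s" "\<gamma> x" "c s"]
      dist_commute[of "c s" "b s"] gap_const_pos by linarith
qed

definition short_window where "short_window n W = {\<gamma> \<in> short_reps. n - W < len \<gamma> \<and> len \<gamma> \<le> n + W}"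
definition core_window where "core_window s V = {h \<in> \<Gamma>\<^sub>0. s \<le> len h \<and> len h \<le> s + V}"
definition spiral_event where "spiral_event n W s V R = (\<Union>p\<in>short_window n W \<times> core_window s V. shadow x ((fst p \<circ> snd p) x) R)"

lemma short_window_mem: "\<gamma> \<in> short_window n W \<Longrightarrow> \<gamma> \<in> \<Gamma>"
  by (simp add: short_window_def short_reps_def)

lemma fin_short_window: "finite (short_window n W)"
  by (rule finite_subset[OF _ fin_ball(1)[of "n + W"]]) (auto simp: short_window_def short_reps_def)

lemma fin_core_window: "finite (core_window s V)"
  by (rule finite_subset[OF _ fin_ball(2)[of "s + V"]]) (auto simp: core_window_def)

lemma spiral_event_sets: "spiral_event n W s V R \<in> sets boundary_borel"
  unfolding spiral_event_def using fin_short_window fin_core_window shadow_sets by (intro sets.finite_UN) auto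

lemma pair_len:
  assumes "\<gamma> \<in> short_window n W" "h \<in> core_window s V"
  shows "\<bar>len (\<gamma> \<circ> h) - (n + s)\<bar> \<le> W + V + gap_const" "\<gamma> \<circ> h \<in> \<Gamma>"
proof -
  have "len \<gamma> + len h - gap_const \<le> len (\<gamma> \<circ> h)" "len (\<gamma> \<circ> h) \<le> len \<gamma> + len h"
    using minimal_gap[of \<gamma> h] len_comp[OF short_window_mem[OF assms(1)], of h] assms by (auto simp: short_window_def core_window_def gap_const_def)
  then show "\<bar>len (\<gamma> \<circ> h) - (n + s)\<bar> \<le> W + V + gap_const" using assms gap_const_pos by (auto simp: short_window_def core_window_def abs_le_iff)
  show "\<gamma> \<circ> h \<in> \<Gamma>" using act_comp short_window_mem[OF assms(1)] assms(2) mem0 by (auto simp: core_window_def)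
qed

lemma pair_near:
  assumes "\<gamma> \<in> short_window n W" "h \<in> core_window s V" "\<xi> \<in> shadow x ((\<gamma> \<circ> h) x) R" "r \<in> \<xi>" "r 0 = x" "\<xi> \<in> boundary"
  shows "dist (r (len \<gamma>)) (\<gamma> x) \<le> 3 * gap_const + R + 4" "dist (r (len (\<gamma> \<circ> h))) ((\<gamma> \<circ> h) x) \<le> R"
proof -
  have rr: "r \<in> geodesic_rays" using boundary_repr assms by metis
  show 1: "dist (r (len (\<gamma> \<circ> h))) ((\<gamma> \<circ> h) x) \<le> R" using shadow_ray[OF assms(3-5)] by (simp add: len_def)
  show "dist (r (len \<gamma>)) (\<gamma> x) \<le> 3 * gap_const + R + 4"
    using ray_passes_minimal[OF _ _ rr assms(5) 1] assms(1,2) by (simp add: short_window_def core_window_def)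
qed

text \<open>The pair is determined by \<gamma> and \<open>\<gamma> \<circ> h\<close>, whose orbit
  points lie near the ray at times \<open>n\<close> and \<open>n + s\<close>. The bound depends on
  neither of these times.\<close>

lemma pair_multiplicity:
  assumes W: "0 \<le> W" and V: "0 \<le> V" and R: "0 \<le> R" and n: "0 \<le> n" and s: "0 \<le> s" and \<xi>: "\<xi> \<in> boundary"
  shows "card {p \<in> short_window n W \<times> core_window s V. \<xi> \<in> shadow x ((fst p \<circ> snd p) x) R} \<le> orbit_count (2 * (3 * gap_const + R + 4 + W)) * orbit_count (2 * (R + W + V + gap_const))"
proof -
  obtain r where r: "r \<in> \<xi>" "r 0 = x" "r \<in> geodesic_rays" using ray_from_ex[OF \<xi>] by blast
  define X where "X = {\<gamma> \<in> \<Gamma>. dist (r n) (\<gamma> x) \<le> 3 * gap_const + R + 4 + W}"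
  define Y where "Y = {\<gamma> \<in> \<Gamma>. dist (r (n + s)) (\<gamma> x) \<le> R + W + V + gap_const}"
  define Z where "Z = {p \<in> short_window n W \<times> core_window s V. \<xi> \<in> shadow x ((fst p \<circ> snd p) x) R}"
  have "card Z \<le> card (X \<times> Y)"
  proof (rule card_inj_on_le)
    show "inj_on (\<lambda>p. (fst p, fst p \<circ> snd p)) Z"
    proof (rule inj_onI)
      fix p q assume p: "p \<in> Z" and q: "q \<in> Z" and e: "(fst p, fst p \<circ> snd p) = (fst q, fst q \<circ> snd q)"
      have G: "fst p \<in> \<Gamma>" using p short_window_mem by (auto simp: Z_def)
      have "ginv (fst p) \<circ> (fst p \<circ> snd p) = ginv (fst p) \<circ> (fst p \<circ> snd q)" using e by (metis Pair_inject)
      then have "snd p = snd q" using G by (simp flip: comp_assoc)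
      then show "p = q" using e by (simp add: prod_eq_iff)
    qed
    show "(\<lambda>p. (fst p, fst p \<circ> snd p)) ` Z \<subseteq> X \<times> Y"
    proof clarify
      fix \<gamma> h assume "(\<gamma>, h) \<in> Z"
      then have m: "\<gamma> \<in> short_window n W" "h \<in> core_window s V" and sh: "\<xi> \<in> shadow x ((\<gamma> \<circ> h) x) R" by (auto simp: Z_def)
      note near = pair_near[OF m sh r(1,2) \<xi>]
      note pl = pair_len[OF m]
      have "\<bar>n - len \<gamma>\<bar> \<le> W" using m(1) by (auto simp: short_window_def abs_le_iff)
      then have "dist (r n) (r (len \<gamma>)) \<le> W" using ray_dist[OF r(3), of n "len \<gamma>"] n by simp
      then have 1: "\<gamma> \<in> X" using near(1) dist_triangle[of "r n" "\<gamma> x" "r (len \<gamma>)"] short_window_mem[OF m(1)] by (simp add: X_def)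
      have "dist (r (n + s)) (r (len (\<gamma> \<circ> h))) \<le> W + V + gap_const" using ray_dist[OF r(3), of "n + s" "len (\<gamma> \<circ> h)"] n s pl(1) by (simp add: abs_minus_commute)
      then have "dist (r (n + s)) ((\<gamma> \<circ> h) x) \<le> R + W + V + gap_const"
        using near(2) dist_triangle[of "r (n + s)" "(\<gamma> \<circ> h) x" "r (len (\<gamma> \<circ> h))"] by linarith
      then have "\<gamma> \<circ> h \<in> Y" using pl(2) by (simp add: Y_def)
      then show "fst (\<gamma>, h) \<in> X \<and> fst (\<gamma>, h) \<circ> snd (\<gamma>, h) \<in> Y" using 1 by simp
    qed
    show "finite (X \<times> Y)" unfolding X_def Y_def using card_orbit_near(1) gap_const_pos R W V by simp
  qed
  also have "\<dots> = card X * card Y" by (rule card_cartesian_product)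
  also have "\<dots> \<le> orbit_count (2 * (3 * gap_const + R + 4 + W)) * orbit_count (2 * (R + W + V + gap_const))"
    unfolding X_def Y_def using gap_const_pos R W V by (intro mult_le_mono card_orbit_near(2)) auto
  finally show ?thesis by (simp add: Z_def)
qed

end

context conformal_pair
begin

text \<open>Bounded multiplicity makes the measure of an event comparable from below to the number
  of pairs times the size of one shadow, about \<open>b k * exp (- \<delta> * s k)\<close>. Together
  with the upper shadow bound for intersections this meets the hypotheses of
  \<open>kochen_stone\<close>.\<close>

lemma spiral_event_limsup_positive:
  fixes n s :: "nat \<Rightarrow> real"
  assumes W: "0 < W" and c: "0 < c" and cM: "\<And>R. 0 \<le> R \<Longrightarrow> c * exp (\<delta> * R) \<le> real (card (short_window R W))"
    and V: "0 \<le> V" and n0: "\<And>k. 0 \<le> n k" and s0: "\<And>k. 0 \<le> s k"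
    and gap: "\<And>j k. j < k \<Longrightarrow> n j + s j \<le> n k"
    and dv: "\<not> summable (\<lambda>k. real (card (core_window (s k) V)) * exp (- \<delta> * s k))"
  shows "\<exists>R::nat. 0 < measure (\<nu> x) (\<Inter>m. \<Union>k\<in>{m..}. spiral_event (n k) W (s k) V (real R))"
proof -
  interpret nu: finite_measure "\<nu> x" by (rule fin_nu)
  obtain R0 cl where R0: "0 < R0" "0 < cl" "\<And>\<gamma>. \<gamma> \<in> \<Gamma> \<Longrightarrow> cl * exp (- \<delta> * len \<gamma>) \<le> measure (\<nu> x) (shadow x (\<gamma> x) R0)"
    using shadow_lower by auto
  \<comment> \<open>The radius of the shadow lemma depends on \<open>\<nu>\<close>. Rounding it up
    to a natural number lets \<open>deep_set\<close> take a countable union over radii and so obtain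
    one set for all densities.\<close>
  obtain Rn :: nat where Rn: "R0 \<le> real Rn" using real_arch_simple by blast
  define R where "R = real Rn"
  have R: "0 < R" using R0(1) Rn by (simp add: R_def)
  define K2 where "K2 = W + V + gap_const"
  have K2: "0 < K2" using W V gap_const_pos by (simp add: K2_def)
  define P where "P k = short_window (n k) W \<times> core_window (s k) V" for k
  define S where "S p = shadow x ((fst p \<circ> snd p) x) R" for p :: "('a \<Rightarrow> 'a) \<times> ('a \<Rightarrow> 'a)"
  define A where "A k = spiral_event (n k) W (s k) V R" for k
  have A_eq: "A k = (\<Union>p\<in>P k. S p)" for k by (simp add: A_def spiral_event_def P_def S_def)
  have finP: "finite (P k)" for k unfolding P_def using fin_short_window fin_core_window by blast
  have Ss: "S p \<in> sets (\<nu> x)" for p by (simp add: S_def sets_nu shadow_sets)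
  have As: "A k \<in> sets (\<nu> x)" for k by (simp add: A_def sets_nu spiral_event_sets)
  define \<tau> where "\<tau> k = n k + s k" for k
  have Pl: "\<bar>len (fst p \<circ> snd p) - \<tau> k\<bar> \<le> K2 \<and> fst p \<circ> snd p \<in> \<Gamma>" if "p \<in> P k" for p k
    using pair_len[of "fst p" "n k" W "snd p" "s k" V] that by (auto simp: P_def \<tau>_def K2_def)
  define cu where "cu = exp (\<delta> * R) * mass * exp (\<delta> * K2)"
  have cu: "0 < cu" using mass_pos by (simp add: cu_def)
  have up: "measure (\<nu> x) (S p) \<le> cu * exp (- \<delta> * \<tau> k)" if p: "p \<in> P k" for p k
  proof -
    have "measure (\<nu> x) (S p) \<le> exp (\<delta> * R) * mass * exp (- \<delta> * len (fst p \<circ> snd p))"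
      unfolding S_def using Pl[OF p] shadow_upper by blast
    also have "\<dots> \<le> exp (\<delta> * R) * mass * exp (\<delta> * (K2 - \<tau> k))"
    proof (intro mult_left_mono)
      have "- len (fst p \<circ> snd p) \<le> K2 - \<tau> k" using Pl[OF p] by linarith
      then have "\<delta> * (- len (fst p \<circ> snd p)) \<le> \<delta> * (K2 - \<tau> k)" using d_nonneg by (rule mult_left_mono)
      then show "exp (- \<delta> * len (fst p \<circ> snd p)) \<le> exp (\<delta> * (K2 - \<tau> k))" by simp
    qed (use mass_pos in auto)
    also have "\<dots> = cu * exp (- \<delta> * \<tau> k)"
      by (simp add: cu_def mult.assoc exp_add[symmetric] algebra_simps)
    finally show ?thesis .
  qed
  have lo: "cl * exp (- \<delta> * K2) * exp (- \<delta> * \<tau> k) \<le> measure (\<nu> x) (S p)" if p: "p \<in> P k" for p k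
  proof -
    have "cl * exp (- \<delta> * K2) * exp (- \<delta> * \<tau> k) = cl * exp (\<delta> * (- (K2 + \<tau> k)))"
      by (simp add: mult.assoc exp_add[symmetric] algebra_simps)
    also have "\<dots> \<le> cl * exp (- \<delta> * len (fst p \<circ> snd p))"
    proof (intro mult_left_mono)
      have "- (K2 + \<tau> k) \<le> - len (fst p \<circ> snd p)" using Pl[OF p] by linarith
      then have "\<delta> * (- (K2 + \<tau> k)) \<le> \<delta> * (- len (fst p \<circ> snd p))" using d_nonneg by (rule mult_left_mono)
      then show "exp (\<delta> * (- (K2 + \<tau> k))) \<le> exp (- \<delta> * len (fst p \<circ> snd p))" by simp
    qed (use R0 in auto)
    also have "\<dots> \<le> measure (\<nu> x) (shadow x ((fst p \<circ> snd p) x) R0)" using Pl[OF p] R0(3) by blast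
    also have "\<dots> \<le> measure (\<nu> x) (S p)"
      unfolding S_def R_def by (rule nu_mono[OF shadow_mono[OF Rn] shadow_sets])
    finally show ?thesis .
  qed
  define m where "m = orbit_count (2 * (3 * gap_const + R + 4 + W)) * orbit_count (2 * (R + W + V + gap_const)) + 1"
  have mult: "(\<Sum>p\<in>P k. measure (\<nu> x) (S p)) \<le> real m * measure (\<nu> x) (A k)" for k
    unfolding A_eq
  proof (rule nu.sum_measure_le_multiplicity[OF finP Ss])
    fix \<xi> assume "\<xi> \<in> space (\<nu> x)"
    then have "\<xi> \<in> boundary" by (simp add: space_nu)
    from pair_multiplicity[OF _ V _ n0 s0 this, of W R k k] show "card {p \<in> P k. \<xi> \<in> S p} \<le> m"
      using W R by (simp add: P_def S_def m_def)
  qed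
  define c2 where "c2 = cl * exp (- \<delta> * K2) / real m"
  have "0 < m" by (simp add: m_def)
  then have mp: "0 < real m" by simp
  then have c2: "0 < c2" using R0(2) by (simp add: c2_def)
  define b where "b k = real (card (core_window (s k) V))" for k
  define w where "w k = real (card (short_window (n k) W))" for k
  have b0: "0 \<le> b k" and w0: "0 \<le> w k" for k by (auto simp: b_def w_def)
  have Ame: "c2 * (w k * b k) * exp (- \<delta> * \<tau> k) \<le> measure (\<nu> x) (A k)" for k
  proof -
    have "real (card (P k)) * (cl * exp (- \<delta> * K2) * exp (- \<delta> * \<tau> k)) = (\<Sum>p\<in>P k. cl * exp (- \<delta> * K2) * exp (- \<delta> * \<tau> k))" by simp
    also have "\<dots> \<le> (\<Sum>p\<in>P k. measure (\<nu> x) (S p))" using lo by (intro sum_mono)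
    also have "\<dots> \<le> real m * measure (\<nu> x) (A k)" by (rule mult)
    finally have "real (card (P k)) * (cl * exp (- \<delta> * K2) * exp (- \<delta> * \<tau> k)) \<le> measure (\<nu> x) (A k) * real m" by (simp add: mult.commute)
    then have "real (card (P k)) * (cl * exp (- \<delta> * K2) * exp (- \<delta> * \<tau> k)) / real m \<le> measure (\<nu> x) (A k)"
      by (simp only: pos_divide_le_eq[OF mp])
    then show ?thesis by (simp add: c2_def P_def card_cartesian_product w_def b_def mult_ac)
  qed
  have wk: "c * exp (\<delta> * n k) \<le> w k" for k using cM[OF n0[of k]] by (simp add: w_def)
  have Ame2: "c2 * c * b k * exp (- \<delta> * s k) \<le> measure (\<nu> x) (A k)" for k
  proof -
    have "c2 * c * b k * exp (- \<delta> * s k) = c2 * ((c * exp (\<delta> * n k)) * b k) * exp (- \<delta> * \<tau> k)"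
      by (simp add: \<tau>_def mult.assoc exp_add[symmetric] algebra_simps)
    also have "\<dots> \<le> c2 * (w k * b k) * exp (- \<delta> * \<tau> k)"
      using c2 wk b0 by (intro mult_right_mono mult_left_mono) auto
    finally show ?thesis using Ame[of k] by linarith
  qed
  define K4 where "K4 = 3 * gap_const + R + 4 + R + W + K2"
  have K4: "0 \<le> K4" using gap_const_pos R W K2 by (simp add: K4_def)
  have inter: "measure (\<nu> x) (A j \<inter> A k) \<le> w j * b j * (CN * exp (\<delta> * (n k - \<tau> j + K4)) * b k) * (cu * exp (- \<delta> * \<tau> k))" if jk: "j < k" for j k
  proof -
    define Q where "Q = {(p, q). p \<in> P j \<and> q \<in> P k \<and> S p \<inter> S q \<noteq> {}}"
    \<comment> \<open>If the shadow of a later pair meets that of \<open>p\<close>, a common ray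
      joins the two, so the later pair starts within about \<open>n k - \<tau> j\<close> of the
      orbit point at which \<open>p\<close> ends. The upper growth bound allows
      \<open>exp (\<delta> * (n k - \<tau> j))\<close> such starts, exactly what a product of
      measures tolerates.\<close>
    define T where "T p = {\<gamma> \<in> \<Gamma>. dist ((fst p \<circ> snd p) x) (\<gamma> x) \<le> n k - \<tau> j + K4}" for p :: "('a \<Rightarrow> 'a) \<times> ('a \<Rightarrow> 'a)"
    have g0: "0 \<le> n k - \<tau> j" using gap[OF jk] by (simp add: \<tau>_def)
    have Qsub: "Q \<subseteq> Sigma (P j) (\<lambda>p. T p \<times> core_window (s k) V)"
    proof
      fix z assume "z \<in> Q"
      then obtain p q where z: "z = (p, q)" "p \<in> P j" "q \<in> P k" "S p \<inter> S q \<noteq> {}" unfolding Q_def by blast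
      then obtain \<xi> where xi: "\<xi> \<in> S p" "\<xi> \<in> S q" by blast
      then have xb: "\<xi> \<in> boundary" by (simp add: S_def shadow_def)
      obtain r where r: "r \<in> \<xi>" "r 0 = x" "r \<in> geodesic_rays" using ray_from_ex[OF xb] by blast
      have pm: "fst p \<in> short_window (n j) W" "snd p \<in> core_window (s j) V" and qm: "fst q \<in> short_window (n k) W" "snd q \<in> core_window (s k) V"
        using z by (auto simp: P_def)
      have 1: "dist (r (len (fst p \<circ> snd p))) ((fst p \<circ> snd p) x) \<le> R"
        using pair_near(2)[OF pm _ r(1,2) xb] xi(1) by (simp add: S_def)
      have 2: "dist (r (len (fst q))) (fst q x) \<le> 3 * gap_const + R + 4"
        using pair_near(1)[OF qm _ r(1,2) xb] xi(2) by (simp add: S_def)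
      have 3: "dist (r (len (fst p \<circ> snd p))) (r (len (fst q))) = \<bar>len (fst p \<circ> snd p) - len (fst q)\<bar>"
        using ray_dist[OF r(3)] by simp
      have "\<bar>len (fst q) - n k\<bar> \<le> W" using qm(1) by (auto simp: short_window_def abs_le_iff)
      then have "\<bar>len (fst p \<circ> snd p) - len (fst q)\<bar> \<le> n k - \<tau> j + W + K2" using Pl[OF z(2)] g0 by linarith
      then have "dist ((fst p \<circ> snd p) x) (fst q x) \<le> n k - \<tau> j + K4"
        using 1 2 3 dist_triangle[of "(fst p \<circ> snd p) x" "fst q x" "r (len (fst p \<circ> snd p))"]
          dist_triangle[of "r (len (fst p \<circ> snd p))" "fst q x" "r (len (fst q))"]
          dist_commute[of "(fst p \<circ> snd p) x" "r (len (fst p \<circ> snd p))"] unfolding K4_def by linarith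
      then have "fst q \<in> T p" using short_window_mem[OF qm(1)] by (simp add: T_def)
      then show "z \<in> Sigma (P j) (\<lambda>p. T p \<times> core_window (s k) V)" using z(1,2) qm(2) by (cases q) auto
    qed
    have Tf: "finite (T p)" "real (card (T p)) \<le> CN * exp (\<delta> * (n k - \<tau> j + K4))" if p: "p \<in> P j" for p
    proof -
      have G: "fst p \<circ> snd p \<in> \<Gamma>" using Pl[OF p] by blast
      show "finite (T p)" unfolding T_def by (rule card_near_orbit(1)[OF G])
      have "card (T p) \<le> orbit_count (n k - \<tau> j + K4)" unfolding T_def by (rule card_near_orbit(2)[OF G])
      then show "real (card (T p)) \<le> CN * exp (\<delta> * (n k - \<tau> j + K4))"
        using orbit_count_bounds(2)[of "n k - \<tau> j + K4"] g0 K4 by linarith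
    qed
    have finS: "finite (Sigma (P j) (\<lambda>p. T p \<times> core_window (s k) V))" using finP Tf fin_core_window by blast
    have finQ: "finite Q" by (rule finite_subset[OF Qsub finS])
    have "real (card Q) \<le> real (card (Sigma (P j) (\<lambda>p. T p \<times> core_window (s k) V)))" using card_mono[OF finS Qsub] by simp
    also have "\<dots> = (\<Sum>p\<in>P j. real (card (T p)) * b k)"
      using finP Tf fin_core_window by (subst card_SigmaI) (auto simp: card_cartesian_product b_def)
    also have "\<dots> \<le> (\<Sum>p\<in>P j. CN * exp (\<delta> * (n k - \<tau> j + K4)) * b k)"
      using Tf b0 by (intro sum_mono mult_right_mono) auto
    also have "\<dots> = w j * b j * (CN * exp (\<delta> * (n k - \<tau> j + K4)) * b k)"
      by (simp add: P_def card_cartesian_product w_def b_def)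
    finally have cQ: "real (card Q) \<le> w j * b j * (CN * exp (\<delta> * (n k - \<tau> j + K4)) * b k)" .
    have "A j \<inter> A k \<subseteq> (\<Union>z\<in>Q. S (snd z))"
      unfolding A_eq Q_def by force
    then have "measure (\<nu> x) (A j \<inter> A k) \<le> measure (\<nu> x) (\<Union>z\<in>Q. S (snd z))"
      using Ss finQ by (intro nu.finite_measure_mono sets.finite_UN) auto
    also have "\<dots> \<le> (\<Sum>z\<in>Q. measure (\<nu> x) (S (snd z)))"
      using Ss finQ by (intro nu.finite_measure_subadditive_finite) auto
    also have "\<dots> \<le> (\<Sum>z\<in>Q. cu * exp (- \<delta> * \<tau> k))"
      using up by (intro sum_mono) (auto simp: Q_def)
    also have "\<dots> = real (card Q) * (cu * exp (- \<delta> * \<tau> k))" by simp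
    also have "\<dots> \<le> w j * b j * (CN * exp (\<delta> * (n k - \<tau> j + K4)) * b k) * (cu * exp (- \<delta> * \<tau> k))"
      using cQ cu by (intro mult_right_mono) auto
    finally show ?thesis .
  qed
  \<comment> \<open>For the event \<open>j\<close> the bound by the number of its pairs is used, for
    the event \<open>k\<close> the bound in which its short window has been replaced by
    \<open>exp (\<delta> * n k)\<close>; hence the unequal factors \<open>c2\<close> and
    \<open>c2 * c\<close>.\<close>
  define C where "C = CN * exp (\<delta> * K4) * cu / (c2 * (c2 * c))"
  have C: "0 \<le> C" using CN cu c2 c by (simp add: C_def)
  have qi: "measure (\<nu> x) (A j \<inter> A k) \<le> C * measure (\<nu> x) (A j) * measure (\<nu> x) (A k)" if jk: "j < k" for j k
  proof -
    have "w j * b j * (CN * exp (\<delta> * (n k - \<tau> j + K4)) * b k) * (cu * exp (- \<delta> * \<tau> k))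
      = C * ((c2 * (w j * b j) * exp (- \<delta> * \<tau> j)) * (c2 * c * b k * exp (- \<delta> * s k)))"
    proof -
      have e: "exp (\<delta> * (n k - \<tau> j + K4)) * exp (- \<delta> * \<tau> k) = exp (\<delta> * K4) * (exp (- \<delta> * \<tau> j) * exp (- \<delta> * s k))"
        by (simp add: exp_add[symmetric] \<tau>_def algebra_simps)
      have "w j * b j * (CN * exp (\<delta> * (n k - \<tau> j + K4)) * b k) * (cu * exp (- \<delta> * \<tau> k))
        = (exp (\<delta> * (n k - \<tau> j + K4)) * exp (- \<delta> * \<tau> k)) * (w j * b j * CN * b k * cu)" by (simp add: mult_ac)
      also have "\<dots> = (CN * exp (\<delta> * K4) * cu) * ((w j * b j * exp (- \<delta> * \<tau> j)) * (b k * exp (- \<delta> * s k)))"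
        unfolding e by (simp add: mult_ac)
      also have "CN * exp (\<delta> * K4) * cu = C * (c2 * (c2 * c))" using c2 c by (simp add: C_def)
      finally show ?thesis by (simp add: mult_ac)
    qed
    also have "\<dots> \<le> C * (measure (\<nu> x) (A j) * measure (\<nu> x) (A k))"
      using C c2 c b0 w0 by (intro mult_left_mono mult_mono Ame Ame2) auto
    finally show ?thesis using inter[OF jk] by (simp add: mult.assoc)
  qed
  have ns: "\<not> summable (\<lambda>k. measure (\<nu> x) (A k))"
  proof
    assume "summable (\<lambda>k. measure (\<nu> x) (A k))"
    then have "summable (\<lambda>k. c2 * c * b k * exp (- \<delta> * s k))"
      by (rule summable_comparison_test'[where N = 0]) (use Ame2 c2 c b0 in \<open>auto simp: abs_mult\<close>)
    then have "summable (\<lambda>k. (c2 * c) * (b k * exp (- \<delta> * s k)))" by (simp add: mult.assoc)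
    then have "summable (\<lambda>k. b k * exp (- \<delta> * s k))" using c2 c by (subst (asm) summable_cmult_iff) auto
    then show False using dv by (simp add: b_def)
  qed
  have "0 < measure (\<nu> x) (\<Inter>m. \<Union>k\<in>{m..}. A k)"
    by (rule nu.kochen_stone[where A = A and C = C, OF As C _ ns]) (rule qi)
  then show ?thesis unfolding A_def R_def by (rule exI[of _ Rn])
qed

end

section \<open>Deep penetration\<close>

lemma penetration_ge:
  fixes C :: "'a::metric_space set"
  assumes "\<gamma> \<in> \<Gamma>" "a \<le> t" "t \<le> b" "\<And>w. a \<le> w \<Longrightarrow> w \<le> b \<Longrightarrow> l w \<in> \<gamma> ` closed_nbhd e C"
  shows "ereal (b - a) \<le> penetration \<Gamma> C e l t"
proof -
  have mem: "l t \<in> (\<Union>\<gamma>\<in>\<Gamma>. \<gamma> ` closed_nbhd e C)" using assms by blast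
  have sub: "l ` {a..b} \<subseteq> \<gamma> ` closed_nbhd e C" using assms(4) by auto
  have I: "{a..b} \<in> {I. is_interval I \<and> t \<in> I \<and> (\<exists>\<gamma>\<in>\<Gamma>. l ` I \<subseteq> \<gamma> ` closed_nbhd e C)}"
    using assms(1-3) sub is_interval_cc[of a b] by auto
  have "ereal (b - a) = enn2ereal (emeasure lborel {a..b})" using assms(2,3) by (simp add: enn2ereal_ennreal)
  also have "\<dots> \<le> (SUP I \<in> {I. is_interval I \<and> t \<in> I \<and> (\<exists>\<gamma>\<in>\<Gamma>. l ` I \<subseteq> \<gamma> ` closed_nbhd e C)}. enn2ereal (emeasure lborel I))"
    by (rule SUP_upper[OF I])
  finally show ?thesis using mem by (simp add: penetration_def)
qed

context core_pair
begin

text \<open>Quantifying over all lines with this end makes it a property of the end, to which null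
  sets on the boundary apply.\<close>

definition deep :: "real \<Rightarrow> real \<Rightarrow> 'a boundary_pt \<Rightarrow> bool" where
  "deep e \<kappa> \<xi> \<longleftrightarrow> (\<forall>l\<in>geodesic_lines. pos_end l = \<xi> \<longrightarrow>
     (\<forall>T0. \<exists>t\<ge>T0. ereal (\<kappa> * ln t) \<le> penetration \<Gamma> C\<^sub>0 e l t))"

lemma line_fellow_ray:
  assumes l: "l \<in> geodesic_lines" "pos_end l = \<xi>"
  obtains r B where "r \<in> \<xi>" "r 0 = x" "r \<in> geodesic_rays" "0 \<le> B" "\<And>t. 0 \<le> t \<Longrightarrow> dist (l t) (r t) \<le> B"
proof -
  have \<xi>: "\<xi> \<in> boundary" "l \<in> \<xi>" using pos_end_boundary[OF l(1)] l(2) by auto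
  obtain r where r: "r \<in> \<xi>" "r 0 = x" "r \<in> geodesic_rays" using ray_from_ex[OF \<xi>(1)] by blast
  obtain B where B: "\<And>t. 0 \<le> t \<Longrightarrow> dist (l t) (r t) \<le> B"
    using boundary_asymptotic[OF \<xi> r(1)] by (auto simp: asymptotic_def)
  moreover have "0 \<le> B" using B[of 0] zero_le_dist order_trans by blast
  ultimately show ?thesis using that r by blast
qed

text \<open>At times \<open>n k\<close> and \<open>n k + s k\<close> the line is at bounded distance
  from two points of the same translate of the core, so by \<open>convex_nbhd\<close> it is
  \<open>e\<close>-close to that translate in between, up to \<open>T\<close> at both ends.
  \<open>T\<close> depends on the line but not on \<open>k\<close>.\<close>

lemma events_imp_penetration:
  fixes n s :: "nat \<Rightarrow> real"
  assumes e: "0 < e" and W: "0 \<le> W" and V: "0 \<le> V" and n0: "\<And>k. 0 \<le> n k" and s0: "\<And>k. 0 \<le> s k"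
    and sinf: "filterlim s at_top sequentially"
    and \<xi>: "\<xi> \<in> (\<Inter>m. \<Union>k\<in>{m..}. spiral_event (n k) W (s k) V R)"
    and l: "l \<in> geodesic_lines" "pos_end l = \<xi>"
  shows "\<exists>T\<ge>0. \<forall>m. \<exists>k\<ge>m. ereal (s k - 2 * T) \<le> penetration \<Gamma> C\<^sub>0 e l (n k + T)"
proof -
  have \<xi>b: "\<xi> \<in> boundary" using pos_end_boundary[OF l(1)] l(2) by simp
  obtain r B where r: "r \<in> \<xi>" "r 0 = x" "r \<in> geodesic_rays" and B: "0 \<le> B" "\<And>t. 0 \<le> t \<Longrightarrow> dist (l t) (r t) \<le> B"
    by (rule line_fellow_ray[OF l]) (rule that)
  define B' where "B' = B + (W + V + gap_const) + (3 * gap_const + \<bar>R\<bar> + 4)"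
  obtain T where T: "0 \<le> T" and Tc:
    "\<And>(C::'a set) p q a a' b w. geodesically_convex C \<Longrightarrow> geodesic_segment b p q \<Longrightarrow> a \<in> C \<Longrightarrow> a' \<in> C \<Longrightarrow>
       dist p a \<le> B' \<Longrightarrow> dist q a' \<le> B' \<Longrightarrow> T \<le> w \<Longrightarrow> w + T \<le> dist p q \<Longrightarrow> infdist (b w) C \<le> e"
    by (rule convex_nbhd[OF e, of B']) blast
  have "\<exists>k\<ge>m. ereal (s k - 2 * T) \<le> penetration \<Gamma> C\<^sub>0 e l (n k + T)" for m
  proof -
    have "eventually (\<lambda>k. 2 * T \<le> s k) sequentially" using sinf by (simp add: filterlim_at_top)
    then obtain m' where m': "\<And>k. m' \<le> k \<Longrightarrow> 2 * T \<le> s k" by (auto simp: eventually_sequentially)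
    obtain k where k: "max m m' \<le> k" "\<xi> \<in> spiral_event (n k) W (s k) V R" using \<xi> by blast
    then have sk: "2 * T \<le> s k" using m' by simp
    obtain \<gamma> h where gh: "\<gamma> \<in> short_window (n k) W" "h \<in> core_window (s k) V" "\<xi> \<in> shadow x ((\<gamma> \<circ> h) x) R"
      using k(2) by (auto simp: spiral_event_def)
    have G: "\<gamma> \<in> \<Gamma>" and H: "h \<in> \<Gamma>\<^sub>0" using gh short_window_mem by (auto simp: core_window_def)
    note near = pair_near[OF gh(1,2,3) r(1,2) \<xi>b]
    define u where "u = n k"
    define v where "v = n k + s k"
    have uv: "0 \<le> u" "u \<le> v" "0 \<le> v" using n0[of k] s0[of k] by (auto simp: u_def v_def)
    have "\<bar>u - len \<gamma>\<bar> \<le> W" using gh(1) by (auto simp: short_window_def u_def abs_le_iff)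
    then have "dist (r u) (r (len \<gamma>)) \<le> W" using ray_dist[OF r(3) uv(1), of "len \<gamma>"] by simp
    then have "dist (l u) (\<gamma> x) \<le> B + W + (3 * gap_const + R + 4)"
      using near(1) B(2)[OF uv(1)] dist_triangle[of "l u" "\<gamma> x" "r u"] dist_triangle[of "r u" "\<gamma> x" "r (len \<gamma>)"] by linarith
    then have du: "dist (l u) (\<gamma> x) \<le> B'" using V gap_const_pos by (simp add: B'_def)
    have "\<bar>v - len (\<gamma> \<circ> h)\<bar> \<le> W + V + gap_const" using pair_len(1)[OF gh(1,2)] by (simp add: v_def abs_minus_commute)
    then have "dist (r v) (r (len (\<gamma> \<circ> h))) \<le> W + V + gap_const" using ray_dist[OF r(3) uv(3), of "len (\<gamma> \<circ> h)"] by simp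
    then have "dist (l v) (\<gamma> (h x)) \<le> B + (W + V + gap_const) + R"
      using near(2) B(2)[OF uv(3)] dist_triangle[of "l v" "(\<gamma> \<circ> h) x" "r v"] dist_triangle[of "r v" "(\<gamma> \<circ> h) x" "r (len (\<gamma> \<circ> h))"] by simp
    then have dv: "dist (l v) (\<gamma> (h x)) \<le> B'" using gap_const_pos by (simp add: B'_def)
    have seg: "geodesic_segment (ginv \<gamma> \<circ> (\<lambda>t. l (u + t))) (ginv \<gamma> (l u)) (ginv \<gamma> (l v))"
      by (rule act_seg[OF act_inv[OF G] line_seg[OF l(1) uv(2)]])
    have dd: "dist (ginv \<gamma> (l u)) (ginv \<gamma> (l v)) = v - u"
      using act_carrier(2)[OF act_inv[OF G]] l(1) uv(2) by (simp add: geodesic_lines_def)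
    have inf: "infdist (ginv \<gamma> (l (u + w))) C\<^sub>0 \<le> e" if "T \<le> w" "w + T \<le> v - u" for w
      using Tc[OF core_convex seg x_core core_inv[OF H x_core], of w] that dd du dv by (simp add: dist_ginv[OF G])
    have "ereal ((v - T) - (u + T)) \<le> penetration \<Gamma> C\<^sub>0 e l (u + T)"
    proof (rule penetration_ge[OF G])
      fix w assume w: "u + T \<le> w" "w \<le> v - T"
      have "ginv \<gamma> (l w) \<in> closed_nbhd e C\<^sub>0" using inf[of "w - u"] w by (simp add: closed_nbhd_def)
      moreover have "l w = \<gamma> (ginv \<gamma> (l w))" using G by simp
      ultimately show "l w \<in> \<gamma> ` closed_nbhd e C\<^sub>0" by blast
    qed (use sk in \<open>auto simp: u_def v_def\<close>)
    then have "ereal (s k - 2 * T) \<le> penetration \<Gamma> C\<^sub>0 e l (n k + T)" by (simp add: u_def v_def algebra_simps)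
    then show ?thesis using k(1) by (intro exI[of _ k]) auto
  qed
  then show ?thesis using T by blast
qed

end

text \<open>As \<eta> tends to 0 the required inequality becomes \<open>\<kappa> < 1 / d\<close>,
  which is strict.\<close>

lemma log_choice:
  assumes \<kappa>: "0 < \<kappa>" "\<kappa> * d < 1" and d: "0 < (d::real)"
  obtains \<eta> where "0 < \<eta>" "\<eta> < 1" "\<kappa> * (1 + \<eta>) < (1 - \<eta>) * (1 / (d + \<eta>))"
proof -
  have "((\<lambda>\<eta>. (1 - \<eta>) * (1 / (d + \<eta>)) - \<kappa> * (1 + \<eta>)) \<longlongrightarrow> (1 - 0) * (1 / (d + 0)) - \<kappa> * (1 + 0)) (at_right 0)"
    using d by (intro tendsto_intros) auto
  moreover have "(1 - 0) * (1 / (d + 0)) - \<kappa> * (1 + 0) > 0" using \<kappa> d by (simp add: field_simps)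
  ultimately have "eventually (\<lambda>\<eta>. 0 < (1 - \<eta>) * (1 / (d + \<eta>)) - \<kappa> * (1 + \<eta>)) (at_right 0)"
    by (rule order_tendstoD(1))
  moreover have "eventually (\<lambda>\<eta>::real. \<eta> \<in> {0<..<1}) (at_right 0)" by (rule eventually_at_right_real) simp
  ultimately have "eventually (\<lambda>\<eta>. 0 < (1 - \<eta>) * (1 / (d + \<eta>)) - \<kappa> * (1 + \<eta>) \<and> \<eta> \<in> {0<..<1}) (at_right 0)"
    by (rule eventually_conj)
  from eventually_happens[OF this] show ?thesis using that by auto
qed

context core_pair
begin

text \<open>The set has to be fixed before the density is known: it will be tested against a density
  living on the complement of its own saturation.\<close>

lemma deep_set:
  assumes e: "0 < e" and \<kappa>: "0 < \<kappa>" "\<kappa> * (\<delta> - \<delta>\<^sub>0) < 1"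
  shows "\<exists>E\<in>sets boundary_borel. (\<forall>\<xi>\<in>E. deep e \<kappa> \<xi>) \<and>
    (\<forall>\<nu>. conformal_pair type_tag \<Gamma> \<Gamma>\<^sub>0 x \<delta> \<delta>\<^sub>0 cN CN D C\<^sub>0 l\<^sub>0 \<nu> \<longrightarrow> 0 < measure (\<nu> x) E)"
proof -
  obtain \<eta> where \<eta>: "0 < \<eta>" "\<eta> < 1" "\<kappa> * (1 + \<eta>) < (1 - \<eta>) * (1 / (\<delta> - \<delta>\<^sub>0 + \<eta>))"
    using log_choice[OF \<kappa>] critical_gap by auto
  \<comment> \<open>With durations \<open>\<theta> * ln u\<close> the lower bound \<open>exp
    ((\<delta>\<^sub>0 - \<eta>) * \<sigma> - \<delta> * \<sigma>)\<close> for the size of an event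
    is exactly \<open>1 / u\<close>, on the divergent side of the harmonic series.\<close>
  define \<theta> where "\<theta> = 1 / (\<delta> - \<delta>\<^sub>0 + \<eta>)"
  have \<theta>: "0 < \<theta>" "\<theta> * (\<delta> - \<delta>\<^sub>0 + \<eta>) = 1" using critical_gap \<eta> by (auto simp: \<theta>_def)
  obtain W c where W: "0 < W" "0 < c" "\<And>R. 0 \<le> R \<Longrightarrow> c * exp (\<delta> * R) \<le> real (card (short_window R W))"
    using minimal_window unfolding short_window_def by auto
  obtain V s1 where V: "0 < V" and s1: "\<And>s. s1 \<le> s \<Longrightarrow> \<exists>s'. (1 - \<eta>) * s \<le> s' \<and> s' \<le> s \<and>
     exp ((\<delta>\<^sub>0 - \<eta>) * s) \<le> real (card (core_window s' V))"
    using window0[OF \<eta>(1,2)] unfolding core_window_def by auto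
  have "eventually (\<lambda>u. \<theta> * ln u \<le> u powr \<eta>) at_top"
    using \<eta> \<theta> by real_asymp
  moreover have "eventually (\<lambda>u. max s1 0 \<le> \<theta> * ln u) at_top"
  proof -
    have "filterlim (\<lambda>u. \<theta> * ln u) at_top at_top" using \<theta> by real_asymp
    then show ?thesis unfolding filterlim_at_top by blast
  qed
  ultimately have "eventually (\<lambda>u. \<theta> * ln u \<le> u powr \<eta> \<and> max s1 0 \<le> \<theta> * ln u) at_top" by (rule eventually_conj)
  then obtain U where U: "\<And>u. U \<le> u \<Longrightarrow> \<theta> * ln u \<le> u powr \<eta> \<and> max s1 0 \<le> \<theta> * ln u"
    by (auto simp: eventually_at_top_linorder)
  obtain k0 :: nat where k0: "max 1 U \<le> real k0" using real_arch_simple by blast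
  define u where "u k = real (k + k0)" for k
  have u1: "1 \<le> u k" "U \<le> u k" for k using k0 by (auto simp: u_def)
  define \<sigma> where "\<sigma> k = \<theta> * ln (u k)" for k
  have \<sigma>: "s1 \<le> \<sigma> k" "0 \<le> \<sigma> k" "\<sigma> k \<le> u k powr \<eta>" for k using U[OF u1(2)[of k]] by (auto simp: \<sigma>_def)
  \<comment> \<open>Consecutive times differ by at least \<open>u k powr \<eta>\<close>, which
    leaves room for the logarithmic durations, while
    \<open>ln (n k) = (1 + \<eta>) * ln (u k)\<close> costs only a factor \<open>1 + \<eta>\<close>
    in the final ratio.\<close>
  define n where "n k = u k powr (1 + \<eta>)" for k
  have n0: "0 \<le> n k" for k by (simp add: n_def)
  have "\<forall>k. \<exists>s'. (1 - \<eta>) * \<sigma> k \<le> s' \<and> s' \<le> \<sigma> k \<and> exp ((\<delta>\<^sub>0 - \<eta>) * \<sigma> k) \<le> real (card (core_window s' V))"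
    using s1[OF \<sigma>(1)] by blast
  then obtain s where s: "\<And>k. (1 - \<eta>) * \<sigma> k \<le> s k" "\<And>k. s k \<le> \<sigma> k" "\<And>k. exp ((\<delta>\<^sub>0 - \<eta>) * \<sigma> k) \<le> real (card (core_window (s k) V))"
    by metis
  have s0: "0 \<le> s k" for k
  proof -
    have "0 \<le> (1 - \<eta>) * \<sigma> k" using \<eta> \<sigma>(2) by simp
    then show ?thesis using s(1)[of k] by linarith
  qed
  have step: "n k + s k \<le> n (Suc k)" for k
  proof -
    have "n k + s k \<le> u k powr (1 + \<eta>) + u k powr \<eta>" using s(2)[of k] \<sigma>(3)[of k] by (simp add: n_def)
    also have "\<dots> = (u k + 1) * u k powr \<eta>" using u1(1)[of k] by (simp add: powr_add algebra_simps)
    also have "\<dots> \<le> (u k + 1) * (u k + 1) powr \<eta>"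
      using u1(1)[of k] \<eta> by (intro mult_left_mono powr_mono2) auto
    also have "\<dots> = (u k + 1) powr (1 + \<eta>)" using u1(1)[of k] by (simp add: powr_add)
    also have "u k + 1 = u (Suc k)" by (simp add: u_def)
    finally show ?thesis by (simp add: n_def)
  qed
  have "n k \<le> n (Suc k)" for k using step[of k] s0[of k] by linarith
  then have nmono: "n j \<le> n k" if "j \<le> k" for j k
    using that by (rule lift_Suc_mono_le)
  have gap: "n j + s j \<le> n k" if "j < k" for j k
    using step[of j] nmono[of "Suc j" k] that by auto
  have ulim: "filterlim u at_top sequentially"
    unfolding u_def by real_asymp
  have \<sigma>lim: "filterlim \<sigma> at_top sequentially"
    unfolding \<sigma>_def using \<theta>
    by (intro filterlim_tendsto_pos_mult_at_top[OF tendsto_const] filterlim_compose[OF ln_at_top ulim]) auto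
  have slim: "filterlim s at_top sequentially"
  proof (rule filterlim_at_top_mono)
    show "filterlim (\<lambda>k. (1 - \<eta>) * \<sigma> k) at_top sequentially"
      using \<eta> by (intro filterlim_tendsto_pos_mult_at_top[OF tendsto_const _ \<sigma>lim]) auto
  qed (use s in auto)
  have dv: "\<not> summable (\<lambda>k. real (card (core_window (s k) V)) * exp (- \<delta> * s k))"
  proof
    assume sm: "summable (\<lambda>k. real (card (core_window (s k) V)) * exp (- \<delta> * s k))"
    have "inverse (u k) \<le> real (card (core_window (s k) V)) * exp (- \<delta> * s k)" for k
    proof -
      have "inverse (u k) = exp (- ln (u k))" using u1(1)[of k] by (simp add: exp_minus)
      also have "- ln (u k) = (\<delta>\<^sub>0 - \<eta>) * \<sigma> k + (- \<delta> * \<sigma> k)"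
      proof -
        have "(\<delta>\<^sub>0 - \<eta>) * \<sigma> k + (- \<delta> * \<sigma> k) = - (\<theta> * (\<delta> - \<delta>\<^sub>0 + \<eta>)) * ln (u k)" by (simp add: \<sigma>_def algebra_simps)
        then show ?thesis using \<theta>(2) by simp
      qed
      also have "exp \<dots> = exp ((\<delta>\<^sub>0 - \<eta>) * \<sigma> k) * exp (- \<delta> * \<sigma> k)" by (rule exp_add)
      also have "\<dots> \<le> real (card (core_window (s k) V)) * exp (- \<delta> * s k)"
        using s(2,3)[of k] d_nonneg by (intro mult_mono) (auto intro: mult_left_mono)
      finally show ?thesis .
    qed
    moreover have "norm (inverse (u k)) = inverse (u k)" for k using u1(1)[of k] by simp
    ultimately have "summable (\<lambda>k. inverse (u k))"
      by (intro summable_comparison_test'[OF sm, of 0]) simp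
    then have "summable (\<lambda>k. inverse (real k))"
      unfolding u_def by (subst (asm) summable_iff_shift[of "\<lambda>k. inverse (real k)"])
    then show False using not_summable_harmonic[where 'a = real] by simp
  qed
  define E where "E = (\<Union>R::nat. \<Inter>m. \<Union>k\<in>{m..}. spiral_event (n k) W (s k) V (real R))"
  have "E \<in> sets boundary_borel"
    unfolding E_def using spiral_event_sets by (intro sets.countable_UN sets.countable_INT image_subsetI sets.countable_UN') auto
  moreover have "deep e \<kappa> \<xi>" if xE: "\<xi> \<in> E" for \<xi>
    unfolding deep_def
  proof (intro ballI impI allI)
    fix l T0 assume l: "l \<in> geodesic_lines" "pos_end l = \<xi>"
    obtain R :: nat where R: "\<xi> \<in> (\<Inter>m. \<Union>k\<in>{m..}. spiral_event (n k) W (s k) V (real R))" using xE unfolding E_def by (elim UN_E)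
    obtain T where T: "0 \<le> T" "\<forall>m. \<exists>k\<ge>m. ereal (s k - 2 * T) \<le> penetration \<Gamma> C\<^sub>0 e l (n k + T)"
      using events_imp_penetration[OF e less_imp_le[OF W(1)] less_imp_le[OF V] n0 s0 slim R l] by (elim exE conjE)
    \<comment> \<open>The strict inequality behind \<eta> leaves a positive multiple of
      \<open>ln (u k)\<close>; beyond \<open>exp Z\<close> it absorbs
      \<open>\<kappa> * ln 2\<close>, from \<open>n k + T \<le> 2 * n k\<close>, and the time
      \<open>2 * T\<close> lost at the ends.\<close>
    define Z where "Z = (\<kappa> * ln 2 + 2 * T) / ((1 - \<eta>) * \<theta> - \<kappa> * (1 + \<eta>))"
    have pos: "0 < (1 - \<eta>) * \<theta> - \<kappa> * (1 + \<eta>)" using \<eta>(3) by (simp add: \<theta>_def)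
    have "eventually (\<lambda>k. max (max T T0) (exp Z) \<le> u k) sequentially" using ulim unfolding filterlim_at_top by blast
    then obtain m where m: "\<And>k::nat. m \<le> k \<Longrightarrow> max (max T T0) (exp Z) \<le> u k" by (auto simp: eventually_sequentially)
    obtain k where k: "m \<le> k" "ereal (s k - 2 * T) \<le> penetration \<Gamma> C\<^sub>0 e l (n k + T)" using T(2)[rule_format, of m] by (elim exE conjE)
    have uk: "T \<le> u k" "T0 \<le> u k" "exp Z \<le> u k" using m[OF k(1)] by auto
    have nu: "u k \<le> n k"
    proof -
      have "u k powr 1 \<le> u k powr (1 + \<eta>)" using u1(1)[of k] \<eta> by (intro powr_mono) auto
      then show ?thesis using u1(1)[of k] by (simp add: n_def)
    qed
    have "Z \<le> ln (u k)" using uk(3) u1(1)[of k] by (subst ln_ge_iff) auto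
    then have "\<kappa> * ln 2 + 2 * T \<le> ln (u k) * ((1 - \<eta>) * \<theta> - \<kappa> * (1 + \<eta>))"
      using pos by (simp add: Z_def pos_divide_le_eq)
    then have a: "\<kappa> * (ln 2 + (1 + \<eta>) * ln (u k)) \<le> (1 - \<eta>) * \<sigma> k - 2 * T" by (simp add: \<sigma>_def algebra_simps)
    have "ln (n k + T) \<le> ln (2 * n k)"
      using uk nu u1(1)[of k] T(1) by (intro ln_mono) auto
    also have "\<dots> = ln 2 + (1 + \<eta>) * ln (u k)" using u1(1)[of k] by (simp add: n_def ln_mult ln_powr)
    finally have "\<kappa> * ln (n k + T) \<le> s k - 2 * T"
      using a s(1)[of k] \<kappa>(1) by (meson diff_right_mono mult_left_mono less_imp_le order_trans)
    then have "ereal (\<kappa> * ln (n k + T)) \<le> penetration \<Gamma> C\<^sub>0 e l (n k + T)" using k(2) by (meson ereal_less_eq(3) order_trans)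
    then show "\<exists>t\<ge>T0. ereal (\<kappa> * ln t) \<le> penetration \<Gamma> C\<^sub>0 e l t"
      using uk nu T(1) by (intro exI[of _ "n k + T"]) auto
  qed
  moreover have "0 < measure (\<nu> x) E" if cp: "conformal_pair type_tag \<Gamma> \<Gamma>\<^sub>0 x \<delta> \<delta>\<^sub>0 cN CN D C\<^sub>0 l\<^sub>0 \<nu>" for \<nu>
  proof -
    interpret cp: conformal_pair type_tag \<Gamma> \<Gamma>\<^sub>0 x \<delta> \<delta>\<^sub>0 cN CN D C\<^sub>0 l\<^sub>0 \<nu> by (rule cp)
    have "\<exists>R::nat. 0 < measure (\<nu> x) (\<Inter>m. \<Union>k\<in>{m..}. spiral_event (n k) W (s k) V (real R))"
    proof (rule cp.spiral_event_limsup_positive[OF W(1,2) _ less_imp_le[OF V] n0 s0 _ dv])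
      show "c * exp (\<delta> * R) \<le> real (card (short_window R W))" if "0 \<le> R" for R using W(3)[OF that] .
      show "n j + s j \<le> n k" if "j < k" for j k using gap[OF that] .
    qed
    then obtain R :: nat where R: "0 < measure (\<nu> x) (\<Inter>m. \<Union>k\<in>{m..}. spiral_event (n k) W (s k) V (real R))"
      by (elim exE)
    note R
    also have "\<dots> \<le> measure (\<nu> x) E"
      by (rule cp.nu_mono) (use \<open>E \<in> sets boundary_borel\<close> in \<open>auto simp: E_def\<close>)
    finally show ?thesis .
  qed
  ultimately show ?thesis by blast
qed

end

section \<open>Bounded penetration\<close>

text \<open>An interval longer than \<open>L\<close> has two points more than \<open>L\<close>
  apart, since otherwise it would fit into \<open>{Inf I..Inf I + L}\<close>. Between them and
  \<open>t\<close> a window of length \<open>L\<close> around \<open>t\<close> can be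
  placed.\<close>

lemma interval_contains_length:
  fixes I :: "real set"
  assumes I: "is_interval I" "t \<in> I" and L: "0 \<le> L" "ereal L < enn2ereal (emeasure lborel I)"
  obtains u where "u \<le> t" "t \<le> u + L" "{u..u + L} \<subseteq> I"
proof -
  have "\<exists>a\<in>I. \<exists>b\<in>I. L < b - a"
  proof (rule ccontr)
    assume "\<not> ?thesis"
    then have n: "\<And>a b. a \<in> I \<Longrightarrow> b \<in> I \<Longrightarrow> b - a \<le> L" by (auto simp: not_less)
    have bdd: "bdd_below I" using n[OF _ I(2)] by (intro bdd_belowI[of _ "t - L"]) (auto simp: algebra_simps)
    have "I \<subseteq> {Inf I..Inf I + L}"
    proof
      fix z assume z: "z \<in> I"
      have "z - L \<le> Inf I" using I(2) n[OF _ z] by (intro cInf_greatest) (auto simp: algebra_simps)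
      then show "z \<in> {Inf I..Inf I + L}" using cInf_lower[OF z bdd] by auto
    qed
    then have "emeasure lborel I \<le> emeasure lborel {Inf I..Inf I + L}" by (intro emeasure_mono) auto
    also have "\<dots> = ennreal L" using L(1) by simp
    finally have "enn2ereal (emeasure lborel I) \<le> enn2ereal (ennreal L)" by (simp add: less_eq_ennreal.rep_eq)
    then show False using L by (simp add: enn2ereal_ennreal)
  qed
  then obtain a b where ab: "a \<in> I" "b \<in> I" "L < b - a" by blast
  define a' b' where "a' = min a t" and "b' = max b t"
  have ab': "a' \<in> I" "b' \<in> I" "L < b' - a'" "a' \<le> t" "t \<le> b'"
    using ab I(2) by (auto simp: a'_def b'_def min_def max_def)
  \<comment> \<open>The leftmost admissible start of the window.\<close>
  define u where "u = max a' (t - L)"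
  have u: "u \<le> t" "t \<le> u + L" "a' \<le> u" "u + L \<le> b'" using ab' L(1) by (auto simp: u_def)
  have "{u..u + L} \<subseteq> I"
  proof
    fix z assume "z \<in> {u..u + L}"
    then have "a' \<le> z" "z \<le> b'" using u by auto
    then show "z \<in> I" using I(1) ab' unfolding is_interval_1 by blast
  qed
  then show ?thesis using that u by blast
qed

section \<open>Invariance under the group, and depth of almost every end\<close>

context isom_action
begin

lemma boundary_map_measurable:
  assumes g: "\<gamma> \<in> \<Gamma>"
  shows "boundary_map \<gamma> \<in> measurable boundary_borel boundary_borel"
proof -
  have "boundary_map \<gamma> -` V \<inter> space boundary_borel \<in> sets boundary_borel" if V: "V \<in> {U. openin boundary_topology U}" for V
  proof -
    obtain Wo where W: "openin cone_topology Wo" "V = Inr -` Wo \<inter> boundary"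
      using V by (auto simp: boundary_topology_def openin_pullback_topology)
    have "openin cone_topology {z \<in> topspace cone_topology. map_sum \<gamma> (boundary_map \<gamma>) z \<in> Wo}"
      by (rule openin_continuous_map_preimage[OF continuous_map_cone_act[OF g] W(1)])
    moreover have "boundary_map \<gamma> -` V \<inter> boundary = Inr -` {z \<in> topspace cone_topology. map_sum \<gamma> (boundary_map \<gamma>) z \<in> Wo} \<inter> boundary"
      unfolding W(2) topspace_cone using boundary_map_boundary[OF g] by auto
    ultimately have "openin boundary_topology (boundary_map \<gamma> -` V \<inter> boundary)"
      unfolding boundary_topology_def openin_pullback_topology by blast
    then show ?thesis unfolding space_boundary_borel by (rule open_in_boundary_borel)
  qed
  then show ?thesis
    unfolding boundary_borel_def
    by (intro measurable_measure_of) (use openin_boundary_subset boundary_map_boundary[OF g] in \<open>auto simp: space_boundary_borel[unfolded boundary_borel_def] boundary_borel_def\<close>)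
qed

lemma penetration_act:
  assumes g: "\<gamma> \<in> \<Gamma>"
  shows "penetration \<Gamma> C e (\<gamma> \<circ> l) t = penetration \<Gamma> C e l t"
proof -
  define K where "K = closed_nbhd e C"
  have imp: "\<exists>\<gamma>'\<in>\<Gamma>. (g \<circ> m) ` I \<subseteq> \<gamma>' ` K" if gm: "g \<in> \<Gamma>" "\<exists>\<gamma>'\<in>\<Gamma>. m ` I \<subseteq> \<gamma>' ` K" for g I and m :: "real \<Rightarrow> 'a"
  proof -
    obtain \<gamma>' where "\<gamma>' \<in> \<Gamma>" "m ` I \<subseteq> \<gamma>' ` K" using gm(2) by blast
    then have "g \<circ> \<gamma>' \<in> \<Gamma>" "(g \<circ> m) ` I \<subseteq> (g \<circ> \<gamma>') ` K" using act_comp[OF gm(1)] by (auto simp: image_comp[symmetric])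
    then show ?thesis by blast
  qed
  have bk: "ginv \<gamma> \<circ> (\<gamma> \<circ> l) = l" using g by (simp flip: comp_assoc)
  have eq: "(\<exists>\<gamma>'\<in>\<Gamma>. (\<gamma> \<circ> l) ` I \<subseteq> \<gamma>' ` K) \<longleftrightarrow> (\<exists>\<gamma>'\<in>\<Gamma>. l ` I \<subseteq> \<gamma>' ` K)" for I
    using imp[OF g, of l I] imp[OF act_inv[OF g], of "\<gamma> \<circ> l" I] unfolding bk by blast
  have "(\<gamma> \<circ> l) t \<in> (\<Union>\<gamma>'\<in>\<Gamma>. \<gamma>' ` K) \<longleftrightarrow> l t \<in> (\<Union>\<gamma>'\<in>\<Gamma>. \<gamma>' ` K)"
    using eq[of "{t}"] by auto
  then show ?thesis unfolding penetration_def K_def[symmetric] eq by simp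
qed

end

context core_pair
begin

lemma countable_group: "countable \<Gamma>"
proof -
  have "\<Gamma> = (\<Union>n::nat. {\<gamma> \<in> \<Gamma>. len \<gamma> \<le> real n})" using real_arch_simple by auto
  moreover have "countable (\<Union>n::nat. {\<gamma> \<in> \<Gamma>. len \<gamma> \<le> real n})"
    by (rule countable_UN, simp, rule countable_finite, rule fin_ball(1))
  ultimately show ?thesis by simp
qed

lemma deep_act:
  assumes g: "\<gamma> \<in> \<Gamma>" and deep: "deep e \<kappa> (boundary_map \<gamma> \<xi>)"
  shows "deep e \<kappa> \<xi>"
  unfolding deep_def
proof (intro ballI impI allI)
  fix l T0 assume l: "l \<in> geodesic_lines" "pos_end l = \<xi>"
  have "\<exists>t\<ge>T0. ereal (\<kappa> * ln t) \<le> penetration \<Gamma> C\<^sub>0 e (\<gamma> \<circ> l) t"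
    using deep act_line[OF g l(1)] pos_end_act(1)[OF g l(1)] l(2) unfolding deep_def by blast
  then show "\<exists>t\<ge>T0. ereal (\<kappa> * ln t) \<le> penetration \<Gamma> C\<^sub>0 e l t" unfolding penetration_act[OF g] .
qed

end

context conformal_pair
begin

text \<open>Restricting \<open>\<nu>\<close> to an invariant set gives another conformal density. This replaces ergodicity: the
  complement of the saturation of the set \<open>E\<close> of \<open>deep_set\<close> cannot carry such a density.\<close>

lemma deep_AE:
  assumes e: "0 < e" and \<kappa>: "0 < \<kappa>" "\<kappa> * (\<delta> - \<delta>\<^sub>0) < 1"
  shows "AE \<xi> in \<nu> x. deep e \<kappa> \<xi>"
proof -
  obtain E where E: "E \<in> sets boundary_borel" "\<And>\<xi>. \<xi> \<in> E \<Longrightarrow> deep e \<kappa> \<xi>"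
    and Epos: "\<And>\<nu>. conformal_pair type_tag \<Gamma> \<Gamma>\<^sub>0 x \<delta> \<delta>\<^sub>0 cN CN D C\<^sub>0 l\<^sub>0 \<nu> \<Longrightarrow> 0 < measure (\<nu> x) E"
    using deep_set[OF e \<kappa>] by auto
  define Sat where "Sat = (\<Union>\<gamma>\<in>\<Gamma>. boundary_map \<gamma> -` E \<inter> boundary)"
  have Sat_sets: "Sat \<in> sets boundary_borel"
    unfolding Sat_def
  proof (intro sets.countable_UN' countable_group image_subsetI)
    fix \<gamma> assume "\<gamma> \<in> \<Gamma>"
    then show "boundary_map \<gamma> -` E \<inter> boundary \<in> sets boundary_borel"
      using measurable_sets[OF boundary_map_measurable E(1)] by (simp add: space_boundary_borel)
  qed
  define F where "F = boundary - Sat"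
  have Fs: "F \<in> sets boundary_borel" unfolding F_def using boundary_sets Sat_sets by blast
  have Sat_inv: "boundary_map \<gamma> \<xi> \<in> Sat \<longleftrightarrow> \<xi> \<in> Sat" if g: "\<gamma> \<in> \<Gamma>" and \<xi>: "\<xi> \<in> boundary" for \<gamma> \<xi>
  proof
    assume "boundary_map \<gamma> \<xi> \<in> Sat"
    then obtain \<gamma>' where "\<gamma>' \<in> \<Gamma>" "boundary_map (\<gamma>' \<circ> \<gamma>) \<xi> \<in> E" by (auto simp: Sat_def boundary_map_comp)
    then show "\<xi> \<in> Sat" using act_comp[OF _ g] \<xi> by (auto simp: Sat_def)
  next
    assume "\<xi> \<in> Sat"
    then obtain \<gamma>' where g': "\<gamma>' \<in> \<Gamma>" "boundary_map \<gamma>' \<xi> \<in> E" by (auto simp: Sat_def)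
    have "\<gamma>' \<circ> ginv \<gamma> \<circ> \<gamma> = \<gamma>'" using g by (simp add: comp_assoc)
    then have "boundary_map (\<gamma>' \<circ> ginv \<gamma>) (boundary_map \<gamma> \<xi>) \<in> E" using g' by (simp add: boundary_map_comp)
    then show "boundary_map \<gamma> \<xi> \<in> Sat" using act_comp[OF g'(1) act_inv[OF g]] boundary_map_boundary[OF g \<xi>] by (auto simp: Sat_def)
  qed
  have F_inv: "boundary_map \<gamma> -` F \<inter> boundary = F" if g: "\<gamma> \<in> \<Gamma>" for \<gamma>
    using Sat_inv[OF g] boundary_map_boundary[OF g] by (auto simp: F_def)
  have F0: "measure (\<nu> x) F = 0"
  proof (rule ccontr)
    assume "measure (\<nu> x) F \<noteq> 0"
    then have Fpos: "0 < measure (\<nu> x) F" using measure_nonneg[of "\<nu> x" F] by linarith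
    define \<nu>' where "\<nu>' y = density (\<nu> y) (indicator F)" for y
    have ms: "measure (\<nu>' y) A = measure (\<nu> y) (F \<inter> A)" if "A \<in> sets boundary_borel" for y A
      using emeasure_restricted[of F "\<nu> y" A] Fs that by (simp add: \<nu>'_def measure_def sets_nu)
    have cp: "conformal_pair type_tag \<Gamma> \<Gamma>\<^sub>0 x \<delta> \<delta>\<^sub>0 cN CN D C\<^sub>0 l\<^sub>0 \<nu>'"
    proof (intro conformal_pair.intro core_pair_axioms conformal_pair_axioms.intro)
      show "sets (\<nu>' y) = sets boundary_borel" for y by (simp add: \<nu>'_def sets_nu)
      show "finite_measure (\<nu>' y)" for y
      proof (rule finite_measureI)
        interpret y: finite_measure "\<nu> y" by (rule fin_nu)
        have "emeasure (\<nu>' y) (space (\<nu>' y)) = emeasure (\<nu> y) (F \<inter> space (\<nu> y))"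
          unfolding \<nu>'_def using Fs by (subst emeasure_restricted) (auto simp: sets_nu sets.top[of "\<nu> y", unfolded sets_nu])
        then show "emeasure (\<nu>' y) (space (\<nu>' y)) \<noteq> \<infinity>" by simp
      qed
      have "F \<inter> boundary = F" by (auto simp: F_def)
      then show "0 < measure (\<nu>' x) boundary" using Fpos ms[OF boundary_sets] by simp
    next
      fix \<gamma> y and A :: "'a boundary_pt set" assume g: "\<gamma> \<in> \<Gamma>" and A: "A \<in> sets boundary_borel"
      have pre: "boundary_map \<gamma> -` A \<inter> boundary \<in> sets boundary_borel"
        using measurable_sets[OF boundary_map_measurable[OF g] A] by (simp add: space_boundary_borel)
      have "measure (\<nu>' (\<gamma> y)) A = measure (\<nu> (\<gamma> y)) (F \<inter> A)" by (rule ms[OF A])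
      also have "\<dots> = measure (\<nu> y) (boundary_map \<gamma> -` (F \<inter> A) \<inter> boundary)" using Fs A by (intro nu_equiv[OF g]) auto
      also have "boundary_map \<gamma> -` (F \<inter> A) \<inter> boundary = F \<inter> (boundary_map \<gamma> -` A \<inter> boundary)"
        using F_inv[OF g] by blast
      also have "measure (\<nu> y) \<dots> = measure (\<nu>' y) (boundary_map \<gamma> -` A \<inter> boundary)" by (rule ms[OF pre, symmetric])
      finally show "measure (\<nu>' (\<gamma> y)) A = measure (\<nu>' y) (boundary_map \<gamma> -` A \<inter> boundary)" .
    next
      fix y z b and A :: "'a boundary_pt set" assume A: "A \<in> sets boundary_borel" and b: "\<And>\<xi>. \<xi> \<in> A \<Longrightarrow> b \<le> busemann \<xi> y z"
      show "measure (\<nu>' y) A \<le> exp (- \<delta> * b) * measure (\<nu>' z) A"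
        unfolding ms[OF A] using Fs A b by (intro nu_conf) auto
    qed
    \<comment> \<open>The identity belongs to the group, so \<open>E\<close> lies in its saturation
      and has measure 0 for the restricted density, against \<open>Epos\<close>.\<close>
    have "E \<subseteq> boundary" using sets.sets_into_space[OF E(1)] by (simp add: space_boundary_borel)
    then have "F \<inter> E = {}" using act_id by (force simp: F_def Sat_def boundary_map_id)
    then show False using Epos[OF cp] ms[OF E(1), of x] by simp
  qed
  interpret nu: finite_measure "\<nu> x" by (rule fin_nu)
  have "F \<in> null_sets (\<nu> x)" using F0 Fs by (auto simp: null_sets_def sets_nu nu.emeasure_eq_measure)
  then have "AE \<xi> in \<nu> x. \<xi> \<notin> F" by (rule AE_not_in)
  then show ?thesis
  proof (rule AE_mp, intro AE_I2 impI)
    fix \<xi> assume "\<xi> \<in> space (\<nu> x)" "\<xi> \<notin> F"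
    then obtain \<gamma> where "\<gamma> \<in> \<Gamma>" "boundary_map \<gamma> \<xi> \<in> E" by (auto simp: F_def Sat_def space_nu)
    then show "deep e \<kappa> \<xi>" using deep_act E(2) by blast
  qed
qed

section \<open>The upper bound: long excursions are summable\<close>

definition shallow :: "real \<Rightarrow> real \<Rightarrow> 'a boundary_pt \<Rightarrow> bool" where
  "shallow e \<kappa> \<xi> \<longleftrightarrow> (\<forall>l\<in>geodesic_lines. pos_end l = \<xi> \<longrightarrow>
     eventually (\<lambda>t. penetration \<Gamma> C\<^sub>0 e l t \<le> ereal (\<kappa> * ln t)) at_top)"

text \<open>Here \<gamma> ranges over the whole ball of the group: overcounting is harmless for an
  upper bound. The lower bound on \<open>len (\<gamma> \<circ> h)\<close> takes the place of
  \<open>minimal_gap\<close>, and \<gamma> marks a point of the translate near which the excursion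
  window begins, at time about \<open>i\<close>.\<close>

definition long_pairs :: "real \<Rightarrow> real \<Rightarrow> nat \<Rightarrow> (('a \<Rightarrow> 'a) \<times> ('a \<Rightarrow> 'a)) set" where
  "long_pairs \<kappa> R i = {(\<gamma>, h). \<gamma> \<in> \<Gamma> \<and> len \<gamma> \<le> real i + 1 \<and> h \<in> \<Gamma>\<^sub>0 \<and> len h \<le> \<kappa> * ln (real i + 1) + R \<and>
     real i + \<kappa> * ln (real i + 1) - R \<le> len (\<gamma> \<circ> h)}"

definition long_event :: "real \<Rightarrow> real \<Rightarrow> nat \<Rightarrow> 'a boundary_pt set" where
  "long_event \<kappa> R i = (\<Union>p\<in>long_pairs \<kappa> R i. shadow x ((fst p \<circ> snd p) x) R)"

lemma fin_long_pairs:
  "finite (long_pairs \<kappa> R i)" "card (long_pairs \<kappa> R i) \<le> orbit_count (real i + 1) * core_count (\<kappa> * ln (real i + 1) + R)"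
proof -
  have sub: "long_pairs \<kappa> R i \<subseteq> {\<gamma> \<in> \<Gamma>. len \<gamma> \<le> real i + 1} \<times> {h \<in> \<Gamma>\<^sub>0. len h \<le> \<kappa> * ln (real i + 1) + R}"
    by (auto simp: long_pairs_def)
  have fin: "finite ({\<gamma> \<in> \<Gamma>. len \<gamma> \<le> real i + 1} \<times> {h \<in> \<Gamma>\<^sub>0. len h \<le> \<kappa> * ln (real i + 1) + R})" using fin_ball by blast
  show "finite (long_pairs \<kappa> R i)" by (rule finite_subset[OF sub fin])
  show "card (long_pairs \<kappa> R i) \<le> orbit_count (real i + 1) * core_count (\<kappa> * ln (real i + 1) + R)"
    using card_mono[OF fin sub] by (simp add: card_cartesian_product orbit_count_def core_count_def)
qed

lemma long_event_sets: "long_event \<kappa> R i \<in> sets boundary_borel"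
  unfolding long_event_def using fin_long_pairs(1) shadow_sets by (intro sets.finite_UN) auto

text \<open>About \<open>exp (\<delta> * i)\<close> choices of \<gamma> and at most a constant times
  \<open>exp (q * s)\<close> choices of \<open>h\<close>, against shadows of size
  \<open>exp (- \<delta> * (i + s))\<close>: with \<open>s = \<kappa> * ln (i + 1)\<close> this
  leaves a power of \<open>i + 1\<close>.\<close>

lemma long_event_summable:
  assumes \<kappa>: "0 < \<kappa>" "1 < \<kappa> * (\<delta> - \<delta>\<^sub>0)"
  shows "summable (\<lambda>i. measure (\<nu> x) (long_event \<kappa> R i))"
proof -
  interpret nu: finite_measure "\<nu> x" by (rule fin_nu)
  \<comment> \<open>Above \<open>\<delta>\<^sub>0\<close>, as \<open>core_count_upper\<close>
    demands, yet small enough that \<open>\<kappa> * (\<delta> - q) > 1\<close>.\<close>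
  define q where "q = (\<delta>\<^sub>0 + (\<delta> - 1 / \<kappa>)) / 2"
  have "1 / \<kappa> < \<delta> - \<delta>\<^sub>0" using \<kappa> by (simp add: field_simps)
  then have q: "\<delta>\<^sub>0 < q" "1 / \<kappa> < \<delta> - q" by (auto simp: q_def field_simps)
  have q1: "1 < \<kappa> * (\<delta> - q)" using q(2) \<kappa>(1) by (simp add: field_simps)
  obtain K where K: "0 < K" "\<And>R. real (core_count R) \<le> K * exp (q * R)" using core_count_upper[OF q(1)] by auto
  define C where "C = CN * exp \<delta> * (K * exp (q * R)) * (exp (\<delta> * R) * mass * exp (\<delta> * R))"
  have bound: "measure (\<nu> x) (long_event \<kappa> R i) \<le> C * (real i + 1) powr (- (\<kappa> * (\<delta> - q)))" for i
  proof -
    define s where "s = \<kappa> * ln (real i + 1)"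
    have "measure (\<nu> x) (long_event \<kappa> R i) \<le> (\<Sum>p\<in>long_pairs \<kappa> R i. measure (\<nu> x) (shadow x ((fst p \<circ> snd p) x) R))"
      unfolding long_event_def using fin_long_pairs(1) shadow_sets sets_nu by (intro nu.finite_measure_subadditive_finite) auto
    also have "\<dots> \<le> (\<Sum>p\<in>long_pairs \<kappa> R i. exp (\<delta> * R) * mass * exp (\<delta> * (R - i - s)))"
    proof (rule sum_mono)
      fix p assume p: "p \<in> long_pairs \<kappa> R i"
      then have G: "fst p \<circ> snd p \<in> \<Gamma>" and len: "i + s - R \<le> len (fst p \<circ> snd p)"
        using act_comp mem0 by (auto simp: long_pairs_def s_def add.commute)
      have "measure (\<nu> x) (shadow x ((fst p \<circ> snd p) x) R) \<le> exp (\<delta> * R) * mass * exp (- \<delta> * len (fst p \<circ> snd p))"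
        by (rule shadow_upper[OF G])
      also have "\<dots> \<le> exp (\<delta> * R) * mass * exp (\<delta> * (R - i - s))"
      proof (intro mult_left_mono)
        have "- len (fst p \<circ> snd p) \<le> R - i - s" using len by linarith
        then have "\<delta> * (- len (fst p \<circ> snd p)) \<le> \<delta> * (R - i - s)" using d_nonneg by (rule mult_left_mono)
        then show "exp (- \<delta> * len (fst p \<circ> snd p)) \<le> exp (\<delta> * (R - i - s))" by simp
      qed (use mass_pos in auto)
      finally show "measure (\<nu> x) (shadow x ((fst p \<circ> snd p) x) R) \<le> exp (\<delta> * R) * mass * exp (\<delta> * (R - i - s))" .
    qed
    also have "\<dots> = real (card (long_pairs \<kappa> R i)) * (exp (\<delta> * R) * mass * exp (\<delta> * (R - i - s)))" by simp
    also have "\<dots> \<le> (CN * exp (\<delta> * (real i + 1)) * (K * exp (q * (s + R)))) * (exp (\<delta> * R) * mass * exp (\<delta> * (R - i - s)))"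
    proof (intro mult_right_mono)
      have "real (card (long_pairs \<kappa> R i)) \<le> real (orbit_count (real i + 1)) * real (core_count (s + R))"
        using fin_long_pairs(2)[of \<kappa> R i] unfolding s_def by (simp only: of_nat_mult[symmetric] of_nat_le_iff)
      also have "\<dots> \<le> (CN * exp (\<delta> * (real i + 1))) * (K * exp (q * (s + R)))"
        using orbit_count_bounds(2)[of "real i + 1"] K CN by (intro mult_mono) auto
      finally show "real (card (long_pairs \<kappa> R i)) \<le> CN * exp (\<delta> * (real i + 1)) * (K * exp (q * (s + R)))" .
    qed (use mass_pos in auto)
    also have "\<dots> = C * (exp (\<delta> * i) * exp (q * s) * exp (- \<delta> * i - \<delta> * s))"
    proof -
      have e1: "exp (\<delta> * (real i + 1)) = exp (\<delta> * i) * exp \<delta>" by (simp add: exp_add[symmetric] algebra_simps)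
      have e2: "exp (q * (s + R)) = exp (q * s) * exp (q * R)" by (simp add: exp_add[symmetric] algebra_simps)
      have e3: "exp (\<delta> * (R - i - s)) = exp (\<delta> * R) * exp (- \<delta> * i - \<delta> * s)" by (simp add: exp_add[symmetric] algebra_simps)
      show ?thesis unfolding e1 e2 e3 C_def by (simp add: mult_ac)
    qed
    also have "exp (\<delta> * i) * exp (q * s) * exp (- \<delta> * i - \<delta> * s) = exp (- (\<kappa> * (\<delta> - q)) * ln (real i + 1))"
      by (simp add: exp_add[symmetric] s_def algebra_simps)
    also have "\<dots> = (real i + 1) powr (- (\<kappa> * (\<delta> - q)))" by (simp add: powr_def)
    finally show ?thesis .
  qed
  have "summable (\<lambda>i. real i powr (- (\<kappa> * (\<delta> - q))))" using q1 by (subst summable_real_powr_iff) simp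
  then have "summable (\<lambda>i. real (i + 1) powr (- (\<kappa> * (\<delta> - q))))"
    by (subst summable_iff_shift)
  then have "summable (\<lambda>i. (real i + 1) powr (- (\<kappa> * (\<delta> - q))))" by (simp add: add.commute)
  then have "summable (\<lambda>i. C * (real i + 1) powr (- (\<kappa> * (\<delta> - q))))" by (rule summable_mult)
  then show ?thesis
    by (rule summable_comparison_test'[where N = 0]) (use bound in simp)
qed

lemma core_orbit_near:
  assumes g: "\<gamma> \<in> \<Gamma>" and p: "p \<in> \<gamma> ` closed_nbhd e C\<^sub>0"
  obtains h where "h \<in> \<Gamma>\<^sub>0" "dist p (\<gamma> (h x)) \<le> e + 1 + D"
proof -
  obtain p' where p': "p = \<gamma> p'" "infdist p' C\<^sub>0 \<le> e" using p by (auto simp: closed_nbhd_def)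
  have "\<exists>c\<in>C\<^sub>0. dist p' c < e + 1"
  proof (rule ccontr)
    assume "\<not> ?thesis"
    then have "e + 1 \<le> infdist p' C\<^sub>0"
      using x_core unfolding infdist_notempty[of C\<^sub>0 p', OF ex_in_conv[THEN iffD1, OF exI, OF x_core]]
      by (intro cINF_greatest) (auto simp: not_less)
    then show False using p'(2) by simp
  qed
  then obtain c where c: "c \<in> C\<^sub>0" "dist p' c < e + 1" by blast
  obtain h where h: "h \<in> \<Gamma>\<^sub>0" "dist c (h x) \<le> D" using core_dense[OF c(1)] by blast
  have "dist p (\<gamma> (h x)) \<le> e + 1 + D"
    using dist_triangle[of p' "h x" c] c(2) h(2) g by (simp add: p'(1) act_carrier(2))
  then show ?thesis using that h(1) by blast
qed

text \<open>The penetration depth is compared with \<open>ln t\<close> at a time inside the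
  excursion, the event with \<open>ln\<close> of about its starting time. The room between
  \<open>\<kappa>'\<close> and \<open>\<kappa>\<close> absorbs this change and the bounded
  errors.\<close>

lemma not_shallow_long_events:
  assumes e: "0 < e" and \<kappa>: "0 < \<kappa>'" "\<kappa>' < \<kappa>" and \<xi>: "\<xi> \<in> boundary" and n: "\<not> shallow e \<kappa> \<xi>"
  shows "\<exists>R::nat. \<forall>m. \<exists>i\<ge>m. \<xi> \<in> long_event \<kappa>' (real R) i"
proof -
  obtain l where l: "l \<in> geodesic_lines" "pos_end l = \<xi>"
    and nl: "\<not> eventually (\<lambda>t. penetration \<Gamma> C\<^sub>0 e l t \<le> ereal (\<kappa> * ln t)) at_top"
    using n by (auto simp: shallow_def)
  obtain r B where r: "r \<in> \<xi>" "r 0 = x" "r \<in> geodesic_rays" and B: "0 \<le> B" "\<And>t. 0 \<le> t \<Longrightarrow> dist (l t) (r t) \<le> B"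
    by (rule line_fellow_ray[OF l]) (rule that)
  define b where "b = B + e + 1 + D"
  have b: "0 < b" using B e D by (simp add: b_def)
  \<comment> \<open>All errors in the lengths and in the shadow condition are at most twice
    \<open>b\<close>, so \<open>4 * b + 1\<close> is ample, and strict where a shadow requires
    it.\<close>
  obtain R :: nat where R: "4 * b + 1 \<le> real R" using real_arch_simple by blast
  have "\<exists>i\<ge>m. \<xi> \<in> long_event \<kappa>' (real R) i" for m
  proof -
    have "eventually (\<lambda>t. \<kappa>' * ln (t + b + 1) \<le> \<kappa> * ln t) at_top"
    proof -
      have "eventually (\<lambda>t. \<kappa>' * (ln (t + b + 1) / ln t) \<le> \<kappa>) at_top"
      proof -
        have "((\<lambda>t. ln (t + b + 1) / ln t) \<longlongrightarrow> 1) at_top" using b by real_asymp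
        then have "((\<lambda>t. \<kappa>' * (ln (t + b + 1) / ln t)) \<longlongrightarrow> \<kappa>' * 1) at_top" by (intro tendsto_intros)
        then have "eventually (\<lambda>t. \<kappa>' * (ln (t + b + 1) / ln t) < \<kappa>) at_top" using \<kappa> by (intro order_tendstoD(2)) auto
        then show ?thesis by eventually_elim simp
      qed
      then show ?thesis using eventually_gt_at_top[of 1] by eventually_elim (simp add: field_simps)
    qed
    \<comment> \<open>A window of length \<open>\<kappa> * ln t\<close> containing \<open>t\<close>
      starts after \<open>t - \<kappa> * ln t\<close>; this sends the index \<open>i\<close> to
      infinity.\<close>
    moreover have "eventually (\<lambda>t. real m + b + 1 \<le> t - \<kappa> * ln t) at_top"
    proof -
      have "filterlim (\<lambda>t. t - \<kappa> * ln t) at_top at_top" by real_asymp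
      then show ?thesis unfolding filterlim_at_top by blast
    qed
    ultimately have "eventually (\<lambda>t. \<kappa>' * ln (t + b + 1) \<le> \<kappa> * ln t \<and> real m + b + 1 \<le> t - \<kappa> * ln t \<and> 1 < t) at_top"
      using eventually_gt_at_top[of 1] by eventually_elim auto
    moreover have "frequently (\<lambda>t. \<not> penetration \<Gamma> C\<^sub>0 e l t \<le> ereal (\<kappa> * ln t)) at_top"
      using nl by (simp add: frequently_def)
    ultimately obtain t where t: "\<kappa>' * ln (t + b + 1) \<le> \<kappa> * ln t" "real m + b + 1 \<le> t - \<kappa> * ln t" "1 < t"
      and pen: "ereal (\<kappa> * ln t) < penetration \<Gamma> C\<^sub>0 e l t"
      using frequently_ex[OF frequently_eventually_frequently] by (force simp: not_le)
    define L where "L = \<kappa> * ln t"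
    have L: "0 \<le> L" using \<kappa> t(3) by (simp add: L_def)
    have "l t \<in> (\<Union>\<gamma>\<in>\<Gamma>. \<gamma> ` closed_nbhd e C\<^sub>0)"
    proof (rule ccontr)
      assume "\<not> ?thesis"
      then have "penetration \<Gamma> C\<^sub>0 e l t = 0" unfolding penetration_def by simp
      then show False using pen L by (simp add: L_def)
    qed
    then have "ereal L < (SUP I \<in> {I. is_interval I \<and> t \<in> I \<and> (\<exists>\<gamma>\<in>\<Gamma>. l ` I \<subseteq> \<gamma> ` closed_nbhd e C\<^sub>0)}. enn2ereal (emeasure lborel I))"
      using pen unfolding penetration_def L_def by simp
    then obtain I where I: "is_interval I" "t \<in> I" "\<exists>\<gamma>\<in>\<Gamma>. l ` I \<subseteq> \<gamma> ` closed_nbhd e C\<^sub>0" "ereal L < enn2ereal (emeasure lborel I)"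
      unfolding less_SUP_iff by blast
    then obtain \<gamma>' where g': "\<gamma>' \<in> \<Gamma>" "l ` I \<subseteq> \<gamma>' ` closed_nbhd e C\<^sub>0" by blast
    obtain u where u: "u \<le> t" "t \<le> u + L" "{u..u + L} \<subseteq> I"
      by (rule interval_contains_length[OF I(1,2) L I(4)])
    have um: "real m + b + 1 \<le> u" using u(2) t(2) by (simp add: L_def)
    have u0: "0 \<le> u" using um b by linarith
    have "u \<in> I" using u(3) L by auto
    then have "l u \<in> \<gamma>' ` closed_nbhd e C\<^sub>0" using g'(2) by blast
    then obtain h1 where h1: "h1 \<in> \<Gamma>\<^sub>0" "dist (l u) (\<gamma>' (h1 x)) \<le> e + 1 + D"
      using core_orbit_near[OF g'(1)] by metis
    \<comment> \<open>The element naming the translate is arbitrary within its coset. Composing with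
      \<open>h1\<close> picks the one whose orbit point is near the start of the window.\<close>
    define \<gamma> where "\<gamma> = \<gamma>' \<circ> h1"
    have G: "\<gamma> \<in> \<Gamma>" using act_comp g' h1 mem0 by (simp add: \<gamma>_def)
    have ru: "dist (r u) (\<gamma> x) \<le> b"
      using h1(2) B(2)[OF u0] dist_triangle[of "r u" "\<gamma> x" "l u"] by (simp add: \<gamma>_def b_def dist_commute)
    have dru: "dist x (r u) = u" using ray_dist[OF r(3), of 0 u] r(2) u0 by simp
    have lg: "\<bar>len \<gamma> - u\<bar> \<le> b"
      using ru dru dist_triangle[of x "\<gamma> x" "r u"] dist_triangle[of x "r u" "\<gamma> x"] by (auto simp: len_def abs_le_iff dist_commute)
    define i where "i = nat \<lfloor>len \<gamma>\<rfloor>"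
    have i: "real i \<le> len \<gamma>" "len \<gamma> \<le> real i + 1" by (auto simp: i_def)
    have mi: "m \<le> i"
    proof -
      have "real m \<le> real i" using i(2) lg um by linarith
      then show ?thesis by simp
    qed
    define s where "s = \<kappa>' * ln (real i + 1)"
    have s0: "0 \<le> s" using \<kappa>(1) by (simp add: s_def)
    have sL: "s \<le> L"
    proof -
      have "ln (real i + 1) \<le> ln (t + b + 1)" using i(1) lg u(1) by (intro ln_mono) auto
      then have "s \<le> \<kappa>' * ln (t + b + 1)" unfolding s_def using \<kappa>(1) by (intro mult_left_mono) auto
      then show ?thesis using t(1) by (simp add: L_def)
    qed
    define v where "v = u + s"
    have v0: "0 \<le> v" using u0 s0 by (simp add: v_def)
    have "v \<in> I" using u(3) s0 sL by (auto simp: v_def)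
    then have "l v \<in> \<gamma>' ` closed_nbhd e C\<^sub>0" using g'(2) by blast
    then obtain h2 where h2: "h2 \<in> \<Gamma>\<^sub>0" "dist (l v) (\<gamma>' (h2 x)) \<le> e + 1 + D"
      using core_orbit_near[OF g'(1)] by metis
    define h where "h = ginv h1 \<circ> h2"
    have H: "h \<in> \<Gamma>\<^sub>0" using act0.act_comp[OF act0.act_inv[OF h1(1)] h2(1)] by (simp add: h_def)
    have gh: "(\<gamma> \<circ> h) x = \<gamma>' (h2 x)" using h1(1) by (simp add: \<gamma>_def h_def)
    have rv: "dist (r v) ((\<gamma> \<circ> h) x) \<le> b"
      unfolding gh b_def using h2(2) B(2)[OF v0] dist_triangle[of "r v" "\<gamma>' (h2 x)" "l v"] by (simp add: dist_commute)
    have drv: "dist x (r v) = v" using ray_dist[OF r(3), of 0 v] r(2) v0 by simp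
    have lgh: "\<bar>len (\<gamma> \<circ> h) - v\<bar> \<le> b"
      using rv drv dist_triangle[of x "(\<gamma> \<circ> h) x" "r v"] dist_triangle[of x "r v" "(\<gamma> \<circ> h) x"] unfolding len_def abs_le_iff
      by (auto simp del: comp_apply simp: dist_commute)
    have lh: "len h \<le> s + 2 * b"
    proof -
      have "len h = dist (\<gamma> x) ((\<gamma> \<circ> h) x)" using G by (simp add: len_def act_carrier(2))
      also have "\<dots> \<le> dist (\<gamma> x) (r u) + dist (r u) (r v) + dist (r v) ((\<gamma> \<circ> h) x)"
        using dist_triangle[of "\<gamma> x" "(\<gamma> \<circ> h) x" "r u"] dist_triangle[of "r u" "(\<gamma> \<circ> h) x" "r v"] by linarith
      also have "dist (r u) (r v) = s" using ray_dist[OF r(3) u0 v0] s0 by (simp add: v_def)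
      finally show ?thesis using ru rv by (simp add: dist_commute)
    qed
    have "(\<gamma>, h) \<in> long_pairs \<kappa>' (real R) i"
      using G H i lh lg lgh R b unfolding long_pairs_def s_def v_def by (auto simp: add.commute abs_le_iff s_def v_def)
    moreover have "\<xi> \<in> shadow x ((\<gamma> \<circ> h) x) (real R)"
    proof -
      have "dist (r (len (\<gamma> \<circ> h))) (r v) \<le> b" using ray_dist[OF r(3), of "len (\<gamma> \<circ> h)" v] v0 lgh by simp
      then have "dist (r (len (\<gamma> \<circ> h))) ((\<gamma> \<circ> h) x) < real R"
        using rv dist_triangle[of "r (len (\<gamma> \<circ> h))" "(\<gamma> \<circ> h) x" "r v"] R b by linarith
      then show ?thesis unfolding shadow_def len_def using \<xi> r by blast
    qed
    ultimately have "\<xi> \<in> long_event \<kappa>' (real R) i" unfolding long_event_def by force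
    then show ?thesis using mi by blast
  qed
  then show ?thesis by blast
qed

lemma shallow_AE:
  assumes e: "0 < e" and \<kappa>: "1 < \<kappa> * (\<delta> - \<delta>\<^sub>0)"
  shows "AE \<xi> in \<nu> x. shallow e \<kappa> \<xi>"
proof -
  interpret nu: finite_measure "\<nu> x" by (rule fin_nu)
  \<comment> \<open>Halfway between the critical value and \<open>\<kappa>\<close>: the events are
    still summable, and there is still room below \<open>\<kappa>\<close>.\<close>
  define \<kappa>' where "\<kappa>' = (1 / (\<delta> - \<delta>\<^sub>0) + \<kappa>) / 2"
  have d: "0 < \<delta> - \<delta>\<^sub>0" using critical_gap by simp
  have k: "1 / (\<delta> - \<delta>\<^sub>0) < \<kappa>" using \<kappa> d by (simp add: pos_divide_less_eq)
  have k': "1 / (\<delta> - \<delta>\<^sub>0) < \<kappa>'" "\<kappa>' < \<kappa>" using k by (auto simp: \<kappa>'_def)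
  have k0: "0 < \<kappa>'" using k'(1) d by (meson divide_pos_pos less_trans zero_less_one)
  have k1: "1 < \<kappa>' * (\<delta> - \<delta>\<^sub>0)" using k'(1) d by (simp add: pos_divide_less_eq)
  have "AE \<xi> in \<nu> x. \<forall>R::nat. eventually (\<lambda>i. \<xi> \<in> space (\<nu> x) - long_event \<kappa>' (real R) i) sequentially"
    unfolding AE_all_countable
  proof
    fix R :: nat
    show "AE \<xi> in \<nu> x. eventually (\<lambda>i. \<xi> \<in> space (\<nu> x) - long_event \<kappa>' (real R) i) sequentially"
      using long_event_summable[OF k0 k1] long_event_sets by (intro borel_cantelli_AE1) (auto simp: sets_nu nu.emeasure_eq_measure)
  qed
  then show ?thesis
  proof (rule AE_mp, intro AE_I2 impI)
    fix \<xi> assume \<xi>: "\<xi> \<in> space (\<nu> x)" and ev: "\<forall>R::nat. eventually (\<lambda>i. \<xi> \<in> space (\<nu> x) - long_event \<kappa>' (real R) i) sequentially"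
    show "shallow e \<kappa> \<xi>"
    proof (rule ccontr)
      assume "\<not> shallow e \<kappa> \<xi>"
      then obtain R :: nat where R: "\<forall>m. \<exists>i\<ge>m. \<xi> \<in> long_event \<kappa>' (real R) i"
        using not_shallow_long_events[OF e k0 k'(2)] \<xi> space_nu by blast
      obtain m where "\<forall>i\<ge>m. \<xi> \<in> space (\<nu> x) - long_event \<kappa>' (real R) i"
        using ev by (auto simp: eventually_sequentially)
      then show False using R by blast
    qed
  qed
qed

end

section \<open>The logarithm law\<close>

context conformal_pair
begin

text \<open>Countably many constants approaching \<open>1 / (\<delta> - \<delta>\<^sub>0)\<close>
  from either side, so that the exceptional sets remain null together.\<close>

lemma logarithm_law_AE:
  assumes e: "0 < e"
  shows "AE \<xi> in \<nu> x. \<forall>l\<in>geodesic_lines. pos_end l = \<xi> \<longrightarrow>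
    Limsup at_top (\<lambda>t. penetration \<Gamma> C\<^sub>0 e l t / ereal (ln t)) = ereal (1 / (\<delta> - \<delta>\<^sub>0))"
proof -
  define K where "K = 1 / (\<delta> - \<delta>\<^sub>0)"
  have d: "0 < \<delta> - \<delta>\<^sub>0" using critical_gap by simp
  have K: "0 < K" "K * (\<delta> - \<delta>\<^sub>0) = 1" using d by (auto simp: K_def)
  have 1: "AE \<xi> in \<nu> x. \<forall>j::nat. shallow e (K + 1 / real (Suc j)) \<xi>"
    unfolding AE_all_countable
  proof
    fix j
    have "1 < K * (\<delta> - \<delta>\<^sub>0) + 1 / real (Suc j) * (\<delta> - \<delta>\<^sub>0)" using K(2) d by simp
    then show "AE \<xi> in \<nu> x. shallow e (K + 1 / real (Suc j)) \<xi>"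
      by (intro shallow_AE[OF e]) (simp add: distrib_right)
  qed
  \<comment> \<open>The index starts at 2 to keep the constant positive, as \<open>deep_AE\<close>
    requires.\<close>
  have 2: "AE \<xi> in \<nu> x. \<forall>j::nat. deep e (K * (1 - 1 / real (Suc (Suc j)))) \<xi>"
    unfolding AE_all_countable
  proof
    fix j
    have p: "0 < 1 - 1 / real (Suc (Suc j))" "1 - 1 / real (Suc (Suc j)) < 1" by auto
    have "K * (1 - 1 / real (Suc (Suc j))) * (\<delta> - \<delta>\<^sub>0) = 1 - 1 / real (Suc (Suc j))"
      using K(2) by (simp add: mult.commute mult.left_commute)
    then have "K * (1 - 1 / real (Suc (Suc j))) * (\<delta> - \<delta>\<^sub>0) < 1" using p(2) by (simp only:)
    with mult_pos_pos[OF K(1) p(1)] show "AE \<xi> in \<nu> x. deep e (K * (1 - 1 / real (Suc (Suc j)))) \<xi>"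
      by (rule deep_AE[OF e])
  qed
  show ?thesis using 1 2
  proof eventually_elim
    case (elim \<xi>)
    show ?case
    proof (intro ballI impI)
      fix l assume l: "l \<in> geodesic_lines" "pos_end l = \<xi>"
      define f where "f t = penetration \<Gamma> C\<^sub>0 e l t / ereal (ln t)" for t
      have up: "Limsup at_top f \<le> ereal (K + 1 / real (Suc j))" for j
      proof (rule Limsup_bounded)
        have "eventually (\<lambda>t. penetration \<Gamma> C\<^sub>0 e l t \<le> ereal ((K + 1 / real (Suc j)) * ln t)) at_top"
          using elim(1) l unfolding shallow_def by blast
        then show "eventually (\<lambda>t. f t \<le> ereal (K + 1 / real (Suc j))) at_top"
          using eventually_gt_at_top[of 1]
        proof eventually_elim
          case (elim t)
          then show ?case by (simp add: f_def ereal_divide_le_pos mult.commute)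
        qed
      qed
      have lo: "ereal (K * (1 - 1 / real (Suc (Suc j)))) \<le> Limsup at_top f" for j
      proof (rule ccontr)
        define \<kappa> where "\<kappa> = K * (1 - 1 / real (Suc (Suc j)))"
        assume "\<not> ereal (K * (1 - 1 / real (Suc (Suc j)))) \<le> Limsup at_top f"
        then have "Limsup at_top f < ereal \<kappa>" by (simp add: \<kappa>_def not_le)
        then have "eventually (\<lambda>t. f t < ereal \<kappa>) at_top" by (rule Limsup_lessD)
        then obtain T where T: "\<And>t. T \<le> t \<Longrightarrow> f t < ereal \<kappa>" by (auto simp: eventually_at_top_linorder)
        have "deep e \<kappa> \<xi>" using elim(2) unfolding \<kappa>_def by blast
        then obtain t where t: "max T 2 \<le> t" "ereal (\<kappa> * ln t) \<le> penetration \<Gamma> C\<^sub>0 e l t"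
          using l unfolding deep_def by blast
        have "ereal \<kappa> \<le> f t"
          using t by (simp add: f_def ereal_le_divide_pos mult.commute)
        then show False using T[of t] t(1) by simp
      qed
      have "(\<lambda>j. ereal (K + 1 / real (Suc j))) \<longlonglongrightarrow> ereal (K + 0)"
        by (intro tendsto_intros lim_ereal[THEN iffD2] LIMSEQ_Suc[OF lim_1_over_n])
      then have "Limsup at_top f \<le> ereal (K + 0)" by (rule LIMSEQ_le_const) (use up in blast)
      then have a: "Limsup at_top f \<le> ereal K" by simp
      have "(\<lambda>j. 1 / real (Suc (Suc j))) \<longlonglongrightarrow> 0" by (intro LIMSEQ_Suc lim_1_over_n)
      then have "(\<lambda>j. K * (1 - 1 / real (Suc (Suc j)))) \<longlonglongrightarrow> K * (1 - 0)" by (intro tendsto_intros)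
      then have "(\<lambda>j. ereal (K * (1 - 1 / real (Suc (Suc j))))) \<longlonglongrightarrow> ereal (K * (1 - 0))" by (simp only: lim_ereal)
      then have "ereal (K * (1 - 0)) \<le> Limsup at_top f" by (rule LIMSEQ_le_const2) (use lo in blast)
      then have b: "ereal K \<le> Limsup at_top f" by simp
      show "Limsup at_top (\<lambda>t. penetration \<Gamma> C\<^sub>0 e l t / ereal (ln t)) = ereal (1 / (\<delta> - \<delta>\<^sub>0))"
        using a b by (simp add: f_def[abs_def] K_def)
    qed
  qed
qed

end

section \<open>From critical exponents and orbit growth to the data of the locales\<close>

context isom_action
begin

lemma poincare_converges_basepoint:
  assumes s: "0 \<le> s" and c: "poincare_converges \<Gamma> s x"
  shows "poincare_converges \<Gamma> s y"
proof -
  have "(\<lambda>\<gamma>. exp (2 * s * dist x y) * exp (- s * dist x (\<gamma> x))) summable_on \<Gamma>"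
    using c unfolding poincare_converges_def by (intro summable_on_cmult_right)
  then show ?thesis unfolding poincare_converges_def
  proof (rule summable_on_comparison_test)
    fix \<gamma> assume g: "\<gamma> \<in> \<Gamma>"
    have "dist x (\<gamma> x) - 2 * dist x y \<le> dist y (\<gamma> y)"
      using dist_triangle[of x "\<gamma> x" y] dist_triangle[of y "\<gamma> x" "\<gamma> y"] act_carrier(2)[OF g, of y x] by (simp add: dist_commute)
    then have "s * (dist x (\<gamma> x) - 2 * dist x y) \<le> s * dist y (\<gamma> y)" using s by (rule mult_left_mono)
    then have "- s * dist y (\<gamma> y) \<le> 2 * s * dist x y + - s * dist x (\<gamma> x)" by (simp add: algebra_simps)
    then show "exp (- s * dist y (\<gamma> y)) \<le> exp (2 * s * dist x y) * exp (- s * dist x (\<gamma> x))"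
      unfolding exp_add[symmetric] by simp
  qed simp
qed

lemma poincare_converges_mono:
  assumes "s \<le> t" and c: "poincare_converges \<Gamma> s x"
  shows "poincare_converges \<Gamma> t x"
  using c unfolding poincare_converges_def
  by (rule summable_on_comparison_test) (use assms in \<open>auto intro: mult_right_mono\<close>)

text \<open>The infimum of the convergent exponents, infinite if there are none, has the defining
  property; two candidates would disagree at an exponent strictly between them.\<close>

lemma critical_exponent_spec:
  defines "e \<equiv> critical_exponent \<Gamma>"
  shows "0 \<le> e \<and> (\<forall>x. \<forall>s\<ge>0. (e < ereal s \<longrightarrow> poincare_converges \<Gamma> s x) \<and> (ereal s < e \<longrightarrow> \<not> poincare_converges \<Gamma> s x))"
proof -
  define P where "P e \<longleftrightarrow> 0 \<le> e \<and> (\<forall>x. \<forall>s\<ge>0. (e < ereal s \<longrightarrow> poincare_converges \<Gamma> s x) \<and> (ereal s < e \<longrightarrow> \<not> poincare_converges \<Gamma> s x))" for e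
  define S where "S = {s. 0 \<le> s \<and> (\<exists>x. poincare_converges \<Gamma> s x)}"
  have S: "s \<in> S \<longleftrightarrow> 0 \<le> s \<and> poincare_converges \<Gamma> s x" for s x
    using poincare_converges_basepoint by (auto simp: S_def)
  define i where "i = (INF s\<in>S. ereal s)"
  have "P i"
    unfolding P_def
  proof (intro conjI allI impI)
    show "0 \<le> i" unfolding i_def by (intro INF_greatest) (auto simp: S_def)
    fix x s assume s: "(0::real) \<le> s"
    show "poincare_converges \<Gamma> s x" if si: "i < ereal s"
    proof -
      obtain s' where "s' \<in> S" "s' < s" using si unfolding i_def INF_less_iff by auto
      then show ?thesis using S[of s' x] poincare_converges_mono[of s' s x] by simp
    qed
    show "\<not> poincare_converges \<Gamma> s x" if "ereal s < i"
    proof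
      assume "poincare_converges \<Gamma> s x"
      then have "s \<in> S" using S s by blast
      then have "i \<le> ereal s" unfolding i_def by (rule INF_lower)
      then show False using that by simp
    qed
  qed
  moreover have "e1 = e2" if "P e1" "P e2" for e1 e2
  proof -
    have False if lt: "e1 < e2" and P: "P e1" "P e2" for e1 e2
    proof -
      obtain s where s: "e1 < ereal s" "ereal s < e2" using ereal_dense2[OF lt] by blast
      have "0 \<le> s" using s(1) P(1) unfolding P_def by (metis ereal_less_eq(5) less_imp_le order_trans)
      then show False using s P unfolding P_def by blast
    qed
    then show ?thesis using that by (metis linorder_neqE)
  qed
  ultimately have "P (THE e. P e)" by (metis theI)
  then show ?thesis unfolding e_def critical_exponent_def P_def .
qed

end

context discrete_action
begin

text \<open>The hypothesis counts orbit points of one point at integer radii, whereas the argument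
  counts group elements at another base point and at all radii. The finite stabiliser, twice the
  distance of the base points and the rounding cost constants only.\<close>

lemma growth_of_orbit_growth:
  assumes d: "0 \<le> \<delta>"
    and cmp: "comparable (\<lambda>n. real (card (isom_orbit \<Gamma> x1 \<inter> cball x1 (real n)))) (\<lambda>n. exp (\<delta> * real n))"
  shows "\<exists>c C. 0 < c \<and> 0 < C \<and> (\<forall>R\<ge>0. c * exp (\<delta> * R) \<le> real (card {\<gamma> \<in> \<Gamma>. dist x (\<gamma> x) \<le> R}) \<and>
     real (card {\<gamma> \<in> \<Gamma>. dist x (\<gamma> x) \<le> R}) \<le> C * exp (\<delta> * R))"
proof -
  define u where "u n = card (isom_orbit \<Gamma> x1 \<inter> cball x1 (real n))" for n :: nat
  obtain c where c: "1 \<le> c" "\<And>n. real (u n) / c \<le> exp (\<delta> * real n)" "\<And>n. exp (\<delta> * real n) \<le> c * real (u n)"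
    using cmp unfolding comparable_def u_def by blast
  define B where "B y R = {\<gamma> \<in> \<Gamma>. dist y (\<gamma> y) \<le> R}" for y R
  have fin: "finite (B y R)" for y R unfolding B_def by (rule finite_ball)
  define F where "F = card {\<gamma> \<in> \<Gamma>. \<gamma> x1 = x1}"
  have img: "(\<lambda>\<gamma>. \<gamma> x1) ` B x1 (real n) = isom_orbit \<Gamma> x1 \<inter> cball x1 (real n)" for n
    by (auto simp: B_def isom_orbit_def)
  have lo: "u n \<le> card (B x1 (real n))" for n
    unfolding u_def img[symmetric] by (rule card_image_le[OF fin])
  have finF: "finite {\<gamma> \<in> \<Gamma>. \<gamma> x1 = x1}" by (rule finite_subset[OF _ fin[of x1 0]]) (auto simp: B_def)
  have up: "card (B x1 (real n)) \<le> F * u n" for n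
    unfolding u_def img[symmetric]
  proof (rule card_le_fibers[OF fin])
    fix y assume "y \<in> (\<lambda>\<gamma>. \<gamma> x1) ` B x1 (real n)"
    then obtain \<gamma>1 where g1: "\<gamma>1 \<in> \<Gamma>" "y = \<gamma>1 x1" by (auto simp: B_def)
    show "card {\<gamma> \<in> B x1 (real n). \<gamma> x1 = y} \<le> F"
      unfolding F_def
    proof (rule card_inj_on_le[OF _ _ finF])
      show "inj_on (\<lambda>\<gamma>. ginv \<gamma>1 \<circ> \<gamma>) {\<gamma> \<in> B x1 (real n). \<gamma> x1 = y}"
      proof (rule inj_onI)
        fix \<gamma> \<gamma>' assume "ginv \<gamma>1 \<circ> \<gamma> = ginv \<gamma>1 \<circ> \<gamma>'"
        then have "\<gamma>1 \<circ> (ginv \<gamma>1 \<circ> \<gamma>) = \<gamma>1 \<circ> (ginv \<gamma>1 \<circ> \<gamma>')" by simp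
        then show "\<gamma> = \<gamma>'" using g1(1) by (simp flip: comp_assoc)
      qed
      show "(\<lambda>\<gamma>. ginv \<gamma>1 \<circ> \<gamma>) ` {\<gamma> \<in> B x1 (real n). \<gamma> x1 = y} \<subseteq> {\<gamma> \<in> \<Gamma>. \<gamma> x1 = x1}"
        using g1 act_comp[OF act_inv[OF g1(1)]] by (auto simp: B_def)
    qed
  qed
  define t where "t = dist x x1"
  have t: "0 \<le> t" by (simp add: t_def)
  have near: "\<bar>dist x (\<gamma> x) - dist x1 (\<gamma> x1)\<bar> \<le> 2 * t" if "\<gamma> \<in> \<Gamma>" for \<gamma>
    using dist_triangle[of x "\<gamma> x" x1] dist_triangle[of x1 "\<gamma> x" "\<gamma> x1"] dist_triangle[of x1 "\<gamma> x1" x] dist_triangle[of x "\<gamma> x1" "\<gamma> x"]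
      act_carrier(2)[OF that, of x x1] by (auto simp: t_def dist_commute abs_le_iff)
  have Fpos: "0 < F" unfolding F_def card_gt_0_iff using finF act_id by auto
  define C where "C = F * c * exp (\<delta> * (2 * t + 1))"
  define c' where "c' = exp (- \<delta> * (2 * t + 1)) / c"
  have upper: "real (card (B x R)) \<le> C * exp (\<delta> * R)" if R: "0 \<le> R" for R
  proof -
    define n where "n = nat \<lceil>R + 2 * t\<rceil>"
    have n: "R + 2 * t \<le> real n" "real n \<le> R + 2 * t + 1" using R t by (auto simp: n_def)
    have sub: "B x R \<subseteq> B x1 (real n)"
    proof
      fix \<gamma> assume "\<gamma> \<in> B x R"
      then show "\<gamma> \<in> B x1 (real n)" using near[of \<gamma>] n(1) by (auto simp: B_def abs_le_iff)
    qed
    have "card (B x R) \<le> F * u n" using card_mono[OF fin sub] up[of n] by linarith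
    then have "real (card (B x R)) \<le> real F * real (u n)" by (metis of_nat_le_iff of_nat_mult)
    also have "\<dots> \<le> real F * (c * exp (\<delta> * real n))"
      using c(2)[of n] c(1) by (intro mult_left_mono) (auto simp: pos_divide_le_eq mult.commute)
    also have "\<dots> \<le> real F * (c * exp (\<delta> * (R + 2 * t + 1)))"
      using n(2) d c(1) by (intro mult_left_mono) (auto intro: mult_left_mono)
    also have "\<dots> = C * exp (\<delta> * R)" by (simp add: C_def exp_add[symmetric] mult.assoc algebra_simps)
    finally show ?thesis .
  qed
  have lower: "c' * exp (\<delta> * R) \<le> real (card (B x R))" if R: "0 \<le> R" for R
  proof (cases "2 * t \<le> R")
    case True
    define n where "n = nat \<lfloor>R - 2 * t\<rfloor>"
    have n: "real n \<le> R - 2 * t" "R - 2 * t - 1 \<le> real n" using True by (auto simp: n_def)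
    have sub: "B x1 (real n) \<subseteq> B x R"
    proof
      fix \<gamma> assume "\<gamma> \<in> B x1 (real n)"
      then show "\<gamma> \<in> B x R" using near[of \<gamma>] n(1) by (auto simp: B_def abs_le_iff)
    qed
    have "c' * exp (\<delta> * R) = exp (\<delta> * (R - 2 * t - 1)) / c" by (simp add: c'_def exp_add[symmetric] algebra_simps)
    also have "\<dots> \<le> exp (\<delta> * real n) / c" using n(2) d c(1) by (intro divide_right_mono) (auto intro: mult_left_mono)
    also have "\<dots> \<le> real (u n)" using c(1) c(3)[of n] by (simp add: pos_divide_le_eq mult.commute)
    also have "\<dots> \<le> real (card (B x R))" using card_mono[OF fin sub] lo[of n] by simp
    finally show ?thesis .
  next
    case False
    \<comment> \<open>Below radius \<open>2 * t\<close> no ball around \<open>x1\<close> fits in,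
      but the identity suffices: \<open>c' * exp (\<delta> * R) \<le> 1\<close> there.\<close>
    have "id \<in> B x R" using act_id R by (simp add: B_def)
    then have "1 \<le> card (B x R)" using fin[of x R] by (metis One_nat_def Suc_leI card_gt_0_iff empty_iff)
    moreover have "c' * exp (\<delta> * R) \<le> 1"
    proof -
      have "c' * exp (\<delta> * R) = exp (\<delta> * (R - 2 * t - 1)) / c" by (simp add: c'_def exp_add[symmetric] algebra_simps)
      also have "\<dots> \<le> 1 / c"
      proof -
        have "\<delta> * (R - 2 * t - 1) \<le> 0" using False d by (intro mult_nonneg_nonpos) auto
        then show ?thesis using c(1) by (intro divide_right_mono) auto
      qed
      also have "\<dots> \<le> 1" using c(1) by simp
      finally show ?thesis .
    qed
    ultimately show ?thesis by linarith
  qed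
  have "0 < c'" "0 < C" using c(1) Fpos by (auto simp: c'_def C_def)
  then show ?thesis using upper lower unfolding B_def by blast
qed

end

lemma patterson_density_conformal:
  fixes \<mu> :: "'a::heine_borel \<Rightarrow> 'a boundary_pt measure"
  assumes cp: "core_pair tag \<Gamma> \<Gamma>\<^sub>0 x \<delta> \<delta>\<^sub>0 cN CN D C\<^sub>0 l\<^sub>0" and pat: "patterson_density \<Gamma> \<delta> \<mu>"
  shows "conformal_pair tag \<Gamma> \<Gamma>\<^sub>0 x \<delta> \<delta>\<^sub>0 cN CN D C\<^sub>0 l\<^sub>0 \<mu>"
proof -
  interpret core_pair tag \<Gamma> \<Gamma>\<^sub>0 x \<delta> \<delta>\<^sub>0 cN CN D C\<^sub>0 l\<^sub>0 by (rule cp)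
  have sets: "\<And>y. sets (\<mu> y) = sets boundary_borel" and fin: "\<And>y. finite_measure (\<mu> y)" and pos: "\<And>y. emeasure (\<mu> y) boundary \<noteq> 0"
    and eqv: "\<And>\<gamma> y. \<gamma> \<in> \<Gamma> \<Longrightarrow> distr (\<mu> y) boundary_borel (boundary_map \<gamma>) = \<mu> (\<gamma> y)"
    and dens: "\<And>y z. \<mu> y = density (\<mu> z) (\<lambda>\<xi>. ennreal (exp (- \<delta> * busemann \<xi> y z)))"
    using pat unfolding patterson_density_def by blast+
  have sp: "space (\<mu> y) = boundary" for y using sets_eq_imp_space_eq[OF sets] space_boundary_borel by metis
  show ?thesis
  proof (intro conformal_pair.intro core_pair_axioms conformal_pair_axioms.intro)
    show "sets (\<mu> y) = sets boundary_borel" "finite_measure (\<mu> y)" for y by (rule sets, rule fin)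
    interpret mx: finite_measure "\<mu> x" by (rule fin)
    show "0 < measure (\<mu> x) boundary"
      using pos[of x] mx.emeasure_eq_measure[of boundary] measure_nonneg[of "\<mu> x" boundary] by (auto simp: less_le)
  next
    fix \<gamma> y and A :: "'a boundary_pt set" assume g: "\<gamma> \<in> \<Gamma>" and A: "A \<in> sets boundary_borel"
    have m: "boundary_map \<gamma> \<in> measurable (\<mu> y) boundary_borel"
      using boundary_map_measurable[OF g] measurable_cong_sets[OF sets refl] by blast
    show "measure (\<mu> (\<gamma> y)) A = measure (\<mu> y) (boundary_map \<gamma> -` A \<inter> boundary)"
      unfolding eqv[OF g, symmetric] measure_distr[OF m A] sp ..
  next
    fix y z b and A :: "'a boundary_pt set" assume A: "A \<in> sets boundary_borel" and b: "\<And>\<xi>. \<xi> \<in> A \<Longrightarrow> b \<le> busemann \<xi> y z"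
    interpret my: finite_measure "\<mu> y" by (rule fin)
    interpret mz: finite_measure "\<mu> z" by (rule fin)
    have "emeasure (\<mu> y) A \<le> (\<integral>\<^sup>+\<xi>. ennreal (exp (- \<delta> * busemann \<xi> y z)) * indicator A \<xi> \<partial>\<mu> z)"
      by (subst dens[of y z]) (rule emeasure_density_le)
    also have "\<dots> \<le> (\<integral>\<^sup>+\<xi>. ennreal (exp (- \<delta> * b)) * indicator A \<xi> \<partial>\<mu> z)"
      using b d_nonneg by (intro nn_integral_mono) (auto simp: indicator_def intro!: ennreal_leI mult_left_mono)
    also have "\<dots> = ennreal (exp (- \<delta> * b)) * emeasure (\<mu> z) A"
      using A by (intro nn_integral_cmult_indicator) (simp add: sets)
    finally have "ennreal (measure (\<mu> y) A) \<le> ennreal (exp (- \<delta> * b) * measure (\<mu> z) A)"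
      by (simp add: my.emeasure_eq_measure mz.emeasure_eq_measure ennreal_mult)
    then show "measure (\<mu> y) A \<le> exp (- \<delta> * b) * measure (\<mu> z) A" by (simp add: ennreal_le_iff)
  qed
qed

theorem theorem4p12:
  fixes \<Gamma> \<Gamma>\<^sub>0 :: "('a::heine_borel \<Rightarrow> 'a) set"
    and \<mu> :: "'a \<Rightarrow> 'a boundary_pt measure"
    and x\<^sub>0 :: 'a and \<delta> \<delta>\<^sub>0 \<epsilon> :: real
  assumes "cat_minus_one TYPE('a)"
    and "discrete_isometry_group \<Gamma>" and "non_elementary \<Gamma>"
    and "critical_exponent \<Gamma> = ereal \<delta>" and "divergent_type \<Gamma>"
    and "patterson_density \<Gamma> \<delta> \<mu>"
    and "\<exists>x. comparable (\<lambda>n. real (card (isom_orbit \<Gamma> x \<inter> cball x (real n)))) (\<lambda>n. exp (\<delta> * real n))"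
    and "subgroup \<Gamma>\<^sub>0 (isometry_group\<lparr>carrier := \<Gamma>\<rparr>)"
    and "almost_malnormal \<Gamma>\<^sub>0 (isometry_group\<lparr>carrier := \<Gamma>\<rparr>)"
    and "convex_cocompact \<Gamma>\<^sub>0"
    and "infinite (rcosets\<^bsub>isometry_group\<lparr>carrier := \<Gamma>\<rparr>\<^esub> \<Gamma>\<^sub>0)"
    and "critical_exponent \<Gamma>\<^sub>0 = ereal \<delta>\<^sub>0"
    and "\<epsilon> > 0"
  shows "AE l in bowen_margulis \<delta> \<mu> x\<^sub>0.
           Limsup at_top (\<lambda>t. penetration \<Gamma> (hull_at_infinity (limit_set \<Gamma>\<^sub>0)) \<epsilon> l t / ereal (ln t))
             = ereal (1 / (\<delta> - \<delta>\<^sub>0))"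
proof -
  interpret c: cat1_space "TYPE('a)" by (rule cat1_space.intro) (rule assms(1))
  have subG: "subgroup \<Gamma> isometry_group" and disc: "discrete \<Gamma>" using assms(2) by (auto simp: discrete_isometry_group_def)
  interpret G: discrete_action "TYPE('a)" \<Gamma>
    by (intro discrete_action.intro isom_action.intro isom_action_axioms.intro discrete_action_axioms.intro c.cat1_space_axioms subG disc)
  have sub0: "subgroup \<Gamma>\<^sub>0 isometry_group" by (rule group.incl_subgroup[OF group_isometry_group subG assms(8)])
  have sub0': "\<Gamma>\<^sub>0 \<subseteq> \<Gamma>" using subgroup.subset[OF assms(8)] by simp
  interpret G0: isom_action "TYPE('a)" \<Gamma>\<^sub>0
    by (intro isom_action.intro isom_action_axioms.intro c.cat1_space_axioms sub0)
  define C\<^sub>0 where "C\<^sub>0 = hull_at_infinity (limit_set \<Gamma>\<^sub>0)"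
  obtain A where A: "A \<subseteq> limit_set \<Gamma>\<^sub>0" "card A = 2" using assms(10) by (auto simp: convex_cocompact_def)
  obtain \<xi> \<eta> where xe: "A = {\<xi>, \<eta>}" "\<xi> \<noteq> \<eta>" using A(2) by (auto simp: card_2_iff)
  have lim: "\<xi> \<in> limit_set \<Gamma>\<^sub>0" "\<eta> \<in> limit_set \<Gamma>\<^sub>0" using A(1) xe(1) by auto
  then have bd: "\<xi> \<in> boundary" "\<eta> \<in> boundary" by (auto simp: limit_set_def)
  obtain l\<^sub>0 where l0: "l\<^sub>0 \<in> geodesic_lines" "neg_end l\<^sub>0 = \<xi>" "pos_end l\<^sub>0 = \<eta>" using c.line_ex[OF bd xe(2)] by blast
  \<comment> \<open>The argument is run from a base point on a line of the core; the base point
    \<open>x\<^sub>0\<close> of the statement returns only at the end.\<close>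
  define x where "x = l\<^sub>0 0"
  have l0C: "l\<^sub>0 t \<in> C\<^sub>0" for t unfolding C\<^sub>0_def using l0 lim by (intro G0.hull_line) auto
  obtain Q where Q: "quotient_map (top_of_set C\<^sub>0) Q (isom_orbit \<Gamma>\<^sub>0)" "compact_space Q"
    using assms(10) by (auto simp: convex_cocompact_def C\<^sub>0_def)
  have C0inv: "h p \<in> C\<^sub>0" if "h \<in> \<Gamma>\<^sub>0" "p \<in> C\<^sub>0" for h p using G0.hull_act that by (simp add: C\<^sub>0_def)
  obtain D where D: "0 \<le> D" "\<forall>p\<in>C\<^sub>0. \<exists>h\<in>\<Gamma>\<^sub>0. dist p (h x) \<le> D"
    using G0.cocompact_orbit_dense[OF Q, of x] C0inv by blast
  have d0: "0 \<le> \<delta>" using G.critical_exponent_spec unfolding assms(4) by simp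
  have d00: "0 \<le> \<delta>\<^sub>0" using G0.critical_exponent_spec unfolding assms(12) by simp
  obtain x1 where "comparable (\<lambda>n. real (card (isom_orbit \<Gamma> x1 \<inter> cball x1 (real n)))) (\<lambda>n. exp (\<delta> * real n))"
    using assms(7) by blast
  from G.growth_of_orbit_growth[OF d0 this, of x] obtain cN CN where growth: "0 < cN" "0 < CN"
    "\<forall>R\<ge>0. cN * exp (\<delta> * R) \<le> real (card {\<gamma> \<in> \<Gamma>. dist x (\<gamma> x) \<le> R}) \<and> real (card {\<gamma> \<in> \<Gamma>. dist x (\<gamma> x) \<le> R}) \<le> CN * exp (\<delta> * R)"
    by blast
  have cp: "core_pair TYPE('a) \<Gamma> \<Gamma>\<^sub>0 x \<delta> \<delta>\<^sub>0 cN CN D C\<^sub>0 l\<^sub>0"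
  proof (intro core_pair.intro core_pair_axioms.intro G.discrete_action_axioms sub0 sub0' d0 d00 growth(1,2) D(1) l0(1) l0C)
    fix g assume g: "g \<in> \<Gamma>" "g \<notin> \<Gamma>\<^sub>0"
    let ?G = "isometry_group\<lparr>carrier := \<Gamma>\<rparr>"
    have inv: "inv\<^bsub>?G\<^esub> g = inv_into UNIV g"
      using group.m_inv_consistent[OF group_isometry_group subG g(1)] G.m_inv_eq[OF g(1)] by simp
    have "finite (((g <#\<^bsub>?G\<^esub> \<Gamma>\<^sub>0) #>\<^bsub>?G\<^esub> inv\<^bsub>?G\<^esub> g) \<inter> \<Gamma>\<^sub>0)"
      using assms(9) g unfolding almost_malnormal_def by simp
    moreover have "(\<lambda>h. g \<circ> h \<circ> inv_into UNIV g) ` {h \<in> \<Gamma>\<^sub>0. g \<circ> h \<circ> inv_into UNIV g \<in> \<Gamma>\<^sub>0} \<subseteq> ((g <#\<^bsub>?G\<^esub> \<Gamma>\<^sub>0) #>\<^bsub>?G\<^esub> inv\<^bsub>?G\<^esub> g) \<inter> \<Gamma>\<^sub>0"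
      unfolding inv by (auto simp: l_coset_def r_coset_def isometry_group_def)
    ultimately have "finite ((\<lambda>h. g \<circ> h \<circ> inv_into UNIV g) ` {h \<in> \<Gamma>\<^sub>0. g \<circ> h \<circ> inv_into UNIV g \<in> \<Gamma>\<^sub>0})"
      by (rule finite_subset[rotated])
    moreover have "inj_on (\<lambda>h. g \<circ> h \<circ> inv_into UNIV g) {h \<in> \<Gamma>\<^sub>0. g \<circ> h \<circ> inv_into UNIV g \<in> \<Gamma>\<^sub>0}"
    proof (rule inj_onI)
      fix h h' assume "g \<circ> h \<circ> inv_into UNIV g = g \<circ> h' \<circ> inv_into UNIV g"
      then have "inv_into UNIV g \<circ> (g \<circ> h \<circ> inv_into UNIV g) \<circ> g = inv_into UNIV g \<circ> (g \<circ> h' \<circ> inv_into UNIV g) \<circ> g" by simp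
      then have "(inv_into UNIV g \<circ> g) \<circ> h \<circ> (inv_into UNIV g \<circ> g) = (inv_into UNIV g \<circ> g) \<circ> h' \<circ> (inv_into UNIV g \<circ> g)"
        by (simp only: comp_assoc)
      then show "h = h'" using g(1) by simp
    qed
    ultimately show "finite {h \<in> \<Gamma>\<^sub>0. g \<circ> h \<circ> inv_into UNIV g \<in> \<Gamma>\<^sub>0}" by (rule finite_imageD)
  next
    show "\<Gamma>\<^sub>0 \<noteq> \<Gamma>"
    proof
      assume eq: "\<Gamma>\<^sub>0 = \<Gamma>"
      let ?G = "isometry_group\<lparr>carrier := \<Gamma>\<rparr>"
      have gr: "group ?G" by (rule subgroup.subgroup_is_group[OF subG group_isometry_group])
      have "rcosets\<^bsub>?G\<^esub> \<Gamma>\<^sub>0 \<subseteq> {\<Gamma>\<^sub>0}"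
        using subgroup.rcos_const[OF assms(8) gr] eq by (auto simp: RCOSETS_def)
      then show False using assms(11) finite_subset by blast
    qed
  next
    show "cN * exp (\<delta> * R) \<le> real (card {\<gamma> \<in> \<Gamma>. dist x (\<gamma> x) \<le> R})" "real (card {\<gamma> \<in> \<Gamma>. dist x (\<gamma> x) \<le> R}) \<le> CN * exp (\<delta> * R)" if "0 \<le> R" for R
      using growth(3) that by blast+
  next
    show "(\<lambda>\<gamma>. exp (- s * dist x (\<gamma> x))) summable_on \<Gamma>\<^sub>0" if "\<delta>\<^sub>0 < s" for s
      using G0.critical_exponent_spec that d00 unfolding assms(12) poincare_converges_def by simp
    show "\<not> (\<lambda>\<gamma>. exp (- s * dist x (\<gamma> x))) summable_on \<Gamma>\<^sub>0" if "0 \<le> s" "s < \<delta>\<^sub>0" for s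
      using G0.critical_exponent_spec that unfolding assms(12) poincare_converges_def by simp
  next
    show "geodesically_convex C\<^sub>0" unfolding C\<^sub>0_def by (rule G0.hull_convex)
    show "h p \<in> C\<^sub>0" if "h \<in> \<Gamma>\<^sub>0" "p \<in> C\<^sub>0" for h p by (rule C0inv[OF that])
    show "\<exists>h\<in>\<Gamma>\<^sub>0. dist p (h x) \<le> D" if "p \<in> C\<^sub>0" for p using D(2) that by blast
    show "l\<^sub>0 0 = x" by (simp add: x_def)
  qed
  interpret P: conformal_pair "TYPE('a)" \<Gamma> \<Gamma>\<^sub>0 x \<delta> \<delta>\<^sub>0 cN CN D C\<^sub>0 l\<^sub>0 \<mu>
    by (rule patterson_density_conformal[OF cp assms(6)])
  define law where "law l \<longleftrightarrow> Limsup at_top (\<lambda>t. penetration \<Gamma> C\<^sub>0 \<epsilon> l t / ereal (ln t)) = ereal (1 / (\<delta> - \<delta>\<^sub>0))" for l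
  have "AE \<xi> in \<mu> x. \<forall>l\<in>geodesic_lines. pos_end l = \<xi> \<longrightarrow> law l"
    unfolding law_def by (rule P.logarithm_law_AE[OF assms(13)])
  then obtain Nl where Nl: "{\<xi> \<in> space (\<mu> x). \<not> (\<forall>l\<in>geodesic_lines. pos_end l = \<xi> \<longrightarrow> law l)} \<subseteq> Nl" "Nl \<in> null_sets (\<mu> x)"
    by (auto elim: AE_E simp: null_sets_def)
  \<comment> \<open>The densities at \<open>x\<close> and \<open>x\<^sub>0\<close> have the same
    null sets, which carries the exceptional set over to the given base point.\<close>
  have "emeasure (\<mu> x\<^sub>0) Nl = 0"
  proof -
    have "\<mu> x\<^sub>0 = density (\<mu> x) (\<lambda>\<xi>. ennreal (exp (- \<delta> * busemann \<xi> x\<^sub>0 x)))"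
      using assms(6) unfolding patterson_density_def by blast
    then show ?thesis using null_density[OF Nl(2)] by metis
  qed
  then have N0: "Nl \<in> null_sets (\<mu> x\<^sub>0)" using Nl(2) by (auto simp: null_sets_def P.sets_nu)
  have "AE l in bowen_margulis \<delta> \<mu> x\<^sub>0. law l"
  proof (rule c.AE_bowen_margulis[where \<mu> = \<mu> and x = x\<^sub>0, OF P.sets_nu P.fin_nu N0])
    fix l :: "real \<Rightarrow> 'a" assume l: "l \<in> geodesic_lines" "pos_end l \<notin> Nl"
    then show "law l" using Nl(1) pos_end_boundary(1)[OF l(1)] by (auto simp: P.space_nu)
  qed
  then show ?thesis unfolding law_def C\<^sub>0_def .
qed

end
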